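(* Let $V$ be a vertex operator algebra satisfying $V_{(0)}=\mathbb{C}\mathbf{1}$ and $V_{(n)}=0$ for $n<0$, let $g$ be an automorphism of $V$, and let $u\in V_{(1)}$ satisfy $L(1)u=0$ and $g(u)=u$. Put $g_u=e^{2\pi iY_0(u)}$. Let $(W,Y_W^g)$ be a $\mathbb{C}/\mathbb{Z}$-graded generalized $g$-twisted $V$-module, and assume that $W$ is a direct sum of generalized eigenspaces of $(Y_W^g)_0(u)$. Define $Y_W^{gg_u}(v,x)=Y_W^g(\Delta_V^{(u)}(x)v,x)$ for $v\in V$. Then $(W,Y_W^{gg_u})$ is a $\mathbb{C}/\mathbb{Z}$-graded generalized $gg_u$-twisted $V$-module.
   Context: Notation. A vertex operator algebra $V=\coprod_{n\in\mathbb{Z}}V_{(n)}$ has vacuum $\mathbf{1}$, conformal vector $\omega$, vertex operators $Y=Y_V$, $Y(v,x)=\sum_{n\in\mathbb{Z}}Y_n(v)x^{-n-1}$, $Y(\omega,x)=\sum_n L(n)x^{-n-2}$; $V_{(n)}$ is the $L(0)$-eigenspace of eigenvalue $n$, is finite dimensional, and vanishes for $n$ sufficiently negative. An automorphism of $V$ is a linear isomorphism $g$ with $gY(v_1,x)v_2=Y(gv_1,x)gv_2$, $g\mathbf{1}=\mathbf{1}$, $g\omega=\omega$. For $u\in V_{(1)}$ with $L(1)u=0$, $g_u=e^{2\pi i Y_0(u)}$ is an automorphism of $V$. The series $\Delta_V^{(u)}(x)$. For $u\in V_{(1)}$, $Y_0(u)$ preserves each $V_{(n)}$; let $Y_0(u)=Y_0(u)_S+Y_0(u)_N$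 be its decomposition into commuting semisimple and locally nilpotent parts and $x^{-Y_0(u)}=x^{-Y_0(u)_S}e^{-Y_0(u)_N\log x}$. Then $\Delta_V^{(u)}(x)=x^{-Y_0(u)}\exp\left(\sum_{m\ge1}\frac{Y_m(u)}{m}(-x)^{-m}\right)$. The operator $\mathcal{L}_g$. For an automorphism $g$, write $g=\sigma g_{\mathcal{U}}$ with $\sigma$ semisimple and $g_{\mathcal{U}}$ locally unipotent, commuting. Let $P_V^g=\{\alpha\in[0,1)+i\mathbb{R}: e^{2\pi i\alpha}\text{ is an eigenvalue of }g\}$, let $V^{[\alpha]}$ be the generalized eigenspace of $g$ of eigenvalue $e^{2\pi i\alpha}$, $\mathcal{S}_g=\alpha$ on $V^{[\alpha]}$ ($\alpha\in P_V^g$), $\mathcal{N}_g=\frac{1}{2\pi i}\log g_{\mathcal{U}}=\frac1{2\pi i}\sum_{j\ge1}\frac{(-1)^{j+1}}{j}(g_{\mathcal{U}}-1)^j$, and $\mathcal{L}_g=\mathcal{S}_g+\mathcal{N}_g$, so $g=e^{2\pi i\mathcal{L}_g}$. Twisted modules. $W\{x\}$ denotes formal series in arbitrary complex powers of $x$ with coefficients in $W$. For $z\in\mathbb{C}^\times$, $p\in\mathbb{Z}$, $l_p(z)=\log|z|+i\arg z+2\pi i p$, $0\le\arg z<2\pi$. A $\mathbb{C}/\mathbb{Z}$-graded generalized $g$-twisted $V$-module is a graded vector space $W=\coprod_{n\in\mathbb{C},\alpha\in\mathbb{C}/\mathbb{Z}}W_{[n]}^{[\alpha]}$ with an action of $g$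 (a linear automorphism, also written $g$, with $gY_W^g(v,x)w=Y_W^g(gv,x)gw$) and a linear map $Y_W^g:V\otimes W\to W\{x\}[\log x]$, $v\otimes w\mapsto Y_W^g(v,x)w$, such that: (1) equivariance: $Y_W^{g;p+1}(gv,z)w=Y_W^{g;p}(v,z)w$ for $p\in\mathbb{Z}$, $z\in\mathbb{C}^\times$, where $Y_W^{g;p}(v,z)w$ is obtained by $x^n=e^{nl_p(z)}$, $\log x=l_p(z)$; (2) $Y_W^g(\mathbf{1},x)w=w$; (3) lower truncation: for all $v,w$ the coefficients of $x^n(\log x)^k$ in $Y_W^g(v,x)w$ vanish when $\Re(n)$ is sufficiently negative; (4) Jacobi identity, with $\delta(x)=\sum_{n\in\mathbb{Z}}x^n$ and the usual expansion conventions (binomials expanded in nonnegative powers of the second variable): $x_0^{-1}\delta\left(\frac{x_1-x_2}{x_0}\right)Y_W^g(v_1,x_1)Y_W^g(v_2,x_2)-x_0^{-1}\delta\left(\frac{-x_2+x_1}{x_0}\right)Y_W^g(v_2,x_2)Y_W^g(v_1,x_1)=x_1^{-1}\delta\left(\frac{x_2+x_0}{x_1}\right)Y_W^g\left(Y\left(\left(\frac{x_2+x_0}{x_1}\right)^{\mathcal{L}_g}v_1,x_0\right)v_2,x_2\right)$; (5) with $Y_W^g(\omega,x)=\sum_nL_W^g(n)x^{-n-2}$, $W_{[n]}=\coprod_\alpha W_{[n]}^{[\alpha]}$, $W^{[\alpha]}=\coprod_nW_{[n]}^{[\alpha]}$: each $w\in W_{[n]}$ is killed by some $(L_W^g(0)-n)^K$,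 and each $w\in W^{[\alpha]}$ by some $(g-e^{2\pi i\alpha})^\Lambda$; (6) $\frac{d}{dx}Y_W^g(v,x)=Y_W^g(L(-1)v,x)$. $(Y_W^g)_0(u)$ is the coefficient of $x^{-1}$ in $Y_W^g(u,x)$ (when $g(u)=u$ only integral powers and no $\log x$ occur). In the conclusion, $gg_u$ acts on $W$ as $g\,e^{2\pi i(Y_W^g)_0(u)}$, and the double grading of $W$ is by the generalized eigenspaces of $L_W^{gg_u}(0)=\mathrm{Res}_x\,xY_W^{gg_u}(\omega,x)$ (eigenvalue $n\in\mathbb{C}$) and of $gg_u$ (eigenvalue $e^{2\pi i\gamma}$, $\gamma\in\mathbb{C}/\mathbb{Z}$). *)

theory Defs
  imports "HOL-Analysis.Analysis" "HOL-Library.Groups_Big_Fun"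
begin

text \<open>
  Complex vector spaces are abelian groups with an explicit scalar multiplication \<open>s\<close> satisfying
  the library predicate \<^const>\<open>vector_space\<close>.  Formal series are represented by their families of
  coefficients.  \<^const>\<open>Sum_any\<close> is the sum of a finitely supported family; it is used for the sums
  of formal calculus, in which only finitely many terms contribute to each coefficient.
\<close>

section \<open>Linear algebra\<close>

definition decomposes :: "'i set \<Rightarrow> ('i \<Rightarrow> 'a::ab_group_add set) \<Rightarrow> 'a \<Rightarrow> ('i \<Rightarrow> 'a) \<Rightarrow> bool" where
  "decomposes I U v f \<longleftrightarrow>
     (\<forall>i\<in>I. f i \<in> U i) \<and> (\<forall>i. i \<notin> I \<longrightarrow> f i = 0) \<and> finite {i. f i \<noteq> 0} \<and> v = Sum_any f"

definition is_direct_sum ::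
  "(complex \<Rightarrow> 'a::ab_group_add \<Rightarrow> 'a) \<Rightarrow> 'i set \<Rightarrow> ('i \<Rightarrow> 'a set) \<Rightarrow> bool" where
  "is_direct_sum s I U \<longleftrightarrow> (\<forall>i\<in>I. module.subspace s (U i)) \<and> (\<forall>v. \<exists>!f. decomposes I U v f)"

definition component :: "'i set \<Rightarrow> ('i \<Rightarrow> 'a::ab_group_add set) \<Rightarrow> 'i \<Rightarrow> 'a \<Rightarrow> 'a" where
  "component I U i v = (THE f. decomposes I U v f) i"

definition eigenspace :: "(complex \<Rightarrow> 'a::ab_group_add \<Rightarrow> 'a) \<Rightarrow> ('a \<Rightarrow> 'a) \<Rightarrow> complex \<Rightarrow> 'a set" where
  "eigenspace s T c = {v. T v = s c v}"

definition gen_eigenspace ::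
  "(complex \<Rightarrow> 'a::ab_group_add \<Rightarrow> 'a) \<Rightarrow> ('a \<Rightarrow> 'a) \<Rightarrow> complex \<Rightarrow> 'a set" where
  "gen_eigenspace s T c = {v. \<exists>K. ((\<lambda>x. T x - s c x) ^^ K) v = 0}"

definition semisimple_op :: "(complex \<Rightarrow> 'a::ab_group_add \<Rightarrow> 'a) \<Rightarrow> ('a \<Rightarrow> 'a) \<Rightarrow> bool" where
  "semisimple_op s T \<longleftrightarrow> Vector_Spaces.linear s s T \<and> is_direct_sum s UNIV (eigenspace s T)"

definition locally_nilpotent ::
  "(complex \<Rightarrow> 'a::ab_group_add \<Rightarrow> 'a) \<Rightarrow> ('a \<Rightarrow> 'a) \<Rightarrow> bool" where
  "locally_nilpotent s T \<longleftrightarrow> Vector_Spaces.linear s s T \<and> (\<forall>v. \<exists>K. (T ^^ K) v = 0)"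

text \<open>The (unique) decomposition \<open>T = T\<^sub>S + T\<^sub>N\<close> into commuting semisimple and locally
  nilpotent parts.\<close>

definition semisimple_part ::
  "(complex \<Rightarrow> 'a::ab_group_add \<Rightarrow> 'a) \<Rightarrow> ('a \<Rightarrow> 'a) \<Rightarrow> 'a \<Rightarrow> 'a" where
  "semisimple_part s T = (THE S. \<exists>N. semisimple_op s S \<and> locally_nilpotent s N \<and>
     S \<circ> N = N \<circ> S \<and> T = (\<lambda>v. S v + N v))"

definition nilpotent_part ::
  "(complex \<Rightarrow> 'a::ab_group_add \<Rightarrow> 'a) \<Rightarrow> ('a \<Rightarrow> 'a) \<Rightarrow> 'a \<Rightarrow> 'a" where
  "nilpotent_part s T v = T v - semisimple_part s T v"

text \<open>The (unique) locally unipotent factor of \<open>T = \<sigma> T\<^sub>U\<close>, with \<open>\<sigma>\<close> semisimple commuting with it.\<close>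

definition unipotent_part ::
  "(complex \<Rightarrow> 'a::ab_group_add \<Rightarrow> 'a) \<Rightarrow> ('a \<Rightarrow> 'a) \<Rightarrow> 'a \<Rightarrow> 'a" where
  "unipotent_part s T = (THE U. \<exists>\<sigma>. semisimple_op s \<sigma> \<and> locally_nilpotent s (\<lambda>v. U v - v) \<and>
     \<sigma> \<circ> U = U \<circ> \<sigma> \<and> T = \<sigma> \<circ> U)"

text \<open>The exponential series \<open>\<Sum>\<^sub>k T\<^sup>k v / k!\<close>.  No topology is given on the space; the series is
  summed against all linear functionals, which for a vector in a finite-dimensional
  \<open>T\<close>-invariant subspace is convergence in the usual topology of that subspace.\<close>

definition op_exp :: "(complex \<Rightarrow> 'a::ab_group_add \<Rightarrow> 'a) \<Rightarrow> ('a \<Rightarrow> 'a) \<Rightarrow> 'a \<Rightarrow> 'a" where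
  "op_exp s T v = (THE e. \<forall>\<phi>. Vector_Spaces.linear s (*) \<phi> \<longrightarrow>
     (\<lambda>k. \<phi> ((T ^^ k) v) / fact k) sums \<phi> e)"

text \<open>\<open>x\<^bsup>S+N\<^esup> = x\<^bsup>S\<^esup> exp (N log x)\<close> for commuting semisimple \<open>S\<close> and locally nilpotent \<open>N\<close>:
  the coefficient of \<open>x\<^bsup>a\<^esup> (log x)\<^bsup>k\<^esup>\<close>.\<close>

definition op_powr ::
  "(complex \<Rightarrow> 'a::ab_group_add \<Rightarrow> 'a) \<Rightarrow> ('a \<Rightarrow> 'a) \<Rightarrow> ('a \<Rightarrow> 'a) \<Rightarrow> complex \<Rightarrow> nat \<Rightarrow> 'a \<Rightarrow> 'a" where
  "op_powr s S N a k v = s (1 / fact k) ((N ^^ k) (component UNIV (eigenspace s S) a v))"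

text \<open>The operator \<open>T (T - 1) \<dots> (T - i + 1) / i!\<close>.\<close>

primrec op_gbinomial ::
  "(complex \<Rightarrow> 'a::ab_group_add \<Rightarrow> 'a) \<Rightarrow> ('a \<Rightarrow> 'a) \<Rightarrow> nat \<Rightarrow> 'a \<Rightarrow> 'a" where
  "op_gbinomial s T 0 = (\<lambda>v. v)"
| "op_gbinomial s T (Suc i) = (\<lambda>v. s (1 / of_nat (Suc i))
     (T (op_gbinomial s T i v) - s (of_nat i) (op_gbinomial s T i v)))"


section \<open>Vertex operator algebras\<close>

text \<open>\<open>Y v n\<close> is the coefficient of \<open>x\<^bsup>-n-1\<^esup>\<close> in \<open>Y(v, x)\<close>.\<close>

definition Lop :: "('v \<Rightarrow> int \<Rightarrow> 'v \<Rightarrow> 'v) \<Rightarrow> 'v \<Rightarrow> int \<Rightarrow> 'v \<Rightarrow> 'v" where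
  "Lop Y \<omega> n = Y \<omega> (n + 1)"

definition wt_space :: "(complex \<Rightarrow> 'v::ab_group_add \<Rightarrow> 'v) \<Rightarrow> ('v \<Rightarrow> int \<Rightarrow> 'v \<Rightarrow> 'v) \<Rightarrow> 'v
    \<Rightarrow> int \<Rightarrow> 'v set" where
  "wt_space s Y \<omega> n = eigenspace s (Lop Y \<omega> 0) (of_int n)"

locale vertex_operator_algebra = vector_space s
  for s :: "complex \<Rightarrow> 'v::ab_group_add \<Rightarrow> 'v" +
  fixes Y :: "'v \<Rightarrow> int \<Rightarrow> 'v \<Rightarrow> 'v" and vac \<omega> :: 'v
  assumes grading: "is_direct_sum s UNIV (wt_space s Y \<omega>)"
    and finite_dimensional: "\<exists>B. finite B \<and> wt_space s Y \<omega> n \<subseteq> span B"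
    and lower_bounded: "\<exists>N. \<forall>n<N. wt_space s Y \<omega> n = {0}"
    and linear_left: "Vector_Spaces.linear s s (\<lambda>v. Y v n w)"
    and linear_right: "Vector_Spaces.linear s s (Y v n)"
    and lower_truncation: "\<exists>N. \<forall>n\<ge>N. Y v n w = 0"
    and vacuum: "Y vac n w = (if n = -1 then w else 0)"
    and creation: "n \<ge> 0 \<Longrightarrow> Y v n vac = 0" "Y v (-1) vac = v"
    \<comment> \<open>the coefficient of \<open>x\<^sub>0\<^bsup>-l-1\<^esup> x\<^sub>1\<^bsup>-m-1\<^esup> x\<^sub>2\<^bsup>-n-1\<^esup>\<close> in the Jacobi identity\<close>
    and jacobi: "Sum_any (\<lambda>i::nat. s ((of_int l gchoose i) * (-1) ^ i)
                    (Y v\<^sub>1 (m + l - int i) (Y v\<^sub>2 (n + int i) w)))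
               - Sum_any (\<lambda>i::nat. s ((of_int l gchoose i) * (-1) powi (l - int i))
                    (Y v\<^sub>2 (n + l - int i) (Y v\<^sub>1 (m + int i) w)))
               = Sum_any (\<lambda>i::nat. s (of_int m gchoose i)
                    (Y (Y v\<^sub>1 (l + int i) v\<^sub>2) (m + n - int i) w))"
    and virasoro: "\<exists>c. \<forall>m n v. Lop Y \<omega> m (Lop Y \<omega> n v) - Lop Y \<omega> n (Lop Y \<omega> m v)
               = s (of_int (m - n)) (Lop Y \<omega> (m + n) v)
               + s (if m + n = 0 then c * of_int (m ^ 3 - m) / 12 else 0) v"
    and L_minus1_derivative: "Y (Lop Y \<omega> (-1) v) n w = s (of_int (- n)) (Y v (n - 1) w)"

definition voa_automorphism ::
  "(complex \<Rightarrow> 'v::ab_group_add \<Rightarrow> 'v) \<Rightarrow> ('v \<Rightarrow> int \<Rightarrow> 'v \<Rightarrow> 'v) \<Rightarrow> 'v \<Rightarrow> 'v \<Rightarrow> ('v \<Rightarrow> 'v) \<Rightarrow> bool" where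
  "voa_automorphism s Y vac \<omega> g \<longleftrightarrow> Vector_Spaces.linear s s g \<and> bij g \<and>
     (\<forall>v\<^sub>1 n v\<^sub>2. g (Y v\<^sub>1 n v\<^sub>2) = Y (g v\<^sub>1) n (g v\<^sub>2)) \<and> g vac = vac \<and> g \<omega> = \<omega>"


section \<open>The operator \<open>\<L>\<^sub>g\<close> and its powers\<close>

definition P_set :: "(complex \<Rightarrow> 'v::ab_group_add \<Rightarrow> 'v) \<Rightarrow> ('v \<Rightarrow> 'v) \<Rightarrow> complex set" where
  "P_set s g = {\<alpha>. 0 \<le> Re \<alpha> \<and> Re \<alpha> < 1 \<and> (\<exists>v. v \<noteq> 0 \<and> g v = s (exp (2 * pi * \<i> * \<alpha>)) v)}"

definition S_op :: "(complex \<Rightarrow> 'v::ab_group_add \<Rightarrow> 'v) \<Rightarrow> ('v \<Rightarrow> 'v) \<Rightarrow> 'v \<Rightarrow> 'v" where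
  "S_op s g = (THE S. Vector_Spaces.linear s s S \<and>
     (\<forall>\<alpha>\<in>P_set s g. \<forall>v\<in>gen_eigenspace s g (exp (2 * pi * \<i> * \<alpha>)). S v = s \<alpha> v))"

definition N_op :: "(complex \<Rightarrow> 'v::ab_group_add \<Rightarrow> 'v) \<Rightarrow> ('v \<Rightarrow> 'v) \<Rightarrow> 'v \<Rightarrow> 'v" where
  "N_op s g v = s (1 / (2 * pi * \<i>)) (Sum_any (\<lambda>j::nat. if j = 0 then 0 else
     s ((-1) ^ (j + 1) / of_nat j) (((\<lambda>x. unipotent_part s g x - x) ^^ j) v)))"

definition L_op :: "(complex \<Rightarrow> 'v::ab_group_add \<Rightarrow> 'v) \<Rightarrow> ('v \<Rightarrow> 'v) \<Rightarrow> 'v \<Rightarrow> 'v" where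
  "L_op s g v = S_op s g v + N_op s g v"

text \<open>
  The coefficient of \<open>x\<^sub>0\<^bsup>i\<^esup> x\<^sub>1\<^bsup>d\<^esup> (log x\<^sub>1)\<^bsup>j\<^esup> x\<^sub>2\<^bsup>c\<^esup> (log x\<^sub>2)\<^bsup>k\<^esup>\<close> in
  \<open>((x\<^sub>2 + x\<^sub>0) / x\<^sub>1)\<^bsup>L\<^esup> = (\<Sum>\<^sub>i binom(L, i) x\<^sub>0\<^bsup>i\<^esup> x\<^sub>2\<^bsup>L-i\<^esup>) x\<^sub>1\<^bsup>-L\<^esup>\<close>, where \<open>L = \<L>\<^sub>g\<close>.
\<close>

definition quotient_powr :: "(complex \<Rightarrow> 'v::ab_group_add \<Rightarrow> 'v) \<Rightarrow> ('v \<Rightarrow> 'v)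
    \<Rightarrow> nat \<Rightarrow> complex \<Rightarrow> nat \<Rightarrow> complex \<Rightarrow> nat \<Rightarrow> 'v \<Rightarrow> 'v" where
  "quotient_powr s g i d j c k v =
     op_gbinomial s (L_op s g) i
       (op_powr s (S_op s g) (N_op s g) (c + of_nat i) k
         (op_powr s (\<lambda>x. - S_op s g x) (\<lambda>x. - N_op s g x) d j v))"


section \<open>Twisted modules\<close>

definition C_mod_Z :: "complex set set" where
  "C_mod_Z = UNIV // {(a, b). a - b \<in> \<int>}"

text \<open>\<open>WG n \<Gamma>\<close> is the homogeneous subspace of \<open>W\<close> of degree \<open>(n, \<Gamma>)\<close>, \<open>\<Gamma> \<in> \<complex>/\<int>\<close>.\<close>

definition wt_part :: "(complex \<Rightarrow> 'w::ab_group_add \<Rightarrow> 'w) \<Rightarrow> (complex \<Rightarrow> complex set \<Rightarrow> 'w set)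
    \<Rightarrow> complex \<Rightarrow> 'w set" where
  "wt_part s WG n = module.span s (\<Union>\<Gamma>\<in>C_mod_Z. WG n \<Gamma>)"

definition g_part :: "(complex \<Rightarrow> 'w::ab_group_add \<Rightarrow> 'w) \<Rightarrow> (complex \<Rightarrow> complex set \<Rightarrow> 'w set)
    \<Rightarrow> complex set \<Rightarrow> 'w set" where
  "g_part s WG \<Gamma> = module.span s (\<Union>n. WG n \<Gamma>)"

definition log_branch :: "int \<Rightarrow> complex \<Rightarrow> complex" where
  "log_branch p z = of_real (ln (cmod z)) + \<i> * of_real (Arg2pi z) + 2 * pi * \<i> * of_int p"

text \<open>\<open>YW v n k\<close> is the coefficient of \<open>x\<^bsup>n\<^esup> (log x)\<^bsup>k\<^esup>\<close> in \<open>Y\<^sub>W(v, x)\<close> (note the exponent \<open>n\<close>, not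
  \<open>-n-1\<close>).  The value of \<open>Y\<^sub>W(v, x) w\<close> at \<open>x\<^bsup>n\<^esup> = exp (n l\<^sub>p(z))\<close>, \<open>log x = l\<^sub>p(z)\<close> is an element
  of the algebraic completion \<open>\<Prod>\<^sub>m W\<^bsub>[m]\<^esub>\<close>, given here by its component of weight \<open>m\<close>.\<close>

definition branch_value :: "(complex \<Rightarrow> 'w::ab_group_add \<Rightarrow> 'w) \<Rightarrow> (complex \<Rightarrow> complex set \<Rightarrow> 'w set)
    \<Rightarrow> ('v \<Rightarrow> complex \<Rightarrow> nat \<Rightarrow> 'w \<Rightarrow> 'w) \<Rightarrow> int \<Rightarrow> 'v \<Rightarrow> complex \<Rightarrow> 'w \<Rightarrow> complex \<Rightarrow> 'w" where
  "branch_value s WG YW p v z w m = Sum_any (\<lambda>(n, k).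
     s (exp (n * log_branch p z) * log_branch p z ^ k)
       (component UNIV (wt_part s WG) m (YW v n k w)))"

text \<open>
  In the Jacobi identity below, both sides are compared at
  \<open>x\<^sub>0\<^bsup>-l-1\<^esup> x\<^sub>1\<^bsup>a\<^esup> (log x\<^sub>1)\<^bsup>j\<^esup> x\<^sub>2\<^bsup>b\<^esup> (log x\<^sub>2)\<^bsup>k\<^esup>\<close>.  On the right-hand side \<open>m\<close>, \<open>i\<close> index the
  terms \<open>binom(m, i) x\<^sub>1\<^bsup>-m-1\<^esup> x\<^sub>2\<^bsup>m-i\<^esup> x\<^sub>0\<^bsup>i\<^esup>\<close> of the delta function and \<open>i'\<close>, \<open>c\<close>, \<open>r\<close> the powers
  \<open>x\<^sub>0\<^bsup>i'\<^esup> x\<^sub>2\<^bsup>c\<^esup> (log x\<^sub>2)\<^bsup>r\<^esup>\<close> in \<open>((x\<^sub>2 + x\<^sub>0) / x\<^sub>1)\<^bsup>L\<^esup> v\<^sub>1\<close>; the remaining exponents are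
  determined by the monomial.
\<close>

locale twisted_module =
    V: vertex_operator_algebra s Y vac \<omega> + W: vector_space t
  for s :: "complex \<Rightarrow> 'v::ab_group_add \<Rightarrow> 'v" and Y vac \<omega>
    and t :: "complex \<Rightarrow> 'w::ab_group_add \<Rightarrow> 'w" +
  fixes g :: "'v \<Rightarrow> 'v"
    and WG :: "complex \<Rightarrow> complex set \<Rightarrow> 'w set"
    and gW :: "'w \<Rightarrow> 'w"
    and YW :: "'v \<Rightarrow> complex \<Rightarrow> nat \<Rightarrow> 'w \<Rightarrow> 'w"
  assumes automorphism: "voa_automorphism s Y vac \<omega> g"
    and grading: "is_direct_sum t (UNIV \<times> C_mod_Z) (\<lambda>(n, \<Gamma>). WG n \<Gamma>)"
    and g_linear: "Vector_Spaces.linear t t gW"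
    and g_bij: "bij gW"
    and g_compatible: "gW (YW v n k w) = YW (g v) n k (gW w)"
    and linear_left: "Vector_Spaces.linear s t (\<lambda>v. YW v n k w)"
    and linear_right: "Vector_Spaces.linear t t (YW v n k)"
    and log_polynomial: "\<exists>K. \<forall>n. \<forall>k>K. YW v n k w = 0"
    and equivariance: "z \<noteq> 0 \<Longrightarrow>
          branch_value t WG YW (p + 1) (g v) z w = branch_value t WG YW p v z w"
    and identity: "YW vac n k w = (if n = 0 \<and> k = 0 then w else 0)"
    and lower_truncation: "\<exists>B. \<forall>n k. Re n < B \<longrightarrow> YW v n k w = 0"
    and jacobi:
      "Sum_any (\<lambda>i::nat. t ((of_int l gchoose i) * (-1) ^ i)
         (YW v\<^sub>1 (a - of_int l + of_nat i) j (YW v\<^sub>2 (b - of_nat i) k w)))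
     - Sum_any (\<lambda>i::nat. t ((of_int l gchoose i) * (-1) powi (l - int i))
         (YW v\<^sub>2 (b - of_int l + of_nat i) k (YW v\<^sub>1 (a - of_nat i) j w)))
     = Sum_any (\<lambda>(m::int, i::nat, i'::nat, c::complex). \<Sum>r\<le>k.
         t (of_int m gchoose i)
           (YW (Y (quotient_powr s g i' (a + of_int m + 1) j c r v\<^sub>1) (l + int i + int i') v\<^sub>2)
             (b - of_int m + of_nat i - c) (k - r) w))"
    and L0_grading: "wt_part t WG n \<subseteq> gen_eigenspace t (YW \<omega> (-2) 0) n"
    and g_grading: "\<Gamma> \<in> C_mod_Z \<Longrightarrow> \<alpha> \<in> \<Gamma> \<Longrightarrow>
          g_part t WG \<Gamma> \<subseteq> gen_eigenspace t gW (exp (2 * pi * \<i> * \<alpha>))"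
    and L_minus1_derivative: "YW (Lop Y \<omega> (-1) v) n k w =
          t (n + 1) (YW v (n + 1) k w) + t (of_nat (k + 1)) (YW v (n + 1) (k + 1) w)"


section \<open>The series \<open>\<Delta>\<close>\<close>

text \<open>Powers and exponentials of operator-valued series \<open>\<Sum>\<^sub>q A q x\<^bsup>-q\<^esup>\<close>.  In \<open>series_exp\<close> the
  series \<open>A\<close> has no constant term, so the powers \<open>A\<^sup>p\<close> with \<open>p > q\<close> do not contribute to the
  coefficient of \<open>x\<^bsup>-q\<^esup>\<close>.\<close>

primrec series_power :: "(nat \<Rightarrow> 'v::ab_group_add \<Rightarrow> 'v) \<Rightarrow> nat \<Rightarrow> nat \<Rightarrow> 'v \<Rightarrow> 'v" where
  "series_power A 0 = (\<lambda>q v. if q = 0 then v else 0)"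
| "series_power A (Suc p) = (\<lambda>q v. \<Sum>i\<le>q. A i (series_power A p (q - i) v))"

definition series_exp :: "(complex \<Rightarrow> 'v::ab_group_add \<Rightarrow> 'v) \<Rightarrow> (nat \<Rightarrow> 'v \<Rightarrow> 'v) \<Rightarrow> nat \<Rightarrow> 'v \<Rightarrow> 'v" where
  "series_exp s A q v = (\<Sum>p\<le>q. s (1 / fact p) (series_power A p q v))"

definition Delta_exponent :: "(complex \<Rightarrow> 'v::ab_group_add \<Rightarrow> 'v) \<Rightarrow> ('v \<Rightarrow> int \<Rightarrow> 'v \<Rightarrow> 'v) \<Rightarrow> 'v
    \<Rightarrow> nat \<Rightarrow> 'v \<Rightarrow> 'v" where
  "Delta_exponent s Y u m v = (if m = 0 then 0 else s ((-1) ^ m / of_nat m) (Y u (int m) v))"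

text \<open>The coefficient of \<open>x\<^bsup>a\<^esup> (log x)\<^bsup>k\<^esup>\<close> in \<open>\<Delta>(x) v\<close>.\<close>

definition Delta :: "(complex \<Rightarrow> 'v::ab_group_add \<Rightarrow> 'v) \<Rightarrow> ('v \<Rightarrow> int \<Rightarrow> 'v \<Rightarrow> 'v) \<Rightarrow> 'v
    \<Rightarrow> complex \<Rightarrow> nat \<Rightarrow> 'v \<Rightarrow> 'v" where
  "Delta s Y u a k v = Sum_any (\<lambda>q::nat.
     op_powr s (\<lambda>x. - semisimple_part s (Y u 0) x) (\<lambda>x. - nilpotent_part s (Y u 0) x)
       (a + of_nat q) k (series_exp s (Delta_exponent s Y u) q v))"

text \<open>The coefficient of \<open>x\<^bsup>n\<^esup> (log x)\<^bsup>k\<^esup>\<close> in \<open>Y\<^sub>W(\<Delta>(x) v, x)\<close>.\<close>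

definition Delta_twist :: "(complex \<Rightarrow> 'v::ab_group_add \<Rightarrow> 'v) \<Rightarrow> ('v \<Rightarrow> int \<Rightarrow> 'v \<Rightarrow> 'v) \<Rightarrow> 'v
    \<Rightarrow> ('v \<Rightarrow> complex \<Rightarrow> nat \<Rightarrow> 'w::ab_group_add \<Rightarrow> 'w) \<Rightarrow> 'v \<Rightarrow> complex \<Rightarrow> nat \<Rightarrow> 'w \<Rightarrow> 'w" where
  "Delta_twist s Y u YW v n k w =
     Sum_any (\<lambda>a::complex. \<Sum>j\<le>k. YW (Delta s Y u a j v) (n - a) (k - j) w)"

end

theory Submission
  imports Defs "HOL-Computational_Algebra.Fundamental_Theorem_Algebra"
    "HOL-Computational_Algebra.Formal_Power_Series"
begin

text \<open>
  The proof separates the formal logarithms from the rest of the structure.  Write \<open>N\<^sub>g\<close> for the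
  nilpotent part of \<open>\<L>\<^sub>g\<close> and \<open>y(v, n)\<close> for the coefficient of \<open>x\<^bsup>n\<^esup> (log x)\<^bsup>0\<^esup>\<close> in \<open>Y\<^sub>W(v, x)\<close>.

  The logarithms are determined by the rest.  The Jacobi identity with \<open>v\<^sub>2 = \<one>\<close> shows that the coefficient of
  \<open>x\<^bsup>n\<^esup> (log x)\<^bsup>k\<^esup>\<close> in \<open>Y\<^sub>W(v, x)\<close> is \<open>y((-N\<^sub>g)\<^bsup>k\<^esup> v / k!, n)\<close>, and that it vanishes unless
  \<open>n \<in> - \<alpha> + \<int>\<close> when \<open>v\<close> has generalized \<open>g\<close>-eigenvalue \<open>e\<^bsup>2\<pi>i\<alpha>\<^esup>\<close> (\<open>twisted_module_structure\<close>).  For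
  the family \<open>y\<close> the right-hand side of the Jacobi identity collapses to
  \<open>\<Sum>\<^sub>i y((binom(N\<^sub>g - a - 1, i) v\<^sub>1)\<^bsub>l+i\<^esub> v\<^sub>2, a + b + 1 + i)\<close>.  Conversely a family \<open>y\<close> with this identity
  and this support yields the Jacobi identity with logarithms, because \<open>N\<^sub>g\<close> is a derivation, and also
  equivariance and the \<open>L(-1)\<close>-derivative property.  The locale \<open>twisted_core\<close> axiomatizes such
  families; \<open>twisted_module_core\<close> and \<open>twisted_moduleI\<close> pass between them and twisted modules, so one
  has to transport \<open>y\<close> and the grading.

  The next ingredient is the conjugation of vertex operators by \<open>\<Delta>\<close>.  Since \<open>V\<^bsub>(0)\<^esub> = \<complex>\<one>\<close> and
  \<open>V\<^bsub>(n)\<^esub> = 0\<close> for \<open>n < 0\<close>, skew symmetry forces \<open>u\<^sub>0 u = 0\<close>, the modes \<open>u\<^sub>m\<close> with \<open>m \<ge> 0\<close> commute, and the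
  coefficients \<open>E\<^sub>q\<close> of \<open>exp(\<Sum>\<^sub>m\<^sub>\<ge>\<^sub>1 u\<^sub>m (-x)\<^bsup>-m\<^esup> / m)\<close> satisfy \<open>q E\<^sub>q = \<Sum>\<^sub>m\<^sub>\<ge>\<^sub>1 (-1)\<^bsup>m\<^esup> u\<^sub>m E\<^bsub>q-m\<^esub>\<close>
  (\<open>E_rec\<close>).  Both sides of \<open>\<Delta>(x\<^sub>2) Y(v, x\<^sub>0) = Y(\<Delta>(x\<^sub>2 + x\<^sub>0) v, x\<^sub>0) \<Delta>(x\<^sub>2)\<close> satisfy the same recursion,
  so they agree (\<open>E_conjugation\<close>).

  The Jacobi identity for \<open>g g\<^sub>u\<close> follows from these two steps.  The automorphism \<open>g g\<^sub>u\<close> has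
  \<open>N\<^bsub>gg\<^sub>u\<^esub> = N\<^sub>g + (nilpotent part of u\<^sub>0)\<close> (\<open>N_op_g_gu\<close>).  On the generalized eigenspace of \<open>u\<^sub>0\<close> of
  eigenvalue \<open>b\<close> the transported family is \<open>\<Sum>\<^sub>q y(E\<^sub>q v, n + b + q)\<close>, so the operator in the Jacobi identity
  for \<open>y\<close> is evaluated at the exponent \<open>a + b + r\<close>, where
  \<open>N\<^sub>g - (a + b + r) - 1 = (N\<^bsub>gg\<^sub>u\<^esub> - a - 1) + (- u\<^sub>0 - r)\<close>.  The Vandermonde identity for binomial coefficients
  of commuting operators splits the sum, and \<open>E_conjugation\<close> turns what is left into the
  right-hand side for the transported family (\<open>jacobi_core\<close>, \<open>yh_jacobi_eigen\<close>).

  It remains to grade \<open>W\<close>.  From \<open>u\<^sub>0 \<omega> = 0\<close>, \<open>u\<^sub>1 \<omega> = u\<close> and \<open>E\<^sub>2 \<omega> \<in> \<complex>\<one>\<close> the new \<open>L(0)\<close> is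
  \<open>L(0) - u\<^sub>0 + \<kappa>\<close> for a constant \<open>\<kappa>\<close>.  The operators \<open>L(0)\<close>, \<open>u\<^sub>0\<close> and \<open>g\<close> on \<open>W\<close> commute and each has a
  decomposition into generalized eigenspaces, so \<open>W\<close> is spanned by joint generalized eigenvectors.
  These are generalized eigenvectors of the new \<open>L(0)\<close> and of \<open>g e\<^bsup>2\<pi>iu\<^sub>0\<^esup>\<close>, which gives the double
  grading (\<open>transported_twisted_module\<close>).
\<close>

section \<open>Linear maps and finitely supported sums\<close>

lemma lin_add: "Vector_Spaces.linear s t f \<Longrightarrow> f (x + y) = f x + f y"
  and lin_scale: "Vector_Spaces.linear s t f \<Longrightarrow> f (s c x) = t c (f x)"
  by (auto simp: Vector_Spaces.linear_iff)

lemma lin_zero: "Vector_Spaces.linear s t f \<Longrightarrow> f 0 = 0"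
  using lin_add[of s t f 0 0] by simp

lemma lin_neg: "Vector_Spaces.linear s t f \<Longrightarrow> f (- x) = - f x"
  using lin_add[of s t f x "- x"] lin_zero[of s t f] by (metis add.inverse_unique add.right_inverse)

lemma lin_diff: "Vector_Spaces.linear s t f \<Longrightarrow> f (x - y) = f x - f y"
  using lin_add[of s t f x "- y"] lin_neg[of s t f y] by simp

lemma lin_sum: "Vector_Spaces.linear s t f \<Longrightarrow> f (sum x A) = (\<Sum>a\<in>A. f (x a))"
  by (induction A rule: infinite_finite_induct) (auto simp: lin_zero lin_add)

lemma lin_Sum_any:
  assumes "Vector_Spaces.linear s t f" "finite {a. x a \<noteq> 0}"
  shows "f (Sum_any x) = Sum_any (\<lambda>a. f (x a))"
proof -
  have "{a. f (x a) \<noteq> 0} \<subseteq> {a. x a \<noteq> 0}" using lin_zero[OF assms(1)] by auto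
  then show ?thesis
    using assms(2) by (simp add: Sum_any.expand_superset[of "{a. x a \<noteq> 0}"] lin_sum[OF assms(1)])
qed

lemma lin_vs: "Vector_Spaces.linear s t f \<Longrightarrow> vector_space s" "Vector_Spaces.linear s t f \<Longrightarrow> vector_space t"
  by (auto simp: Vector_Spaces.linear_iff)

lemma lin_compose: "Vector_Spaces.linear s t f \<Longrightarrow> Vector_Spaces.linear t r g \<Longrightarrow> Vector_Spaces.linear s r (\<lambda>x. g (f x))"
  by (auto simp: Vector_Spaces.linear_iff)

lemma lin_plus: "Vector_Spaces.linear s t f \<Longrightarrow> Vector_Spaces.linear s t g \<Longrightarrow> Vector_Spaces.linear s t (\<lambda>x. f x + g x)"
  by (auto simp: Vector_Spaces.linear_iff vector_space.vector_space_assms)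

lemma lin_uminus: "Vector_Spaces.linear s t f \<Longrightarrow> Vector_Spaces.linear s t (\<lambda>x. - f x)"
  by (auto simp: Vector_Spaces.linear_iff module.scale_minus_right module_iff_vector_space)

lemma lin_minus: "Vector_Spaces.linear s t f \<Longrightarrow> Vector_Spaces.linear s t g \<Longrightarrow> Vector_Spaces.linear s t (\<lambda>x. f x - g x)"
  using lin_plus[of s t f "\<lambda>x. - g x"] lin_uminus[of s t g] by simp

lemma lin_smult: "Vector_Spaces.linear s t f \<Longrightarrow> Vector_Spaces.linear s t (\<lambda>x. t c (f x))"
  by (auto simp: Vector_Spaces.linear_iff vector_space.vector_space_assms mult.commute)

lemma lin_setsum: "vector_space s \<Longrightarrow> vector_space t \<Longrightarrow> (\<And>a. a \<in> A \<Longrightarrow> Vector_Spaces.linear s t (f a))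
   \<Longrightarrow> Vector_Spaces.linear s t (\<lambda>x. \<Sum>a\<in>A. f a x)"
proof (induction A rule: infinite_finite_induct)
  case (insert a A)
  then show ?case using lin_plus[of s t "f a" "\<lambda>x. \<Sum>a\<in>A. f a x"] by simp
qed (auto simp: Vector_Spaces.linear_iff module.scale_zero_right module_iff_vector_space)

lemma lin_id: "vector_space s \<Longrightarrow> Vector_Spaces.linear s s (\<lambda>x. x)"
  by (auto simp: Vector_Spaces.linear_iff)

lemma lin_scaleop: "vector_space s \<Longrightarrow> Vector_Spaces.linear s s (\<lambda>x. s c x)"
  by (rule lin_smult[OF lin_id])

lemma lin_funpow: "Vector_Spaces.linear s s T \<Longrightarrow> Vector_Spaces.linear s s (T ^^ k)"
proof (induction k)
  case 0 then show ?case using lin_id[OF lin_vs(1)[OF 0]] by (simp add: id_def)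
next
  case (Suc k) then show ?case using lin_compose[of s s "T^^k" s T] by (simp add: o_def)
qed

lemma funpow_commute_op: "(\<And>x. A (B x) = B (A x)) \<Longrightarrow> (A ^^ k) (B x) = B ((A ^^ k) x)"
  by (induction k arbitrary: x) auto

lemma Sum_any_eq_sum: "finite A \<Longrightarrow> (\<And>a. a \<notin> A \<Longrightarrow> f a = 0) \<Longrightarrow> Sum_any f = sum f A"
  by (rule Sum_any.expand_superset) auto

lemma Sum_any_sum_swap:
  assumes "finite A" "\<And>a. a \<in> A \<Longrightarrow> finite {i. f a i \<noteq> 0}"
  shows "Sum_any (\<lambda>i. \<Sum>a\<in>A. f a i) = (\<Sum>a\<in>A. Sum_any (f a))"
    and "finite {i. (\<Sum>a\<in>A. f a i) \<noteq> 0}"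
proof -
  let ?I = "\<Union>a\<in>A. {i. f a i \<noteq> 0}"
  have fin: "finite ?I" using assms by auto
  have z: "(\<Sum>a\<in>A. f a i) = 0" if "i \<notin> ?I" for i using that by (auto intro!: sum.neutral)
  show "finite {i. (\<Sum>a\<in>A. f a i) \<noteq> 0}" by (rule finite_subset[OF _ fin]) (use z in blast)
  have "Sum_any (\<lambda>i. \<Sum>a\<in>A. f a i) = (\<Sum>i\<in>?I. \<Sum>a\<in>A. f a i)"
    by (rule Sum_any_eq_sum[OF fin]) (use z in blast)
  also have "\<dots> = (\<Sum>a\<in>A. \<Sum>i\<in>?I. f a i)" by (rule sum.swap)
  also have "\<dots> = (\<Sum>a\<in>A. Sum_any (f a))"
    by (rule sum.cong[OF refl], rule Sum_any_eq_sum[symmetric, OF fin]) auto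
  finally show "Sum_any (\<lambda>i. \<Sum>a\<in>A. f a i) = (\<Sum>a\<in>A. Sum_any (f a))" .
qed

locale complex_vector_space = vector_space scale
  for scale :: "complex \<Rightarrow> 'a::ab_group_add \<Rightarrow> 'a"
begin

abbreviation lin where "lin T \<equiv> Vector_Spaces.linear scale scale T"
abbreviation ge where "ge T c \<equiv> gen_eigenspace scale T c"
abbreviation shift where "shift T c \<equiv> (\<lambda>x. T x - scale c x)"

lemma vs: "vector_space scale" by unfold_locales

lemmas lin_idV = lin_id[OF vs] and lin_scaleV = lin_scaleop[OF vs]

lemma linI: "(\<And>x y. T (x + y) = T x + T y) \<Longrightarrow> (\<And>c x. T (scale c x) = scale c (T x)) \<Longrightarrow> lin T"
  by (auto simp: Vector_Spaces.linear_iff vs)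

lemma lin_shift: "lin T \<Longrightarrow> lin (shift T c)"
  by (intro lin_minus lin_scaleV)

lemma lin_shift_pow: "lin T \<Longrightarrow> lin (shift T c ^^ k)"
  by (intro lin_funpow lin_shift)

lemma geI: "(shift T c ^^ K) v = 0 \<Longrightarrow> v \<in> ge T c"
  by (auto simp: gen_eigenspace_def)

lemma geE: assumes "v \<in> ge T c" obtains K where "(shift T c ^^ K) v = 0"
  using assms by (auto simp: gen_eigenspace_def)

lemma ge_of_shift: assumes "shift T c v \<in> ge T c" shows "v \<in> ge T c"
proof -
  obtain K where "(shift T c ^^ K) (shift T c v) = 0" using assms geE by metis
  then have "(shift T c ^^ Suc K) v = 0" by (simp only: funpow_Suc_right o_apply)
  then show ?thesis by (rule geI)
qed

lemma shift_pow_mono: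
  assumes "lin T" "(shift T c ^^ K) v = 0" "K \<le> K'" shows "(shift T c ^^ K') v = 0"
proof -
  have "(shift T c ^^ K') v = (shift T c ^^ (K' - K)) ((shift T c ^^ K) v)"
    using assms(3) by (metis comp_apply funpow_add le_add_diff_inverse2)
  then show ?thesis using assms(2) lin_zero[OF lin_shift_pow[OF assms(1)]] by metis
qed

lemma subspace_ge: assumes T: "lin T" shows "subspace (ge T c)"
  unfolding subspace_def
proof (intro conjI ballI allI)
  show "0 \<in> ge T c" by (rule geI[where K=0]) simp
next
  fix x y assume "x \<in> ge T c" "y \<in> ge T c"
  then obtain K L where "(shift T c ^^ K) x = 0" "(shift T c ^^ L) y = 0" by (metis geE)
  then have "(shift T c ^^ (max K L)) x = 0" "(shift T c ^^ (max K L)) y = 0"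
    using shift_pow_mono[OF T] by (meson max.cobounded1 max.cobounded2)+
  then show "x + y \<in> ge T c"
    by (intro geI[where K="max K L"]) (simp add: lin_add[OF lin_shift_pow[OF T]])
next
  fix a x assume "x \<in> ge T c"
  then obtain K where "(shift T c ^^ K) x = 0" by (metis geE)
  then show "scale a x \<in> ge T c"
    by (intro geI[where K=K]) (simp add: lin_scale[OF lin_shift_pow[OF T]])
qed

lemma ge_commute:
  assumes "lin S" "\<And>x. T (S x) = S (T x)" "v \<in> ge T c" shows "S v \<in> ge T c"
proof -
  obtain K where K: "(shift T c ^^ K) v = 0" using assms(3) geE by metis
  have "(shift T c ^^ K) (S v) = S ((shift T c ^^ K) v)"
    by (rule funpow_commute_op) (simp add: assms(2) lin_diff[OF assms(1)] lin_scale[OF assms(1)])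
  then show ?thesis using K lin_zero[OF assms(1)] by (intro geI[where K=K]) simp
qed

lemma ge_self: "lin T \<Longrightarrow> v \<in> ge T c \<Longrightarrow> T v \<in> ge T c"
  by (rule ge_commute) auto

lemma ge_shift: "lin T \<Longrightarrow> v \<in> ge T c \<Longrightarrow> shift T d v \<in> ge T c"
  by (rule ge_commute) (auto intro!: lin_shift simp: lin_diff lin_scale)

lemma ge_shift_pow: "lin T \<Longrightarrow> v \<in> ge T c \<Longrightarrow> (shift T d ^^ K) v \<in> ge T c"
  by (induction K) (auto intro: ge_shift)

lemma ge_0: "lin T \<Longrightarrow> 0 \<in> ge T c" by (simp add: subspace_ge subspace_0)
lemma ge_add: "lin T \<Longrightarrow> x \<in> ge T c \<Longrightarrow> y \<in> ge T c \<Longrightarrow> x + y \<in> ge T c" by (simp add: subspace_ge subspace_add)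
lemma ge_scale: "lin T \<Longrightarrow> x \<in> ge T c \<Longrightarrow> scale a x \<in> ge T c" by (simp add: subspace_ge subspace_scale)
lemma ge_diff: "lin T \<Longrightarrow> x \<in> ge T c \<Longrightarrow> y \<in> ge T c \<Longrightarrow> x - y \<in> ge T c" by (simp add: subspace_ge subspace_diff)
lemma ge_sum: "lin T \<Longrightarrow> (\<And>a. a \<in> A \<Longrightarrow> x a \<in> ge T c) \<Longrightarrow> sum x A \<in> ge T c" by (rule subspace_sum[OF subspace_ge])

text \<open>By induction on the nilpotency degree of \<open>T - d\<close> at \<open>x\<close>: if \<open>(T - c) z = (T - d) x\<close>, then
  \<open>(T - c) (x - z) = (T - c) x - (T - d) x = (d - c) x\<close>, so that \<open>(x - z) / (d - c)\<close> is a preimage of \<open>x\<close>.\<close>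

lemma shift_surj_ge:
  assumes T: "lin T" and cd: "c \<noteq> d" and x: "x \<in> ge T d"
  shows "\<exists>z\<in>ge T d. shift T c z = x"
proof -
  obtain K where "(shift T d ^^ K) x = 0" using x geE by metis
  then show ?thesis
  proof (induction K arbitrary: x)
    case 0 then show ?case using ge_0[OF T] lin_zero[OF T] by (intro bexI[of _ 0]) auto
  next
    case (Suc K)
    have "(shift T d ^^ K) (shift T d x) = 0" using Suc.prems by (simp only: funpow_Suc_right o_apply)
    then obtain z where z: "z \<in> ge T d" "shift T c z = shift T d x" using Suc.IH by blast
    have "x \<in> ge T d" using Suc.prems by (rule geI)
    moreover have "shift T c (scale (1 / (d - c)) (x - z)) = scale (1 / (d - c)) (shift T c x - shift T c z)"
      by (simp add: lin_scale[OF T] lin_diff[OF T] algebra_simps)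
    moreover have "\<dots> = scale (1 / (d - c)) (scale (d - c) x)"
      by (simp only: z(2)) (simp add: algebra_simps)
    moreover have "\<dots> = x" using cd by simp
    ultimately show ?case using z(1) T by (metis ge_diff ge_scale)
  qed
qed

text \<open>A vector with \<open>T x = c x\<close> is scaled by \<open>T - d\<close> with the nonzero factor \<open>c - d\<close>, and no power of
  \<open>T - d\<close> can kill it.\<close>

lemma shift_inj_ge:
  assumes T: "lin T" and cd: "c \<noteq> d" and x: "x \<in> ge T d" and "shift T c x = 0"
  shows "x = 0"
proof -
  obtain K where "(shift T d ^^ K) x = 0" using x geE by metis
  then show ?thesis using assms(4)
  proof (induction K)
    case 0 then show ?case by simp
  next
    case (Suc K)
    have "shift T d x = scale (c - d) x" using Suc.prems(2) by (simp add: algebra_simps)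
    then have "(shift T d ^^ Suc K) x = scale (c - d) ((shift T d ^^ K) x)"
      by (simp only: funpow_Suc_right o_apply) (simp add: lin_scale[OF lin_shift_pow[OF T]])
    then show ?case using Suc cd by simp
  qed
qed

lemma shift_pow_inj_ge:
  assumes T: "lin T" and cd: "c \<noteq> d" and x: "x \<in> ge T d" and "(shift T c ^^ K) x = 0"
  shows "x = 0"
  using assms(4,3)
proof (induction K arbitrary: x)
  case 0 then show ?case by simp
next
  case (Suc K)
  have "shift T c x = 0" using Suc.IH[of "shift T c x"] Suc.prems ge_shift[OF T]
    by (simp only: funpow_Suc_right o_apply)
  then show ?case using shift_inj_ge[OF T cd Suc.prems(2)] by blast
qed

text \<open>A power of \<open>T - d\<close> that kills the component for \<open>d\<close> is injective on the generalized eigenspaces for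
  the other eigenvalues, which reduces the number of components.\<close>

lemma ge_independent:
  assumes T: "lin T" and "finite F" "\<And>c. c \<in> F \<Longrightarrow> x c \<in> ge T c" "(\<Sum>c\<in>F. x c) = 0" "c \<in> F"
  shows "x c = 0"
  using assms(2-)
proof (induction F arbitrary: x c rule: finite_induct)
  case empty then show ?case by simp
next
  case (insert d F)
  obtain K where K: "(shift T d ^^ K) (x d) = 0" using geE[OF insert.prems(1)[of d, simplified]] by blast
  let ?D = "shift T d ^^ K"
  have D: "lin ?D" by (rule lin_shift_pow[OF T])
  have "?D (\<Sum>c\<in>insert d F. x c) = 0" using insert.prems(2) lin_zero[OF D] by simp
  then have "(\<Sum>c\<in>F. ?D (x c)) = 0"
    using insert.hyps K by (simp add: lin_add[OF D] lin_sum[OF D])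
  then have z: "?D (x c) = 0" if "c \<in> F" for c
    using insert.IH[of "\<lambda>c. ?D (x c)" c] insert.prems(1) that ge_shift_pow[OF T] by blast
  have x0: "x c = 0" if "c \<in> F" for c
    using shift_pow_inj_ge[OF T _ insert.prems(1) z[OF that]] that insert.hyps by auto
  then have "x d = 0" using insert.prems(2) insert.hyps by simp
  then show ?case using x0 insert.prems by blast
qed

section \<open>Direct sums\<close>

lemma decomposes_unique:
  assumes "is_direct_sum scale I U" "decomposes I U v f" "decomposes I U v f'" shows "f = f'"
  using assms unfolding is_direct_sum_def by blast

lemma component_eq:
  assumes "is_direct_sum scale I U" "decomposes I U v f" shows "component I U i v = f i"
proof -
  have "(THE f. decomposes I U v f) = f"
    using assms decomposes_unique by (intro the_equality) auto
  then show ?thesis by (simp add: component_def)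
qed

lemma decomposes_component:
  assumes "is_direct_sum scale I U" shows "decomposes I U v (\<lambda>i. component I U i v)"
proof -
  obtain f where "decomposes I U v f" using assms unfolding is_direct_sum_def by blast
  moreover then have "(\<lambda>i. component I U i v) = f" using component_eq[OF assms] by blast
  ultimately show ?thesis by simp
qed

lemma component_in: "is_direct_sum scale I U \<Longrightarrow> i \<in> I \<Longrightarrow> component I U i v \<in> U i"
  and component_finite: "is_direct_sum scale I U \<Longrightarrow> finite {i. component I U i v \<noteq> 0}"
  and component_sum: "is_direct_sum scale I U \<Longrightarrow> Sum_any (\<lambda>i. component I U i v) = v"
  using decomposes_component[of I U v] unfolding decomposes_def by auto

lemma Sum_any_add_fin:
  fixes f g :: "'i \<Rightarrow> 'b::comm_monoid_add"
  assumes "finite {i. f i \<noteq> 0}" "finite {i. g i \<noteq> 0}"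
  shows "Sum_any (\<lambda>i. f i + g i) = Sum_any f + Sum_any g" "finite {i. f i + g i \<noteq> 0}"
proof -
  show "Sum_any (\<lambda>i. f i + g i) = Sum_any f + Sum_any g" using assms by (rule Sum_any.distrib)
  have "{i. f i + g i \<noteq> 0} \<subseteq> {i. f i \<noteq> 0} \<union> {i. g i \<noteq> 0}" by auto
  then show "finite {i. f i + g i \<noteq> 0}" using assms finite_subset by blast
qed

lemma component_linear:
  assumes D: "is_direct_sum scale I U" shows "lin (component I U i)"
proof (rule linI)
  have sub: "j \<in> I \<Longrightarrow> subspace (U j)" for j using D by (simp add: is_direct_sum_def)
  fix x y
  note X = decomposes_component[OF D, of x] and Y = decomposes_component[OF D, of y]
  have "decomposes I U (x + y) (\<lambda>i. component I U i x + component I U i y)"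
    using X Y Sum_any_add_fin[of "\<lambda>i. component I U i x" "\<lambda>i. component I U i y"]
    unfolding decomposes_def by (auto intro: subspace_add sub)
  then show "component I U i (x + y) = component I U i x + component I U i y"
    by (rule component_eq[OF D])
next
  have sub: "j \<in> I \<Longrightarrow> subspace (U j)" for j using D by (simp add: is_direct_sum_def)
  fix c x
  note X = decomposes_component[OF D, of x]
  have "decomposes I U (scale c x) (\<lambda>i. scale c (component I U i x))"
    using X lin_Sum_any[OF lin_scaleV, of "\<lambda>i. component I U i x" c]
      finite_subset[of "{i. scale c (component I U i x) \<noteq> 0}" "{i. component I U i x \<noteq> 0}"]
    unfolding decomposes_def by (auto intro: subspace_scale sub)
  then show "component I U i (scale c x) = scale c (component I U i x)"
    by (rule component_eq[OF D])
qed

lemma component_self: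
  assumes D: "is_direct_sum scale I U" and "i \<in> I" "v \<in> U i"
  shows "component I U j v = (if j = i then v else 0)"
proof (rule component_eq[OF D])
  have sub: "j \<in> I \<Longrightarrow> subspace (U j)" for j using D by (simp add: is_direct_sum_def)
  have "{j. (if j = i then v else 0) \<noteq> 0} \<subseteq> {i}" by auto
  moreover have "Sum_any (\<lambda>j. if j = i then v else 0) = v" by (simp add: Sum_any.delta[of i "\<lambda>_. v"])
  ultimately show "decomposes I U v (\<lambda>j. if j = i then v else 0)"
    using assms(2,3) finite_subset[of _ "{i}"] unfolding decomposes_def
    by (auto intro: subspace_0 sub)
qed

lemma direct_sum_induct:
  assumes D: "is_direct_sum scale I U"
    and "\<And>i x. i \<in> I \<Longrightarrow> x \<in> U i \<Longrightarrow> P x" "\<And>x y. P x \<Longrightarrow> P y \<Longrightarrow> P (x + y)" "P 0"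
  shows "P v"
proof -
  have *: "P (\<Sum>i\<in>F. component I U i v)" if "finite F" for F
    using that
  proof (induction F)
    case (insert i F)
    have "P (component I U i v)"
      using component_in[OF D] decomposes_component[OF D] assms(2,4) unfolding decomposes_def by metis
    then show ?case using insert assms(3) by auto
  qed (use assms(4) in auto)
  have "v = (\<Sum>i\<in>{i. component I U i v \<noteq> 0}. component I U i v)"
    using component_sum[OF D, of v] by (simp add: Sum_any.expand_set)
  then show ?thesis using *[OF component_finite[OF D]] by metis
qed

text \<open>The operators attached to a Jordan decomposition and to its logarithm are all defined by their
  restrictions to generalized eigenspaces.\<close>

lemma direct_sum_extend:
  assumes D: "is_direct_sum scale UNIV U" and F: "\<And>i. lin (F i)"
  shows "\<exists>G. lin G \<and> (\<forall>i. \<forall>v\<in>U i. G v = F i v)"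
proof (intro exI conjI allI ballI)
  let ?p = "\<lambda>i. component UNIV U i"
  let ?G = "\<lambda>v. Sum_any (\<lambda>i. F i (?p i v))"
  have p: "lin (?p i)" for i by (rule component_linear[OF D])
  have fin: "finite {i. F i (?p i v) \<noteq> 0}" for v
    by (rule finite_subset[OF _ component_finite[OF D, of v]]) (auto simp: lin_zero[OF F])
  show "lin ?G"
  proof (rule linI)
    fix x y show "?G (x + y) = ?G x + ?G y"
      using Sum_any_add_fin(1)[OF fin fin] by (simp add: lin_add[OF p] lin_add[OF F])
  next
    fix c x show "?G (scale c x) = scale c (?G x)"
      using lin_Sum_any[OF lin_scaleV fin] by (simp add: lin_scale[OF p] lin_scale[OF F])
  qed
  fix i v assume "v \<in> U i"
  then have "?p j v = (if j = i then v else 0)" for j using component_self[OF D, of i v j] by simp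
  then have "(\<lambda>j. F j (?p j v)) = (\<lambda>j. if j = i then F i v else 0)"
    by (auto simp: lin_zero[OF F])
  then show "?G v = F i v" using Sum_any.delta[of i "\<lambda>_. F i v"] by metis
qed

text \<open>Uniqueness of decompositions only has to be tested at \<open>0\<close>, since two decompositions of a vector
  differ by a decomposition of \<open>0\<close>.\<close>

lemma is_direct_sumI:
  assumes sub: "\<And>i. i \<in> I \<Longrightarrow> subspace (U i)" and span: "\<And>v. v \<in> span (\<Union>i\<in>I. U i)"
    and ind: "\<And>f. decomposes I U 0 f \<Longrightarrow> f = (\<lambda>_. 0)"
  shows "is_direct_sum scale I U"
proof -
  have ex: "\<exists>f. decomposes I U v f" for v
    using span[of v]
  proof (induction rule: span_induct_alt)
    case base
    show ?case by (intro exI[of _ "\<lambda>_. 0"]) (auto simp: decomposes_def subspace_0[OF sub])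
  next
    case (step a x y)
    then obtain d f where f: "d \<in> I" "x \<in> U d" "decomposes I U y f" by auto
    let ?h = "\<lambda>c. if c = d then scale a x else 0"
    have h: "Sum_any ?h = scale a x" "finite {c. ?h c \<noteq> 0}" "\<forall>c\<in>I. ?h c \<in> U c" "\<forall>c. c \<notin> I \<longrightarrow> ?h c = 0"
      using f(1,2) subspace_0[OF sub] subspace_scale[OF sub] by (auto simp: Sum_any.delta[of d "\<lambda>_. scale a x"])
    have "decomposes I U (scale a x + y) (\<lambda>c. ?h c + f c)"
      using f(3) h Sum_any_add_fin[of ?h f] subspace_add[OF sub] unfolding decomposes_def by simp
    then show ?case by blast
  qed
  have "f = g" if f: "decomposes I U v f" and g: "decomposes I U v g" for v f g
  proof -
    have "finite {c. g c \<noteq> 0}" using g by (auto simp: decomposes_def)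
    then have "Sum_any (\<lambda>c. - g c) = - Sum_any g" "finite {c. - g c \<noteq> 0}"
      using lin_Sum_any[OF lin_uminus[OF lin_idV], of g] by auto
    then have "decomposes I U 0 (\<lambda>c. f c + - g c)"
      using f g Sum_any_add_fin[of f "\<lambda>c. - g c"] subspace_diff[OF sub] unfolding decomposes_def by auto
    from ind[OF this] show ?thesis by (simp add: fun_eq_iff)
  qed
  then have "\<exists>!f. decomposes I U v f" for v using ex[of v] by blast
  then show ?thesis using sub unfolding is_direct_sum_def by blast
qed

section \<open>Operators with a decomposition into generalized eigenspaces\<close>

text \<open>The operators with a Jordan decomposition.  Only spanning is required: independence of generalized
  eigenspaces is automatic, and a condition on spans can be checked on any spanning set.\<close>

definition triangulable :: "('a \<Rightarrow> 'a) \<Rightarrow> bool" where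
  "triangulable T \<longleftrightarrow> lin T \<and> span (\<Union>c. ge T c) = UNIV"

lemma triangulable_lin: "triangulable T \<Longrightarrow> lin T" by (simp add: triangulable_def)

lemma decomposes_ge_zero:
  assumes T: "lin T" and "decomposes UNIV (ge T) 0 f" shows "f = (\<lambda>_. 0)"
proof
  fix c
  have "c \<in> {c. f c \<noteq> 0} \<Longrightarrow> f c = 0"
    using assms(2) by (intro ge_independent[OF T, of "{c. f c \<noteq> 0}" f])
      (auto simp: decomposes_def Sum_any.expand_set)
  then show "f c = 0" by blast
qed

lemma triangulable_direct_sum:
  assumes T: "triangulable T" shows "is_direct_sum scale UNIV (ge T)"
  using T by (intro is_direct_sumI decomposes_ge_zero subspace_ge) (auto simp: triangulable_def)

lemma triangulable_decomposes: "triangulable T \<Longrightarrow> \<exists>f. decomposes UNIV (ge T) v f"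
  using triangulable_direct_sum unfolding is_direct_sum_def by blast

lemma direct_sum_triangulable:
  assumes "lin T" "is_direct_sum scale UNIV (ge T)" shows "triangulable T"
proof -
  have "v \<in> span (\<Union>c. ge T c)" for v
    by (rule direct_sum_induct[OF assms(2)]) (auto intro: span_base span_add span_zero)
  then show ?thesis using assms(1) by (auto simp: triangulable_def)
qed

lemma triangulable_induct [consumes 1, case_names ge add]:
  assumes "triangulable T" "\<And>c x. x \<in> ge T c \<Longrightarrow> P x" "\<And>x y. P x \<Longrightarrow> P y \<Longrightarrow> P (x + y)"
  shows "P v"
proof (rule direct_sum_induct[OF triangulable_direct_sum[OF assms(1)], of P])
  show "P 0" using assms(2) ge_0[OF triangulable_lin[OF assms(1)]] by metis
qed (use assms(2,3) in simp_all)

lemma decomposes_ge_commute: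
  assumes T: "lin T" and S: "lin S" and c: "\<And>x. T (S x) = S (T x)" and f: "decomposes UNIV (ge T) v f"
  shows "decomposes UNIV (ge T) (S v) (\<lambda>c. S (f c))"
proof -
  have "finite {c. f c \<noteq> 0}" using f by (simp add: decomposes_def)
  moreover then have "finite {c. S (f c) \<noteq> 0}"
    by (rule rev_finite_subset) (auto simp: lin_zero[OF S])
  ultimately show ?thesis
    using f lin_Sum_any[OF S, of f] ge_commute[where T=T and S=S, OF S c] by (auto simp: decomposes_def)
qed

text \<open>An operator commuting with \<open>T\<close> acts componentwise.  Applied to a power of \<open>S - d\<close> that kills \<open>v\<close>, this
  shows that the power kills every component of \<open>v\<close>.\<close>

lemma decomposes_in_ge:
  assumes T: "lin T" and S: "lin S" and c: "\<And>x. T (S x) = S (T x)"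
    and f: "decomposes UNIV (ge T) v f" and v: "v \<in> ge S d"
  shows "f c \<in> ge S d"
proof -
  obtain K where K: "(shift S d ^^ K) v = 0" using v geE by metis
  let ?D = "shift S d ^^ K"
  have D: "lin ?D" by (rule lin_shift_pow[OF S])
  have comm: "T (?D x) = ?D (T x)" for x
    by (rule funpow_commute_op[symmetric]) (simp add: c lin_diff[OF T] lin_scale[OF T])
  have "decomposes UNIV (ge T) (?D v) (\<lambda>c. ?D (f c))"
    by (rule decomposes_ge_commute[where T=T, OF T D comm f])
  then have "?D (f c) = 0" using K decomposes_ge_zero[OF T] by (metis (mono_tags, lifting))
  then show ?thesis by (rule geI)
qed

lemma decomposes_induct:
  assumes f: "decomposes UNIV U v f" and "\<And>c. P (f c)" "\<And>x y. P x \<Longrightarrow> P y \<Longrightarrow> P (x + y)" "P 0"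
  shows "P v"
proof -
  have *: "P (\<Sum>i\<in>F. f i)" if "finite F" for F
    using that by (induction F) (use assms in auto)
  have "v = (\<Sum>i\<in>{i. f i \<noteq> 0}. f i)" "finite {i. f i \<noteq> 0}"
    using f by (auto simp: decomposes_def Sum_any.expand_set)
  then show ?thesis using * by metis
qed

text \<open>Commuting operators preserve each other's generalized eigenspaces, so a vector of \<open>ge R c\<close> can be
  decomposed with respect to \<open>T\<close> without leaving \<open>ge R c\<close>.  Repeating this with further commuting
  operators reduces additive statements to joint generalized eigenvectors.\<close>

lemma triangulable_induct_within:
  assumes T: "triangulable T" and R: "lin R" "\<And>x. T (R x) = R (T x)" and v: "v \<in> ge R c"
    and P: "\<And>a x. x \<in> ge T a \<Longrightarrow> x \<in> ge R c \<Longrightarrow> P x" "\<And>x y. P x \<Longrightarrow> P y \<Longrightarrow> P (x + y)"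
  shows "P v"
proof -
  have lT: "lin T" by (rule triangulable_lin[OF T])
  obtain f where f: "decomposes UNIV (ge T) v f" using triangulable_decomposes[OF T] by blast
  have "P (f a)" for a
    by (rule P(1)[of _ a]) (use f decomposes_in_ge[where T=T and S=R, OF lT R f v] in \<open>auto simp: decomposes_def\<close>)
  then show ?thesis using decomposes_induct[OF f, of P] P ge_0[OF lT] ge_0[OF R(1)] by blast
qed

lemma joint_induct_within:
  assumes T: "triangulable T" and S: "triangulable S" and c: "\<And>x. T (S x) = S (T x)"
    and R: "lin R" "\<And>x. T (R x) = R (T x)" "\<And>x. S (R x) = R (S x)" and v: "v \<in> ge R c"
    and P: "\<And>a b x. x \<in> ge T a \<Longrightarrow> x \<in> ge S b \<Longrightarrow> x \<in> ge R c \<Longrightarrow> P x" "\<And>x y. P x \<Longrightarrow> P y \<Longrightarrow> P (x + y)"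
  shows "P v"
proof (rule triangulable_induct_within[where T=S and R=R and P=P, OF S R(1,3) v])
  fix b x assume x: "x \<in> ge S b" "x \<in> ge R c"
  have l: "lin T" "lin S" using T S triangulable_lin by auto
  obtain f where f: "decomposes UNIV (ge T) x f" using triangulable_decomposes[OF T] by blast
  have "P (f a)" for a
    by (rule P(1)[of _ a b]) (use f decomposes_in_ge[where T=T and S=S, OF l(1,2) c f x(1)]
      decomposes_in_ge[where T=T and S=R, OF l(1) R(1,2) f x(2)] in \<open>auto simp: decomposes_def\<close>)
  then show "P x" using decomposes_induct[OF f, of P] P ge_0 l R(1) by blast
qed (rule P(2))

lemma joint_induct:
  assumes T: "triangulable T" and S: "triangulable S" and c: "\<And>x. T (S x) = S (T x)"
    and P: "\<And>a b x. x \<in> ge T a \<Longrightarrow> x \<in> ge S b \<Longrightarrow> P x" "\<And>x y. P x \<Longrightarrow> P y \<Longrightarrow> P (x + y)"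
  shows "P v"
  using S
proof (induction v rule: triangulable_induct)
  case (ge b x)
  show ?case by (rule triangulable_induct_within[where T=T and R=S and P=P, OF T triangulable_lin[OF S] c ge P])
qed (rule P(2))

lemma joint_induct3:
  assumes T: "triangulable T" and S: "triangulable S" and R: "triangulable R"
    and c: "\<And>x. T (S x) = S (T x)" "\<And>x. T (R x) = R (T x)" "\<And>x. S (R x) = R (S x)"
    and P: "\<And>a b c x. x \<in> ge T a \<Longrightarrow> x \<in> ge S b \<Longrightarrow> x \<in> ge R c \<Longrightarrow> P x" "\<And>x y. P x \<Longrightarrow> P y \<Longrightarrow> P (x + y)"
  shows "P v"
  using R
proof (induction v rule: triangulable_induct)
  case (ge d x)
  show ?case by (rule joint_induct_within[where T=T and S=S and R=R and P=P, OF T S c(1) triangulable_lin[OF R] c(2,3) ge P])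
qed (rule P(2))

section \<open>Finite-dimensional invariant subspaces\<close>

text \<open>Let \<open>G\<close> be the span of the generalized eigenspaces.  Every element of \<open>G\<close> is congruent modulo
  \<open>ge T c\<close> to an element of \<open>(T - c) G\<close>, because \<open>T - c\<close> is surjective on \<open>ge T d\<close> for \<open>d \<noteq> c\<close>.  Hence
  \<open>(T - c) (v - z) \<in> ge T c\<close> for some \<open>z \<in> G\<close>, and then \<open>v - z \<in> ge T c\<close>.\<close>

lemma ge_span_preimage:
  assumes T: "lin T" and x: "shift T c v \<in> span (\<Union>c. ge T c)" shows "v \<in> span (\<Union>c. ge T c)"
proof -
  let ?G = "span (\<Union>c. ge T c)"
  have s: "lin (shift T c)" by (rule lin_shift[OF T])
  have *: "\<exists>z\<in>?G. x - shift T c z \<in> ge T c" if "x \<in> ?G" for x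
    using that
  proof (induction rule: span_induct_alt)
    case base
    show ?case using ge_0[OF T] lin_zero[OF s] by (intro bexI[of _ 0]) (auto simp: span_zero)
  next
    case (step a x y)
    then obtain d where d: "x \<in> ge T d" by auto
    obtain z where z: "z \<in> ?G" "y - shift T c z \<in> ge T c" using step by auto
    have "\<exists>z\<in>?G. x - shift T c z \<in> ge T c"
    proof (cases "d = c")
      case True then show ?thesis using d lin_zero[OF s] by (intro bexI[of _ 0]) (auto simp: span_zero)
    next
      case False
      then obtain z where "z \<in> ge T d" "shift T c z = x" using shift_surj_ge[OF T _ d, of c] by auto
      then show ?thesis using ge_0[OF T] by (intro bexI[of _ z]) (auto intro: span_base)
    qed
    then obtain z' where z': "z' \<in> ?G" "x - shift T c z' \<in> ge T c" by auto
    have "(scale a x + y) - shift T c (scale a z' + z) = scale a (x - shift T c z') + (y - shift T c z)"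
      by (simp only: lin_add[OF s] lin_scale[OF s] scale_right_diff_distrib) simp
    also have "\<dots> \<in> ge T c" using z z' by (intro ge_add ge_scale T)
    finally show ?case using z z' by (intro bexI[of _ "scale a z' + z"]) (auto intro: span_add span_scale)
  qed
  obtain z where z: "z \<in> ?G" "shift T c v - shift T c z \<in> ge T c" using *[OF x] by auto
  have "shift T c (v - z) \<in> ge T c" using z(2) lin_diff[OF s] by metis
  then have "v - z \<in> ge T c" by (rule ge_of_shift[where T=T])
  then have "(v - z) + z \<in> ?G" using z(1) by (intro span_add) (auto intro: span_base)
  then show ?thesis by simp
qed

definition poly_op :: "('a \<Rightarrow> 'a) \<Rightarrow> complex poly \<Rightarrow> 'a \<Rightarrow> 'a" where
  "poly_op T p v = (\<Sum>i\<le>degree p. scale (coeff p i) ((T ^^ i) v))"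

lemma poly_op_bound: "degree p \<le> n \<Longrightarrow> poly_op T p v = (\<Sum>i\<le>n. scale (coeff p i) ((T ^^ i) v))"
  unfolding poly_op_def by (rule sum.mono_neutral_left) (auto simp: coeff_eq_0)

lemma poly_op_linear_factor:
  assumes T: "lin T" shows "poly_op T ([:- c, 1:] * q) v = poly_op T q (shift T c v)"
proof -
  let ?n = "degree q"
  have "poly_op T ([:- c, 1:] * q) v = (\<Sum>i\<le>Suc ?n. scale (coeff ([:- c, 1:] * q) i) ((T ^^ i) v))"
    by (rule poly_op_bound) (use degree_mult_le[of "[:-c,1:]" q] in simp)
  also have "\<dots> = (\<Sum>i\<le>Suc ?n. scale (coeff (pCons 0 q) i) ((T ^^ i) v)) - (\<Sum>i\<le>Suc ?n. scale (c * coeff q i) ((T ^^ i) v))"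
    by (simp add: sum_subtractf[symmetric] algebra_simps del: sum.atMost_Suc)
  also have "(\<Sum>i\<le>Suc ?n. scale (coeff (pCons 0 q) i) ((T ^^ i) v)) = (\<Sum>i\<le>?n. scale (coeff q i) ((T ^^ Suc i) v))"
    by (simp add: sum.atMost_Suc_shift del: sum.atMost_Suc funpow.simps)
  also have "(\<Sum>i\<le>Suc ?n. scale (c * coeff q i) ((T ^^ i) v)) = (\<Sum>i\<le>?n. scale (c * coeff q i) ((T ^^ i) v))"
    by (simp add: coeff_eq_0)
  also have "(\<Sum>i\<le>?n. scale (coeff q i) ((T ^^ Suc i) v)) - \<dots> = poly_op T q (shift T c v)"
    unfolding poly_op_def sum_subtractf[symmetric]
    by (intro sum.cong refl) (simp add: lin_diff[OF lin_funpow[OF T]] lin_scale[OF lin_funpow[OF T]]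
       scale_right_diff_distrib funpow_swap1 mult.commute)
  finally show ?thesis .
qed

text \<open>A root \<open>c\<close> of \<open>p\<close> splits off a factor: if \<open>p = (X - c) q\<close>, then \<open>(T - c) v\<close> is killed by \<open>q(T)\<close>, and
  \<open>ge_span_preimage\<close> passes from \<open>(T - c) v\<close> to \<open>v\<close>.\<close>

lemma poly_op_kernel:
  assumes T: "lin T" and "p \<noteq> 0" "poly_op T p v = 0" shows "v \<in> span (\<Union>c. ge T c)"
  using assms(2,3)
proof (induction "degree p" arbitrary: p v)
  case 0
  then have "coeff p 0 \<noteq> 0" using leading_coeff_0_iff by metis
  then have "v = 0" using 0 by (simp add: poly_op_def)
  then show ?case by (simp add: span_zero)
next
  case (Suc n)
  then obtain c where "poly p c = 0"
    using fundamental_theorem_of_algebra[of p] by (metis constant_degree nat.distinct(1))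
  then obtain q where q: "p = [:- c, 1:] * q" by (metis dvdE poly_eq_0_iff_dvd)
  then have "q \<noteq> 0" "degree q = n" using Suc by (auto simp: degree_mult_eq simp del: mult_pCons_left)
  moreover have "poly_op T q (shift T c v) = 0" using Suc.prems poly_op_linear_factor[OF T] q by metis
  ultimately show ?case using Suc.hyps(1)[of q] ge_span_preimage[OF T] by metis
qed

text \<open>The vectors \<open>v, T v, \<dots>, T\<^bsup>n\<^esup> v\<close> with \<open>n = card B\<close> satisfy a linear relation, that is, a nonzero
  polynomial in \<open>T\<close> kills \<open>v\<close>.\<close>

lemma finite_dim_in_ge_span:
  assumes T: "lin T" and B: "finite B" "\<And>k. (T ^^ k) v \<in> span B" shows "v \<in> span (\<Union>c. ge T c)"
proof -
  let ?n = "card B"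
  have "\<exists>a. (\<Sum>i\<le>?n. scale (a i) ((T ^^ i) v)) = 0 \<and> (\<exists>i\<le>?n. a i \<noteq> (0::complex))"
  \<comment> \<open>a repetition among the vectors is itself a linear relation\<close>
  proof (cases "inj_on (\<lambda>k. (T ^^ k) v) {..?n}")
    case True
    let ?S = "(\<lambda>k. (T ^^ k) v) ` {..?n}"
    have "card ?S = Suc ?n" using card_image[OF True] by simp
    then have "dependent ?S" using independent_span_bound[OF B(1), of ?S] B(2) by force
    then obtain r where r: "(\<Sum>x\<in>?S. scale (r x) x) = 0" "\<exists>x\<in>?S. r x \<noteq> 0"
      using dependent_finite[of ?S] by auto
    have "(\<Sum>i\<le>?n. scale (r ((T ^^ i) v)) ((T ^^ i) v)) = 0"
      using r(1) by (simp add: sum.reindex[OF True])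
    then show ?thesis using r(2) by (intro exI[of _ "\<lambda>i. r ((T ^^ i) v)"]) auto
  next
    case False
    then obtain i j where ij: "i \<le> ?n" "j \<le> ?n" "i \<noteq> j" "(T ^^ i) v = (T ^^ j) v"
      by (auto simp: inj_on_def)
    let ?a = "\<lambda>k. if k = i then 1 else if k = j then -1 else (0::complex)"
    have "(\<Sum>k\<le>?n. scale (?a k) ((T ^^ k) v)) = (\<Sum>k\<in>{i,j}. scale (?a k) ((T ^^ k) v))"
      using ij by (intro sum.mono_neutral_right) auto
    also have "\<dots> = 0" using ij by simp
    finally show ?thesis using ij by (intro exI[of _ ?a]) auto
  qed
  then obtain a i where a: "(\<Sum>i\<le>?n. scale (a i) ((T ^^ i) v)) = 0" "i \<le> ?n" "a i \<noteq> 0" by blast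
  define p where "p = (\<Sum>i\<le>?n. monom (a i) i)"
  have cp: "coeff p j = (if j \<le> ?n then a j else 0)" for j by (simp add: p_def coeff_sum)
  then have "degree p \<le> ?n" by (intro degree_le) auto
  then have "poly_op T p v = 0" using a(1) cp by (simp add: poly_op_bound)
  moreover have "p \<noteq> 0" using a cp[of i] by auto
  ultimately show ?thesis using poly_op_kernel[OF T] by blast
qed

section \<open>Power series in locally nilpotent operators\<close>

text \<open>The value of a formal power series at a locally nilpotent operator.  Only finitely many terms act
  on a given vector, so identities between power series become identities between operators.\<close>

definition ps_op :: "complex fps \<Rightarrow> ('a \<Rightarrow> 'a) \<Rightarrow> 'a \<Rightarrow> 'a" where
  "ps_op f X v = Sum_any (\<lambda>k. scale (fps_nth f k) ((X ^^ k) v))"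

abbreviation nilp where "nilp X \<equiv> locally_nilpotent scale X"

lemma nilp_lin: "nilp X \<Longrightarrow> lin X" by (simp add: locally_nilpotent_def)

lemma funpow_zero_mono:
  assumes "lin X" "(X ^^ K) v = 0" "K \<le> k" shows "(X ^^ k) v = 0"
proof -
  have "(X ^^ k) v = (X ^^ (k - K)) ((X ^^ K) v)"
    using assms(3) by (metis comp_apply funpow_add le_add_diff_inverse2)
  then show ?thesis using assms(2) lin_zero[OF lin_funpow[OF assms(1)]] by metis
qed

lemma nilpE:
  assumes "nilp X" obtains K where "\<And>k. k \<ge> K \<Longrightarrow> (X ^^ k) v = 0"
proof -
  obtain K where "(X ^^ K) v = 0" using assms by (auto simp: locally_nilpotent_def)
  then show ?thesis using that[of K] funpow_zero_mono[OF nilp_lin[OF assms]] by blast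
qed

lemma ps_op_eq_sum:
  assumes "\<And>k. k \<ge> K \<Longrightarrow> (X ^^ k) v = 0" shows "ps_op f X v = (\<Sum>k<K. scale (fps_nth f k) ((X ^^ k) v))"
  unfolding ps_op_def by (rule Sum_any_eq_sum) (auto simp: assms)

lemma ps_op_finite: "nilp X \<Longrightarrow> finite {k. scale (c k) ((X ^^ k) v) \<noteq> 0}"
proof -
  assume "nilp X"
  then obtain K where K: "\<And>k. k \<ge> K \<Longrightarrow> (X ^^ k) v = 0" using nilpE by metis
  have "{k. scale (c k) ((X ^^ k) v) \<noteq> 0} \<subseteq> {..<K}"
  proof
    fix k assume "k \<in> {k. scale (c k) ((X ^^ k) v) \<noteq> 0}"
    then show "k \<in> {..<K}" using K[of k] by (cases "k \<ge> K") auto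
  qed
  then show ?thesis using finite_subset by blast
qed

lemma ps_op_lin:
  assumes X: "nilp X" shows "lin (ps_op f X)"
proof (rule linI)
  have l: "lin (X ^^ k)" for k by (rule lin_funpow[OF nilp_lin[OF X]])
  fix x y c
  show "ps_op f X (x + y) = ps_op f X x + ps_op f X y"
    unfolding ps_op_def
    by (subst Sum_any_add_fin(1)[OF ps_op_finite[OF X] ps_op_finite[OF X], symmetric])
      (simp add: lin_add[OF l] scale_right_distrib)
  show "ps_op f X (scale c x) = scale c (ps_op f X x)"
    unfolding ps_op_def lin_Sum_any[OF lin_scaleV ps_op_finite[OF X]]
    by (simp add: lin_scale[OF l] mult.commute)
qed

lemma ps_op_commute:
  assumes X: "nilp X" and C: "lin C" and "\<And>x. X (C x) = C (X x)"
  shows "C (ps_op f X v) = ps_op f X (C v)"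
  unfolding ps_op_def lin_Sum_any[OF C ps_op_finite[OF X]]
  by (simp add: funpow_commute_op[of X C, OF assms(3)] lin_scale[OF C])

lemma ps_op_mult:
  assumes X: "nilp X" shows "ps_op (f * g) X v = ps_op f X (ps_op g X v)"
proof -
  obtain K where K: "\<And>k. k \<ge> K \<Longrightarrow> (X ^^ k) v = 0" using nilpE[OF X] by metis
  have l: "lin (X ^^ k)" for k by (rule lin_funpow[OF nilp_lin[OF X]])
  have X0: "(X ^^ k) 0 = 0" for k by (rule lin_zero[OF l])
  let ?t = "\<lambda>i j. scale (fps_nth f i * fps_nth g j) ((X ^^ (i + j)) v)"
  have g: "ps_op g X v = (\<Sum>k<K. scale (fps_nth g k) ((X ^^ k) v))" by (rule ps_op_eq_sum[OF K])
  have Xg: "(X ^^ i) (ps_op g X v) = (\<Sum>j<K. scale (fps_nth g j) ((X ^^ (i + j)) v))" for i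
    unfolding g by (simp add: lin_sum[OF l] lin_scale[OF l] funpow_add)
  have "ps_op f X (ps_op g X v) = (\<Sum>i<K. scale (fps_nth f i) ((X ^^ i) (ps_op g X v)))"
    by (rule ps_op_eq_sum) (auto simp: Xg K intro!: sum.neutral)
  also have "\<dots> = (\<Sum>i<K. \<Sum>j<K. ?t i j)" by (simp add: Xg scale_sum_right)
  also have "\<dots> = (\<Sum>i<K. \<Sum>j<K-i. ?t i j)"
    by (intro sum.cong refl sum.mono_neutral_right) (auto simp: K)
  also have "\<dots> = (\<Sum>(i,j)\<in>Sigma {..<K} (\<lambda>i. {..<K-i}). ?t i j)" by (rule sum.Sigma) auto
  also have "\<dots> = (\<Sum>(k,i)\<in>Sigma {..<K} (\<lambda>k. {0..k}). ?t i (k - i))"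
    by (rule sum.reindex_bij_witness[of _ "\<lambda>(k,i). (i, k - i)" "\<lambda>(i,j). (i + j, i)"]) auto
  also have "\<dots> = (\<Sum>k<K. \<Sum>i=0..k. ?t i (k - i))" by (rule sum.Sigma[symmetric]) auto
  also have "\<dots> = (\<Sum>k<K. scale (fps_nth (f * g) k) ((X ^^ k) v))"
    by (intro sum.cong refl) (simp add: fps_mult_nth scale_sum_left)
  also have "\<dots> = ps_op (f * g) X v" by (rule ps_op_eq_sum[OF K, symmetric])
  finally show ?thesis by simp
qed

lemma ps_op_1 [simp]: "ps_op 1 X v = v"
proof -
  have "(\<lambda>k. scale (fps_nth 1 k) ((X ^^ k) v)) = (\<lambda>k. if k = 0 then v else 0)" by auto
  then show ?thesis unfolding ps_op_def using Sum_any.delta[of 0 "\<lambda>_. v"] by metis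
qed

lemma ps_op_power: "nilp X \<Longrightarrow> ps_op (f ^ n) X v = (ps_op f X ^^ n) v"
  by (induction n) (auto simp: ps_op_mult)

lemma ps_op_nilp:
  assumes X: "nilp X" and f: "fps_nth f 0 = 0" shows "nilp (ps_op f X)"
  unfolding locally_nilpotent_def
proof (intro conjI allI ps_op_lin X)
  fix v
  obtain K where K: "\<And>k. k \<ge> K \<Longrightarrow> (X ^^ k) v = 0" using nilpE[OF X] by metis
  have "(ps_op f X ^^ K) v = (\<Sum>k<K. scale (fps_nth (f ^ K) k) ((X ^^ k) v))"
    by (simp add: ps_op_power[OF X, symmetric] ps_op_eq_sum[OF K])
  also have "\<dots> = 0" using startsby_zero_power_prefix[OF f] by (intro sum.neutral) auto
  finally show "\<exists>K. (ps_op f X ^^ K) v = 0" by blast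
qed

text \<open>Substitution of series is composition of operators; this transfers \<open>exp(log(1 + X)) = 1 + X\<close>.\<close>

lemma ps_op_compose:
  assumes X: "nilp X" and g: "fps_nth g 0 = 0" shows "ps_op (f oo g) X v = ps_op f (ps_op g X) v"
proof -
  obtain K where K: "\<And>k. k \<ge> K \<Longrightarrow> (X ^^ k) v = 0" using nilpE[OF X] by metis
  have G: "(ps_op g X ^^ k) v = (\<Sum>m<K. scale (fps_nth (g ^ k) m) ((X ^^ m) v))" for k
    by (simp add: ps_op_power[OF X, symmetric] ps_op_eq_sum[OF K])
  have z: "fps_nth (g ^ k) m = 0" if "m < k" for m k using startsby_zero_power_prefix[OF g] that by blast
  have "ps_op f (ps_op g X) v = (\<Sum>k<K. scale (fps_nth f k) ((ps_op g X ^^ k) v))"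
    by (rule ps_op_eq_sum) (auto simp: G z intro!: sum.neutral)
  also have "\<dots> = (\<Sum>k<K. \<Sum>m<K. scale (fps_nth f k * fps_nth (g ^ k) m) ((X ^^ m) v))"
    by (simp add: G scale_sum_right)
  also have "\<dots> = (\<Sum>m<K. \<Sum>k<K. scale (fps_nth f k * fps_nth (g ^ k) m) ((X ^^ m) v))" by (rule sum.swap)
  also have "\<dots> = (\<Sum>m<K. scale (fps_nth (f oo g) m) ((X ^^ m) v))"
  proof (intro sum.cong refl)
    fix m assume "m \<in> {..<K}"
    then have "(\<Sum>k<K. fps_nth f k * fps_nth (g ^ k) m) = fps_nth (f oo g) m"
      unfolding fps_compose_nth by (intro sum.mono_neutral_right) (auto simp: z)
    then show "(\<Sum>k<K. scale (fps_nth f k * fps_nth (g ^ k) m) ((X ^^ m) v)) = scale (fps_nth (f oo g) m) ((X ^^ m) v)"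
      by (metis scale_sum_left)
  qed
  also have "\<dots> = ps_op (f oo g) X v" by (rule ps_op_eq_sum[OF K, symmetric])
  finally show ?thesis by simp
qed

text \<open>\<open>fps_ln a\<close> is the series \<open>log(1 + X) / a\<close>, the compositional inverse of \<open>exp(a X) - 1\<close>.\<close>

lemma ps_op_exp_ln:
  assumes X: "nilp X" and "a \<noteq> 0" shows "ps_op (fps_exp a) (ps_op (fps_ln a) X) v = v + X v"
proof -
  have "(fps_exp a - 1) oo fps_ln a = fps_X"
    unfolding fps_ln_fps_exp_inv[OF assms(2)] by (rule fps_inv_right) (use assms in auto)
  then have e: "fps_exp a oo fps_ln a = 1 + fps_X"
    unfolding fps_compose_sub_distrib by (simp add: algebra_simps)
  have "ps_op (1 + fps_X) X v = v + X v"
    unfolding ps_op_def by (subst Sum_any_eq_sum[of "{0,1}"]) auto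
  then show ?thesis using ps_op_compose[OF X, of "fps_ln a" "fps_exp a" v] e by simp
qed

section \<open>Divided powers and exponentials of commuting operators\<close>

abbreviation dpow :: "nat \<Rightarrow> ('a \<Rightarrow> 'a) \<Rightarrow> 'a \<Rightarrow> 'a" where
  "dpow k X v \<equiv> scale (1 / fact k) ((X ^^ k) v)"

lemma dpow_Suc: "lin X \<Longrightarrow> scale (of_nat (Suc k)) (dpow (Suc k) X v) = X (dpow k X v)"
  by (simp add: lin_scale del: of_nat_Suc)

lemma lin_dpow: "lin X \<Longrightarrow> lin (dpow k X)"
  by (intro lin_smult lin_funpow)

lemma Suc_scale_cancel: "scale (of_nat (Suc k)) x = scale (of_nat (Suc k)) y \<Longrightarrow> x = y"
  by (simp del: of_nat_Suc)

text \<open>The common induction step for the power of a sum of commuting operators and for the power of a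
  derivation applied to a product.  In terms of the divided powers \<open>X\<^bsup>k\<^esup> / k!\<close> both are convolutions
  without binomial coefficients; \<open>B i j\<close> stands for the term formed from the \<open>i\<close>-th and the \<open>j\<close>-th
  divided power, and \<open>S\<close> is the Leibniz rule.\<close>

lemma leibniz_convolution:
  assumes D: "lin D" and S: "\<And>i j. D (B i j) = scale (of_nat (Suc i)) (B (Suc i) j) + scale (of_nat (Suc j)) (B i (Suc j))"
  shows "D (\<Sum>i\<le>k. B i (k - i)) = scale (of_nat (Suc k)) (\<Sum>i\<le>Suc k. B i (Suc k - i))"
proof -
  have 1: "(\<Sum>i\<le>k. scale (of_nat (Suc i)) (B (Suc i) (k - i))) = (\<Sum>i\<le>Suc k. scale (of_nat i) (B i (Suc k - i)))"
    by (simp add: sum.atMost_Suc_shift del: sum.atMost_Suc of_nat_Suc)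
  have 2: "(\<Sum>i\<le>k. scale (of_nat (Suc (k - i))) (B i (Suc (k - i)))) = (\<Sum>i\<le>Suc k. scale (of_nat (Suc k - i)) (B i (Suc k - i)))"
    by (simp add: Suc_diff_le del: of_nat_Suc of_nat_diff)
  have "D (\<Sum>i\<le>k. B i (k - i)) = (\<Sum>i\<le>Suc k. scale (of_nat i) (B i (Suc k - i)) + scale (of_nat (Suc k - i)) (B i (Suc k - i)))"
    by (simp only: lin_sum[OF D] S sum.distrib 1 2)
  also have "\<dots> = (\<Sum>i\<le>Suc k. scale (of_nat (Suc k)) (B i (Suc k - i)))"
    by (intro sum.cong refl) (simp add: scale_left_distrib[symmetric] of_nat_add[symmetric] del: of_nat_Suc of_nat_add)
  finally show ?thesis by (simp only: scale_sum_right)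
qed

lemma dpow_add:
  assumes A: "lin A" and B: "lin B" and c: "\<And>x. A (B x) = B (A x)"
  shows "dpow k (\<lambda>x. A x + B x) v = (\<Sum>i\<le>k. dpow i A (dpow (k - i) B v))"
proof (induction k)
  case 0 then show ?case by simp
next
  case (Suc k)
  let ?C = "\<lambda>x. A x + B x" let ?B = "\<lambda>i j. dpow i A (dpow j B v)"
  have C: "lin ?C" by (intro lin_plus A B)
  have "?C (?B i j) = scale (of_nat (Suc i)) (?B (Suc i) j) + scale (of_nat (Suc j)) (?B i (Suc j))" for i j
  proof -
    have "B (?B i j) = dpow i A (B (dpow j B v))"
      by (simp add: lin_scale[OF B] funpow_commute_op[of A B, OF c, symmetric])
    also have "\<dots> = dpow i A (scale (of_nat (Suc j)) (dpow (Suc j) B v))" by (simp only: dpow_Suc[OF B])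
    also have "\<dots> = scale (of_nat (Suc j)) (?B i (Suc j))" by (rule lin_scale[OF lin_dpow[OF A]])
    finally show ?thesis by (simp only: dpow_Suc[OF A])
  qed
  from leibniz_convolution[OF C, of ?B, OF this, of k]
  have "?C (dpow k ?C v) = scale (of_nat (Suc k)) (\<Sum>i\<le>Suc k. ?B i (Suc k - i))" using Suc.IH by simp
  then show ?case unfolding dpow_Suc[OF C, symmetric] by (rule Suc_scale_cancel)
qed

lemma ps_op_exp_eq: "ps_op (fps_exp a) X v = Sum_any (\<lambda>k. scale (a ^ k) (dpow k X v))"
  by (simp add: ps_op_def)

lemma nilp_add:
  assumes A: "nilp A" and B: "nilp B" and c: "\<And>x. A (B x) = B (A x)"
  shows "nilp (\<lambda>x. A x + B x)"
  unfolding locally_nilpotent_def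
proof (intro conjI allI lin_plus nilp_lin A B)
  fix v
  obtain K where K: "\<And>k. k \<ge> K \<Longrightarrow> (A ^^ k) v = 0" using nilpE[OF A] by metis
  obtain L where L: "\<And>k. k \<ge> L \<Longrightarrow> (B ^^ k) v = 0" using nilpE[OF B] by metis
  have lA: "lin A" and lB: "lin B" using A B nilp_lin by auto
  have AB: "(A ^^ i) ((B ^^ j) v) = (B ^^ j) ((A ^^ i) v)" for i j
    by (rule funpow_commute_op, rule funpow_commute_op[symmetric], rule c[symmetric])
  have "dpow (K + L) (\<lambda>x. A x + B x) v = (\<Sum>i\<le>K+L. dpow i A (dpow (K + L - i) B v))"
    by (rule dpow_add[OF lA lB c])
  also have "\<dots> = 0"
  proof (intro sum.neutral ballI)
    fix i
    have "(A ^^ i) ((B ^^ (K + L - i)) v) = 0"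
    proof (cases "i \<ge> K")
      case True then show ?thesis using K AB lin_zero[OF lin_funpow[OF lB]] by metis
    next
      case False
      then show ?thesis using L[of "K + L - i"] lin_zero[OF lin_funpow[OF lA]] by simp
    qed
    then show "dpow i A (dpow (K + L - i) B v) = 0" by (simp add: lin_scale[OF lin_funpow[OF lA]])
  qed
  finally show "\<exists>K. ((\<lambda>x. A x + B x) ^^ K) v = 0" by (intro exI[of _ "K + L"]) (simp add: fact_nonzero)
qed

lemma Sum_any_convolution:
  fixes B :: "nat \<Rightarrow> nat \<Rightarrow> 'b::comm_monoid_add"
  assumes z: "\<And>i j. i \<ge> K \<or> j \<ge> L \<Longrightarrow> B i j = 0"
  shows "Sum_any (\<lambda>k. \<Sum>i\<le>k. B i (k - i)) = (\<Sum>i<K. \<Sum>j<L. B i j)"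
    and "k \<ge> K + L \<Longrightarrow> (\<Sum>i\<le>k. B i (k - i)) = 0"
proof -
  have z': "k \<ge> K + L \<Longrightarrow> (\<Sum>i\<le>k. B i (k - i)) = 0" for k
    by (intro sum.neutral ballI z) auto
  then show "k \<ge> K + L \<Longrightarrow> (\<Sum>i\<le>k. B i (k - i)) = 0" by simp
  have "Sum_any (\<lambda>k. \<Sum>i\<le>k. B i (k - i)) = (\<Sum>k<K+L. \<Sum>i\<le>k. B i (k - i))"
    by (rule Sum_any_eq_sum) (auto simp: z')
  also have "\<dots> = (\<Sum>(k,i)\<in>Sigma {..<K+L} (\<lambda>k. {..k}). B i (k - i))" by (rule sum.Sigma) auto
  also have "\<dots> = (\<Sum>(i,j)\<in>Sigma {..<K+L} (\<lambda>i. {..<K+L-i}). B i j)"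
    by (rule sum.reindex_bij_witness[of _ "\<lambda>(i,j). (i + j, i)" "\<lambda>(k,i). (i, k - i)"]) auto
  also have "\<dots> = (\<Sum>(i,j)\<in>{..<K} \<times> {..<L}. B i j)"
    by (intro sum.mono_neutral_right) (auto intro!: z)
  finally show "Sum_any (\<lambda>k. \<Sum>i\<le>k. B i (k - i)) = (\<Sum>i<K. \<Sum>j<L. B i j)"
    by (simp add: sum.cartesian_product)
qed

text \<open>The finite double sum of the divided powers is rearranged by total degree.\<close>

lemma ps_op_exp_add:
  assumes A: "nilp A" and B: "nilp B" and c: "\<And>x. A (B x) = B (A x)"
  shows "ps_op (fps_exp a) (\<lambda>x. A x + B x) v = ps_op (fps_exp a) A (ps_op (fps_exp a) B v)"
proof -
  have lA: "lin A" and lB: "lin B" using A B nilp_lin by auto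
  obtain L where L: "\<And>k. k \<ge> L \<Longrightarrow> (B ^^ k) v = 0" using nilpE[OF B] by metis
  obtain K where K: "\<And>k. k \<ge> K \<Longrightarrow> (A ^^ k) v = 0" using nilpE[OF A] by metis
  let ?B = "\<lambda>i j. scale (a ^ (i + j)) (dpow i A (dpow j B v))"
  have AB: "(A ^^ i) ((B ^^ j) v) = (B ^^ j) ((A ^^ i) v)" for i j
    by (rule funpow_commute_op, rule funpow_commute_op[symmetric], rule c[symmetric])
  have z: "?B i j = 0" if "i \<ge> K \<or> j \<ge> L" for i j
  proof -
    have "(A ^^ i) ((B ^^ j) v) = 0"
    proof (cases "i \<ge> K")
      case True then show ?thesis using K AB lin_zero[OF lin_funpow[OF lB]] by metis
    next
      case False then show ?thesis using L[of j] that lin_zero[OF lin_funpow[OF lA]] by simp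
    qed
    then show ?thesis by (simp add: lin_scale[OF lin_funpow[OF lA]])
  qed
  have "ps_op (fps_exp a) (\<lambda>x. A x + B x) v = Sum_any (\<lambda>k. \<Sum>i\<le>k. ?B i (k - i))"
    unfolding ps_op_exp_eq dpow_add[OF lA lB c] by (simp add: scale_sum_right)
  also have "\<dots> = (\<Sum>i<K. \<Sum>j<L. ?B i j)" by (rule Sum_any_convolution[where K=K and L=L]) (rule z)
  also have "\<dots> = (\<Sum>i<K. scale (a ^ i) (dpow i A (\<Sum>j<L. scale (a ^ j) (dpow j B v))))"
    by (simp add: lin_sum[OF lin_funpow[OF lA]] lin_scale[OF lin_funpow[OF lA]] scale_sum_right power_add mult_ac)
  also have "(\<Sum>j<L. scale (a ^ j) (dpow j B v)) = ps_op (fps_exp a) B v"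
    by (simp add: ps_op_eq_sum[OF L])
  also have "(\<Sum>i<K. scale (a ^ i) (dpow i A (ps_op (fps_exp a) B v))) = ps_op (fps_exp a) A (ps_op (fps_exp a) B v)"
  proof -
    have "(A ^^ k) (ps_op (fps_exp a) B v) = ps_op (fps_exp a) B ((A ^^ k) v)" for k
      by (rule ps_op_commute[OF B lin_funpow[OF lA]], rule funpow_commute_op[symmetric], rule c)
    then have "\<And>k. k \<ge> K \<Longrightarrow> (A ^^ k) (ps_op (fps_exp a) B v) = 0"
      using K lin_zero[OF ps_op_lin[OF B]] by simp
    from ps_op_eq_sum[OF this, where f="fps_exp a"] show ?thesis by simp
  qed
  finally show ?thesis .
qed

end

definition cis2pi :: "complex \<Rightarrow> complex" where "cis2pi a = exp (2 * pi * \<i> * a)"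

lemma cis2pi_nonzero [simp]: "cis2pi a \<noteq> 0" by (simp add: cis2pi_def)

lemma cis2pi_add: "cis2pi (a + b) = cis2pi a * cis2pi b"
  by (simp add: cis2pi_def distrib_left exp_add)

lemma cis2pi_minus: "cis2pi (- a) = inverse (cis2pi a)"
  by (simp add: cis2pi_def exp_minus)

lemma cis2pi_eq_1_iff: "cis2pi a = 1 \<longleftrightarrow> a \<in> \<int>"
proof
  assume "cis2pi a = 1"
  then obtain n :: int where n: "- (2 * pi * Im a) = 0" "2 * pi * Re a = of_int (2 * n) * pi"
    by (auto simp: cis2pi_def exp_eq_1)
  then have "a = of_int n" by (simp add: complex_eq_iff)
  then show "a \<in> \<int>" by simp
next
  assume "a \<in> \<int>"
  then obtain n where "a = of_int n" by (auto elim: Ints_cases)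
  then show "cis2pi a = 1" using exp_2pi_1_int[of n] by (simp add: cis2pi_def mult_ac)
qed

lemma cis2pi_eq_iff: "cis2pi a = cis2pi b \<longleftrightarrow> a - b \<in> \<int>"
  using cis2pi_eq_1_iff[of "a - b"] cis2pi_add[of a "- b"] cis2pi_minus[of b]
  by (auto simp: field_simps)

lemma strip_log_exists: "c \<noteq> 0 \<Longrightarrow> \<exists>a. 0 \<le> Re a \<and> Re a < 1 \<and> cis2pi a = c"
proof -
  assume c: "c \<noteq> 0"
  let ?b = "Ln c / (2 * pi * \<i>)"
  let ?a = "?b - of_int \<lfloor>Re ?b\<rfloor>"
  have "cis2pi ?b = c" using c by (simp add: cis2pi_def)
  moreover have "cis2pi ?a = cis2pi ?b" by (simp only: cis2pi_eq_iff) simp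
  ultimately have "cis2pi ?a = c" by simp
  moreover have "0 \<le> Re ?a" "Re ?a < 1" using floor_correct[of "Re ?b"] by (simp_all add: algebra_simps del: Re_divide_of_real)
  ultimately show ?thesis by blast
qed

lemma strip_unique:
  assumes "0 \<le> Re a" "Re a < 1" "0 \<le> Re b" "Re b < 1" "cis2pi a = cis2pi b" shows "a = b"
proof -
  obtain n where n: "a - b = of_int n" using assms(5) by (auto simp: cis2pi_eq_iff elim: Ints_cases)
  then have "Re a - Re b = of_int n" by (metis minus_complex.simps(1) Re_complex_of_real of_real_of_int_eq)
  then have "of_int n < (1::real)" "of_int n > (-1::real)" using assms by auto
  then have "n = 0" by linarith
  then show ?thesis using n by simp
qed

text \<open>The representative of \<open>(1 / 2\<pi>i) log c\<close> in the strip that is used by \<^const>\<open>P_set\<close>.\<close>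

definition strip_log :: "complex \<Rightarrow> complex" where
  "strip_log c = (SOME a. 0 \<le> Re a \<and> Re a < 1 \<and> cis2pi a = c)"

lemma strip_log:
  assumes "c \<noteq> 0" shows "0 \<le> Re (strip_log c)" "Re (strip_log c) < 1" "cis2pi (strip_log c) = c"
  using someI_ex[OF strip_log_exists[OF assms]] by (auto simp: strip_log_def)

context complex_vector_space begin

section \<open>The Jordan decomposition\<close>

lemma ge_eigenvector:
  assumes T: "lin T" and v: "v \<in> ge T c" "v \<noteq> 0" shows "\<exists>w. w \<noteq> 0 \<and> T w = scale c w"
proof -
  obtain K where "(shift T c ^^ K) v = 0" using v geE by metis
  then show ?thesis using v(2)
  proof (induction K arbitrary: v)
    case 0 then show ?case by simp
  next
    case (Suc K)
    show ?case
    proof (cases "shift T c v = 0")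
      case True then show ?thesis using Suc.prems by (intro exI[of _ v]) simp
    next
      case False
      moreover have "(shift T c ^^ K) (shift T c v) = 0" using Suc.prems(1) by (simp only: funpow_Suc_right o_apply)
      ultimately show ?thesis using Suc.IH by blast
    qed
  qed
qed

lemma eigenspace_ge: "v \<in> eigenspace scale T c \<Longrightarrow> v \<in> ge T c"
  by (rule geI[where K=1]) (simp add: eigenspace_def)

lemma subspace_eigenspace: "lin S \<Longrightarrow> subspace (eigenspace scale S c)"
  by (auto simp: subspace_def eigenspace_def lin_zero lin_add lin_scale scale_right_distrib mult.commute)

text \<open>The decomposition of a vector into eigenvectors is also one into generalized eigenvectors, so by
  uniqueness a generalized eigenvector is its own eigencomponent.\<close>

lemma semisimple_ge:
  assumes S: "semisimple_op scale S" shows "ge S c = eigenspace scale S c" "triangulable S"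
proof -
  have l: "lin S" and d: "is_direct_sum scale UNIV (eigenspace scale S)" using S by (auto simp: semisimple_op_def)
  have "v \<in> span (\<Union>c. ge S c)" for v
    by (rule direct_sum_induct[OF d]) (auto intro: span_base span_add span_zero eigenspace_ge)
  then show "triangulable S" using l by (auto simp: triangulable_def)
  show "ge S c = eigenspace scale S c"
  proof (intro equalityI subsetI eigenspace_ge)
    fix v assume v: "v \<in> ge S c"
    have c: "decomposes UNIV (eigenspace scale S) v (\<lambda>i. component UNIV (eigenspace scale S) i v)"
      by (rule decomposes_component[OF d])
    then have "decomposes UNIV (ge S) v (\<lambda>i. component UNIV (eigenspace scale S) i v)"
      by (auto simp: decomposes_def intro: eigenspace_ge)
    moreover have "decomposes UNIV (ge S) v (\<lambda>i. component UNIV (ge S) i v)"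
      by (rule decomposes_component[OF triangulable_direct_sum[OF \<open>triangulable S\<close>]])
    ultimately have "component UNIV (eigenspace scale S) c v = component UNIV (ge S) c v"
      using decomposes_unique[OF triangulable_direct_sum[OF \<open>triangulable S\<close>]] by metis
    also have "\<dots> = v" using component_self[OF triangulable_direct_sum[OF \<open>triangulable S\<close>] _ v, of c] by simp
    finally show "v \<in> eigenspace scale S c" using component_in[OF d, of c v] by simp
  qed
qed

lemma semisimpleI:
  assumes l: "lin S" and s: "\<And>v. v \<in> span (\<Union>c. eigenspace scale S c)" shows "semisimple_op scale S"
proof -
  have "f = (\<lambda>_. 0)" if "decomposes UNIV (eigenspace scale S) 0 f" for f
    using that by (intro decomposes_ge_zero[OF l]) (auto simp: decomposes_def intro: eigenspace_ge)
  then show ?thesis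
    using s l unfolding semisimple_op_def by (intro conjI is_direct_sumI subspace_eigenspace) auto
qed

lemma triangulable_eqI:
  assumes T: "triangulable T" and "lin A" "lin B" "\<And>c v. v \<in> ge T c \<Longrightarrow> A v = B v" shows "A v = B v"
  using T by (induction v rule: triangulable_induct) (auto simp: assms lin_add[OF assms(2)] lin_add[OF assms(3)])

text \<open>The semisimple part of \<open>T\<close> (with \<open>a c = c\<close>) and the semisimple part of its logarithm (with \<open>a\<close> a branch of
  the logarithm) both arise in this way and are treated together in the following lemmas.\<close>

lemma scalar_extension:
  assumes T: "triangulable T" shows "\<exists>S. lin S \<and> (\<forall>c. \<forall>v\<in>ge T c. S v = scale (a c) v)"
  by (rule direct_sum_extend[OF triangulable_direct_sum[OF T] lin_scaleV])

lemma scalar_on_ge_commute: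
  assumes T: "triangulable T" and S: "lin S" "\<And>c v. v \<in> ge T c \<Longrightarrow> S v = scale (a c) v"
    and C: "lin C" "\<And>x. T (C x) = C (T x)"
  shows "S (C x) = C (S x)"
proof (rule triangulable_eqI[where A="\<lambda>x. S (C x)" and B="\<lambda>x. C (S x)", OF T])
  show "lin (\<lambda>x. S (C x))" "lin (\<lambda>x. C (S x))"
    by (rule lin_compose[OF C(1) S(1)], rule lin_compose[OF S(1) C(1)])
  fix c v assume v: "v \<in> ge T c"
  then have "C v \<in> ge T c" by (rule ge_commute[where T=T and S=C, OF C])
  then show "S (C v) = C (S v)" using v S(2) by (simp add: lin_scale[OF C(1)])
qed

lemma scalar_on_ge_semisimple:
  assumes T: "triangulable T" and S: "lin S" "\<And>c v. v \<in> ge T c \<Longrightarrow> S v = scale (a c) v"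
  shows "semisimple_op scale S"
proof (rule semisimpleI[OF S(1)])
  fix v show "v \<in> span (\<Union>c. eigenspace scale S c)"
    using T
  proof (induction v rule: triangulable_induct)
    case (ge c v)
    then show ?case by (intro span_base UN_I[of "a c"]) (auto simp: eigenspace_def S(2))
  qed (rule span_add)
qed

lemma scalar_on_ge_eigenspace:
  assumes T: "triangulable T" and S: "lin S" "\<And>c v. v \<in> ge T c \<Longrightarrow> S v = scale (a c) v"
    and v: "v \<in> eigenspace scale S d" and c: "component UNIV (ge T) c v \<noteq> 0"
  shows "a c = d"
proof -
  note d = triangulable_direct_sum[OF T]
  let ?p = "\<lambda>v. component UNIV (ge T) c v"
  have lT: "lin T" by (rule triangulable_lin[OF T])
  have ST: "T (S x) = S (T x)" for x by (rule scalar_on_ge_commute[where T=T and S=S and a=a and C=T, symmetric, OF T S lT]) auto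
  have "decomposes UNIV (ge T) (S v) (\<lambda>c. S (component UNIV (ge T) c v))"
    by (rule decomposes_ge_commute[where T=T, OF lT S(1) ST decomposes_component[OF d]])
  then have "?p (S v) = S (?p v)" by (rule component_eq[OF d])
  also have "\<dots> = scale (a c) (?p v)" using component_in[OF d] by (intro S(2)) auto
  finally have "scale d (?p v) = scale (a c) (?p v)"
    using v lin_scale[OF component_linear[OF d]] by (simp add: eigenspace_def)
  then show ?thesis using c by (simp add: scale_cancel_right)
qed

lemma scalar_on_ge_eigenspace_eq:
  assumes T: "triangulable T" and S: "lin S" "\<And>c v. v \<in> ge T c \<Longrightarrow> S v = scale (a c) v"
    and inj: "\<And>c'. ge T c' \<noteq> {0} \<Longrightarrow> a c' = a c \<Longrightarrow> c' = c"
  shows "eigenspace scale S (a c) = ge T c"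
proof (intro equalityI subsetI)
  note d = triangulable_direct_sum[OF T]
  fix v assume v: "v \<in> eigenspace scale S (a c)"
  have "component UNIV (ge T) c' v = 0" if "c' \<noteq> c" for c'
    using scalar_on_ge_eigenspace[where T=T and S=S and a=a, OF T S v, of c'] inj[of c'] that component_in[OF d, of c' v] by auto
  then have "Sum_any (\<lambda>i. component UNIV (ge T) i v) = component UNIV (ge T) c v"
    by (subst Sum_any_eq_sum[of "{c}"]) auto
  then show "v \<in> ge T c" using component_sum[OF d, of v] component_in[OF d, of c v] by simp
qed (auto simp: eigenspace_def S(2))

lemma shift_of_scalar_part_nilp:
  assumes T: "triangulable T" and "lin N" "\<And>c v. v \<in> ge T c \<Longrightarrow> N v = scale (b c) (shift T c v)"
  shows "nilp N"
  unfolding locally_nilpotent_def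
proof (intro conjI allI assms(2))
  have lT: "lin T" by (rule triangulable_lin[OF T])
  fix v show "\<exists>K. (N ^^ K) v = 0" using T
  proof (induction v rule: triangulable_induct)
    case (ge c v)
    have "(N ^^ k) v = scale (b c ^ k) ((shift T c ^^ k) v)" for k
      by (induction k) (auto simp: assms(3)[OF ge_shift_pow[OF lT ge]] lin_scale[OF assms(2)] mult.commute)
    then show ?case using geE[OF ge] by (metis scale_zero_right)
  next
    case (add x y)
    then obtain K L where "(N ^^ K) x = 0" "(N ^^ L) y = 0" by auto
    then have "(N ^^ (max K L)) x = 0" "(N ^^ (max K L)) y = 0"
      using funpow_zero_mono[OF assms(2)] by (meson max.cobounded1 max.cobounded2)+
    then show ?case by (intro exI[of _ "max K L"]) (simp add: lin_add[OF lin_funpow[OF assms(2)]])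
  qed
qed

text \<open>The operator \<open>S\<close> acting by the scalar \<open>c\<close> on \<open>ge T c\<close> is a semisimple part.  For uniqueness let
  \<open>T = S' + N'\<close> be another decomposition.  On the eigenspace of \<open>S'\<close> of eigenvalue \<open>c\<close>, which \<open>N'\<close>
  preserves, \<open>T - c\<close> agrees with the locally nilpotent \<open>N'\<close>; so this eigenspace is contained in
  \<open>ge T c\<close>, where \<open>S\<close> acts by \<open>c\<close> as well.\<close>

lemma semisimple_part_props:
  assumes T: "triangulable T"
  shows "lin (semisimple_part scale T)" "v \<in> ge T c \<Longrightarrow> semisimple_part scale T v = scale c v"
proof -
  have lT: "lin T" by (rule triangulable_lin[OF T])
  obtain S where S: "lin S" "\<And>c v. v \<in> ge T c \<Longrightarrow> S v = scale c v"
    using scalar_extension[OF T, of "\<lambda>c. c"] by blast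
  let ?N = "\<lambda>v. T v - S v"
  have N: "lin ?N" by (intro lin_minus lT S)
  have ST: "S (T x) = T (S x)" for x by (rule scalar_on_ge_commute[where T=T and S=S and a="\<lambda>c. c" and C=T, OF T S lT]) auto
  have nN: "nilp ?N" by (rule shift_of_scalar_part_nilp[OF T N, of "\<lambda>_. 1"]) (simp add: S(2))
  have sS: "semisimple_op scale S" by (rule scalar_on_ge_semisimple[OF T S])
  have SN: "S \<circ> ?N = ?N \<circ> S" by (auto simp: fun_eq_iff lin_diff[OF S(1)] ST)
  have "semisimple_part scale T = S"
    unfolding semisimple_part_def
  proof (rule the_equality)
    show "\<exists>N. semisimple_op scale S \<and> nilp N \<and> S \<circ> N = N \<circ> S \<and> T = (\<lambda>v. S v + N v)"
      using sS nN SN by (intro exI[of _ ?N]) auto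
  next
    fix S' assume "\<exists>N. semisimple_op scale S' \<and> nilp N \<and> S' \<circ> N = N \<circ> S' \<and> T = (\<lambda>v. S' v + N v)"
    then obtain N' where a: "semisimple_op scale S'" "nilp N'" "S' \<circ> N' = N' \<circ> S'" "T = (\<lambda>v. S' v + N' v)" by blast
    have "S' v = S v" for v
    proof (rule triangulable_eqI[where A=S' and B=S, OF semisimple_ge(2)[OF a(1)]])
      show "lin S'" using a(1) by (simp add: semisimple_op_def)
      show "lin S" by (rule S)
      fix c v assume "v \<in> ge S' c"
      then have v: "v \<in> eigenspace scale S' c" by (simp add: semisimple_ge(1)[OF a(1)])
      have N'e: "N' x \<in> eigenspace scale S' c" if "x \<in> eigenspace scale S' c" for x
        using that a(3) lin_scale[OF nilp_lin[OF a(2)]] by (auto simp: eigenspace_def fun_eq_iff)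
      have "(shift T c ^^ k) v = (N' ^^ k) v \<and> (N' ^^ k) v \<in> eigenspace scale S' c" for k
        by (induction k) (use v N'e in \<open>auto simp: a(4) eigenspace_def\<close>)
      then have "v \<in> ge T c" using nilpE[OF a(2)] geI by (metis order_refl)
      then show "S' v = S v" using v S(2) by (simp add: eigenspace_def)
    qed
    then show "S' = S" by blast
  qed
  then show "lin (semisimple_part scale T)" "v \<in> ge T c \<Longrightarrow> semisimple_part scale T v = scale c v"
    using S by auto
qed

lemma semisimple_part_eigenspace:
  assumes T: "triangulable T" shows "eigenspace scale (semisimple_part scale T) c = ge T c"
  by (rule scalar_on_ge_eigenspace_eq[where a="\<lambda>c. c", OF T semisimple_part_props[OF T]]) auto

lemma nilpotent_part_props:
  assumes T: "triangulable T"
  shows "nilp (nilpotent_part scale T)" "v \<in> ge T c \<Longrightarrow> nilpotent_part scale T v = shift T c v"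
proof -
  show *: "v \<in> ge T c \<Longrightarrow> nilpotent_part scale T v = shift T c v" for v c
    by (simp add: nilpotent_part_def semisimple_part_props(2)[OF T])
  have "lin (nilpotent_part scale T)" unfolding nilpotent_part_def[abs_def]
    by (intro lin_minus triangulable_lin T semisimple_part_props(1))
  then show "nilp (nilpotent_part scale T)"
    by (rule shift_of_scalar_part_nilp[OF T, of _ "\<lambda>_. 1"]) (simp add: *)
qed

lemma nilpotent_part_commute:
  assumes T: "triangulable T" and C: "lin C" "\<And>x. T (C x) = C (T x)"
  shows "nilpotent_part scale T (C x) = C (nilpotent_part scale T x)"
  using scalar_on_ge_commute[where T=T and a="\<lambda>c. c" and C=C, OF T semisimple_part_props[OF T] C] C
  by (simp add: nilpotent_part_def lin_diff)

text \<open>As for the semisimple part: if \<open>T = S' U'\<close>, then on the eigenspace of \<open>S'\<close> of eigenvalue \<open>c\<close> the operator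
  \<open>T - c\<close> is \<open>c (U' - 1)\<close>, so this eigenspace lies in \<open>ge T c\<close> and \<open>U' = c\<^bsup>-1\<^esup> T\<close> on it.  Injectivity of
  \<open>T\<close> excludes the eigenvalue \<open>0\<close>.\<close>

lemma unipotent_part_props:
  assumes T: "triangulable T" and inj: "inj T"
  shows "lin (unipotent_part scale T)" "v \<in> ge T c \<Longrightarrow> unipotent_part scale T v = scale (inverse c) (T v)"
proof -
  have lT: "lin T" by (rule triangulable_lin[OF T])
  have ge0: "v = 0" if "v \<in> ge T 0" for v
    using ge_eigenvector[OF lT that] injD[OF inj, of _ 0] lin_zero[OF lT] by auto
  obtain S where S: "lin S" "\<And>c v. v \<in> ge T c \<Longrightarrow> S v = scale c v"
    using scalar_extension[OF T, of "\<lambda>c. c"] by blast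
  have "\<exists>U. lin U \<and> (\<forall>c. \<forall>v\<in>ge T c. U v = scale (inverse c) (T v))"
    by (rule direct_sum_extend[OF triangulable_direct_sum[OF T]]) (intro lin_smult lT)
  then obtain U where U: "lin U" "\<And>c v. v \<in> ge T c \<Longrightarrow> U v = scale (inverse c) (T v)" by blast
  have cancel: "scale c (scale (inverse c) v) = v" "scale (inverse c) (scale c v) = v" if "v \<in> ge T c" for v c
    using that ge0 by (cases "c = 0"; auto)+
  have N: "lin (\<lambda>v. U v - v)" by (intro lin_minus U lin_idV)
  have "U v - v = scale (inverse c) (shift T c v)" if "v \<in> ge T c" for v c
    using that U(2)[OF that] cancel[OF that] by (simp add: scale_right_diff_distrib)
  from shift_of_scalar_part_nilp[OF T N this] have nN: "nilp (\<lambda>v. U v - v)" .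
  have sS: "semisimple_op scale S" by (rule scalar_on_ge_semisimple[OF T S])
  have SU: "S \<circ> U = U \<circ> S"
  proof
    fix x
    have "S (U x) = U (S x)"
    proof (rule triangulable_eqI[where A="\<lambda>x. S (U x)" and B="\<lambda>x. U (S x)", OF T])
      show "lin (\<lambda>x. S (U x))" "lin (\<lambda>x. U (S x))"
        by (rule lin_compose[OF U(1) S(1)], rule lin_compose[OF S(1) U(1)])
      fix c v assume v: "v \<in> ge T c"
      have "S (U v) = scale c (U v)" by (rule S(2)) (simp add: U(2)[OF v] ge_self[OF lT v] ge_scale[OF lT])
      then show "S (U v) = U (S v)" by (simp add: S(2)[OF v] lin_scale[OF U(1)])
    qed
    then show "(S \<circ> U) x = (U \<circ> S) x" by simp
  qed
  have TSU: "T = S \<circ> U"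
  proof
    fix x
    have "T x = S (U x)"
    proof (rule triangulable_eqI[where A=T and B="\<lambda>x. S (U x)", OF T])
      show "lin T" "lin (\<lambda>x. S (U x))" by (rule lT, rule lin_compose[OF U(1) S(1)])
      fix c v assume v: "v \<in> ge T c"
      then have "S (U v) = scale c (scale (inverse c) (T v))"
        using S(2)[OF ge_scale[OF lT ge_self[OF lT v]]] by (simp add: U(2)[OF v])
      then show "T v = S (U v)" using cancel[OF ge_self[OF lT v]] by simp
    qed
    then show "T x = (S \<circ> U) x" by simp
  qed
  have "unipotent_part scale T = U"
    unfolding unipotent_part_def
  proof (rule the_equality)
    show "\<exists>\<sigma>. semisimple_op scale \<sigma> \<and> nilp (\<lambda>v. U v - v) \<and> \<sigma> \<circ> U = U \<circ> \<sigma> \<and> T = \<sigma> \<circ> U"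
      using sS nN SU TSU by (intro exI[of _ S]) auto
  next
    fix U' assume "\<exists>\<sigma>. semisimple_op scale \<sigma> \<and> nilp (\<lambda>v. U' v - v) \<and> \<sigma> \<circ> U' = U' \<circ> \<sigma> \<and> T = \<sigma> \<circ> U'"
    then obtain S' where a: "semisimple_op scale S'" "nilp (\<lambda>v. U' v - v)" "S' \<circ> U' = U' \<circ> S'" "T = S' \<circ> U'" by blast
    have lS': "lin S'" using a(1) by (simp add: semisimple_op_def)
    have lU': "lin U'" using lin_plus[OF nilp_lin[OF a(2)] lin_idV] by simp
    have "U' v = U v" for v
    proof (rule triangulable_eqI[OF semisimple_ge(2)[OF a(1)] lU' U(1)])
      fix c v assume "v \<in> ge S' c"
      then have v: "v \<in> eigenspace scale S' c" by (simp add: semisimple_ge(1)[OF a(1)])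
      let ?X = "\<lambda>v. U' v - v"
      have Te: "T x = scale c (U' x)" "U' x \<in> eigenspace scale S' c" if "x \<in> eigenspace scale S' c" for x
        using that a(3,4) lin_scale[OF lU'] by (auto simp: eigenspace_def fun_eq_iff)
      have "(shift T c ^^ k) v = scale (c ^ k) ((?X ^^ k) v) \<and> (?X ^^ k) v \<in> eigenspace scale S' c" for k
      proof (induction k)
        case (Suc k)
        let ?x = "(?X ^^ k) v"
        have x: "?x \<in> eigenspace scale S' c" using Suc by simp
        have "(shift T c ^^ Suc k) v = shift T c (scale (c ^ k) ?x)" using Suc by simp
        also have "\<dots> = scale (c ^ k) (scale c (U' ?x) - scale c ?x)"
          by (simp add: lin_scale[OF lT] Te(1)[OF x] scale_right_diff_distrib mult.commute)
        also have "\<dots> = scale (c ^ Suc k) (?X ?x)" by (simp add: scale_right_diff_distrib mult.commute)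
        finally show ?case using x Te(2)[OF x] subspace_diff[OF subspace_eigenspace[OF lS']] by simp
      qed (use v in simp)
      then have vT: "v \<in> ge T c" using nilpE[OF a(2)] geI by (metis order_refl scale_zero_right)
      show "U' v = U v"
      proof (cases "c = 0")
        case True then show ?thesis using ge0 vT lin_zero[OF lU'] lin_zero[OF U(1)] by metis
      next
        case False then show ?thesis using U(2)[OF vT] Te(1)[OF v] by simp
      qed
    qed
    then show "U' = U" by blast
  qed
  then show "lin (unipotent_part scale T)" "v \<in> ge T c \<Longrightarrow> unipotent_part scale T v = scale (inverse c) (T v)"
    using U by auto
qed

section \<open>The logarithm of an invertible operator\<close>

context
  fixes h :: "'a \<Rightarrow> 'a"
  assumes T: "triangulable h" and inj: "inj h"
begin

lemma ge_inj_0: "v \<in> ge h 0 \<Longrightarrow> v = 0"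
  using ge_eigenvector[OF triangulable_lin[OF T], of v 0] injD[OF inj, of _ 0] lin_zero[OF triangulable_lin[OF T]]
  by auto

lemma P_set_iff: "\<alpha> \<in> P_set scale h \<longleftrightarrow> 0 \<le> Re \<alpha> \<and> Re \<alpha> < 1 \<and> ge h (cis2pi \<alpha>) \<noteq> {0}"
proof -
  have "(\<exists>v. v \<noteq> 0 \<and> h v = scale (cis2pi \<alpha>) v) \<longleftrightarrow> ge h (cis2pi \<alpha>) \<noteq> {0}"
    using ge_eigenvector[OF triangulable_lin[OF T]] ge_0[OF triangulable_lin[OF T]]
      eigenspace_ge[of _ h "cis2pi \<alpha>"] unfolding eigenspace_def by blast
  then show ?thesis by (simp add: P_set_def cis2pi_def)
qed

text \<open>The description in the definition of \<^const>\<open>S_op\<close> determines the operator, because the nonzero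
  generalized eigenspaces are those for \<open>e\<^bsup>2\<pi>i\<alpha>\<^esup>\<close> with \<open>\<alpha>\<close> in \<^const>\<open>P_set\<close>.\<close>

lemma S_op_props:
  "lin (S_op scale h)" "v \<in> ge h c \<Longrightarrow> S_op scale h v = scale (strip_log c) v"
proof -
  obtain S where S: "lin S" "\<And>c v. v \<in> ge h c \<Longrightarrow> S v = scale (strip_log c) v"
    using scalar_extension[OF T, of strip_log] by blast
  have "S_op scale h = S"
    unfolding S_op_def
  proof (rule the_equality, intro conjI ballI)
    show "lin S" by (rule S)
    fix \<alpha> v assume a: "\<alpha> \<in> P_set scale h" "v \<in> ge h (exp (2 * pi * \<i> * \<alpha>))"
    have "strip_log (cis2pi \<alpha>) = \<alpha>"
      by (rule strip_unique) (use a(1) strip_log[of "cis2pi \<alpha>"] in \<open>auto simp: P_set_iff\<close>)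
    then show "S v = scale \<alpha> v" using S(2)[OF a(2)] by (simp add: cis2pi_def)
  next
    fix S' assume a: "lin S' \<and> (\<forall>\<alpha>\<in>P_set scale h. \<forall>v\<in>ge h (exp (2 * pi * \<i> * \<alpha>)). S' v = scale \<alpha> v)"
    have "S' v = S v" for v
    proof (rule triangulable_eqI[where A=S' and B=S, OF T])
      show "lin S'" "lin S" using a S by auto
      fix c v assume v: "v \<in> ge h c"
      show "S' v = S v"
      proof (cases "v = 0")
        case True then show ?thesis using lin_zero a S by metis
      next
        case False
        then have c: "c \<noteq> 0" using v ge_inj_0 by auto
        then have "strip_log c \<in> P_set scale h" using strip_log[OF c] v False by (auto simp: P_set_iff)
        then show ?thesis using a v S(2)[OF v] strip_log[OF c] by (auto simp: cis2pi_def)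
      qed
    qed
    then show "S' = S" by blast
  qed
  then show "lin (S_op scale h)" "v \<in> ge h c \<Longrightarrow> S_op scale h v = scale (strip_log c) v" using S by auto
qed

lemma S_op_semisimple: "semisimple_op scale (S_op scale h)"
  by (rule scalar_on_ge_semisimple[OF T S_op_props])

lemma S_op_eigenspace:
  assumes "0 \<le> Re \<alpha>" "Re \<alpha> < 1" shows "eigenspace scale (S_op scale h) \<alpha> = ge h (cis2pi \<alpha>)"
proof -
  have a: "strip_log (cis2pi \<alpha>) = \<alpha>"
    by (rule strip_unique) (use assms strip_log[of "cis2pi \<alpha>"] in auto)
  have "eigenspace scale (S_op scale h) (strip_log (cis2pi \<alpha>)) = ge h (cis2pi \<alpha>)"
  proof (rule scalar_on_ge_eigenspace_eq[where a=strip_log, OF T S_op_props])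
    fix c' assume "ge h c' \<noteq> {0}" "strip_log c' = strip_log (cis2pi \<alpha>)"
    moreover then have "c' \<noteq> 0" using ge_inj_0 ge_0[OF triangulable_lin[OF T]] by auto
    ultimately show "c' = cis2pi \<alpha>" using strip_log(3) cis2pi_nonzero by metis
  qed
  then show ?thesis by (simp only: a)
qed

lemma S_op_eigenspace_cis:
  assumes "v \<in> eigenspace scale (S_op scale h) \<alpha>" shows "v \<in> ge h (cis2pi \<alpha>)"
proof (cases "0 \<le> Re \<alpha> \<and> Re \<alpha> < 1")
  case True then show ?thesis using S_op_eigenspace assms by blast
next
  case False
  note d = triangulable_direct_sum[OF T]
  have "component UNIV (ge h) c v = 0" for c
  proof (rule ccontr)
    assume n: "component UNIV (ge h) c v \<noteq> 0"
    have "strip_log c = \<alpha>" by (rule scalar_on_ge_eigenspace[where T=h and a=strip_log, OF T S_op_props assms n])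
    moreover have "c \<noteq> 0" using n component_in[OF d, of c v] ge_inj_0 by auto
    ultimately show False using strip_log False by metis
  qed
  then have "v = 0" using component_sum[OF d, of v] by simp
  then show ?thesis using ge_0[OF triangulable_lin[OF T]] by simp
qed

lemma S_op_commute:
  "lin C \<Longrightarrow> (\<And>x. h (C x) = C (h x)) \<Longrightarrow> S_op scale h (C x) = C (S_op scale h x)"
  by (rule scalar_on_ge_commute[where T=h and a=strip_log and C=C, OF T S_op_props])

abbreviation unip_shift :: "'a \<Rightarrow> 'a" where "unip_shift \<equiv> \<lambda>x. unipotent_part scale h x - x"

lemma unip_shift_nilp: "nilp unip_shift"
proof (rule shift_of_scalar_part_nilp[OF T, of _ inverse])
  show "lin unip_shift" by (intro lin_minus lin_idV unipotent_part_props T inj)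
  fix c v assume v: "v \<in> ge h c"
  show "unip_shift v = scale (inverse c) (shift h c v)"
    using unipotent_part_props(2)[OF T inj v] ge_inj_0[of v] v
    by (cases "c = 0") (auto simp: scale_right_diff_distrib)
qed

lemma N_op_eq: "N_op scale h v = ps_op (fps_ln (2 * pi * \<i>)) unip_shift v"
proof -
  let ?X = unip_shift
  have "N_op scale h v = scale (1 / (2 * pi * \<i>)) (ps_op (fps_ln 1) ?X v)"
  proof -
    have "(if j = 0 then 0 else scale ((-1) ^ (j + 1) / of_nat j) ((?X ^^ j) v)) = scale (fps_nth (fps_ln 1) j) ((?X ^^ j) v)" for j
      by (cases j) (auto simp: fps_ln_nth)
    then show ?thesis unfolding N_op_def ps_op_def by simp
  qed
  also have "\<dots> = ps_op (fps_ln (2 * pi * \<i>)) ?X v"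
    unfolding ps_op_def lin_Sum_any[OF lin_scaleV ps_op_finite[OF unip_shift_nilp]]
    by (intro Sum_any.cong) (auto simp: fps_ln_nth)
  finally show ?thesis .
qed

lemma N_op_nilp: "nilp (N_op scale h)"
  unfolding N_op_eq[abs_def] by (rule ps_op_nilp[OF unip_shift_nilp]) simp

lemma N_op_lin: "lin (N_op scale h)"
  by (rule nilp_lin[OF N_op_nilp])

text \<open>On \<open>ge h c\<close> the operator \<open>h\<close> is \<open>c\<close> times its unipotent part \<open>exp(2\<pi>i N)\<close>.\<close>

lemma N_op_exp:
  assumes "v \<in> ge h c" shows "h v = scale c (ps_op (fps_exp (2 * pi * \<i>)) (N_op scale h) v)"
proof -
  have "ps_op (fps_exp (2 * pi * \<i>)) (N_op scale h) v = v + unip_shift v"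
    unfolding N_op_eq[abs_def] by (rule ps_op_exp_ln[OF unip_shift_nilp]) simp
  then have "ps_op (fps_exp (2 * pi * \<i>)) (N_op scale h) v = scale (inverse c) (h v)"
    using unipotent_part_props(2)[OF T inj assms] by simp
  moreover have "c = 0 \<Longrightarrow> h v = 0" using ge_inj_0 assms lin_zero[OF triangulable_lin[OF T]] by blast
  ultimately show ?thesis by (cases "c = 0") auto
qed

lemma N_op_commute:
  assumes C: "lin C" "\<And>x. h (C x) = C (h x)" shows "N_op scale h (C x) = C (N_op scale h x)"
proof -
  have "unipotent_part scale h (C x) = C (unipotent_part scale h x)" for x
  proof (rule triangulable_eqI[where A="\<lambda>x. unipotent_part scale h (C x)" and B="\<lambda>x. C (unipotent_part scale h x)", OF T])
    show "lin (\<lambda>x. unipotent_part scale h (C x))" "lin (\<lambda>x. C (unipotent_part scale h x))"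
      by (rule lin_compose[OF C(1) unipotent_part_props(1)[OF T inj]], rule lin_compose[OF unipotent_part_props(1)[OF T inj] C(1)])
    fix c v assume v: "v \<in> ge h c"
    then have "C v \<in> ge h c" by (rule ge_commute[where T=h and S=C, OF C])
    then show "unipotent_part scale h (C v) = C (unipotent_part scale h v)"
      using v by (simp add: unipotent_part_props(2)[OF T inj] lin_scale[OF C(1)] C(2))
  qed
  then have "unip_shift (C x) = C (unip_shift x)" for x by (simp add: lin_diff[OF C(1)])
  then show ?thesis unfolding N_op_eq by (intro ps_op_commute[OF unip_shift_nilp C(1), symmetric])
qed

end

section \<open>Exponentials of operators\<close>

text \<open>The series defining \<^const>\<open>op_exp\<close> is tested against linear functionals, and these determine
  its value.\<close>

lemma functional_separates:
  assumes "x \<noteq> 0" shows "\<exists>\<phi>. Vector_Spaces.linear scale ((*) :: complex \<Rightarrow> _) \<phi> \<and> \<phi> x \<noteq> 0"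
proof -
  interpret C: vector_space "(*) :: complex \<Rightarrow> complex \<Rightarrow> complex"
    by unfold_locales (auto simp: algebra_simps)
  interpret P: vector_space_pair scale "(*) :: complex \<Rightarrow> complex \<Rightarrow> complex" by unfold_locales
  have "independent {x}" using assms by simp
  from P.linear_independent_extend[OF this, of "\<lambda>_. 1"] show ?thesis by auto
qed

lemma functional_eqI:
  assumes "\<And>\<phi>. Vector_Spaces.linear scale ((*) :: complex \<Rightarrow> _) \<phi> \<Longrightarrow> \<phi> x = \<phi> y" shows "x = y"
  using functional_separates[of "x - y"] assms lin_diff[of scale "(*)"] by force

text \<open>A polynomial function with vector coefficients that vanishes on an infinite set has zero
  coefficients; linear functionals reduce this to complex polynomials.\<close>

lemma poly_vanish:
  assumes "\<And>n::nat. (\<Sum>k<M. scale ((a * of_nat n) ^ k) (C k)) = 0" "a \<noteq> 0" "k < M" shows "C k = 0"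
proof (rule functional_eqI)
  fix \<phi> :: "'a \<Rightarrow> complex" assume p: "Vector_Spaces.linear scale (*) \<phi>"
  define q where "q = (\<Sum>k<M. monom (\<phi> (C k)) k)"
  have "poly q (a * of_nat n) = 0" for n :: nat
  proof -
    have "\<phi> (\<Sum>k<M. scale ((a * of_nat n) ^ k) (C k)) = 0" by (simp only: assms(1) lin_zero[OF p])
    then show ?thesis by (simp add: q_def poly_sum poly_monom lin_sum[OF p] lin_scale[OF p] mult.commute)
  qed
  then have "range (\<lambda>n::nat. a * of_nat n) \<subseteq> {x. poly q x = 0}" by auto
  moreover have "infinite (range (\<lambda>n::nat. a * of_nat n))"
    using assms(2) by (intro range_inj_infinite) (auto simp: inj_def)
  ultimately have "q = 0" using poly_roots_finite finite_subset by metis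
  then have "coeff q k = 0" by simp
  then show "\<phi> (C k) = \<phi> 0" using assms(3) by (simp add: q_def coeff_sum lin_zero[OF p])
qed

text \<open>On \<open>ge T c\<close> the operator \<open>T\<close> is \<open>c + N\<close> with \<open>N\<close> nilpotent, so \<open>T\<^bsup>k\<^esup> v / k!\<close> is the sum over \<open>j < K\<close> of
  \<open>(c\<^bsup>k-j\<^esup> / (k-j)!) N\<^bsup>j\<^esup> v / j!\<close>.  Every functional turns this into finitely many shifted exponential
  series, which converge to \<open>e\<^bsup>c\<^esup>\<close> times the value on \<open>exp(N) v\<close>.  Existence for general \<open>v\<close> follows by
  additivity, and uniqueness because functionals separate vectors.\<close>

lemma op_exp_props:
  assumes T: "triangulable T"
  shows "lin (op_exp scale T)"
    and "v \<in> ge T c \<Longrightarrow> op_exp scale T v = scale (exp c) (ps_op (fps_exp 1) (nilpotent_part scale T) v)"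
proof -
  let ?N = "nilpotent_part scale T"
  have lT: "lin T" by (rule triangulable_lin[OF T])
  have N: "nilp ?N" by (rule nilpotent_part_props[OF T])
  have lN: "lin ?N" by (rule nilp_lin[OF N])
  define E where "E v e \<longleftrightarrow> (\<forall>\<phi>. Vector_Spaces.linear scale ((*) :: complex \<Rightarrow> _) \<phi> \<longrightarrow>
     (\<lambda>k. \<phi> ((T ^^ k) v) / fact k) sums \<phi> e)" for v e
  have E_unique: "E v e \<Longrightarrow> E v e' \<Longrightarrow> e = e'" for v e e'
  proof (rule functional_eqI)
    fix \<phi> :: "'a \<Rightarrow> complex" assume "E v e" "E v e'" and p: "Vector_Spaces.linear scale (*) \<phi>"
    then have "(\<lambda>k. \<phi> ((T ^^ k) v) / fact k) sums \<phi> e" "(\<lambda>k. \<phi> ((T ^^ k) v) / fact k) sums \<phi> e'"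
      unfolding E_def by blast+
    then show "\<phi> e = \<phi> e'" by (rule sums_unique2)
  qed
  have E_add: "E x e \<Longrightarrow> E y e' \<Longrightarrow> E (x + y) (e + e')" for x y e e'
    unfolding E_def
  proof (intro allI impI)
    fix \<phi> :: "'a \<Rightarrow> complex" assume a: "\<forall>\<phi>. Vector_Spaces.linear scale (*) \<phi> \<longrightarrow> (\<lambda>k. \<phi> ((T ^^ k) x) / fact k) sums \<phi> e"
      "\<forall>\<phi>. Vector_Spaces.linear scale (*) \<phi> \<longrightarrow> (\<lambda>k. \<phi> ((T ^^ k) y) / fact k) sums \<phi> e'"
      and p: "Vector_Spaces.linear scale (*) \<phi>"
    then have "(\<lambda>k. \<phi> ((T ^^ k) x) / fact k + \<phi> ((T ^^ k) y) / fact k) sums (\<phi> e + \<phi> e')" by (intro sums_add) blast+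
    then show "(\<lambda>k. \<phi> ((T ^^ k) (x + y)) / fact k) sums \<phi> (e + e')"
      by (simp only: lin_add[OF lin_funpow[OF lT]] lin_add[OF p] add_divide_distrib)
  qed
  have E_scale: "E x e \<Longrightarrow> E (scale a x) (scale a e)" for x e a
    unfolding E_def
  proof (intro allI impI)
    fix \<phi> :: "'a \<Rightarrow> complex" assume a: "\<forall>\<phi>. Vector_Spaces.linear scale (*) \<phi> \<longrightarrow> (\<lambda>k. \<phi> ((T ^^ k) x) / fact k) sums \<phi> e"
      and p: "Vector_Spaces.linear scale (*) \<phi>"
    then have "(\<lambda>k. a * (\<phi> ((T ^^ k) x) / fact k)) sums (a * \<phi> e)" by (intro sums_mult) blast
    then show "(\<lambda>k. \<phi> ((T ^^ k) (scale a x)) / fact k) sums \<phi> (scale a e)"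
      by (simp only: lin_scale[OF lin_funpow[OF lT]] lin_scale[OF p] times_divide_eq_right)
  qed
  have E_ge: "E v (scale (exp c) (ps_op (fps_exp 1) ?N v))" if v: "v \<in> ge T c" for v c
    unfolding E_def
  proof (intro allI impI)
    fix \<phi> :: "'a \<Rightarrow> complex" assume p: "Vector_Spaces.linear scale (*) \<phi>"
    obtain K where K: "\<And>k. k \<ge> K \<Longrightarrow> (?N ^^ k) v = 0" using nilpE[OF N] by metis
    let ?S = "\<lambda>x. ?N x + scale c x"
    have Tk: "(T ^^ k) v = (?S ^^ k) v \<and> (T ^^ k) v \<in> ge T c" for k
    proof (induction k)
      case (Suc k)
      let ?x = "(T ^^ k) v"
      have "T ?x = ?S ?x" using nilpotent_part_props(2)[OF T conjunct2[OF Suc]] by (simp add: algebra_simps)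
      then show ?case using conjunct1[OF Suc] ge_self[OF lT conjunct2[OF Suc]] by simp
    qed (use v in simp)
    have sc: "((\<lambda>x. scale c x) ^^ j) x = scale (c ^ j) x" for j x
      by (induction j) (auto simp: mult.commute)
    have ex: "\<phi> ((T ^^ k) v) / fact k = (\<Sum>j<K. (if j \<le> k then c ^ (k - j) / fact (k - j) else 0) * \<phi> (dpow j ?N v))" for k
    proof -
      have "\<phi> ((T ^^ k) v) / fact k = \<phi> (dpow k ?S v)"
        using Tk[of k] by (simp add: lin_scale[OF p])
      also have "dpow k ?S v = (\<Sum>i\<le>k. dpow i ?N (dpow (k - i) (\<lambda>x. scale c x) v))"
        by (rule dpow_add[OF lN lin_scaleV]) (rule lin_scale[OF lN])
      also have "\<dots> = (\<Sum>i\<le>k. scale (c ^ (k - i) / fact (k - i)) (dpow i ?N v))"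
        by (intro sum.cong refl) (simp add: sc lin_scale[OF lin_funpow[OF lN]] mult.commute)
      also have "\<phi> \<dots> = (\<Sum>i\<le>k. c ^ (k - i) / fact (k - i) * \<phi> (dpow i ?N v))"
        by (simp only: lin_sum[OF p] lin_scale[OF p])
      also have "\<dots> = (\<Sum>j\<in>{..k} \<inter> {..<K}. c ^ (k - j) / fact (k - j) * \<phi> (dpow j ?N v))"
        by (intro sum.mono_neutral_right) (auto simp: K lin_zero[OF p])
      also have "\<dots> = (\<Sum>j<K. (if j \<le> k then c ^ (k - j) / fact (k - j) else 0) * \<phi> (dpow j ?N v))"
        by (intro sum.mono_neutral_cong_left) auto
      finally show ?thesis .
    qed
    have es: "(\<lambda>k. if j \<le> k then c ^ (k - j) / fact (k - j) else 0) sums exp c" for j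
    proof -
      have "(\<lambda>n. c ^ n / fact n) sums exp c" using exp_converges[of c] by (simp add: scaleR_conv_of_real field_simps)
      then have "(\<lambda>i. if j \<le> i + j then c ^ (i + j - j) / fact (i + j - j) else 0) sums exp c" by simp
      then show ?thesis by (subst (asm) sums_zero_iff_shift) auto
    qed
    have "(\<lambda>k. \<phi> ((T ^^ k) v) / fact k) sums (\<Sum>j<K. exp c * \<phi> (dpow j ?N v))"
      unfolding ex by (intro sums_sum sums_mult2 es)
    moreover have "(\<Sum>j<K. exp c * \<phi> (dpow j ?N v)) = \<phi> (scale (exp c) (ps_op (fps_exp 1) ?N v))"
    proof -
      have "ps_op (fps_exp 1) ?N v = (\<Sum>k<K. scale (fps_nth (fps_exp 1) k) ((?N ^^ k) v))"
        by (rule ps_op_eq_sum[OF K])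
      then show ?thesis by (simp add: lin_scale[OF p] lin_sum[OF p] sum_distrib_left)
    qed
    ultimately show "(\<lambda>k. \<phi> ((T ^^ k) v) / fact k) sums \<phi> (scale (exp c) (ps_op (fps_exp 1) ?N v))" by simp
  qed
  have "\<exists>e. E v e" for v
    using T by (induction v rule: triangulable_induct) (use E_ge E_add in blast)+
  then have E_op: "E v (op_exp scale T v)" for v
    unfolding op_exp_def E_def[symmetric] using theI[of "E v"] E_unique by metis
  show "lin (op_exp scale T)"
    by (rule linI; metis E_unique E_op E_add E_scale)
  show "v \<in> ge T c \<Longrightarrow> op_exp scale T v = scale (exp c) (ps_op (fps_exp 1) ?N v)"
    using E_unique E_op E_ge by blast
qed

lemma op_exp_commute:
  assumes T: "triangulable T" and C: "lin C" "\<And>x. T (C x) = C (T x)"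
  shows "op_exp scale T (C x) = C (op_exp scale T x)"
proof (rule triangulable_eqI[where A="\<lambda>x. op_exp scale T (C x)" and B="\<lambda>x. C (op_exp scale T x)", OF T])
  show "lin (\<lambda>x. op_exp scale T (C x))" "lin (\<lambda>x. C (op_exp scale T x))"
    by (rule lin_compose[OF C(1) op_exp_props(1)[OF T]], rule lin_compose[OF op_exp_props(1)[OF T] C(1)])
  fix c v assume v: "v \<in> ge T c"
  then have "C v \<in> ge T c" by (rule ge_commute[where T=T and S=C, OF C])
  then show "op_exp scale T (C v) = C (op_exp scale T v)"
    using ps_op_commute[OF nilpotent_part_props(1)[OF T] C(1), of "fps_exp 1" v] nilpotent_part_commute[where T=T and C=C, OF T C]
    by (simp add: op_exp_props(2)[OF T v] op_exp_props(2)[OF T, of "C v" c] lin_scale[OF C(1)])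
qed

lemma triangulable_scale:
  assumes T: "triangulable T"
  shows "triangulable (\<lambda>x. scale a (T x))" "v \<in> ge T c \<Longrightarrow> v \<in> ge (\<lambda>x. scale a (T x)) (a * c)"
    "v \<in> ge T c \<Longrightarrow> nilpotent_part scale (\<lambda>x. scale a (T x)) v = scale a (nilpotent_part scale T v)"
proof -
  have lT: "lin T" by (rule triangulable_lin[OF T])
  have *: "v \<in> ge (\<lambda>x. scale a (T x)) (a * c)" if v: "v \<in> ge T c" for v c
  proof -
    obtain K where "(shift T c ^^ K) v = 0" using v by (auto simp: gen_eigenspace_def)
    moreover have "(shift (\<lambda>x. scale a (T x)) (a * c) ^^ k) v = scale (a ^ k) ((shift T c ^^ k) v)" for k
    proof (induction k)
      case (Suc k)
      have "shift (\<lambda>x. scale a (T x)) (a * c) (scale (a ^ k) y) = scale (a ^ Suc k) (shift T c y)" for y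
        by (simp add: lin_scale[OF lT] scale_right_diff_distrib mult.commute mult.left_commute)
      then show ?case by (simp only: Suc funpow.simps o_apply)
    qed simp
    ultimately show ?thesis by (intro geI[where K=K]) simp
  qed
  have "v \<in> span (\<Union>c. ge (\<lambda>x. scale a (T x)) c)" for v
    using T
  proof (induction v rule: triangulable_induct)
    case (ge c v)
    then show ?case by (intro span_base UN_I[of "a * c"] *) auto
  qed (rule span_add)
  then show **: "triangulable (\<lambda>x. scale a (T x))" by (auto simp: triangulable_def intro: lin_smult lT)
  show "v \<in> ge T c \<Longrightarrow> v \<in> ge (\<lambda>x. scale a (T x)) (a * c)" by (rule *)
  show "nilpotent_part scale (\<lambda>x. scale a (T x)) v = scale a (nilpotent_part scale T v)" if "v \<in> ge T c"
    unfolding nilpotent_part_props(2)[OF ** *[OF that]] nilpotent_part_props(2)[OF T that] by (simp add: scale_right_diff_distrib)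
qed

text \<open>The nilpotent part of \<open>a T\<close> is \<open>a\<close> times that of \<open>T\<close>; the factor is moved into the series \<open>exp(a X)\<close>, in
  the shape in which \<open>N_op_exp\<close> describes automorphisms.\<close>

lemma op_exp_scaled:
  assumes T: "triangulable T" and v: "v \<in> ge T c"
  shows "op_exp scale (\<lambda>x. scale a (T x)) v = scale (exp (a * c)) (ps_op (fps_exp a) (nilpotent_part scale T) v)"
proof -
  have lT: "lin T" by (rule triangulable_lin[OF T])
  let ?N = "nilpotent_part scale T"
  let ?N' = "nilpotent_part scale (\<lambda>x. scale a (T x))"
  have lN: "lin ?N" by (rule nilp_lin[OF nilpotent_part_props(1)[OF T]])
  have Nge: "?N x \<in> ge T c" if "x \<in> ge T c" for x
    using nilpotent_part_props(2)[OF T that] ge_shift[OF lT that, of c] by simp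
  have "(?N' ^^ k) v = scale (a ^ k) ((?N ^^ k) v) \<and> (?N ^^ k) v \<in> ge T c" for k
  proof (induction k)
    case (Suc k)
    have "?N' (scale (a ^ k) ((?N ^^ k) v)) = scale a (?N (scale (a ^ k) ((?N ^^ k) v)))"
      by (rule triangulable_scale(3)[OF T, of _ c]) (use Suc ge_scale[OF lT] in auto)
    then show ?case using Suc Nge by (simp add: lin_scale[OF lN] mult.commute)
  qed (use v in auto)
  then have "ps_op (fps_exp 1) ?N' v = ps_op (fps_exp a) ?N v"
    unfolding ps_op_def by simp
  then show ?thesis
    using op_exp_props(2)[OF triangulable_scale(1)[OF T] triangulable_scale(2)[OF T v]] by simp
qed

lemma op_exp_inverse:
  assumes T: "triangulable T"
  shows "op_exp scale (\<lambda>x. scale a (T x)) (op_exp scale (\<lambda>x. scale (- a) (T x)) v) = v"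
proof -
  let ?N = "nilpotent_part scale T"
  let ?A = "op_exp scale (\<lambda>x. scale a (T x))" and ?B = "op_exp scale (\<lambda>x. scale (- a) (T x))"
  have lA: "lin ?A" and lB: "lin ?B" by (rule op_exp_props(1)[OF triangulable_scale(1)[OF T]])+
  have N: "nilp ?N" by (rule nilpotent_part_props(1)[OF T])
  have lT: "lin T" by (rule triangulable_lin[OF T])
  show ?thesis
  proof (rule triangulable_eqI[where A="\<lambda>v. ?A (?B v)" and B="\<lambda>v. v", OF T lin_compose[OF lB lA] lin_idV])
    fix c v assume v: "v \<in> ge T c"
    have "?N (T x) = T (?N x)" for x by (rule nilpotent_part_commute[where T=T and C=T, OF T lT]) simp
    then have "T (ps_op (fps_exp (- a)) ?N x) = ps_op (fps_exp (- a)) ?N (T x)" for x by (rule ps_op_commute[OF N lT])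
    then have p: "ps_op (fps_exp (- a)) ?N v \<in> ge T c"
      by (rule ge_commute[where T=T and S="ps_op (fps_exp (- a)) ?N", OF ps_op_lin[OF N] _ v])
    have "?A (?B v) = scale (exp (- a * c)) (?A (ps_op (fps_exp (- a)) ?N v))"
      by (simp only: op_exp_scaled[OF T v] lin_scale[OF lA])
    also have "\<dots> = scale (exp (- a * c)) (scale (exp (a * c)) (ps_op (fps_exp a * fps_exp (- a)) ?N v))"
      by (simp only: op_exp_scaled[OF T p] ps_op_mult[OF N])
    also have "\<dots> = v" by (simp add: fps_exp_add_mult[symmetric] exp_add[symmetric])
    finally show "?A (?B v) = v" .
  qed
qed

lemma bij_op_exp:
  assumes "triangulable T" shows "bij (op_exp scale (\<lambda>x. scale a (T x)))"
  using op_exp_inverse[OF assms, of a] op_exp_inverse[OF assms, of "- a"]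
  by (intro o_bij[of "op_exp scale (\<lambda>x. scale (- a) (T x))"]) (auto simp: fun_eq_iff)

section \<open>Binomial coefficients of operators\<close>

abbreviation obinom :: "('a \<Rightarrow> 'a) \<Rightarrow> nat \<Rightarrow> 'a \<Rightarrow> 'a" where "obinom \<equiv> op_gbinomial scale"

lemma lin_obinom: "lin T \<Longrightarrow> lin (obinom T i)"
proof (induction i)
  case (Suc i)
  then show ?case by (auto intro!: lin_smult lin_minus lin_compose[OF Suc(1) Suc(2)])
qed (auto intro: lin_idV)

lemma obinom_commute:
  assumes "lin C" "\<And>x. T (C x) = C (T x)" shows "obinom T i (C x) = C (obinom T i x)"
  by (induction i) (auto simp: assms lin_diff[OF assms(1)] lin_scale[OF assms(1)])

lemma obinom_Suc: "scale (of_nat (Suc i)) (obinom T (Suc i) v) = T (obinom T i v) - scale (of_nat i) (obinom T i v)"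
  by (simp del: of_nat_Suc)

lemma obinom_eigen:
  assumes T: "lin T" and "T v = scale c v" shows "obinom T i v = scale (c gchoose i) v"
proof (induction i)
  case (Suc i)
  have "scale (of_nat (Suc i)) (obinom T (Suc i) v) = scale ((c - of_nat i) * (c gchoose i)) v"
    unfolding obinom_Suc Suc lin_scale[OF T] assms(2) by (simp add: algebra_simps)
  also have "(c - of_nat i) * (c gchoose i) = of_nat (Suc i) * (c gchoose Suc i)"
    using gbinomial_mult_1[of c i] by (simp add: algebra_simps)
  finally show ?case by (rule Suc_scale_cancel[of i, OF trans]) (simp only: scale_scale)
qed simp

text \<open>The recursion \<open>(i + 1) binom(T, i + 1) = (T - i) binom(T, i)\<close> behaves like a Leibniz rule: \<open>P + Q - (a + b)\<close>
  is the sum of \<open>P - a\<close> and \<open>Q - b\<close>.\<close>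

lemma obinom_vandermonde:
  assumes P: "lin P" and Q: "lin Q" and c: "\<And>x. P (Q x) = Q (P x)"
  shows "obinom (\<lambda>x. P x + Q x) i v = (\<Sum>a\<le>i. obinom P a (obinom Q (i - a) v))"
proof (induction i)
  case 0 then show ?case by simp
next
  case (Suc i)
  let ?R = "\<lambda>x. P x + Q x" and ?B = "\<lambda>a b. obinom P a (obinom Q b v)"
  have D: "lin (\<lambda>x. P x + Q x - scale (of_nat i) x)" by (intro lin_plus lin_minus P Q lin_scaleV)
  have QB: "Q (?B a b) = obinom P a (Q (obinom Q b v))" for a b
    using obinom_commute[where T=P and C=Q, OF Q c] by simp
  have step: "?R (?B a b) - scale (of_nat (a + b)) (?B a b) =
      scale (of_nat (Suc a)) (?B (Suc a) b) + scale (of_nat (Suc b)) (?B a (Suc b))" for a b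
  proof -
    have "scale (of_nat (Suc b)) (?B a (Suc b)) = obinom P a (scale (of_nat (Suc b)) (obinom Q (Suc b) v))"
      by (rule lin_scale[OF lin_obinom[OF P], symmetric])
    also have "\<dots> = Q (?B a b) - scale (of_nat b) (?B a b)"
      unfolding obinom_Suc lin_diff[OF lin_obinom[OF P]] lin_scale[OF lin_obinom[OF P]] QB ..
    finally show ?thesis unfolding obinom_Suc by (simp add: algebra_simps)
  qed
  have 1: "(\<Sum>a\<le>i. scale (of_nat (Suc a)) (?B (Suc a) (i - a))) = (\<Sum>a\<le>Suc i. scale (of_nat a) (?B a (Suc i - a)))"
    by (simp add: sum.atMost_Suc_shift del: sum.atMost_Suc of_nat_Suc op_gbinomial.simps)
  have 2: "(\<Sum>a\<le>i. scale (of_nat (Suc (i - a))) (?B a (Suc (i - a)))) = (\<Sum>a\<le>Suc i. scale (of_nat (Suc i - a)) (?B a (Suc i - a)))"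
    by (simp add: Suc_diff_le del: of_nat_Suc of_nat_diff op_gbinomial.simps)
  have "scale (of_nat (Suc i)) (obinom ?R (Suc i) v) = (\<Sum>a\<le>i. ?R (?B a (i - a)) - scale (of_nat (a + (i - a))) (?B a (i - a)))"
    unfolding obinom_Suc Suc by (simp add: lin_sum[OF P] lin_sum[OF Q] sum.distrib sum_subtractf scale_sum_right)
  also have "\<dots> = (\<Sum>a\<le>Suc i. scale (of_nat a) (?B a (Suc i - a)) + scale (of_nat (Suc i - a)) (?B a (Suc i - a)))"
    by (simp only: step sum.distrib 1 2)
  also have "\<dots> = (\<Sum>a\<le>Suc i. scale (of_nat (Suc i)) (?B a (Suc i - a)))"
    by (intro sum.cong refl) (simp add: scale_left_distrib[symmetric] of_nat_add[symmetric] del: of_nat_Suc of_nat_add op_gbinomial.simps)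
  finally show ?case using Suc_scale_cancel[of i] by (simp only: scale_sum_right[symmetric])
qed

text \<open>Both sides equal \<open>X (X - 1) \<dots> (X - i) / i!\<close>.\<close>

lemma obinom_pred:
  assumes X: "lin X"
  shows "X (obinom (\<lambda>x. X x - x) i v) = X (obinom X i v) - scale (of_nat i) (obinom X i v)"
proof (induction i)
  case (Suc i)
  let ?Y = "\<lambda>x. X x - x"
  have lY: "lin ?Y" by (intro lin_minus X lin_idV)
  have "scale (of_nat (Suc i)) (X (obinom ?Y (Suc i) v)) = X (scale (of_nat (Suc i)) (obinom ?Y (Suc i) v))"
    by (rule lin_scale[OF X, symmetric])
  also have "\<dots> = ?Y (X (obinom ?Y i v)) - scale (of_nat i) (X (obinom ?Y i v))"
    unfolding obinom_Suc by (simp add: lin_diff[OF X] lin_scale[OF X])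
  also have "\<dots> = X (X (obinom X i v) - scale (of_nat i) (obinom X i v))
      - scale (of_nat (Suc i)) (X (obinom X i v) - scale (of_nat i) (obinom X i v))"
    unfolding Suc by (simp add: algebra_simps)
  also have "\<dots> = scale (of_nat (Suc i)) (X (obinom X (Suc i) v)) - scale (of_nat (Suc i)) (scale (of_nat (Suc i)) (obinom X (Suc i) v))"
    by (simp only: obinom_Suc[symmetric] lin_scale[OF X])
  also have "\<dots> = scale (of_nat (Suc i)) (X (obinom X (Suc i) v) - scale (of_nat (Suc i)) (obinom X (Suc i) v))"
    by (simp only: scale_right_diff_distrib)
  finally show ?case by (rule Suc_scale_cancel)
qed simp

end

section \<open>Bilinear products\<close>

text \<open>The products \<open>v\<^sub>n w\<close> of the vertex operator algebra and the coefficients of \<open>Y\<^sub>W(v, x) w\<close> are both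
  families of bilinear maps \<open>V \<times> W \<rightarrow> W\<close>.  Derivations and automorphisms are pairs of operators, one
  on the acting space and one on the space acted upon.\<close>

locale bilinear_product = V: complex_vector_space s + W: complex_vector_space t
  for s :: "complex \<Rightarrow> 'v::ab_group_add \<Rightarrow> 'v" and t :: "complex \<Rightarrow> 'w::ab_group_add \<Rightarrow> 'w" +
  fixes B :: "'v \<Rightarrow> 'w \<Rightarrow> 'w"
  assumes lin_l: "Vector_Spaces.linear s t (\<lambda>v. B v w)" and lin_r: "W.lin (B v)"
begin

text \<open>Induction on the sum of the nilpotency degrees, since
  \<open>(D' - a - b) (v \<cdot> w) = ((D - a) v) \<cdot> w + v \<cdot> ((D' - b) w)\<close>.\<close>

lemma derivation_ge:
  assumes D: "V.lin D" "W.lin D'" and der: "\<And>v w. D' (B v w) = B (D v) w + B v (D' w)"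
    and vw: "v \<in> V.ge D a" "w \<in> W.ge D' b"
  shows "B v w \<in> W.ge D' (a + b)"
proof -
  obtain K L where "(V.shift D a ^^ K) v = 0" "(W.shift D' b ^^ L) w = 0" using V.geE W.geE vw by metis
  then show ?thesis
  proof (induction "K + L" arbitrary: K L v w)
    case 0
    then show ?case using W.ge_0[OF D(2)] lin_zero[OF lin_l] by simp
  next
    case (Suc n)
    have e: "W.shift D' (a + b) (B v w) = B (V.shift D a v) w + B v (W.shift D' b w)"
      by (simp add: der lin_diff[OF lin_l] lin_diff[OF lin_r] lin_scale[OF lin_l] lin_scale[OF lin_r] algebra_simps)
    have 1: "B (V.shift D a v) w \<in> W.ge D' (a + b)"
    proof (cases K)
      case 0 then show ?thesis using Suc.prems W.ge_0[OF D(2)] lin_zero[OF lin_l] lin_zero[OF V.lin_shift[OF D(1)]] by simp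
    next
      case (Suc K') then show ?thesis using Suc.hyps(1)[of K' L] Suc.hyps(2) Suc.prems by (simp only: funpow_Suc_right o_apply)
    qed
    have 2: "B v (W.shift D' b w) \<in> W.ge D' (a + b)"
    proof (cases L)
      case 0 then show ?thesis using Suc.prems W.ge_0[OF D(2)] lin_zero[OF lin_r] lin_zero[OF W.lin_shift[OF D(2)]] by simp
    next
      case (Suc L') then show ?thesis using Suc.hyps(1)[of K L'] Suc.hyps(2) Suc.prems by (simp only: funpow_Suc_right o_apply)
    qed
    have "W.shift D' (a + b) (B v w) \<in> W.ge D' (a + b)" unfolding e using 1 2 by (rule W.ge_add[OF D(2)])
    then show ?case by (rule W.ge_of_shift[where T=D'])
  qed
qed

lemma dpow_leibniz:
  assumes D: "V.lin D" "W.lin D'" and der: "\<And>v w. D' (B v w) = B (D v) w + B v (D' w)"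
  shows "W.dpow k D' (B v w) = (\<Sum>i\<le>k. B (V.dpow i D v) (W.dpow (k - i) D' w))"
proof (induction k)
  case 0 then show ?case by simp
next
  case (Suc k)
  let ?B = "\<lambda>i j. B (V.dpow i D v) (W.dpow j D' w)"
  have "D' (?B i j) = t (of_nat (Suc i)) (?B (Suc i) j) + t (of_nat (Suc j)) (?B i (Suc j))" for i j
    by (simp only: der V.dpow_Suc[OF D(1), symmetric] W.dpow_Suc[OF D(2), symmetric]
      lin_scale[OF lin_l, where c="of_nat (Suc i)"] lin_scale[OF lin_r, where c="of_nat (Suc j)"])
  from W.leibniz_convolution[OF D(2), of ?B, OF this, of k]
  have "D' (W.dpow k D' (B v w)) = t (of_nat (Suc k)) (\<Sum>i\<le>Suc k. ?B i (Suc k - i))" using Suc.IH by simp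
  then show ?case unfolding W.dpow_Suc[OF D(2), symmetric] by (rule W.Suc_scale_cancel)
qed

lemma exp_derivation:
  assumes D: "V.nilp D" "W.nilp D'" and der: "\<And>v w. D' (B v w) = B (D v) w + B v (D' w)"
  shows "W.ps_op (fps_exp a) D' (B v w) = B (V.ps_op (fps_exp a) D v) (W.ps_op (fps_exp a) D' w)"
proof -
  have l: "V.lin D" "W.lin D'" using D V.nilp_lin W.nilp_lin by auto
  obtain K where K: "\<And>k. k \<ge> K \<Longrightarrow> (D ^^ k) v = 0" using V.nilpE[OF D(1)] by metis
  obtain L where L: "\<And>k. k \<ge> L \<Longrightarrow> (D' ^^ k) w = 0" using W.nilpE[OF D(2)] by metis
  let ?B = "\<lambda>i j. t (a ^ (i + j)) (B (V.dpow i D v) (W.dpow j D' w))"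
  have "W.ps_op (fps_exp a) D' (B v w) = Sum_any (\<lambda>k. \<Sum>i\<le>k. ?B i (k - i))"
    unfolding W.ps_op_exp_eq dpow_leibniz[OF l der] by (simp add: W.scale_sum_right)
  also have "\<dots> = (\<Sum>i<K. \<Sum>j<L. ?B i j)"
  proof (rule V.Sum_any_convolution)
    fix i j assume "i \<ge> K \<or> j \<ge> L"
    then show "?B i j = 0" using K[of i] L[of j] lin_zero[OF lin_l] lin_zero[OF lin_r] by (elim disjE) simp_all
  qed
  also have "\<dots> = B (\<Sum>i<K. s (a ^ i) (V.dpow i D v)) (\<Sum>j<L. t (a ^ j) (W.dpow j D' w))"
    by (simp only: lin_sum[OF lin_l] lin_scale[OF lin_l])
     (simp add: lin_sum[OF lin_r] lin_scale[OF lin_r] power_add mult_ac W.scale_sum_right)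
  also have "\<dots> = B (V.ps_op (fps_exp a) D v) (W.ps_op (fps_exp a) D' w)"
    by (simp add: V.ps_op_eq_sum[OF K] W.ps_op_eq_sum[OF L])
  finally show ?thesis .
qed

lemma nilpotent_part_derivation:
  assumes D: "V.triangulable D" "W.triangulable D'" and der: "\<And>v w. D' (B v w) = B (D v) w + B v (D' w)"
  shows "nilpotent_part t D' (B v w) = B (nilpotent_part s D v) w + B v (nilpotent_part t D' w)"
proof -
  have l: "V.lin D" "W.lin D'" using D V.triangulable_lin W.triangulable_lin by auto
  have lN: "V.lin (nilpotent_part s D)" "W.lin (nilpotent_part t D')"
    using V.nilpotent_part_props(1)[OF D(1)] W.nilpotent_part_props(1)[OF D(2)] V.nilp_lin W.nilp_lin by auto
  show ?thesis using D(1)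
  proof (induction v rule: V.triangulable_induct)
    case (ge a v)
    show ?case using D(2)
    proof (induction w rule: W.triangulable_induct)
      case (ge b w)
      then show ?case
        using derivation_ge[OF l der \<open>v \<in> V.ge D a\<close> ge] \<open>v \<in> V.ge D a\<close>
        by (simp add: W.nilpotent_part_props(2)[OF D(2)] V.nilpotent_part_props(2)[OF D(1)] der
          lin_diff[OF lin_l] lin_diff[OF lin_r] lin_scale[OF lin_l] lin_scale[OF lin_r] algebra_simps)
    qed (simp add: lin_add[OF lin_r] lin_add[OF lN(2)] algebra_simps)
  qed (simp add: lin_add[OF lin_l] lin_add[OF lN(1)] lin_add[OF lN(2)] algebra_simps)
qed

text \<open>On generalized eigenvectors the scalar factors multiply since eigenvalues of a derivation add, and
  the nilpotent parts again form a derivation, whose exponential is multiplicative by the Leibniz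
  rule.\<close>

lemma op_exp_derivation:
  assumes D: "V.triangulable D" "W.triangulable D'" and der: "\<And>v w. D' (B v w) = B (D v) w + B v (D' w)"
  shows "op_exp t (\<lambda>x. t a (D' x)) (B v w) = B (op_exp s (\<lambda>x. s a (D x)) v) (op_exp t (\<lambda>x. t a (D' x)) w)"
proof -
  have l: "V.lin D" "W.lin D'" using D V.triangulable_lin W.triangulable_lin by auto
  note le = V.op_exp_props(1)[OF V.triangulable_scale(1)[OF D(1)]] W.op_exp_props(1)[OF W.triangulable_scale(1)[OF D(2)]]
  note ex = exp_derivation[OF V.nilpotent_part_props(1)[OF D(1)] W.nilpotent_part_props(1)[OF D(2)] nilpotent_part_derivation[OF D der]]
  show ?thesis using D(1)
  proof (induction v rule: V.triangulable_induct)
    case (ge b v)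
    show ?case using D(2)
    proof (induction w rule: W.triangulable_induct)
      case (ge c w)
      show ?case
        using derivation_ge[OF l der \<open>v \<in> V.ge D b\<close> ge]
        by (simp add: V.op_exp_scaled[OF D(1) \<open>v \<in> V.ge D b\<close>] W.op_exp_scaled[OF D(2)] W.op_exp_scaled[OF D(2) ge] ex
           lin_scale[OF lin_l] lin_scale[OF lin_r] distrib_left exp_add mult_ac)
    qed (simp add: lin_add[OF lin_r] lin_add[OF le(2)])
  qed (simp add: lin_add[OF lin_l] lin_add[OF le(1)] lin_add[OF le(2)])
qed

end

context complex_vector_space begin

lemma exp_power:
  assumes h: "lin h" and M: "nilp M" and c: "\<And>x. M (h x) = h (M x)"
    and e: "h v = scale c (ps_op (fps_exp a) M v)"
  shows "(h ^^ n) v = scale (c ^ n) (ps_op (fps_exp (a * of_nat n)) M v)"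
proof (induction n)
  case 0 then show ?case by simp
next
  case (Suc n)
  let ?e = "\<lambda>f. ps_op f M"
  have "(h ^^ Suc n) v = scale (c ^ n) (h (?e (fps_exp (a * of_nat n)) v))"
    by (simp add: Suc lin_scale[OF h])
  also have "h (?e (fps_exp (a * of_nat n)) v) = ?e (fps_exp (a * of_nat n)) (h v)"
    by (rule ps_op_commute[OF M h c])
  also have "\<dots> = scale c (?e (fps_exp (a * of_nat n) * fps_exp a) v)"
    by (simp add: e lin_scale[OF ps_op_lin[OF M]] ps_op_mult[OF M])
  also have "fps_exp (a * of_nat n) * fps_exp a = fps_exp (a * of_nat (Suc n))"
    by (simp add: fps_exp_add_mult[symmetric] algebra_simps)
  finally show ?case by (simp add: mult.commute)
qed

text \<open>The vector \<open>h\<^bsup>n\<^esup> v = c\<^bsup>n\<^esup> \<Sum>\<^sub>k (a n)\<^bsup>k\<^esup> M\<^bsup>k\<^esup> v / k!\<close> is, up to the factor \<open>c\<^bsup>n\<^esup>\<close>, a polynomial in \<open>n\<close> whose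
  linear coefficient is \<open>a M v\<close>.  So \<open>h\<close> determines \<open>M v\<close>.\<close>

lemma exp_generator_unique:
  assumes h: "lin h" and M: "nilp M" "\<And>x. M (h x) = h (M x)" "h v = scale c (ps_op (fps_exp a) M v)"
    and N: "nilp N" "\<And>x. N (h x) = h (N x)" "h v = scale c (ps_op (fps_exp a) N v)"
    and "c \<noteq> 0" "a \<noteq> 0"
  shows "M v = N v"
proof -
  obtain K where K: "\<And>k. k \<ge> K \<Longrightarrow> (M ^^ k) v = 0" using nilpE[OF M(1)] by metis
  obtain L where L: "\<And>k. k \<ge> L \<Longrightarrow> (N ^^ k) v = 0" using nilpE[OF N(1)] by metis
  let ?K = "K + L + 2"
  have "(\<Sum>k<?K. scale ((a * of_nat n) ^ k) (dpow k M v - dpow k N v)) = 0" for n :: nat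
  proof -
    have "scale (c ^ n) (ps_op (fps_exp (a * of_nat n)) M v) = scale (c ^ n) (ps_op (fps_exp (a * of_nat n)) N v)"
      using exp_power[where M=M, OF h M, of n] exp_power[where M=N, OF h N, of n] by metis
    then have "ps_op (fps_exp (a * of_nat n)) M v = ps_op (fps_exp (a * of_nat n)) N v" using assms by simp
    moreover have "ps_op f M v = (\<Sum>k<?K. scale (fps_nth f k) ((M ^^ k) v))" for f by (rule ps_op_eq_sum) (auto intro: K)
    moreover have "ps_op f N v = (\<Sum>k<?K. scale (fps_nth f k) ((N ^^ k) v))" for f by (rule ps_op_eq_sum) (auto intro: L)
    ultimately show ?thesis by (simp add: scale_right_diff_distrib sum_subtractf)
  qed
  then have "dpow 1 M v - dpow 1 N v = 0"
    by (rule poly_vanish[where k=1 and M="?K" and a=a and C="\<lambda>k. dpow k M v - dpow k N v"]) (use assms in auto)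
  then show ?thesis by simp
qed

end

context bilinear_product begin

text \<open>Induction on the sum of the nilpotency degrees, since
  \<open>(h' - a b) (v \<cdot> w) = ((h - a) v) \<cdot> (h' w) + (a v) \<cdot> ((h' - b) w)\<close>.\<close>

lemma automorphism_ge:
  assumes D: "V.lin h" "W.lin h'" and aut: "\<And>v w. h' (B v w) = B (h v) (h' w)"
    and vw: "v \<in> V.ge h a" "w \<in> W.ge h' b"
  shows "B v w \<in> W.ge h' (a * b)"
proof -
  obtain K L where "(V.shift h a ^^ K) v = 0" "(W.shift h' b ^^ L) w = 0" using V.geE W.geE vw by metis
  then show ?thesis
  proof (induction "K + L" arbitrary: K L v w)
    case 0
    then show ?case using W.ge_0[OF D(2)] lin_zero[OF lin_l] by simp
  next
    case (Suc n)
    have e: "W.shift h' (a * b) (B v w) = B (V.shift h a v) (h' w) + B (s a v) (W.shift h' b w)"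
      by (simp add: aut lin_diff[OF lin_l] lin_diff[OF lin_r] lin_scale[OF lin_l] lin_scale[OF lin_r] algebra_simps)
    have hw: "(W.shift h' b ^^ L) (h' w) = h' ((W.shift h' b ^^ L) w)"
      by (rule funpow_commute_op) (simp add: lin_diff[OF D(2)] lin_scale[OF D(2)])
    have av: "(V.shift h a ^^ K) (s a v) = s a ((V.shift h a ^^ K) v)"
      by (rule lin_scale[OF V.lin_shift_pow[OF D(1)]])
    have 1: "B (V.shift h a v) (h' w) \<in> W.ge h' (a * b)"
    proof (cases K)
      case 0 then show ?thesis using Suc.prems W.ge_0[OF D(2)] lin_zero[OF lin_l] lin_zero[OF V.lin_shift[OF D(1)]] by simp
    next
      case (Suc K') then show ?thesis using Suc.hyps(1)[of K' L "V.shift h a v" "h' w"] Suc.hyps(2) Suc.prems hw lin_zero[OF D(2)]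
        by (simp only: funpow_Suc_right o_apply)
    qed
    have 2: "B (s a v) (W.shift h' b w) \<in> W.ge h' (a * b)"
    proof (cases L)
      case 0 then show ?thesis using Suc.prems W.ge_0[OF D(2)] lin_zero[OF lin_r] lin_zero[OF W.lin_shift[OF D(2)]] by simp
    next
      case (Suc L') then show ?thesis using Suc.hyps(1)[of K L' "s a v" "W.shift h' b w"] Suc.hyps(2) Suc.prems av
        by (simp only: funpow_Suc_right o_apply V.scale_zero_right)
    qed
    have "W.shift h' (a * b) (B v w) \<in> W.ge h' (a * b)" unfolding e using 1 2 by (rule W.ge_add[OF D(2)])
    then show ?case by (rule W.ge_of_shift[where T=h'])
  qed
qed

text \<open>The logarithm of a multiplicative operator is a derivation: compare the linear coefficients in \<open>n\<close> of
  the two sides of \<open>h'\<^bsup>n\<^esup> (v \<cdot> w) = h\<^bsup>n\<^esup> v \<cdot> h'\<^bsup>n\<^esup> w\<close>, which up to a scalar \<open>n\<close>-th power are polynomials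
  in \<open>n\<close>.\<close>

lemma N_op_derivation:
  assumes T: "V.triangulable h" "W.triangulable h'" and inj: "inj h" "inj h'"
    and aut: "\<And>v w. h' (B v w) = B (h v) (h' w)"
  shows "N_op t h' (B v w) = B (N_op s h v) w + B v (N_op t h' w)"
proof -
  have l: "V.lin h" "W.lin h'" using T V.triangulable_lin W.triangulable_lin by auto
  let ?N = "N_op s h" and ?N' = "N_op t h'"
  note N = V.N_op_nilp[OF T(1) inj(1)] and N' = W.N_op_nilp[OF T(2) inj(2)]
  note lN = V.N_op_lin[OF T(1) inj(1)] and lN' = W.N_op_lin[OF T(2) inj(2)]
  have cN: "?N (h x) = h (?N x)" for x by (rule V.N_op_commute[where h=h and C=h, OF T(1) inj(1) l(1)]) simp
  have cN': "?N' (h' x) = h' (?N' x)" for x by (rule W.N_op_commute[where h=h' and C=h', OF T(2) inj(2) l(2)]) simp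
  have main: "?N' (B v w) = B (?N v) w + B v (?N' w)" if v: "v \<in> V.ge h a" and w: "w \<in> W.ge h' b" and ab: "a \<noteq> 0" "b \<noteq> 0" for v w a b
  proof -
    let ?a = "2 * pi * \<i>"
    have vw: "B v w \<in> W.ge h' (a * b)" by (rule automorphism_ge[OF l aut v w])
    have pw: "(h' ^^ n) (B v w) = B ((h ^^ n) v) ((h' ^^ n) w)" for n by (induction n) (auto simp: aut)
    have ex: "W.ps_op (fps_exp (?a * of_nat n)) ?N' (B v w) =
       B (V.ps_op (fps_exp (?a * of_nat n)) ?N v) (W.ps_op (fps_exp (?a * of_nat n)) ?N' w)" for n :: nat
    proof -
      have "t ((a * b) ^ n) (W.ps_op (fps_exp (?a * of_nat n)) ?N' (B v w)) =
        B (s (a ^ n) (V.ps_op (fps_exp (?a * of_nat n)) ?N v)) (t (b ^ n) (W.ps_op (fps_exp (?a * of_nat n)) ?N' w))"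
        using pw[of n] V.exp_power[where M="?N" and h=h, OF l(1) N cN V.N_op_exp[OF T(1) inj(1) v], of n]
          W.exp_power[where M="?N'" and h=h', OF l(2) N' cN' W.N_op_exp[OF T(2) inj(2) w], of n]
          W.exp_power[where M="?N'" and h=h', OF l(2) N' cN' W.N_op_exp[OF T(2) inj(2) vw], of n] by simp
      also have "\<dots> = t ((a * b) ^ n) (B (V.ps_op (fps_exp (?a * of_nat n)) ?N v) (W.ps_op (fps_exp (?a * of_nat n)) ?N' w))"
        by (simp add: lin_scale[OF lin_l] lin_scale[OF lin_r] power_mult_distrib mult.commute)
      finally show ?thesis using ab by simp
    qed
    obtain K where K: "\<And>k. k \<ge> K \<Longrightarrow> (?N ^^ k) v = 0" using V.nilpE[OF N] by metis
    obtain L where L: "\<And>k. k \<ge> L \<Longrightarrow> (?N' ^^ k) w = 0" using W.nilpE[OF N'] by metis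
    obtain M where M: "\<And>k. k \<ge> M \<Longrightarrow> (?N' ^^ k) (B v w) = 0" using W.nilpE[OF N'] by metis
    \<comment> \<open>the coefficients of the product of the two exponential series, which vanish from \<open>?K\<close> on\<close>
    let ?c = "\<lambda>k. \<Sum>i\<le>k. B (V.dpow i ?N v) (W.dpow (k - i) ?N' w)"
    let ?K = "K + L + M + 2"
    have z: "B (V.dpow i ?N v) (W.dpow j ?N' w) = 0" if "i \<ge> K \<or> j \<ge> L" for i j
      using that K[of i] L[of j] lin_zero[OF lin_l] lin_zero[OF lin_r] by (elim disjE) simp_all
    have z': "?c k = 0" if "k \<ge> ?K" for k
      by (rule V.Sum_any_convolution(2)[where K=K and L=L and B="\<lambda>i j. B (V.dpow i ?N v) (W.dpow j ?N' w)"]) (use that z in auto)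
    have "(\<Sum>k<?K. t ((?a * of_nat n) ^ k) (W.dpow k ?N' (B v w) - ?c k)) = 0" for n :: nat
    proof -
      let ?x = "?a * of_nat n"
      let ?B = "\<lambda>i j. t (?x ^ (i + j)) (B (V.dpow i ?N v) (W.dpow j ?N' w))"
      have "B (V.ps_op (fps_exp ?x) ?N v) (W.ps_op (fps_exp ?x) ?N' w) =
          B (\<Sum>i<K. s (?x ^ i) (V.dpow i ?N v)) (\<Sum>j<L. t (?x ^ j) (W.dpow j ?N' w))"
        by (simp add: V.ps_op_eq_sum[OF K] W.ps_op_eq_sum[OF L])
      also have "\<dots> = (\<Sum>i<K. \<Sum>j<L. ?B i j)"
        by (simp only: lin_sum[OF lin_l] lin_scale[OF lin_l])
          (simp add: lin_sum[OF lin_r] lin_scale[OF lin_r] power_add mult_ac W.scale_sum_right)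
      also have "\<dots> = Sum_any (\<lambda>k. \<Sum>i\<le>k. ?B i (k - i))"
        by (rule V.Sum_any_convolution(1)[symmetric]) (simp only: z W.scale_zero_right)
      also have "\<dots> = Sum_any (\<lambda>k. t (?x ^ k) (?c k))" by (simp add: W.scale_sum_right)
      also have "\<dots> = (\<Sum>k<?K. t (?x ^ k) (?c k))"
      proof (rule Sum_any_eq_sum)
        fix k assume "k \<notin> {..<?K}" then have "?c k = 0" by (intro z') simp
        then show "t (?x ^ k) (?c k) = 0" by (simp only: W.scale_zero_right)
      qed simp
      finally have 1: "B (V.ps_op (fps_exp ?x) ?N v) (W.ps_op (fps_exp ?x) ?N' w) = (\<Sum>k<?K. t (?x ^ k) (?c k))" .
      have "W.ps_op (fps_exp ?x) ?N' (B v w) = (\<Sum>k<?K. t (?x ^ k) (W.dpow k ?N' (B v w)))"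
        unfolding W.ps_op_exp_eq by (rule Sum_any_eq_sum) (auto simp: M)
      then have "(\<Sum>k<?K. t (?x ^ k) (W.dpow k ?N' (B v w))) = (\<Sum>k<?K. t (?x ^ k) (?c k))" using ex[of n] 1 by simp
      then show ?thesis by (simp only: W.scale_right_diff_distrib sum_subtractf) simp
    qed
    then have "W.dpow 1 ?N' (B v w) - ?c 1 = 0"
      by (rule W.poly_vanish[where k=1 and M="?K" and a="?a" and C="\<lambda>k. W.dpow k ?N' (B v w) - ?c k"]) auto
    then show ?thesis by (simp add: atMost_Suc lin_scale[OF lin_l] lin_scale[OF lin_r])
  qed
  have z0: "v = 0" if "v \<in> V.ge h 0" for v using V.ge_inj_0[OF T(1) inj(1) that] .
  have z0': "w = 0" if "w \<in> W.ge h' 0" for w using W.ge_inj_0[OF T(2) inj(2) that] .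
  show ?thesis using T(1)
  proof (induction v rule: V.triangulable_induct)
    case (ge a v)
    show ?case using T(2)
    proof (induction w rule: W.triangulable_induct)
      case (ge b w)
      show ?case
      proof (cases "a = 0 \<or> b = 0")
        case True
        then have "v = 0 \<or> w = 0" using z0 z0' \<open>v \<in> V.ge h a\<close> ge by auto
        then show ?thesis using lin_zero[OF lin_l] lin_zero[OF lin_r] lin_zero[OF lN] lin_zero[OF lN'] by auto
      next
        case False then show ?thesis using main[OF \<open>v \<in> V.ge h a\<close> ge] by blast
      qed
    qed (simp add: lin_add[OF lin_r] lin_add[OF lN'] algebra_simps)
  qed (simp add: lin_add[OF lin_l] lin_add[OF lN] lin_add[OF lN'] algebra_simps)
qed

end

section \<open>Triangular sums\<close>

lemma triangle_swap:
  fixes f :: "nat \<Rightarrow> nat \<Rightarrow> 'b::comm_monoid_add"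
  shows "(\<Sum>m\<le>q. \<Sum>p\<le>q-m. f m p) = (\<Sum>p\<le>q. \<Sum>m\<le>q-p. f m p)"
proof -
  have "(\<Sum>m\<le>q. \<Sum>p\<le>q-m. f m p) = (\<Sum>(m,p)\<in>Sigma {..q} (\<lambda>m. {..q-m}). f m p)" by (rule sum.Sigma) auto
  also have "\<dots> = (\<Sum>(p,m)\<in>Sigma {..q} (\<lambda>p. {..q-p}). f m p)"
    by (rule sum.reindex_bij_witness[of _ "\<lambda>(p,m). (m,p)" "\<lambda>(m,p). (p,m)"]) auto
  also have "\<dots> = (\<Sum>p\<le>q. \<Sum>m\<le>q-p. f m p)" by (rule sum.Sigma[symmetric]) auto
  finally show ?thesis .
qed

lemma triangle_diagonal:
  fixes f :: "nat \<Rightarrow> nat \<Rightarrow> 'b::comm_monoid_add"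
  shows "(\<Sum>p\<le>q. \<Sum>m\<le>q-p. f m p) = (\<Sum>k\<le>q. \<Sum>m\<le>k. f m (k - m))"
proof -
  have "(\<Sum>p\<le>q. \<Sum>m\<le>q-p. f m p) = (\<Sum>(p,m)\<in>Sigma {..q} (\<lambda>p. {..q-p}). f m p)" by (rule sum.Sigma) auto
  also have "\<dots> = (\<Sum>(k,m)\<in>Sigma {..q} (\<lambda>k. {..k}). f m (k - m))"
    by (rule sum.reindex_bij_witness[of _ "\<lambda>(k,m). (k-m,m)" "\<lambda>(p,m). (p+m,m)"]) auto
  also have "\<dots> = (\<Sum>k\<le>q. \<Sum>m\<le>k. f m (k - m))" by (rule sum.Sigma[symmetric]) auto
  finally show ?thesis .
qed

section \<open>Vertex operator algebras\<close>

sublocale vertex_operator_algebra \<subseteq> complex_vector_space s ..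

context vertex_operator_algebra begin

lemma Y_0_left [simp]: "Y 0 n w = 0" by (rule lin_zero[OF linear_left])
lemma Y_0_right [simp]: "Y v n 0 = 0" by (rule lin_zero[OF linear_right])

lemmas Y_add = lin_add[OF linear_left] lin_add[OF linear_right]
lemmas Y_scale = lin_scale[OF linear_left] lin_scale[OF linear_right]
lemmas Y_sum = lin_sum[OF linear_left] lin_sum[OF linear_right]

lemma Y_neg: "Y (- v) n w = - Y v n w" "Y v n (- w) = - Y v n w"
  by (rule lin_neg[OF linear_left], rule lin_neg[OF linear_right])

lemma Y_diff: "Y (v - v') n w = Y v n w - Y v' n w" "Y v n (w - w') = Y v n w - Y v n w'"
  by (rule lin_diff[OF linear_left], rule lin_diff[OF linear_right])

lemma bilinear_mode: "bilinear_product s s (\<lambda>v w. Y v n w)"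
  by (intro bilinear_product.intro bilinear_product_axioms.intro linear_left linear_right complex_vector_space_axioms)

lemma commutator:
  "Y a m (Y b n w) - Y b n (Y a m w) = Sum_any (\<lambda>i::nat. s (of_int m gchoose i) (Y (Y a (int i) b) (m + n - int i) w))"
proof -
  have d: "Sum_any (\<lambda>i::nat. s ((of_int 0 gchoose i) * c i) (x i)) = s (c 0) (x 0)" for c :: "nat \<Rightarrow> complex" and x
    by (subst Sum_any_eq_sum[of "{0}"]) (auto simp: gbinomial_0_left)
  show ?thesis
    using jacobi[of 0 a m b n w] unfolding d[of "\<lambda>i. (-1)^i"] d[of "\<lambda>i. (-1) powi (0 - int i)"] by simp
qed

lemma commutator_nat:
  "Y a (int m) (Y b n w) = Y b n (Y a (int m) w) + (\<Sum>i\<le>m. s (of_nat (m choose i)) (Y (Y a (int i) b) (int m + n - int i) w))"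
proof -
  have "Sum_any (\<lambda>i::nat. s (of_int (int m) gchoose i) (Y (Y a (int i) b) (int m + n - int i) w))
     = (\<Sum>i\<le>m. s (of_nat (m choose i)) (Y (Y a (int i) b) (int m + n - int i) w))"
    by (subst Sum_any_eq_sum[of "{..m}"]) (auto simp: binomial_gbinomial[symmetric])
  then show ?thesis using commutator[of a "int m" b n w] by (simp add: algebra_simps)
qed

subsection \<open>Weights\<close>

abbreviation wt :: "int \<Rightarrow> 'v set" where "wt \<equiv> wt_space s Y \<omega>"

lemma wt_iff: "v \<in> wt n \<longleftrightarrow> Y \<omega> 1 v = s (of_int n) v"
  by (simp add: wt_space_def eigenspace_def Lop_def)

lemma L0_commutator:
  "Y \<omega> 1 (Y v n w) = Y v n (Y \<omega> 1 w) + Y (Y \<omega> 1 v) n w - s (of_int (n + 1)) (Y v n w)"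
  using commutator_nat[of \<omega> 1 v n w] L_minus1_derivative[of v "n + 1" w]
  by (simp add: Lop_def atMost_Suc algebra_simps)

lemma wt_mode:
  assumes "v \<in> wt h" "w \<in> wt k" shows "Y v n w \<in> wt (h + k - n - 1)"
  using assms by (simp add: wt_iff L0_commutator Y_scale algebra_simps)

lemma subspace_wt: "subspace (wt n)"
  unfolding wt_space_def by (rule subspace_eigenspace) (simp add: Lop_def linear_right)

lemma wt_induct [case_names wt add]:
  assumes "\<And>n x. x \<in> wt n \<Longrightarrow> P x" "\<And>x y. P x \<Longrightarrow> P y \<Longrightarrow> P (x + y)" shows "P v"
  using direct_sum_induct[OF grading, of P v] assms subspace_0[OF subspace_wt] by blast

text \<open>Such an operator preserves the weight spaces, which are finite dimensional.\<close>

lemma wt_triangulable: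
  assumes T: "lin T" and c: "\<And>x. Y \<omega> 1 (T x) = T (Y \<omega> 1 x)" shows "triangulable T"
proof -
  have "v \<in> span (\<Union>c. ge T c)" for v
  proof (induction v rule: wt_induct)
    case (wt n v)
    obtain B where B: "finite B" "wt n \<subseteq> span B" using finite_dimensional by blast
    have "(T ^^ k) v \<in> wt n" for k
      by (induction k) (use wt in \<open>auto simp: wt_iff c lin_scale[OF T]\<close>)
    then show ?case using finite_dim_in_ge_span[OF T B(1), of v] B(2) by blast
  qed (rule span_add)
  then show ?thesis using T by (auto simp: triangulable_def)
qed

lemma creation_minus2: "Y v (-2) vac = Y \<omega> 0 v"
  using L_minus1_derivative[of v "-1" vac] creation(2)[of "Y \<omega> 0 v"] by (simp add: Lop_def)

lemma vac_wt: "vac \<in> wt 0"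
  by (simp add: wt_iff creation)

text \<open>\<open>\<omega> = L(-2) \<one>\<close>, and \<open>[L(0), L(-2)] = 2 L(-2)\<close> by the Virasoro relations.\<close>

lemma omega_wt: "\<omega> \<in> wt 2"
proof -
  have "vac \<in> wt 0" by (rule vac_wt)
  obtain c where c: "\<And>m n v. Lop Y \<omega> m (Lop Y \<omega> n v) - Lop Y \<omega> n (Lop Y \<omega> m v)
               = s (of_int (m - n)) (Lop Y \<omega> (m + n) v)
               + s (if m + n = 0 then c * of_int (m ^ 3 - m) / 12 else 0) v" using virasoro by blast
  have "Lop Y \<omega> 0 (Lop Y \<omega> (-2) vac) = s 2 (Lop Y \<omega> (-2) vac)"
    using c[of 0 "-2" vac] by (simp add: Lop_def creation)
  then show ?thesis by (simp add: wt_iff Lop_def creation)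
qed

text \<open>Since \<open>b = b\<^bsub>-1\<^esub> \<one>\<close> and \<open>a\<^sub>m \<one> = 0\<close>, the vector \<open>a\<^sub>m b\<close> is \<open>- [b\<^bsub>-1\<^esub>, a\<^sub>m] \<one>\<close>, and the commutator formula
  expands this with \<open>binom(-1, i) = (-1)\<^bsup>i\<^esup>\<close>.\<close>

lemma skew_symmetry:
  "Y a (int m) b = - Sum_any (\<lambda>i::nat. s ((-1) ^ i) (Y (Y b (int i) a) (int m - 1 - int i) vac))"
proof -
  have "Y a (int m) b = Y a (int m) (Y b (-1) vac)" by (simp add: creation)
  also have "\<dots> = - (Y b (-1) (Y a (int m) vac) - Y a (int m) (Y b (-1) vac))" by (simp add: creation)
  also have "\<dots> = - Sum_any (\<lambda>i::nat. s ((-1) ^ i) (Y (Y b (int i) a) (int m - 1 - int i) vac))"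
    unfolding commutator
    by (simp add: gbinomial_minus[of 1, simplified] binomial_gbinomial[symmetric] algebra_simps)
  finally show ?thesis .
qed

end

section \<open>The operators \<open>\<Delta>\<close>\<close>

locale shift_vector = vertex_operator_algebra s Y vac \<omega>
  for s :: "complex \<Rightarrow> 'v::ab_group_add \<Rightarrow> 'v" and Y vac \<omega> +
  fixes u :: 'v
  assumes wt0: "wt_space s Y \<omega> 0 = range (\<lambda>c. s c vac)"
    and wt_neg: "\<forall>n<0. wt_space s Y \<omega> n = {0}"
    and u_wt: "u \<in> wt_space s Y \<omega> 1"
    and L1_u: "Lop Y \<omega> 1 u = 0"
begin

lemma u_mode_wt: "v \<in> wt h \<Longrightarrow> Y u n v \<in> wt (h - n)"
  using wt_mode[OF u_wt, of v h n] by (simp add: algebra_simps)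

lemma neg_wt_zero: "v \<in> wt n \<Longrightarrow> n < 0 \<Longrightarrow> v = 0"
  using wt_neg by blast

lemma u_u_1: obtains c where "Y u 1 u = s c vac"
  using u_mode_wt[OF u_wt, of 1] wt0 by auto

lemma u_u_ge2: "n \<ge> 2 \<Longrightarrow> Y u n u = 0"
  using u_mode_wt[OF u_wt, of n] neg_wt_zero by force

text \<open>Skew symmetry reads \<open>u\<^sub>0 u = - u\<^sub>0 u + (u\<^sub>1 u)\<^bsub>-2\<^esub> \<one>\<close>, and the last term vanishes because \<open>u\<^sub>1 u\<close> is a
  multiple of \<open>\<one>\<close>.\<close>

lemma u_u_0: "Y u 0 u = 0"
proof -
  obtain c where c: "Y u 1 u = s c vac" by (rule u_u_1)
  have "Sum_any (\<lambda>i::nat. s ((-1) ^ i) (Y (Y u (int i) u) (0 - 1 - int i) vac)) =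
      (\<Sum>i\<in>{0,1}. s ((-1) ^ i) (Y (Y u (int i) u) (0 - 1 - int i) vac))"
    by (rule Sum_any_eq_sum) (auto simp: u_u_ge2)
  also have "\<dots> = Y u 0 u" by (simp add: c Y_scale vacuum creation)
  finally have "Y u 0 u = - Y u 0 u" using skew_symmetry[of u 0 u] by simp
  then have "s 2 (Y u 0 u) = 0" using scale_left_distrib[of 1 1 "Y u 0 u"] by (simp add: eq_neg_iff_add_eq_0)
  then show ?thesis by simp
qed

lemma omega_u: "Y \<omega> 0 u = Y u (-2) vac" "Y \<omega> 1 u = u" "Y \<omega> 2 u = 0" "n \<ge> 3 \<Longrightarrow> Y \<omega> n u = 0"
proof -
  show "Y \<omega> 0 u = Y u (-2) vac" by (rule creation_minus2[symmetric])
  show "Y \<omega> 1 u = u" using u_wt by (simp add: wt_iff)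
  show "Y \<omega> 2 u = 0" using L1_u by (simp add: Lop_def)
  assume "n \<ge> 3" then show "Y \<omega> n u = 0" using wt_mode[OF omega_wt u_wt, of n] neg_wt_zero by force
qed

text \<open>Skew symmetry expresses \<open>u\<^sub>m \<omega>\<close> through \<open>\<omega>\<^sub>0 u = u\<^bsub>-2\<^esub> \<one>\<close>, \<open>\<omega>\<^sub>1 u = u\<close> and \<open>\<omega>\<^sub>2 u = L(1) u = 0\<close>.\<close>

lemma u_omega: "Y u (int m) \<omega> = Y u (int m - 2) vac - Y (Y u (-2) vac) (int m - 1) vac"
proof -
  have "Sum_any (\<lambda>i::nat. s ((-1) ^ i) (Y (Y \<omega> (int i) u) (int m - 1 - int i) vac)) =
      (\<Sum>i\<in>{0,1}. s ((-1) ^ i) (Y (Y \<omega> (int i) u) (int m - 1 - int i) vac))"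
  proof (rule Sum_any_eq_sum)
    fix i :: nat assume "i \<notin> {0, 1}"
    then have "i = 2 \<or> int i \<ge> 3" by auto
    then show "s ((-1) ^ i) (Y (Y \<omega> (int i) u) (int m - 1 - int i) vac) = 0" using omega_u(3,4) by auto
  qed simp
  then show ?thesis using skew_symmetry[of u m \<omega>] by (simp add: omega_u(1,2))
qed

lemma u_omega_0: "Y u 0 \<omega> = 0" using u_omega[of 0] by (simp add: creation)
lemma u_omega_1: "Y u 1 \<omega> = u" using u_omega[of 1] by (simp add: creation)

text \<open>The commutator \<open>[u\<^sub>m, u\<^sub>n]\<close> is \<open>(u\<^sub>0 u)\<^bsub>m+n\<^esub> + m (u\<^sub>1 u)\<^bsub>m+n-1\<^esub>\<close>.  The first term is zero; the second is a mode of
  a multiple of \<open>\<one>\<close>, whose index is nonnegative when \<open>m \<ge> 1\<close>.\<close>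

lemma u_commute: "Y u (int m) (Y u (int n) w) = Y u (int n) (Y u (int m) w)"
proof -
  obtain c where c: "Y u 1 u = s c vac" by (rule u_u_1)
  have "(\<Sum>i\<le>m. s (of_nat (m choose i)) (Y (Y u (int i) u) (int m + int n - int i) w)) = 0"
  proof (intro sum.neutral ballI)
    fix i :: nat assume i: "i \<in> {..m}"
    consider "i = 0" | "i = 1" | "int i \<ge> 2" by linarith
    then show "s (of_nat (m choose i)) (Y (Y u (int i) u) (int m + int n - int i) w) = 0"
      by cases (use i in \<open>auto simp: u_u_0 u_u_ge2 c Y_scale vacuum\<close>)
  qed
  then show ?thesis using commutator_nat[of u m u "int n" w] by simp
qed

lemma u0_derivation: "Y u 0 (Y v n w) = Y (Y u 0 v) n w + Y v n (Y u 0 w)"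
  using commutator_nat[of u 0 v n w] by (simp add: add.commute)

lemma u0_L0: "Y \<omega> 1 (Y u 0 x) = Y u 0 (Y \<omega> 1 x)"
  using L0_commutator[of u 0 x] omega_u(2) by simp

lemma u0_triangulable: "triangulable (Y u 0)"
  by (rule wt_triangulable[OF linear_right u0_L0])

subsection \<open>The positive part of \<open>\<Delta>\<close>\<close>

abbreviation A :: "nat \<Rightarrow> 'v \<Rightarrow> 'v" where "A \<equiv> Delta_exponent s Y u"
abbreviation E :: "nat \<Rightarrow> 'v \<Rightarrow> 'v" where "E \<equiv> series_exp s A"

lemma A_lin: "lin (A m)"
  unfolding Delta_exponent_def[abs_def]
  by (cases "m = 0") (auto intro: lin_smult linear_right linI)

lemma A_commute: "A m (A n x) = A n (A m x)"
  by (simp add: Delta_exponent_def Y_scale u_commute mult.commute)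

lemma A_0: "A 0 x = 0" by (simp add: Delta_exponent_def)

abbreviation AP :: "nat \<Rightarrow> nat \<Rightarrow> 'v \<Rightarrow> 'v" where "AP \<equiv> series_power A"

lemma AP_lin: "lin (AP p q)"
proof (induction p arbitrary: q)
  case 0 show ?case by (cases "q = 0") (auto intro: linI lin_idV)
next
  case (Suc p)
  then show ?case by (auto intro!: lin_setsum vs lin_compose[OF Suc A_lin])
qed

lemma AP_commute: "lin C \<Longrightarrow> (\<And>m x. A m (C x) = C (A m x)) \<Longrightarrow> AP p q (C x) = C (AP p q x)"
  by (induction p arbitrary: q) (auto simp: lin_sum lin_zero)

lemma AP_zero: "q < p \<Longrightarrow> AP p q v = 0"
proof (induction p arbitrary: q)
  case (Suc p)
  have "A i (AP p (q - i) v) = 0" if "i \<le> q" for i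
  proof (cases "i = 0")
    case False then show ?thesis using Suc lin_zero[OF A_lin] that by simp
  qed (simp add: A_0)
  then show ?case by simp
qed simp

text \<open>The coefficients of the series \<open>A = \<Sum>\<^sub>q A\<^sub>q x\<^bsup>-q\<^esup>\<close> commute, so \<open>(A\<^bsup>p+1\<^esup>)' = (p + 1) A' A\<^bsup>p\<^esup>\<close> for the derivation
  \<open>- x d/dx\<close>, which multiplies the coefficient of \<open>x\<^bsup>-q\<^esup>\<close> by \<open>q\<close>.\<close>

lemma AP_derivative:
  "s (of_nat q) (AP (Suc p) q v) = s (of_nat (Suc p)) (\<Sum>m\<le>q. s (of_nat m) (A m (AP p (q - m) v)))"
proof (induction p arbitrary: q)
  case 0
  have "AP (Suc 0) q v = A q v"
    using sum.delta[of "{..q}" q "\<lambda>_. A q v"] by (simp add: if_distrib[of "A _"] lin_zero[OF A_lin] cong: if_cong)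
  moreover have "(\<Sum>m\<le>q. s (of_nat m) (A m (AP 0 (q - m) v))) = (\<Sum>m\<le>q. if m = q then s (of_nat q) (A q v) else 0)"
    by (intro sum.cong refl) (auto simp: lin_zero[OF A_lin])
  ultimately show ?case by simp
next
  case (Suc p)
  let ?D = "\<lambda>q. \<Sum>m\<le>q. s (of_nat m) (A m (AP p (q - m) v))"
  let ?T = "\<lambda>i m. s (of_nat m) (A i (A m (AP p (q - i - m) v)))"
  have tri: "(\<Sum>i\<le>q. A i (?D (q - i))) = (\<Sum>m\<le>q. s (of_nat m) (A m (AP (Suc p) (q - m) v)))"
  proof -
    have "(\<Sum>i\<le>q. A i (?D (q - i))) = (\<Sum>i\<le>q. \<Sum>m\<le>q-i. ?T i m)"
      by (simp add: lin_sum[OF A_lin] lin_scale[OF A_lin])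
    also have "\<dots> = (\<Sum>m\<le>q. \<Sum>i\<le>q-m. ?T i m)" by (rule triangle_swap)
    also have "\<dots> = (\<Sum>m\<le>q. s (of_nat m) (A m (AP (Suc p) (q - m) v)))"
      by (intro sum.cong refl) (simp add: lin_sum[OF A_lin] scale_sum_right A_commute[of _ _] add.commute)
    finally show ?thesis .
  qed
  have "s (of_nat q) (AP (Suc (Suc p)) q v) = (\<Sum>i\<le>q. s (of_nat i) (A i (AP (Suc p) (q - i) v)) + A i (s (of_nat (q - i)) (AP (Suc p) (q - i) v)))"
    unfolding series_power.simps(2)[of A "Suc p"] scale_sum_right
    by (intro sum.cong refl) (simp add: lin_scale[OF A_lin] scale_left_distrib[symmetric] of_nat_add[symmetric] del: series_power.simps of_nat_add of_nat_diff)
  also have "\<dots> = (\<Sum>i\<le>q. s (of_nat i) (A i (AP (Suc p) (q - i) v))) + s (of_nat (Suc p)) (\<Sum>i\<le>q. A i (?D (q - i)))"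
    by (simp only: Suc sum.distrib lin_scale[OF A_lin, where c="of_nat (Suc p)"] scale_sum_right[of "of_nat (Suc p)" _ "{..q}"])
  also have "\<dots> = s (of_nat (Suc (Suc p))) (\<Sum>m\<le>q. s (of_nat m) (A m (AP (Suc p) (q - m) v)))"
    unfolding tri by (simp only: of_nat_Suc[of "Suc p"] scale_left_distrib scale_one)
  finally show ?case .
qed

lemma E_0 [simp]: "E 0 v = v" by (simp add: series_exp_def)

lemma E_lin: "lin (E q)"
  unfolding series_exp_def[abs_def] by (intro lin_setsum vs lin_smult AP_lin)

text \<open>The differential equation of the exponential, \<open>- x E'(x) = (\<Sum>\<^sub>m\<^sub>\<ge>\<^sub>1 (-1)\<^bsup>m\<^esup> u\<^sub>m x\<^bsup>-m\<^esup>) E(x)\<close>.  The term with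
  \<open>m = 0\<close> is added on both sides, in order that the sum runs over all modes to which the
  commutator formula will be applied.\<close>

lemma E_rec: "(\<Sum>m\<le>q. s ((-1) ^ m) (Y u (int m) (E (q - m) v))) = s (of_nat q) (E q v) + Y u 0 (E q v)"
proof -
  have Eb: "E k v = (\<Sum>p\<le>n. s (1 / fact p) (AP p k v))" if "k \<le> n" for k n
    unfolding series_exp_def by (rule sum.mono_neutral_left) (use that in \<open>auto simp: AP_zero\<close>)
  have "s (of_nat q) (E q v) = (\<Sum>p\<le>Suc q. s (1 / fact p) (s (of_nat q) (AP p q v)))"
    by (simp add: Eb[of q "Suc q"] scale_sum_right mult.commute del: sum.atMost_Suc)
  also have "\<dots> = (\<Sum>p\<le>q. s (1 / fact (Suc p)) (s (of_nat q) (AP (Suc p) q v)))"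
    by (simp add: sum.atMost_Suc_shift del: sum.atMost_Suc series_power.simps(2) fact_Suc)
  also have "\<dots> = (\<Sum>p\<le>q. \<Sum>m\<le>q. s (1 / fact p) (s (of_nat m) (A m (AP p (q - m) v))))"
  proof (intro sum.cong refl)
    fix p
    have "s (1 / fact (Suc p)) (s (of_nat (Suc p)) x) = s (1 / fact p) x" for x
      by (simp add: field_simps del: of_nat_Suc)
    then show "s (1 / fact (Suc p)) (s (of_nat q) (AP (Suc p) q v)) = (\<Sum>m\<le>q. s (1 / fact p) (s (of_nat m) (A m (AP p (q - m) v))))"
      by (simp only: AP_derivative scale_sum_right)
  qed
  also have "\<dots> = (\<Sum>m\<le>q. \<Sum>p\<le>q. s (1 / fact p) (s (of_nat m) (A m (AP p (q - m) v))))" by (rule sum.swap)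
  also have "\<dots> = (\<Sum>m\<le>q. s (of_nat m) (A m (E (q - m) v)))"
    by (intro sum.cong refl) (simp add: Eb[of _ q] lin_sum[OF A_lin] lin_scale[OF A_lin] scale_sum_right mult.commute)
  also have "\<dots> = (\<Sum>m\<le>q. (if m = 0 then 0 else s ((-1) ^ m) (Y u (int m) (E (q - m) v))))"
    by (intro sum.cong refl) (auto simp: Delta_exponent_def)
  finally have "s (of_nat q) (E q v) = (\<Sum>m\<le>q. (if m = 0 then 0 else s ((-1) ^ m) (Y u (int m) (E (q - m) v))))" .
  moreover have "(\<Sum>m\<le>q. s ((-1) ^ m) (Y u (int m) (E (q - m) v))) =
     (\<Sum>m\<le>q. (if m = 0 then 0 else s ((-1) ^ m) (Y u (int m) (E (q - m) v))) + (if m = 0 then Y u 0 (E q v) else 0))"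
    by (intro sum.cong refl) auto
  ultimately show ?thesis by (simp add: sum.distrib)
qed

lemma E_commute:
  assumes C: "lin C" "\<And>m x. Y u (int m) (C x) = C (Y u (int m) x)" shows "E q (C x) = C (E q x)"
proof -
  have "A m (C x) = C (A m x)" for m x
    using C by (auto simp: Delta_exponent_def lin_scale lin_zero)
  then show ?thesis
    unfolding series_exp_def by (simp add: AP_commute[OF C(1)] lin_sum[OF C(1)] lin_scale[OF C(1)])
qed

lemma E_wt: "v \<in> wt h \<Longrightarrow> E q v \<in> wt (h - int q)"
proof -
  assume v: "v \<in> wt h"
  have A: "x \<in> wt k \<Longrightarrow> A m x \<in> wt (k - int m)" for x k m
    using u_mode_wt[of x k "int m"] subspace_scale[OF subspace_wt] subspace_0[OF subspace_wt]
    by (auto simp: Delta_exponent_def)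
  have "AP p q v \<in> wt (h - int q)" for p q
  proof (induction p arbitrary: q)
    case 0 show ?case using v subspace_0[OF subspace_wt] by simp
  next
    case (Suc p)
    show ?case unfolding series_power.simps
    proof (rule subspace_sum[OF subspace_wt])
      fix i assume "i \<in> {..q}"
      then show "A i (AP p (q - i) v) \<in> wt (h - int q)" using A[OF Suc, of i "q - i"] by (simp add: algebra_simps of_nat_diff)
    qed
  qed
  then show ?thesis unfolding series_exp_def by (intro subspace_sum[OF subspace_wt] subspace_scale[OF subspace_wt])
qed

lemma E_bound: "\<exists>K. \<forall>q\<ge>K. E q v = 0"
proof (induction v rule: wt_induct)
  case (wt n v)
  have "E q v = 0" if "q \<ge> nat (n + 1)" for q
    using E_wt[OF wt, of q] neg_wt_zero[of "E q v" "n - int q"] that by linarith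
  then show ?case by blast
next
  case (add x y)
  then obtain K L where "\<forall>q\<ge>K. E q x = 0" "\<forall>q\<ge>L. E q y = 0" by blast
  then show ?case by (intro exI[of _ "max K L"]) (simp add: lin_add[OF E_lin])
qed

end

lemma sum_dependent_product:
  "finite A \<Longrightarrow> (\<And>m. finite (B m)) \<Longrightarrow> (\<And>m. finite (C m)) \<Longrightarrow>
   (\<Sum>m\<in>A. \<Sum>r\<in>B m. \<Sum>i\<in>C m. f m r i) = (\<Sum>(m,r,i)\<in>Sigma A (\<lambda>m. B m \<times> C m). f m r i)"
  by (simp add: sum.Sigma sum.cartesian_product split_def)

context shift_vector begin

section \<open>Conjugation of vertex operators by \<open>\<Delta>\<close>\<close>

abbreviation U0 :: "'v \<Rightarrow> 'v" where "U0 \<equiv> Y u 0"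

text \<open>The exponent of \<open>x\<close> in the \<open>r\<close>-th term of \<open>\<Delta>(x) v = \<Sum>\<^sub>r x\<^bsup>- u\<^sub>0 - r\<^esup> E\<^sub>r v\<close>.\<close>

definition D :: "nat \<Rightarrow> 'v \<Rightarrow> 'v" where "D r x = - U0 x - s (of_nat r) x"

lemma U0_lin: "lin U0" by (rule linear_right)

lemma D_lin: "lin (D r)"
  unfolding D_def[abs_def] by (intro lin_minus lin_uminus U0_lin lin_scaleV)

lemma D_commute: "lin C \<Longrightarrow> (\<And>x. U0 (C x) = C (U0 x)) \<Longrightarrow> D r (C x) = C (D r x)"
  by (simp add: D_def lin_diff lin_neg lin_scale)

lemma u_D_commute: "Y u (int m) (D r x) = D r (Y u (int m) x)"
  using D_commute[OF linear_right[of u "int m"], of r x] u_commute[of 0 m] by simp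

text \<open>The coefficients of \<open>Y(\<Delta>(x\<^sub>2 + x\<^sub>0) v, x\<^sub>0)\<close>: the term \<open>binom(D\<^sub>r, i) x\<^sub>2\<^bsup>D\<^sub>r - i\<^esup> x\<^sub>0\<^bsup>i\<^esup>\<close> of \<open>(x\<^sub>2 + x\<^sub>0)\<^bsup>D\<^sub>r\<^esup>\<close> raises the index of
  the mode by \<open>i\<close>, and \<open>Q = r + i\<close> is the power of \<open>x\<^sub>2\<^bsup>-1\<^esup>\<close> that remains when \<open>x\<^sub>2\<^bsup>- u\<^sub>0\<^esup>\<close> is split off.\<close>

definition R :: "nat \<Rightarrow> 'v \<Rightarrow> int \<Rightarrow> 'v \<Rightarrow> 'v" where
  "R Q v n w = (\<Sum>r\<le>Q. Y (obinom (D r) (Q - r) (E r v)) (n + int (Q - r)) w)"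

lemma R_lin: "lin (R Q v n)"
  unfolding R_def[abs_def] by (intro lin_setsum vs linear_right)

text \<open>As \<open>D\<^sub>r - 1 = - (i + 1) + D\<^bsub>r-i\<^esub>\<close>, this is the Vandermonde expansion of \<open>binom(D\<^sub>r - 1, I)\<close>, in which
  \<open>binom(- i - 1, h) = (-1)\<^bsup>h\<^esup> binom(i + h, i)\<close>.\<close>

lemma D_vandermonde:
  assumes "i \<le> r"
  shows "(\<Sum>h\<le>I. s ((-1) ^ h * of_nat ((i + h) choose i)) (obinom (D (r - i)) (I - h) x)) = obinom (\<lambda>x. D r x - x) I x"
proof -
  let ?P = "\<lambda>x. s (- of_nat (Suc i)) x"
  have e: "(\<lambda>x. D r x - x) = (\<lambda>x. ?P x + D (r - i) x)"
    using assms by (auto simp: fun_eq_iff D_def algebra_simps of_nat_diff)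
  have "obinom (\<lambda>x. D r x - x) I x = (\<Sum>h\<le>I. obinom ?P h (obinom (D (r - i)) (I - h) x))"
    unfolding e by (rule obinom_vandermonde[OF lin_scaleV D_lin]) (rule lin_scale[OF D_lin, symmetric])
  also have "\<dots> = (\<Sum>h\<le>I. s ((-1) ^ h * of_nat ((i + h) choose i)) (obinom (D (r - i)) (I - h) x))"
  proof (intro sum.cong refl)
    fix h
    have "(- of_nat (Suc i) gchoose h :: complex) = (-1) ^ h * (of_nat (i + h) gchoose h)"
      unfolding gbinomial_minus by (simp add: algebra_simps)
    also have "(of_nat (i + h) gchoose h :: complex) = of_nat ((i + h) choose i)"
      by (simp only: binomial_gbinomial[symmetric]) (simp add: binomial_symmetric[of i "i + h"])
    finally show "obinom ?P h (obinom (D (r - i)) (I - h) x) = s ((-1) ^ h * of_nat ((i + h) choose i)) (obinom (D (r - i)) (I - h) x)"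
      by (subst obinom_eigen[OF lin_scaleV, where c="- of_nat (Suc i)"]) auto
  qed
  finally show ?thesis by simp
qed

text \<open>Under \<open>binom(D\<^sub>r - 1, I)\<close> the recursion of \<open>E_rec\<close> gives \<open>- D\<^sub>r E\<^sub>r v\<close>, and
  \<open>- D\<^sub>r binom(D\<^sub>r - 1, I) = - (D\<^sub>r - I) binom(D\<^sub>r, I) = (r + I + u\<^sub>0) binom(D\<^sub>r, I)\<close>.\<close>

lemma D_recursion:
  "(\<Sum>i\<le>r. s ((-1) ^ i) (Y u (int i) (obinom (\<lambda>x. D r x - x) I (E (r - i) v)))) =
   s (of_nat (r + I)) (obinom (D r) I (E r v)) + U0 (obinom (D r) I (E r v))"
proof -
  let ?Z = "\<lambda>x. D r x - x"
  have Z: "lin ?Z" by (intro lin_minus D_lin lin_idV)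
  have c: "Y u (int i) (obinom ?Z I x) = obinom ?Z I (Y u (int i) x)" for i x
    by (rule obinom_commute[where C="Y u (int i)" and T="?Z", symmetric, OF linear_right])
      (simp add: Y_diff u_D_commute)
  have "(\<Sum>i\<le>r. s ((-1) ^ i) (Y u (int i) (obinom ?Z I (E (r - i) v)))) =
      obinom ?Z I (\<Sum>i\<le>r. s ((-1) ^ i) (Y u (int i) (E (r - i) v)))"
    by (simp add: lin_sum[OF lin_obinom[OF Z]] lin_scale[OF lin_obinom[OF Z]] c)
  also have "\<dots> = obinom ?Z I (- D r (E r v))"
    unfolding E_rec by (simp add: D_def)
  also have "\<dots> = - obinom ?Z I (D r (E r v))"
    by (rule lin_neg[OF lin_obinom[OF Z]])
  also have "obinom ?Z I (D r (E r v)) = D r (obinom ?Z I (E r v))"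
    by (rule obinom_commute[OF D_lin]) (simp add: lin_diff[OF D_lin])
  also have "\<dots> = D r (obinom (D r) I (E r v)) - s (of_nat I) (obinom (D r) I (E r v))"
    by (rule obinom_pred[OF D_lin])
  finally show ?thesis by (simp add: D_def algebra_simps)
qed

text \<open>The coefficients \<open>R\<close> satisfy, with commutators in place of products, the recursion of \<open>E_rec\<close>.  The
  commutator formula puts \<open>u\<^sub>i\<close> in front of the coefficient of \<open>E\<^bsub>r-i\<^esub> v\<close>; with \<open>m = i + h\<close> the sum over \<open>h\<close> is
  evaluated by \<open>D_vandermonde\<close> and then the sum over \<open>i\<close> by \<open>D_recursion\<close>.\<close>

lemma R_commutator:
  "(\<Sum>m\<le>Q. s ((-1) ^ m) (Y u (int m) (R (Q - m) v n w) - R (Q - m) v n (Y u (int m) w))) =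
    s (of_nat Q) (R Q v n w) + (U0 (R Q v n w) - R Q v n (U0 w))"
proof -
  let ?T = "\<lambda>r i h. s ((-1) ^ (i + h) * of_nat ((i + h) choose i))
     (Y (Y u (int i) (obinom (D (r - i)) (Q - r - h) (E (r - i) v))) (n + int (Q - r)) w)"
  have c: "Y u (int m) (R k v n w) - R k v n (Y u (int m) w) =
     (\<Sum>r\<le>k. \<Sum>i\<le>m. s (of_nat (m choose i)) (Y (Y u (int i) (obinom (D r) (k - r) (E r v))) (int m + (n + int (k - r)) - int i) w))" for m k
    unfolding R_def Y_sum(2) sum_subtractf[symmetric]
    by (intro sum.cong refl) (simp add: commutator_nat)
  have "(\<Sum>m\<le>Q. s ((-1) ^ m) (Y u (int m) (R (Q - m) v n w) - R (Q - m) v n (Y u (int m) w))) =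
     (\<Sum>m\<le>Q. \<Sum>r\<le>Q-m. \<Sum>i\<le>m. s ((-1) ^ m * of_nat (m choose i))
       (Y (Y u (int i) (obinom (D r) (Q - m - r) (E r v))) (int m + (n + int (Q - m - r)) - int i) w))"
    unfolding c scale_sum_right by simp
  also have "\<dots> = (\<Sum>(m,r,i)\<in>Sigma {..Q} (\<lambda>m. {..Q-m} \<times> {..m}). s ((-1) ^ m * of_nat (m choose i))
       (Y (Y u (int i) (obinom (D r) (Q - m - r) (E r v))) (int m + (n + int (Q - m - r)) - int i) w))"
    by (rule sum_dependent_product) auto
  also have "\<dots> = (\<Sum>(r,i,h)\<in>Sigma {..Q} (\<lambda>r. {..r} \<times> {..Q-r}). ?T r i h)"
  proof (rule sum.reindex_bij_witness[of _ "\<lambda>(r,i,h). (i+h,r-i,i)" "\<lambda>(m,r,i). (r+i,i,m-i)"], goal_cases)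
    case (5 a)
    obtain m r i where a: "a = (m, r, i)" by (cases a)
    with 5 have "m \<le> Q" "r \<le> Q - m" "i \<le> m" by auto
    then have e: "i + (m - i) = m" "r + i - i = r" "Q - (r + i) - (m - i) = Q - m - r"
      "int m + (n + int (Q - m - r)) - int i = n + int (Q - (r + i))" by auto
    show ?case unfolding a by (simp only: prod.case e)
  qed auto
  also have "\<dots> = (\<Sum>r\<le>Q. \<Sum>i\<le>r. \<Sum>h\<le>Q-r. ?T r i h)"
    by (rule sum_dependent_product[symmetric]) auto
  also have "\<dots> = (\<Sum>r\<le>Q. Y (s (of_nat Q) (obinom (D r) (Q - r) (E r v)) + U0 (obinom (D r) (Q - r) (E r v))) (n + int (Q - r)) w)"
  proof (intro sum.cong refl)
    fix r assume "r \<in> {..Q}"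
    then have r: "r + (Q - r) = Q" by simp
    have "(\<Sum>h\<le>Q-r. ?T r i h) = Y (s ((-1) ^ i) (Y u (int i) (obinom (\<lambda>x. D r x - x) (Q - r) (E (r - i) v)))) (n + int (Q - r)) w"
      if "i \<le> r" for i
      unfolding D_vandermonde[OF that, symmetric] Y_sum Y_scale scale_sum_right
      by (simp add: power_add mult_ac)
    then have "(\<Sum>i\<le>r. \<Sum>h\<le>Q-r. ?T r i h) = Y (\<Sum>i\<le>r. s ((-1) ^ i) (Y u (int i) (obinom (\<lambda>x. D r x - x) (Q - r) (E (r - i) v)))) (n + int (Q - r)) w"
      by (simp add: Y_sum)
    then show "(\<Sum>i\<le>r. \<Sum>h\<le>Q-r. ?T r i h) = Y (s (of_nat Q) (obinom (D r) (Q - r) (E r v)) + U0 (obinom (D r) (Q - r) (E r v))) (n + int (Q - r)) w"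
      unfolding D_recursion r .
  qed
  also have "\<dots> = s (of_nat Q) (R Q v n w) + (U0 (R Q v n w) - R Q v n (U0 w))"
    unfolding R_def Y_sum scale_sum_right sum_subtractf[symmetric] sum.distrib[symmetric]
    by (intro sum.cong refl) (simp add: Y_add Y_scale u0_derivation)
  finally show ?thesis .
qed

text \<open>This is \<open>\<Delta>(x\<^sub>2) Y(v, x\<^sub>0) = Y(\<Delta>(x\<^sub>2 + x\<^sub>0) v, x\<^sub>0) \<Delta>(x\<^sub>2)\<close> with the factor \<open>x\<^sub>2\<^bsup>- u\<^sub>0\<^esup>\<close> split off.  The left-hand
  side obeys the recursion of \<open>E_rec\<close>; the right-hand side obeys it by \<open>R_commutator\<close> for the outer
  factor and \<open>E_rec\<close> for the inner one.  For \<open>q > 0\<close> the recursion determines the \<open>q\<close>-th coefficient from the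
  lower ones.\<close>

theorem E_conjugation: "E q (Y v n w) = (\<Sum>p\<le>q. R (q - p) v n (E p w))"
proof (induction q rule: less_induct)
  case (less q)
  show ?case
  proof (cases "q = 0")
    case True then show ?thesis by (simp add: R_def)
  next
    case False
    let ?X = "\<lambda>q. \<Sum>p\<le>q. R (q - p) v n (E p w)"
    let ?s = "\<lambda>m::nat. (-1::complex) ^ m"
    \<comment> \<open>by induction the two sides differ at most in degree \<open>q\<close>, which enters only with the mode \<open>u\<^sub>0\<close>\<close>
    have IH: "(\<Sum>m\<le>q. s (?s m) (Y u (int m) (E (q - m) (Y v n w)))) =
       (\<Sum>m\<le>q. s (?s m) (Y u (int m) (?X (q - m)))) + (U0 (E q (Y v n w)) - U0 (?X q))"
    proof -
      have "(\<Sum>m\<le>q. s (?s m) (Y u (int m) (E (q - m) (Y v n w)))) - (\<Sum>m\<le>q. s (?s m) (Y u (int m) (?X (q - m))))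
        = (\<Sum>m\<le>q. if m = 0 then U0 (E q (Y v n w)) - U0 (?X q) else 0)"
        unfolding sum_subtractf[symmetric]
      proof (intro sum.cong refl)
        fix m assume "m \<in> {..q}"
        then show "s (?s m) (Y u (int m) (E (q - m) (Y v n w))) - s (?s m) (Y u (int m) (?X (q - m))) =
          (if m = 0 then U0 (E q (Y v n w)) - U0 (?X q) else 0)"
          using less[of "q - m"] False by (cases "m = 0") (simp_all only: , simp_all)
      qed
      then show ?thesis by (simp add: algebra_simps)
    qed
    let ?H = "\<lambda>m k x. Y u (int m) (R k v n x) - R k v n (Y u (int m) x)"
    have "(\<Sum>m\<le>q. s (?s m) (Y u (int m) (?X (q - m)))) = (\<Sum>m\<le>q. \<Sum>p\<le>q-m. s (?s m) (Y u (int m) (R (q - m - p) v n (E p w))))"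
      by (simp add: Y_sum scale_sum_right)
    also have "\<dots> = (\<Sum>p\<le>q. \<Sum>m\<le>q-p. s (?s m) (Y u (int m) (R (q - p - m) v n (E p w))))"
      by (subst triangle_swap) (simp add: add.commute)
    also have "\<dots> = (\<Sum>p\<le>q. \<Sum>m\<le>q-p. s (?s m) (?H m (q - p - m) (E p w))) + (\<Sum>p\<le>q. \<Sum>m\<le>q-p. s (?s m) (R (q - p - m) v n (Y u (int m) (E p w))))"
      by (simp add: sum.distrib[symmetric] scale_right_diff_distrib)
    also have "(\<Sum>p\<le>q. \<Sum>m\<le>q-p. s (?s m) (?H m (q - p - m) (E p w))) =
      (\<Sum>p\<le>q. s (of_nat (q - p)) (R (q - p) v n (E p w)) + (U0 (R (q - p) v n (E p w)) - R (q - p) v n (U0 (E p w))))"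
      by (simp only: R_commutator)
    also have "(\<Sum>p\<le>q. \<Sum>m\<le>q-p. s (?s m) (R (q - p - m) v n (Y u (int m) (E p w)))) =
      (\<Sum>k\<le>q. \<Sum>m\<le>k. s (?s m) (R (q - k) v n (Y u (int m) (E (k - m) w))))"
    proof -
      have "(\<Sum>p\<le>q. \<Sum>m\<le>q-p. s (?s m) (R (q - p - m) v n (Y u (int m) (E p w)))) =
        (\<Sum>p\<le>q. \<Sum>m\<le>q-p. s (?s m) (R (q - (p + m)) v n (Y u (int m) (E (p + m - m) w))))" by simp
      also have "\<dots> = (\<Sum>k\<le>q. \<Sum>m\<le>k. s (?s m) (R (q - (k - m + m)) v n (Y u (int m) (E (k - m + m - m) w))))"
        by (rule triangle_diagonal[where f="\<lambda>m p. s (?s m) (R (q - (p + m)) v n (Y u (int m) (E (p + m - m) w)))"])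
      also have "\<dots> = (\<Sum>k\<le>q. \<Sum>m\<le>k. s (?s m) (R (q - k) v n (Y u (int m) (E (k - m) w))))"
        by (intro sum.cong refl) simp
      finally show ?thesis .
    qed
    also have "\<dots> = (\<Sum>k\<le>q. R (q - k) v n (\<Sum>m\<le>k. s (?s m) (Y u (int m) (E (k - m) w))))"
      by (simp add: lin_sum[OF R_lin] lin_scale[OF R_lin])
    also have "\<dots> = (\<Sum>p\<le>q. s (of_nat p) (R (q - p) v n (E p w)) + R (q - p) v n (U0 (E p w)))"
      by (simp only: E_rec lin_add[OF R_lin] lin_scale[OF R_lin])
    also have "(\<Sum>p\<le>q. s (of_nat (q - p)) (R (q - p) v n (E p w)) + (U0 (R (q - p) v n (E p w)) - R (q - p) v n (U0 (E p w)))) + \<dots>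
       = (\<Sum>p\<le>q. s (of_nat q) (R (q - p) v n (E p w)) + U0 (R (q - p) v n (E p w)))"
      unfolding sum.distrib[symmetric]
    proof (intro sum.cong refl)
      fix p assume "p \<in> {..q}"
      then have "of_nat q = of_nat (q - p) + (of_nat p :: complex)" by (simp add: of_nat_diff)
      then show "s (of_nat (q - p)) (R (q - p) v n (E p w)) + (U0 (R (q - p) v n (E p w)) - R (q - p) v n (U0 (E p w)))
          + (s (of_nat p) (R (q - p) v n (E p w)) + R (q - p) v n (U0 (E p w)))
        = s (of_nat q) (R (q - p) v n (E p w)) + U0 (R (q - p) v n (E p w))"
        by (simp only: scale_left_distrib) (simp add: algebra_simps)
    qed
    also have "\<dots> = s (of_nat q) (?X q) + U0 (?X q)"
      by (simp add: sum.distrib scale_sum_right Y_sum)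
    finally have "s (of_nat q) (E q (Y v n w)) = s (of_nat q) (?X q)"
      using IH E_rec[of q "Y v n w"] by (simp add: algebra_simps)
    then show ?thesis using False by simp
  qed
qed

end

context complex_vector_space begin

text \<open>Each application of \<open>C - d = P (A - a) + Q (B - b)\<close> lowers one of the two nilpotency degrees, and all
  operators commute.\<close>

lemma ge_combine:
  assumes l: "lin A" "lin B" "lin C" "lin P" "lin Q" and c: "\<And>x. A (B x) = B (A x)"
    and P: "\<And>x. A (P x) = P (A x)" "\<And>x. B (P x) = P (B x)" and Q: "\<And>x. A (Q x) = Q (A x)" "\<And>x. B (Q x) = Q (B x)"
    and e: "\<And>x. shift C d x = P (shift A a x) + Q (shift B b x)"
    and v: "v \<in> ge A a" "v \<in> ge B b"
  shows "v \<in> ge C d"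
proof -
  obtain K L where "(shift A a ^^ K) v = 0" "(shift B b ^^ L) v = 0" using geE v by metis
  then show ?thesis
  proof (induction "K + L" arbitrary: K L v)
    case 0 then show ?case using ge_0[OF l(3)] by simp
  next
    case (Suc n)
    have comm: "(shift X x ^^ K) (T v) = T ((shift X x ^^ K) v)" if "lin T" "\<And>x. X (T x) = T (X x)" for X x T K v
      by (rule funpow_commute_op) (simp add: that(2) lin_diff[OF that(1)] lin_scale[OF that(1)])
    have 1: "P (shift A a v) \<in> ge C d"
    proof (cases K)
      case 0 then show ?thesis using Suc.prems ge_0[OF l(3)] lin_zero[OF lin_shift[OF l(1)]] lin_zero[OF l(4)] by simp
    next
      case (Suc K')
      have "(shift A a ^^ K') (P (shift A a v)) = P ((shift A a ^^ K) v)"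
        unfolding Suc by (simp only: funpow_Suc_right o_apply comm[where X=A and T=P, OF l(4) P(1)])
      moreover have "(shift B b ^^ L) (P (shift A a v)) = P (shift A a ((shift B b ^^ L) v))"
        by (simp only: comm[where X=B and T=P, OF l(4) P(2)]) (subst comm[where X=B and T="shift A a", OF lin_shift[OF l(1)]], simp_all add: c lin_diff[OF l(2)] lin_scale[OF l(2)])
      ultimately show ?thesis using Suc.hyps(1)[of K' L "P (shift A a v)"] Suc.hyps(2) Suc.prems Suc
          lin_zero[OF lin_shift[OF l(1)]] lin_zero[OF l(4)] by simp
    qed
    have 2: "Q (shift B b v) \<in> ge C d"
    proof (cases L)
      case 0 then show ?thesis using Suc.prems ge_0[OF l(3)] lin_zero[OF lin_shift[OF l(2)]] lin_zero[OF l(5)] by simp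
    next
      case (Suc L')
      have "(shift B b ^^ L') (Q (shift B b v)) = Q ((shift B b ^^ L) v)"
        unfolding Suc by (simp only: funpow_Suc_right o_apply comm[where X=B and T=Q, OF l(5) Q(2)])
      moreover have "(shift A a ^^ K) (Q (shift B b v)) = Q (shift B b ((shift A a ^^ K) v))"
        by (simp only: comm[where X=A and T=Q, OF l(5) Q(1)]) (subst comm[where X=A and T="shift B b", OF lin_shift[OF l(2)]], simp_all add: c lin_diff[OF l(1)] lin_scale[OF l(1)])
      ultimately show ?thesis using Suc.hyps(1)[of K L' "Q (shift B b v)"] Suc.hyps(2) Suc.prems Suc
          lin_zero[OF lin_shift[OF l(2)]] lin_zero[OF l(5)] by simp
    qed
    have "shift C d v \<in> ge C d" unfolding e using 1 2 by (rule ge_add[OF l(3)])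
    then show ?case by (rule ge_of_shift[where T=C])
  qed
qed

lemma ge_compose:
  assumes l: "lin A" "lin B" and c: "\<And>x. A (B x) = B (A x)" and v: "v \<in> ge A a" "v \<in> ge B b"
  shows "v \<in> ge (\<lambda>x. A (B x)) (a * b)"
  by (rule ge_combine[where A=A and B=B and P=B and Q="scale a" and a=a and b=b, OF l lin_compose[OF l(2,1)] l(2) lin_scaleV c])
    (auto simp: v c lin_scale[OF l(1)] lin_scale[OF l(2)] lin_diff[OF l(2)] algebra_simps)

lemma ge_minus:
  assumes l: "lin A" "lin B" and c: "\<And>x. A (B x) = B (A x)" and v: "v \<in> ge A a" "v \<in> ge B b"
  shows "v \<in> ge (\<lambda>x. A x - B x + scale k x) (a - b + k)"
  by (rule ge_combine[where A=A and B=B and P="\<lambda>x. x" and Q="\<lambda>x. - x" and a=a and b=b, OF l _ lin_idV lin_uminus[OF lin_idV] c])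
    (auto simp: v lin_neg[OF l(1)] lin_neg[OF l(2)] algebra_simps intro!: lin_plus lin_minus l lin_scaleV)

text \<open>On \<open>ge T b\<close> the difference \<open>exp(a T) - e\<^bsup>a b\<^esup>\<close> is \<open>e\<^bsup>a b\<^esup> (exp(a N) - 1)\<close>, a multiple of a locally nilpotent
  operator.\<close>

lemma ge_op_exp:
  assumes T: "triangulable T" and v: "v \<in> ge T b" shows "v \<in> ge (op_exp scale (\<lambda>x. scale a (T x))) (exp (a * b))"
proof -
  let ?N = "nilpotent_part scale T" and ?G = "op_exp scale (\<lambda>x. scale a (T x))"
  note N = nilpotent_part_props(1)[OF T]
  have lT: "lin T" by (rule triangulable_lin[OF T])
  let ?X = "ps_op (fps_exp a - 1) ?N"
  have X: "nilp ?X" by (rule ps_op_nilp[OF N]) simp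
  have Xe: "?X x = ps_op (fps_exp a) ?N x - x" for x
  proof -
    have "ps_op (fps_exp a) ?N x = ps_op (1 + (fps_exp a - 1)) ?N x" by simp
    also have "\<dots> = ps_op 1 ?N x + ?X x"
      unfolding ps_op_def by (subst Sum_any_add_fin(1)[OF ps_op_finite[OF N] ps_op_finite[OF N], symmetric]) (simp only: fps_add_nth scale_left_distrib)
    finally show ?thesis by simp
  qed
  have "?N (T x) = T (?N x)" for x by (rule nilpotent_part_commute[where T=T and C=T, OF T lT]) simp
  then have cT: "T (?X x) = ?X (T x)" for x by (rule ps_op_commute[OF N lT])
  have "(shift ?G (exp (a * b)) ^^ k) v = scale (exp (a * b) ^ k) ((?X ^^ k) v) \<and> (?X ^^ k) v \<in> ge T b" for k
  proof (induction k)
    case (Suc k)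
    let ?x = "(?X ^^ k) v" let ?e = "exp (a * b)"
    have x: "?x \<in> ge T b" using Suc by simp
    have "(shift ?G ?e ^^ Suc k) v = shift ?G ?e (scale (?e ^ k) ?x)" using Suc by simp
    also have "\<dots> = scale (?e ^ k) (shift ?G ?e ?x)"
      by (rule lin_scale[OF lin_shift[OF op_exp_props(1)[OF triangulable_scale(1)[OF T]]]])
    also have "shift ?G ?e ?x = scale ?e (?X ?x)" unfolding op_exp_scaled[OF T x] Xe by (simp add: scale_right_diff_distrib)
    finally show ?case using ge_commute[where T=T and S="?X", OF nilp_lin[OF X] cT x] by (simp add: mult.commute)
  qed (use v in simp)
  moreover obtain K where "(?X ^^ K) v = 0" using X unfolding locally_nilpotent_def by blast
  ultimately have "(shift ?G (exp (a * b)) ^^ K) v = 0" by simp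
  then show ?thesis by (rule geI)
qed

lemma ps_op_fixed: assumes "nilp X" "X v = 0" shows "ps_op f X v = scale (fps_nth f 0) v"
proof -
  have z: "(X ^^ k) v = 0" if "k \<noteq> 0" for k
    by (rule funpow_zero_mono[OF nilp_lin[OF assms(1)], of 1]) (use that assms in auto)
  show ?thesis unfolding ps_op_def by (subst Sum_any_eq_sum[of "{0}"]) (auto simp: z)
qed

lemma op_exp_fixed:
  assumes T: "triangulable T" and "T v = 0" shows "op_exp scale (\<lambda>x. scale a (T x)) v = v"
proof -
  have v: "v \<in> ge T 0" by (rule geI[where K=1]) (simp add: assms)
  have "nilpotent_part scale T v = 0" by (simp add: nilpotent_part_props(2)[OF T v] assms)
  then show ?thesis unfolding op_exp_scaled[OF T v] by (simp add: ps_op_fixed[OF nilpotent_part_props(1)[OF T]])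
qed

lemma N_op_fixed:
  assumes T: "triangulable h" and inj: "inj h" and v: "h v = v" shows "N_op scale h v = 0" "v \<in> ge h (cis2pi 0)"
proof -
  show "v \<in> ge h (cis2pi 0)" by (rule geI[where K=1]) (simp add: v cis2pi_def)
  have v1: "v \<in> ge h 1" by (rule geI[where K=1]) (simp add: v)
  show "N_op scale h v = 0" unfolding N_op_eq[OF T inj]
    by (subst ps_op_fixed[OF unip_shift_nilp[OF T inj]]) (simp_all add: unipotent_part_props(2)[OF T inj v1] v)
qed

end

context vertex_operator_algebra begin

lemma automorphism_props:
  assumes h: "voa_automorphism s Y vac \<omega> h"
  shows "lin h" "inj h" "triangulable h" "h (Y v n w) = Y (h v) n (h w)"
    "N_op s h (Y v n w) = Y (N_op s h v) n w + Y v n (N_op s h w)" "N_op s h (Y \<omega> n x) = Y \<omega> n (N_op s h x)"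
    "h vac = vac" "h \<omega> = \<omega>"
proof -
  have h': "lin h" "bij h" "\<forall>v n w. h (Y v n w) = Y (h v) n (h w)" "h vac = vac" "h \<omega> = \<omega>"
    using h unfolding voa_automorphism_def by metis+
  show l: "lin h" by (rule h'(1))
  show inj: "inj h" by (rule bij_is_inj[OF h'(2)])
  have a: "h (Y v n w) = Y (h v) n (h w)" for v n w using h'(3) by simp
  then show "h (Y v n w) = Y (h v) n (h w)" .
  show "h vac = vac" by (rule h'(4))
  show o: "h \<omega> = \<omega>" by (rule h'(5))
  show T: "triangulable h" by (rule wt_triangulable[OF l]) (simp add: a o)
  show "N_op s h (Y v n w) = Y (N_op s h v) n w + Y v n (N_op s h w)"
    by (rule bilinear_product.N_op_derivation[OF bilinear_mode[of n], where h=h and h'=h, OF T T inj inj a])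
  show "N_op s h (Y \<omega> n x) = Y \<omega> n (N_op s h x)"
    by (rule N_op_commute[where h=h and C="Y \<omega> n", OF T inj linear_right]) (simp add: a o)
qed

end

context shift_vector begin

section \<open>The automorphism \<open>g\<^sub>u\<close>\<close>

definition gu :: "'v \<Rightarrow> 'v" where "gu = op_exp s (\<lambda>v. s (2 * pi * \<i>) (Y u 0 v))"

abbreviation NU :: "'v \<Rightarrow> 'v" where "NU \<equiv> nilpotent_part s U0"

text \<open>The mode \<open>u\<^sub>0\<close> is a derivation of all products that kills \<open>\<one>\<close> and \<open>\<omega>\<close>, so its exponential is an automorphism.\<close>

lemma gu_automorphism: "voa_automorphism s Y vac \<omega> gu"
  unfolding voa_automorphism_def
proof (intro conjI allI)
  show "lin gu" unfolding gu_def by (rule op_exp_props(1)[OF triangulable_scale(1)[OF u0_triangulable]])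
  show "bij gu" unfolding gu_def by (rule bij_op_exp[OF u0_triangulable])
  show "gu (Y v n w) = Y (gu v) n (gu w)" for v n w
    unfolding gu_def by (rule bilinear_product.op_exp_derivation[OF bilinear_mode[of n], where D="Y u 0" and D'="Y u 0", OF u0_triangulable u0_triangulable u0_derivation])
  show "gu vac = vac" unfolding gu_def by (rule op_exp_fixed[OF u0_triangulable]) (simp add: creation)
  show "gu \<omega> = \<omega>" unfolding gu_def by (rule op_exp_fixed[OF u0_triangulable u_omega_0])
qed

lemma NU_nilp: "nilp NU" by (rule nilpotent_part_props(1)[OF u0_triangulable])
lemma NU_ge: "v \<in> ge U0 b \<Longrightarrow> NU v = U0 v - s b v" by (rule nilpotent_part_props(2)[OF u0_triangulable])

lemma NU_commute: "lin C \<Longrightarrow> (\<And>x. U0 (C x) = C (U0 x)) \<Longrightarrow> NU (C x) = C (NU x)"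
  by (rule nilpotent_part_commute[where T=U0 and C=C, OF u0_triangulable])

context
  fixes g :: "'v \<Rightarrow> 'v"
  assumes g: "voa_automorphism s Y vac \<omega> g" and gu_fix: "g u = u"
begin

lemma g_commute_u: "g (Y u n x) = Y u n (g x)"
  using automorphism_props(4)[OF g] gu_fix by simp

lemma Ng_commute_u: "N_op s g (Y u n x) = Y u n (N_op s g x)"
  by (rule N_op_commute[where h=g and C="Y u n", OF automorphism_props(3,2)[OF g] linear_right]) (simp add: g_commute_u)

lemma g_gu_automorphism: "voa_automorphism s Y vac \<omega> (g \<circ> gu)"
proof -
  have "bij (g \<circ> gu)" using g gu_automorphism unfolding voa_automorphism_def by (intro bij_comp) auto
  moreover have "lin (g \<circ> gu)" unfolding comp_def
    by (rule lin_compose[OF automorphism_props(1)[OF gu_automorphism] automorphism_props(1)[OF g]])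
  ultimately show ?thesis using g gu_automorphism unfolding voa_automorphism_def by simp
qed

lemma Ng_commute_NU: "N_op s g (NU x) = NU (N_op s g x)"
  by (rule NU_commute[symmetric, OF N_op_lin[OF automorphism_props(3,2)[OF g]]]) (simp add: Ng_commute_u)

lemma g_gu_commute: "g (gu x) = gu (g x)"
  unfolding gu_def
  by (rule op_exp_commute[where C=g, symmetric, OF triangulable_scale(1)[OF u0_triangulable] automorphism_props(1)[OF g]])
    (simp add: g_commute_u lin_scale[OF automorphism_props(1)[OF g]])

lemma joint_ge:
  assumes "v \<in> ge g a" "v \<in> ge U0 b" shows "v \<in> ge (g \<circ> gu) (a * cis2pi b)"
proof -
  have "v \<in> ge gu (cis2pi b)" unfolding gu_def cis2pi_def by (rule ge_op_exp[OF u0_triangulable assms(2)])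
  then have "v \<in> ge (\<lambda>x. g (gu x)) (a * cis2pi b)"
    using ge_compose[where A=g and B=gu, OF automorphism_props(1)[OF g] automorphism_props(1)[OF gu_automorphism] g_gu_commute assms(1)] by blast
  then show ?thesis by (simp add: comp_def)
qed

text \<open>On a joint generalized eigenvector of \<open>g\<close> and \<open>u\<^sub>0\<close> the automorphism \<open>g g\<^sub>u\<close> is a scalar times
  \<open>exp(2\<pi>i N\<^sub>g) exp(2\<pi>i N\<^sub>u) = exp(2\<pi>i (N\<^sub>g + N\<^sub>u))\<close>, where \<open>N\<^sub>u\<close> is the nilpotent part of \<open>u\<^sub>0\<close>; the exponent
  of such a representation is unique.\<close>

lemma N_op_g_gu: "N_op s (g \<circ> gu) v = N_op s g v + NU v"
proof -
  let ?h = "g \<circ> gu" and ?Ng = "N_op s g" and ?M = "\<lambda>x. N_op s g x + NU x"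
  note pg = automorphism_props[OF g] and pu = automorphism_props[OF gu_automorphism] and ph = automorphism_props[OF g_gu_automorphism]
  have lNg: "lin ?Ng" by (rule N_op_lin[OF pg(3,2)])
  have lNU: "lin NU" by (rule nilp_lin[OF NU_nilp])
  have M: "nilp ?M" by (rule nilp_add[OF N_op_nilp[OF pg(3,2)] NU_nilp Ng_commute_NU])
  have guT: "gu (U0 x) = U0 (gu x)" for x
    unfolding gu_def by (rule op_exp_commute[where C=U0, OF triangulable_scale(1)[OF u0_triangulable] U0_lin]) (simp add: lin_scale[OF U0_lin])
  have c1: "?Ng (g x) = g (?Ng x)" for x by (rule N_op_commute[where h=g and C=g, OF pg(3,2,1)]) simp
  have c2: "?Ng (gu x) = gu (?Ng x)" for x unfolding gu_def
    by (rule op_exp_commute[where C="?Ng", symmetric, OF triangulable_scale(1)[OF u0_triangulable] lNg]) (simp add: Ng_commute_u lin_scale[OF lNg])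
  have c3: "NU (g x) = g (NU x)" for x by (rule NU_commute[OF pg(1)]) (simp add: g_commute_u)
  have c4: "NU (gu x) = gu (NU x)" for x by (rule NU_commute[OF pu(1)]) (simp add: guT)
  have cM: "?M (?h x) = ?h (?M x)" for x by (simp add: c1 c2 c3 c4 lin_add[OF pg(1)] lin_add[OF pu(1)])
  have cN: "N_op s ?h (?h x) = ?h (N_op s ?h x)" for x by (rule N_op_commute[where h="?h" and C="?h", OF ph(3,2,1)]) simp
  show ?thesis
  proof (rule joint_induct[where T=g and S=U0 and P="\<lambda>v. N_op s ?h v = ?M v", OF pg(3) u0_triangulable])
    show "g (U0 x) = U0 (g x)" for x by (rule g_commute_u)
    fix a b v assume v: "v \<in> ge g a" "v \<in> ge U0 b"
    let ?c = "a * cis2pi b"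
    have vh: "v \<in> ge ?h ?c" by (rule joint_ge[OF v])
    show "N_op s ?h v = ?M v"
    proof (cases "a = 0")
      case True
      then have "v = 0" using ge_inj_0[OF pg(3,2)] v by blast
      then show ?thesis using lin_zero[OF lNg] lin_zero[OF lNU] lin_zero[OF N_op_lin[OF ph(3,2)]] by simp
    next
      case False
      have "?h v = g (s (cis2pi b) (ps_op (fps_exp (2 * pi * \<i>)) NU v))"
        by (simp add: gu_def op_exp_scaled[OF u0_triangulable v(2)] cis2pi_def)
      also have "\<dots> = s (cis2pi b) (ps_op (fps_exp (2 * pi * \<i>)) NU (g v))"
        by (simp add: lin_scale[OF pg(1)] ps_op_commute[OF NU_nilp pg(1) c3])
      also have "\<dots> = s ?c (ps_op (fps_exp (2 * pi * \<i>)) NU (ps_op (fps_exp (2 * pi * \<i>)) ?Ng v))"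
        by (simp add: N_op_exp[OF pg(3,2) v(1)] lin_scale[OF ps_op_lin[OF NU_nilp]] mult.commute)
      also have "\<dots> = s ?c (ps_op (fps_exp (2 * pi * \<i>)) ?M v)"
        using ps_op_exp_add[OF NU_nilp N_op_nilp[OF pg(3,2)] Ng_commute_NU[symmetric], of "2 * pi * \<i>" v] by (simp add: add.commute)
      finally have "?h v = s ?c (ps_op (fps_exp (2 * pi * \<i>)) ?M v)" .
      then show ?thesis
        using exp_generator_unique[where M="N_op s ?h" and N="?M" and h="?h" and v=v,
          OF ph(1) N_op_nilp[OF ph(3,2)] cN N_op_exp[OF ph(3,2) vh] M cM] False by simp
    qed
  next
    fix x y assume "N_op s ?h x = ?M x" "N_op s ?h y = ?M y"
    then show "N_op s ?h (x + y) = ?M (x + y)" by (simp add: lin_add[OF lNg] lin_add[OF lNU] lin_add[OF N_op_lin[OF ph(3,2)]])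
  qed
qed

end

section \<open>The algebraic core of the Jacobi identity\<close>

text \<open>\<open>E_conjugation\<close> is applied to the products \<open>(binom(M, i) v\<^sub>1)\<^bsub>l+i\<^esub> v\<^sub>2\<close>.  Since \<open>M\<close> commutes with the
  modes of \<open>u\<close>, the factor \<open>binom(M, i)\<close> meets the factor \<open>binom(D\<^sub>r, k)\<close> of the conjugation formula, and the
  sum over \<open>i + k\<close> fixed is the Vandermonde expansion of \<open>binom(M + D\<^sub>r, i + k)\<close>.\<close>

lemma jacobi_core:
  assumes M: "lin M" "\<And>m x. Y u (int m) (M x) = M (Y u (int m) x)"
  shows "(\<Sum>p\<le>T. \<Sum>r\<le>T-p. Y (obinom (\<lambda>x. M x + D r x) (T - p - r) (E r v1)) (l + int (T - p - r)) (E p v2)) =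
    (\<Sum>i\<le>T. E (T - i) (Y (obinom M i v1) (l + int i) v2))"
proof -
  have MD: "M (D r x) = D r (M x)" for r x using M(2)[of 0] by (intro D_commute[symmetric] M(1)) simp
  have uM: "Y u (int m) (obinom M i x) = obinom M i (Y u (int m) x)" for m i x
    by (rule obinom_commute[where T=M, symmetric, OF linear_right]) (simp add: M(2))
  have EM: "E r (obinom M i x) = obinom M i (E r x)" for r i x
    by (rule E_commute[OF lin_obinom[OF M(1)] uM])
  have DM: "obinom (D r) k (obinom M i x) = obinom M i (obinom (D r) k x)" for r k i x
  proof (rule obinom_commute[OF lin_obinom[OF M(1)]])
    fix x show "D r (obinom M i x) = obinom M i (D r x)"
      by (rule obinom_commute[where T=M, symmetric, OF D_lin MD])
  qed
  let ?T = "\<lambda>p r i. Y (obinom (D r) (T - i - p - r) (obinom M i (E r v1))) (l + int i + int (T - i - p - r)) (E p v2)"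
  have "(\<Sum>i\<le>T. E (T - i) (Y (obinom M i v1) (l + int i) v2)) = (\<Sum>i\<le>T. \<Sum>p\<le>T-i. \<Sum>r\<le>T-i-p. ?T p r i)"
    unfolding E_conjugation R_def EM ..
  also have "\<dots> = (\<Sum>p\<le>T. \<Sum>i\<le>T-p. \<Sum>r\<le>T-i-p. ?T p r i)" by (rule triangle_swap)
  also have "\<dots> = (\<Sum>p\<le>T. \<Sum>i\<le>T-p. \<Sum>r\<le>T-p-i. ?T p r i)" by (simp add: add.commute)
  also have "\<dots> = (\<Sum>p\<le>T. \<Sum>r\<le>T-p. \<Sum>i\<le>T-p-r. ?T p r i)" by (subst triangle_swap) simp
  also have "\<dots> = (\<Sum>p\<le>T. \<Sum>r\<le>T-p. Y (obinom (\<lambda>x. M x + D r x) (T - p - r) (E r v1)) (l + int (T - p - r)) (E p v2))"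
  proof (intro sum.cong refl)
    fix p r
    have "(\<Sum>i\<le>T-p-r. ?T p r i) = (\<Sum>i\<le>T-p-r. Y (obinom M i (obinom (D r) (T - p - r - i) (E r v1))) (l + int (T - p - r)) (E p v2))"
    proof (intro sum.cong refl)
      fix i assume "i \<in> {..T-p-r}"
      then have e: "T - i - p - r = T - p - r - i" "l + int i + int (T - p - r - i) = l + int (T - p - r)" by auto
      show "?T p r i = Y (obinom M i (obinom (D r) (T - p - r - i) (E r v1))) (l + int (T - p - r)) (E p v2)"
        unfolding e DM ..
    qed
    also have "\<dots> = Y (obinom (\<lambda>x. M x + D r x) (T - p - r) (E r v1)) (l + int (T - p - r)) (E p v2)"
      by (simp only: obinom_vandermonde[where P=M and Q="D r", OF M(1) D_lin MD] Y_sum)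
    finally show "(\<Sum>i\<le>T-p-r. ?T p r i) = Y (obinom (\<lambda>x. M x + D r x) (T - p - r) (E r v1)) (l + int (T - p - r)) (E p v2)" .
  qed
  finally show ?thesis by simp
qed

end

context complex_vector_space begin

lemma dpow_neg: "lin N \<Longrightarrow> dpow k (\<lambda>x. - N x) v = scale ((-1) ^ k) (dpow k N v)"
proof -
  assume N: "lin N"
  have "((\<lambda>x. - N x) ^^ k) v = scale ((-1) ^ k) ((N ^^ k) v)"
    by (induction k) (auto simp: lin_scale[OF N])
  then show ?thesis by (simp add: mult.commute)
qed

lemma nilp_neg: assumes "nilp N" shows "nilp (\<lambda>x. - N x)"
proof -
  have "dpow k (\<lambda>x. - N x) v = scale ((-1) ^ k) (dpow k N v)" for k v by (rule dpow_neg[OF nilp_lin[OF assms]])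
  then have "(N ^^ k) v = 0 \<Longrightarrow> ((\<lambda>x. - N x) ^^ k) v = 0" for k v
    by (metis scale_eq_0_iff fact_nonzero divide_eq_0_iff one_neq_zero)
  then show ?thesis using assms lin_uminus[OF nilp_lin[OF assms]] unfolding locally_nilpotent_def by metis
qed

lemma ps_op_exp_neg: "lin N \<Longrightarrow> ps_op (fps_exp a) (\<lambda>x. - N x) v = ps_op (fps_exp (- a)) N v"
proof -
  assume N: "lin N"
  have "scale (a ^ k) (dpow k (\<lambda>x. - N x) v) = scale ((- a) ^ k) (dpow k N v)" for k
    unfolding dpow_neg[OF N] by (simp add: power_minus[of a] mult.commute mult.left_commute)
  then show ?thesis unfolding ps_op_exp_eq by presburger
qed

lemma subspace_obinom: "subspace U \<Longrightarrow> (\<And>x. x \<in> U \<Longrightarrow> T x \<in> U) \<Longrightarrow> x \<in> U \<Longrightarrow> obinom T i x \<in> U"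
  by (induction i) (auto intro!: subspace_scale subspace_diff)

lemma obinom_cong:
  assumes "\<And>x. x \<in> U \<Longrightarrow> T x = T' x" "subspace U" "\<And>x. x \<in> U \<Longrightarrow> T x \<in> U" "x \<in> U"
  shows "obinom T i x = obinom T' i x"
proof (induction i)
  case (Suc i)
  have "obinom T i x \<in> U" by (rule subspace_obinom[OF assms(2,3,4)])
  then have "T (obinom T i x) = T' (obinom T' i x)" using assms(1) Suc by simp
  then show ?case using Suc by simp
qed simp

lemma funpow_in: "(\<And>x. x \<in> U \<Longrightarrow> T x \<in> U) \<Longrightarrow> x \<in> U \<Longrightarrow> (T ^^ k) x \<in> U"
  by (induction k) auto

end

section \<open>Twisted modules without logarithms\<close>

text \<open>The family \<open>y v n\<close> consists of the coefficients of \<open>x\<^bsup>n\<^esup>\<close> without logarithms, for the automorphism \<open>h\<close>.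
  The condition \<open>y_supp\<close> expresses that \<open>Y\<^sub>W(v, x)\<close> involves the exponents \<open>- \<alpha> + \<int>\<close> only, if \<open>\<S>\<^sub>h v = \<alpha> v\<close>.\<close>

locale twisted_family = V: vertex_operator_algebra s Y vac \<omega> + W: complex_vector_space t
  for s :: "complex \<Rightarrow> 'v::ab_group_add \<Rightarrow> 'v" and Y vac \<omega>
    and t :: "complex \<Rightarrow> 'w::ab_group_add \<Rightarrow> 'w" +
  fixes h :: "'v \<Rightarrow> 'v" and y :: "'v \<Rightarrow> complex \<Rightarrow> 'w \<Rightarrow> 'w"
  assumes aut: "voa_automorphism s Y vac \<omega> h"
    and y_l: "Vector_Spaces.linear s t (\<lambda>v. y v n w)"
    and y_r: "Vector_Spaces.linear t t (y v n)"
    and y_supp: "v \<in> eigenspace s (S_op s h) \<alpha> \<Longrightarrow> n + \<alpha> \<notin> \<int> \<Longrightarrow> y v n w = 0"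
    and y_trunc: "\<exists>B. \<forall>n. Re n < B \<longrightarrow> y v n w = 0"
begin

abbreviation S where "S \<equiv> S_op s h"
abbreviation N where "N \<equiv> N_op s h"
abbreviation ES where "ES \<alpha> \<equiv> eigenspace s S \<alpha>"
abbreviation M where "M k \<equiv> V.dpow k (\<lambda>x. - N x)"

lemmas h_props = V.automorphism_props[OF aut]
lemmas N_nilp = V.N_op_nilp[OF h_props(3,2)]
lemmas N_lin = V.N_op_lin[OF h_props(3,2)]
lemmas S_lin = V.S_op_props(1)[OF h_props(3,2)]
lemmas S_semisimple = V.S_op_semisimple[OF h_props(3,2)]
lemmas y_add = lin_add[OF y_l] lin_add[OF y_r]
lemmas y_scale = lin_scale[OF y_l] lin_scale[OF y_r]
lemmas y_zero = lin_zero[OF y_l] lin_zero[OF y_r]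
lemmas y_sum = lin_sum[OF y_l] lin_sum[OF y_r]
lemmas y_diff = lin_diff[OF y_l] lin_diff[OF y_r]

lemma h_N: "h (N x) = N (h x)"
  by (rule V.N_op_commute[where h=h and C=h, symmetric, OF h_props(3,2,1)]) simp

lemma S_N: "S (N x) = N (S x)"
  by (rule V.S_op_commute[where h=h and C=N, OF h_props(3,2) N_lin h_N])

lemma subspace_ES: "V.subspace (ES \<alpha>)" by (rule V.subspace_eigenspace[OF S_lin])

lemma ES_commute: "V.lin C \<Longrightarrow> (\<And>x. S (C x) = C (S x)) \<Longrightarrow> v \<in> ES \<alpha> \<Longrightarrow> C v \<in> ES \<alpha>"
  by (simp add: eigenspace_def lin_scale)

lemma ES_N: "v \<in> ES \<alpha> \<Longrightarrow> N v \<in> ES \<alpha>" by (rule ES_commute[OF N_lin S_N])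

lemma ES_M: "v \<in> ES \<alpha> \<Longrightarrow> M k v \<in> ES \<alpha>"
  by (intro V.subspace_scale[OF subspace_ES] V.funpow_in) (auto intro: V.subspace_neg[OF subspace_ES] ES_N)

lemma M_lin: "V.lin (M k)" by (intro V.lin_dpow lin_uminus N_lin)

lemma S_direct: "is_direct_sum s UNIV (eigenspace s S)"
  using S_semisimple by (simp add: semisimple_op_def)

lemma S_induct [case_names ES add]:
  assumes "\<And>\<alpha> x. x \<in> ES \<alpha> \<Longrightarrow> P x" "\<And>x y. P x \<Longrightarrow> P y \<Longrightarrow> P (x + y)" shows "P v"
  by (rule V.direct_sum_induct[OF S_direct, of P]) (use assms V.subspace_0[OF subspace_ES] in blast)+

lemma N_derivation: "N (Y v n w) = Y (N v) n w + Y v n (N w)" by (rule h_props(5))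

text \<open>The coefficients with logarithms, read off from \<open>Y\<^sub>W(v, x) = y(e\<^bsup>- N log x\<^esup> v, x)\<close>.\<close>

definition YL :: "'v \<Rightarrow> complex \<Rightarrow> nat \<Rightarrow> 'w \<Rightarrow> 'w" where "YL v n k w = y (M k v) n w"

lemma YL_lin_l: "Vector_Spaces.linear s t (\<lambda>v. YL v n k w)"
  unfolding YL_def by (rule lin_compose[OF M_lin y_l])

lemma YL_lin_r: "Vector_Spaces.linear t t (YL v n k)"
  unfolding YL_def[abs_def] by (rule y_r)

lemma neg_S_direct: "is_direct_sum s UNIV (eigenspace s (\<lambda>x. - S x))"
proof -
  have "eigenspace s (\<lambda>x. - S x) d = ES (- d)" for d
    by (auto simp: eigenspace_def neg_eq_iff_add_eq_0 eq_neg_iff_add_eq_0)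
  moreover have "v \<in> V.span (\<Union>d. ES (- d))" for v
  proof (induction v rule: S_induct)
    case (ES \<alpha> x)
    then show ?case by (intro V.span_base UN_I[of "- \<alpha>"]) auto
  qed (rule V.span_add)
  ultimately have "semisimple_op s (\<lambda>x. - S x)"
    by (intro V.semisimpleI lin_uminus S_lin) simp
  then show ?thesis by (simp add: semisimple_op_def)
qed

text \<open>On the eigenspace of \<open>\<S>\<^sub>h\<close> the factor \<open>x\<^sub>1\<^bsup>-L\<^esup>\<close> contributes only the exponent \<open>- \<alpha>\<close> of \<open>x\<^sub>1\<close>, and the
  factor \<open>x\<^sub>2\<^bsup>L-i\<^esup>\<close> only the exponent \<open>\<alpha> - i\<close> of \<open>x\<^sub>2\<close>.\<close>

lemma quotient_powr_eigen:
  assumes v: "v \<in> ES \<alpha>"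
  shows "quotient_powr s h i d j c r v =
    (if d = - \<alpha> \<and> c + of_nat i = \<alpha> then V.obinom (\<lambda>x. N x + s \<alpha> x) i (V.dpow r N (M j v)) else 0)"
proof -
  have "v \<in> eigenspace s (\<lambda>x. - S x) (- \<alpha>)" using v by (simp add: eigenspace_def)
  then have 1: "op_powr s (\<lambda>x. - S x) (\<lambda>x. - N x) d j v = (if d = - \<alpha> then M j v else 0)"
    using V.component_self[OF neg_S_direct, of "- \<alpha>" v d] by (auto simp: op_powr_def lin_zero[OF lin_funpow[OF lin_uminus[OF N_lin]]])
  have Mv: "M j v \<in> ES \<alpha>" by (rule ES_M[OF v])
  have 2: "op_powr s S N (c + of_nat i) r (M j v) = (if c + of_nat i = \<alpha> then V.dpow r N (M j v) else 0)"
    using V.component_self[OF S_direct _ Mv, of "c + of_nat i"] by (auto simp: op_powr_def lin_zero[OF lin_funpow[OF N_lin]])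
  have 3: "op_powr s S N (c + of_nat i) r 0 = 0" for c r
    by (simp add: op_powr_def lin_zero[OF V.component_linear[OF S_direct]] lin_zero[OF lin_funpow[OF N_lin]])
  have L: "V.lin (L_op s h)" unfolding L_op_def[abs_def] by (intro lin_plus S_lin N_lin)
  have d: "V.dpow r N (M j v) \<in> ES \<alpha>"
    by (intro V.subspace_scale[OF subspace_ES] V.funpow_in[of _ N] ES_N Mv)
  have 4: "V.obinom (L_op s h) i (V.dpow r N (M j v)) = V.obinom (\<lambda>x. N x + s \<alpha> x) i (V.dpow r N (M j v))"
  proof (rule V.obinom_cong[OF _ subspace_ES _ d])
    fix x assume x: "x \<in> ES \<alpha>"
    then show "L_op s h x = N x + s \<alpha> x" by (simp add: L_op_def eigenspace_def add.commute)
    then show "L_op s h x \<in> ES \<alpha>" using x ES_N V.subspace_add[OF subspace_ES] V.subspace_scale[OF subspace_ES] by simp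
  qed
  show ?thesis unfolding quotient_powr_def 1 using 2 3 4 lin_zero[OF V.lin_obinom[OF L]] by auto
qed

text \<open>The vectors \<open>binom(N + c, i) v\<close> lie in the \<open>N\<close>-invariant span of the finitely many nonzero \<open>N\<^bsup>k\<^esup> v\<close>, so one
  truncation bound serves all \<open>i\<close>.\<close>

lemma uniform_truncation: "\<exists>n0. \<forall>n\<ge>n0. \<forall>i. Y (V.obinom (\<lambda>x. N x + s c x) i v) n w = 0"
proof -
  obtain K where K: "\<And>k. k \<ge> K \<Longrightarrow> (N ^^ k) v = 0" using V.nilpE[OF N_nilp] by metis
  have ex: "\<forall>k. \<exists>n1. \<forall>n\<ge>n1. Y ((N ^^ k) v) n w = 0" using V.lower_truncation by blast
  obtain n1 where n1: "\<forall>k. \<forall>n\<ge>n1 k. Y ((N ^^ k) v) n w = 0" using choice[OF ex] by blast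
  define n2 where "n2 = Max (n1 ` {..K})"
  have n: "Y ((N ^^ k) v) n w = 0" if "n \<ge> n2" for k n
  proof (cases "k \<le> K")
    case True then have "n1 k \<le> n2" unfolding n2_def by (intro Max_ge) auto
    then have "n \<ge> n1 k" using that by (rule order_trans)
    then show ?thesis using n1 by blast
  qed (use K in auto)
  let ?U = "{z. \<forall>j. \<forall>n\<ge>n2. Y ((N ^^ j) z) n w = 0}"
  have U: "V.subspace ?U"
  proof (rule V.subspaceI)
    show "0 \<in> ?U" by (simp add: lin_zero[OF lin_funpow[OF N_lin]])
    show "x + x' \<in> ?U" if "x \<in> ?U" "x' \<in> ?U" for x x'
      using that by (simp add: lin_add[OF lin_funpow[OF N_lin]] V.Y_add)
    show "s c x \<in> ?U" if "x \<in> ?U" for c x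
      using that by (simp add: lin_scale[OF lin_funpow[OF N_lin]] V.Y_scale)
  qed
  have UN: "N x \<in> ?U" if "x \<in> ?U" for x
  proof -
    have "Y ((N ^^ j) (N x)) n w = 0" if "n \<ge> n2" for j n
    proof -
      have "Y ((N ^^ Suc j) x) n w = 0" using \<open>x \<in> ?U\<close> that by blast
      then show ?thesis by (simp only: funpow_Suc_right o_apply)
    qed
    then show ?thesis by blast
  qed
  have "V.obinom (\<lambda>x. N x + s c x) i v \<in> ?U" for i
  proof (rule V.subspace_obinom[OF U])
    show "N x + s c x \<in> ?U" if "x \<in> ?U" for x
      by (rule V.subspace_add[OF U UN[OF that] V.subspace_scale[OF U that]])
    show "v \<in> ?U" using n by blast
  qed
  then have "Y ((N ^^ 0) (V.obinom (\<lambda>x. N x + s c x) i v)) n w = 0" if "n \<ge> n2" for i n using that by blast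
  then show ?thesis by auto
qed

definition rhs_term :: "'v \<Rightarrow> 'v \<Rightarrow> int \<Rightarrow> complex \<Rightarrow> nat \<Rightarrow> complex \<Rightarrow> nat \<Rightarrow> 'w \<Rightarrow> int \<times> nat \<times> nat \<times> complex \<Rightarrow> 'w" where
  "rhs_term v\<^sub>1 v\<^sub>2 l a j b k w = (\<lambda>(m::int, i::nat, i'::nat, c::complex). \<Sum>r\<le>k.
         t (of_int m gchoose i)
           (YL (Y (quotient_powr s h i' (a + of_int m + 1) j c r v\<^sub>1) (l + int i + int i') v\<^sub>2)
             (b - of_int m + of_nat i - c) (k - r) w))"

text \<open>As \<open>N\<close> is a derivation, \<open>e\<^bsup>- N log x\<^esup> (Y(e\<^bsup>N log x\<^esup> p) q) = Y(p) (e\<^bsup>- N log x\<^esup> q)\<close>; this is the coefficient of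
  \<open>(log x)\<^bsup>k\<^esup>\<close>.\<close>

lemma log_conjugation:
  "(\<Sum>r\<le>k. M (k - r) (Y (V.dpow r N p) n q)) = Y p n (M k q)"
proof -
  let ?N = "\<lambda>x. - N x"
  have lN: "V.lin ?N" by (rule lin_uminus[OF N_lin])
  have der: "?N (Y v n w) = Y (?N v) n w + Y v n (?N w)" for v w
    by (simp add: N_derivation V.Y_neg)
  have e: "M (k - r) (Y (V.dpow r N p) n q) = (\<Sum>i\<le>k-r. Y (M i (V.dpow r N p)) n (M (k - r - i) q))" for r
    by (rule bilinear_product.dpow_leibniz[OF V.bilinear_mode[of n], where D="?N" and D'="?N", OF lN lN der])
  have z: "(\<Sum>i\<le>k. M i (V.dpow (k - i) N p)) = (if k = 0 then p else 0)" for k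
  proof -
    have "(\<Sum>i\<le>k. M i (V.dpow (k - i) N p)) = V.dpow k (\<lambda>x. ?N x + N x) p"
      by (rule V.dpow_add[symmetric, OF lN N_lin]) (simp add: lin_neg[OF N_lin])
    also have "\<dots> = (if k = 0 then p else 0)" by (cases k) auto
    finally show ?thesis .
  qed
  have "(\<Sum>r\<le>k. M (k - r) (Y (V.dpow r N p) n q)) = (\<Sum>r\<le>k. \<Sum>i\<le>k-r. Y (M i (V.dpow r N p)) n (M (k - (r + i)) q))"
    unfolding e by simp
  also have "\<dots> = (\<Sum>e\<le>k. \<Sum>i\<le>e. Y (M i (V.dpow (e - i) N p)) n (M (k - (e - i + i)) q))"
    by (rule triangle_diagonal[where f="\<lambda>i r. Y (M i (V.dpow r N p)) n (M (k - (r + i)) q)"])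
  also have "\<dots> = (\<Sum>e\<le>k. \<Sum>i\<le>e. Y (M i (V.dpow (e - i) N p)) n (M (k - e) q))"
    by (intro sum.cong refl) simp
  also have "\<dots> = (\<Sum>e\<le>k. Y (\<Sum>i\<le>e. M i (V.dpow (e - i) N p)) n (M (k - e) q))"
    by (simp only: V.Y_sum)
  also have "\<dots> = (\<Sum>e\<le>k. if e = 0 then Y p n (M k q) else 0)"
    unfolding z by (intro sum.cong refl) auto
  finally show ?thesis by simp
qed

text \<open>For an eigenvector of \<open>\<S>\<^sub>h\<close> the index \<open>m\<close> of the delta function is forced by \<open>a + m + 1 = - \<alpha>\<close>, the exponent
  \<open>c\<close> by \<open>c = \<alpha> - i'\<close>, and the logarithms disappear by \<open>log_conjugation\<close>.  The remaining sum over \<open>i\<close> and \<open>i'\<close>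
  with \<open>i + i' = I\<close> is the Vandermonde expansion of \<open>binom(m + (N + \<alpha>), I) = binom(N - a - 1, I)\<close>.\<close>

lemma rhs_eigen:
  assumes v: "v\<^sub>1 \<in> ES \<alpha>"
  shows "finite {p. rhs_term v\<^sub>1 v\<^sub>2 l a j b k w p \<noteq> 0}"
    and "Sum_any (rhs_term v\<^sub>1 v\<^sub>2 l a j b k w) = (if a + \<alpha> \<in> \<int> then
      Sum_any (\<lambda>i::nat. y (Y (V.obinom (\<lambda>x. N x - s (a + 1) x) i (M j v\<^sub>1)) (l + int i) (M k v\<^sub>2)) (a + b + 1 + of_nat i) w) else 0)"
proof -
  let ?x = "M j v\<^sub>1" and ?z = "M k v\<^sub>2"
  let ?O = "\<lambda>x. N x + s \<alpha> x"
  let ?F = "rhs_term v\<^sub>1 v\<^sub>2 l a j b k w"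
  have lO: "V.lin ?O" by (intro lin_plus N_lin V.lin_scaleV)
  have NO: "V.obinom ?O i (V.dpow r N x) = V.dpow r N (V.obinom ?O i x)" for i r x
    by (rule V.obinom_commute[where C="V.dpow r N", OF V.lin_dpow[OF N_lin]])
      (simp add: lin_scale[OF N_lin] lin_scale[OF lin_funpow[OF N_lin]] lin_add[OF lin_funpow[OF N_lin]] V.scale_right_distrib funpow_swap1 mult.commute)
  let ?G = "\<lambda>m i i'. t (of_int m gchoose i) (y (Y (V.obinom ?O i' ?x) (l + int (i + i')) ?z) (a + b + 1 + of_nat (i + i')) w)"
  have F: "?F (m,i,i',c) = (if a + of_int m + 1 = - \<alpha> \<and> c = \<alpha> - of_nat i' then ?G m i i' else 0)" for m i i' c
  proof (cases "a + of_int m + 1 = - \<alpha> \<and> c = \<alpha> - of_nat i'")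
    case True
    have "\<alpha> = - (a + of_int m + 1)" using conjunct1[OF True] by (metis minus_minus)
    then have cc: "c = - (a + of_int m + 1) - of_nat i'" using conjunct2[OF True] by simp
    have c: "c + of_nat i' = \<alpha>" "b - of_int m + of_nat i - c = a + b + 1 + of_nat (i + i')"
      by (simp add: True) (simp add: cc)
    have "?F (m,i,i',c) = (\<Sum>r\<le>k. t (of_int m gchoose i) (y (M (k - r) (Y (V.dpow r N (V.obinom ?O i' ?x)) (l + int (i + i')) v\<^sub>2)) (a + b + 1 + of_nat (i + i')) w))"
      unfolding rhs_term_def prod.case quotient_powr_eigen[OF v] YL_def c(2)
      using True c(1) by (simp only: NO simp_thms if_True) (simp add: add.assoc)
    also have "\<dots> = ?G m i i'"
      by (simp only: W.scale_sum_right[symmetric] y_sum(1)[symmetric] log_conjugation)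
    finally show ?thesis using True by simp
  next
    case False
    then have "\<not> (a + of_int m + 1 = - \<alpha> \<and> c + of_nat i' = \<alpha>)" by auto
    then have "?F (m,i,i',c) = 0"
      unfolding rhs_term_def prod.case quotient_powr_eigen[OF v] by (simp only: if_False V.Y_0_left lin_zero[OF YL_lin_l] W.scale_zero_right sum.neutral_const)
    then show ?thesis unfolding if_not_P[OF False] .
  qed
  obtain n0 where n0: "\<And>n i. n \<ge> n0 \<Longrightarrow> Y (V.obinom ?O i ?x) n ?z = 0" using uniform_truncation by metis
  \<comment> \<open>with this bound \<open>i \<ge> K\<close> or \<open>i' \<ge> K\<close> implies \<open>l + i + i' \<ge> n0\<close>, so the sum is finite\<close>
  define K where "K = nat (n0 - l)"
  have G0: "?G m i i' = 0" if "i \<ge> K \<or> i' \<ge> K" for m i i'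
  proof -
    have "l + int (i + i') \<ge> n0" using that unfolding K_def by linarith
    from n0[OF this] show ?thesis by (simp only: y_zero W.scale_zero_right)
  qed
  show "finite {p. ?F p \<noteq> 0}"
    and "Sum_any ?F = (if a + \<alpha> \<in> \<int> then
      Sum_any (\<lambda>i::nat. y (Y (V.obinom (\<lambda>x. N x - s (a + 1) x) i ?x) (l + int i) ?z) (a + b + 1 + of_nat i) w) else 0)"
  proof (atomize (full), cases "a + \<alpha> \<in> \<int>")
    case False
    have "?F p = 0" for p
    proof (cases p)
      case (fields m i i' c)
      have "a + of_int m + 1 \<noteq> - \<alpha>"
      proof
        assume "a + of_int m + 1 = - \<alpha>"
        then have "\<alpha> = - (a + of_int m + 1)" by simp
        then have "a + \<alpha> = of_int (- m - 1)" by simp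
        then show False using False by simp
      qed
      then show ?thesis unfolding fields F by simp
    qed
    then show "finite {p. ?F p \<noteq> 0} \<and> Sum_any ?F = (if a + \<alpha> \<in> \<int> then
      Sum_any (\<lambda>i::nat. y (Y (V.obinom (\<lambda>x. N x - s (a + 1) x) i ?x) (l + int i) ?z) (a + b + 1 + of_nat i) w) else 0)" using False by simp
  next
    case True
    then obtain m' where "a + \<alpha> = of_int m'" by (auto elim: Ints_cases)
    define m where "m = - m' - 1"
    have m: "a + of_int m + 1 = - \<alpha>" "of_int m + \<alpha> = - (a + 1)"
    proof -
      have "\<alpha> = of_int m' - a" using \<open>a + \<alpha> = of_int m'\<close> by (metis add_diff_cancel_left')
      then show "a + of_int m + 1 = - \<alpha>" "of_int m + \<alpha> = - (a + 1)" unfolding m_def by auto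
    qed
    have uniq: "a + of_int m2 + 1 = - \<alpha> \<Longrightarrow> m2 = m" for m2 :: int using m(1) by (metis add_left_cancel add_right_cancel of_int_eq_iff)
    let ?e = "\<lambda>(i,i'). (m, i, i', \<alpha> - of_nat i')"
    let ?A = "?e ` ({..<K} \<times> {..<K})"
    have inj: "inj_on ?e ({..<K} \<times> {..<K})" by (auto simp: inj_on_def)
    have zero: "?F p = 0" if "p \<notin> ?A" for p
    proof (cases p)
      case (fields m2 i i' c)
      show ?thesis
      proof (cases "a + of_int m2 + 1 = - \<alpha> \<and> c = \<alpha> - of_nat i'")
        case True
        then have "p = ?e (i, i')" using uniq fields by simp
        have "(i, i') \<notin> {..<K} \<times> {..<K}"
        proof
          assume "(i, i') \<in> {..<K} \<times> {..<K}"
          then have "?e (i, i') \<in> ?A" by (rule imageI)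
          then show False using that \<open>p = ?e (i, i')\<close> by simp
        qed
        then have "i \<ge> K \<or> i' \<ge> K" by auto
        then show ?thesis unfolding fields F by (simp only: G0 if_cancel)
      qed (simp only: fields F if_False)
    qed
    have "{p. ?F p \<noteq> 0} \<subseteq> ?A" using zero by blast
    moreover have A: "finite ?A" by simp
    ultimately have fin: "finite {p. ?F p \<noteq> 0}" by (rule finite_subset)
    have "Sum_any ?F = sum ?F ?A" by (rule Sum_any_eq_sum[OF A zero])
    also have "\<dots> = (\<Sum>p\<in>{..<K} \<times> {..<K}. ?F (?e p))" by (simp only: sum.reindex[OF inj] o_def)
    also have "\<dots> = (\<Sum>(i,i')\<in>{..<K} \<times> {..<K}. ?G m i i')"
      by (intro sum.cong refl) (clarsimp simp only: F m(1) simp_thms if_True prod.case)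
    also have "\<dots> = (\<Sum>i<K. \<Sum>i'<K. ?G m i i')" by (rule sum.cartesian_product[symmetric])
    also have "\<dots> = Sum_any (\<lambda>I. \<Sum>i\<le>I. ?G m i (I - i))"
      by (rule V.Sum_any_convolution(1)[where K=K and L=K, symmetric]) (rule G0)
    also have "\<dots> = Sum_any (\<lambda>I::nat. y (Y (V.obinom (\<lambda>x. N x - s (a + 1) x) I ?x) (l + int I) ?z) (a + b + 1 + of_nat I) w)"
    proof (rule Sum_any.cong)
      fix I :: nat
      let ?P = "\<lambda>x. s (of_int m) x"
      have e: "(\<lambda>x. N x - s (a + 1) x) = (\<lambda>x. ?P x + ?O x)"
      proof
        fix x
        have "?P x + ?O x = N x + s (of_int m + \<alpha>) x" by (simp add: V.scale_left_distrib)
        also have "\<dots> = N x - s (a + 1) x" unfolding m(2) V.scale_minus_left by simp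
        finally show "N x - s (a + 1) x = ?P x + ?O x" by simp
      qed
      have "V.obinom (\<lambda>x. N x - s (a + 1) x) I ?x = (\<Sum>i\<le>I. V.obinom ?P i (V.obinom ?O (I - i) ?x))"
        unfolding e by (rule V.obinom_vandermonde[OF V.lin_scaleV lO]) (rule lin_scale[OF lO, symmetric])
      also have "\<dots> = (\<Sum>i\<le>I. s (of_int m gchoose i) (V.obinom ?O (I - i) ?x))"
        by (intro sum.cong refl V.obinom_eigen[OF V.lin_scaleV])
      finally have ob: "V.obinom (\<lambda>x. N x - s (a + 1) x) I ?x = (\<Sum>i\<le>I. s (of_int m gchoose i) (V.obinom ?O (I - i) ?x))" .
      show "(\<Sum>i\<le>I. ?G m i (I - i)) = y (Y (V.obinom (\<lambda>x. N x - s (a + 1) x) I ?x) (l + int I) ?z) (a + b + 1 + of_nat I) w"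
        unfolding ob V.Y_sum y_sum V.Y_scale(1)[where c="of_int m gchoose _"] y_scale(1)[where c="of_int m gchoose _"]
        by simp
    qed
    finally show "finite {p. ?F p \<noteq> 0} \<and> Sum_any ?F = (if a + \<alpha> \<in> \<int> then
      Sum_any (\<lambda>i::nat. y (Y (V.obinom (\<lambda>x. N x - s (a + 1) x) i ?x) (l + int i) ?z) (a + b + 1 + of_nat i) w) else 0)"
      using fin True by simp
  qed
qed

end

lemma finite_Re_ge:
  fixes b :: complex assumes "\<And>i::nat. Re b - real i < B \<Longrightarrow> f i = 0" shows "finite {i. f i \<noteq> 0}"
proof (rule finite_subset)
  show "{i. f i \<noteq> 0} \<subseteq> {..nat \<lceil>Re b - B\<rceil>}"
  proof
    fix i assume "i \<in> {i. f i \<noteq> 0}"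
    then have "\<not> Re b - real i < B" using assms by blast
    then show "i \<in> {..nat \<lceil>Re b - B\<rceil>}" by simp linarith
  qed
qed simp

context twisted_family begin

definition lhs_term1 :: "'v \<Rightarrow> 'v \<Rightarrow> int \<Rightarrow> complex \<Rightarrow> nat \<Rightarrow> complex \<Rightarrow> nat \<Rightarrow> 'w \<Rightarrow> nat \<Rightarrow> 'w" where
  "lhs_term1 v\<^sub>1 v\<^sub>2 l a j b k w = (\<lambda>i. t ((of_int l gchoose i) * (-1) ^ i)
         (YL v\<^sub>1 (a - of_int l + of_nat i) j (YL v\<^sub>2 (b - of_nat i) k w)))"

definition lhs_term2 :: "'v \<Rightarrow> 'v \<Rightarrow> int \<Rightarrow> complex \<Rightarrow> nat \<Rightarrow> complex \<Rightarrow> nat \<Rightarrow> 'w \<Rightarrow> nat \<Rightarrow> 'w" where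
  "lhs_term2 v\<^sub>1 v\<^sub>2 l a j b k w = (\<lambda>i. t ((of_int l gchoose i) * (-1) powi (l - int i))
         (YL v\<^sub>2 (b - of_int l + of_nat i) k (YL v\<^sub>1 (a - of_nat i) j w)))"

abbreviation lhs where "lhs v\<^sub>1 v\<^sub>2 l a j b k w \<equiv> Sum_any (lhs_term1 v\<^sub>1 v\<^sub>2 l a j b k w) - Sum_any (lhs_term2 v\<^sub>1 v\<^sub>2 l a j b k w)"

lemma lhs_finite: "finite {i. lhs_term1 v\<^sub>1 v\<^sub>2 l a j b k w i \<noteq> 0}" "finite {i. lhs_term2 v\<^sub>1 v\<^sub>2 l a j b k w i \<noteq> 0}"
proof -
  obtain B where B: "\<And>n. Re n < B \<Longrightarrow> y (M k v\<^sub>2) n w = 0" using y_trunc by blast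
  show "finite {i. lhs_term1 v\<^sub>1 v\<^sub>2 l a j b k w i \<noteq> 0}"
    by (rule finite_Re_ge[of b B]) (simp add: lhs_term1_def YL_def B y_zero)
  obtain C where C: "\<And>n. Re n < C \<Longrightarrow> y (M j v\<^sub>1) n w = 0" using y_trunc by blast
  show "finite {i. lhs_term2 v\<^sub>1 v\<^sub>2 l a j b k w i \<noteq> 0}"
    by (rule finite_Re_ge[of a C]) (simp add: lhs_term2_def YL_def C y_zero)
qed

end

text \<open>The Jacobi identity of a twisted module at \<open>(log x\<^sub>1)\<^bsup>0\<^esup> (log x\<^sub>2)\<^bsup>0\<^esup>\<close>, for \<open>v\<^sub>1\<close> an eigenvector of \<open>\<S>\<^sub>h\<close> and with the
  right-hand side simplified as in \<open>rhs_eigen\<close>.  The other exponents \<open>a\<close> carry no condition: both sides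
  vanish there by the support condition.\<close>

locale twisted_core = twisted_family s Y vac \<omega> t h y
  for s :: "complex \<Rightarrow> 'v::ab_group_add \<Rightarrow> 'v" and Y vac \<omega>
    and t :: "complex \<Rightarrow> 'w::ab_group_add \<Rightarrow> 'w" and h y +
  assumes y_vac: "y vac n w = (if n = 0 then w else 0)"
    and y_jacobi: "v\<^sub>1 \<in> eigenspace s (S_op s h) \<alpha> \<Longrightarrow> a + \<alpha> \<in> \<int> \<Longrightarrow>
      Sum_any (\<lambda>i::nat. t ((of_int l gchoose i) * (-1) ^ i) (y v\<^sub>1 (a - of_int l + of_nat i) (y v\<^sub>2 (b - of_nat i) w)))
    - Sum_any (\<lambda>i::nat. t ((of_int l gchoose i) * (-1) powi (l - int i)) (y v\<^sub>2 (b - of_int l + of_nat i) (y v\<^sub>1 (a - of_nat i) w)))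
    = Sum_any (\<lambda>i::nat. y (Y (op_gbinomial s (\<lambda>x. N_op s h x - s (a + 1) x) i v\<^sub>1) (l + int i) v\<^sub>2) (a + b + 1 + of_nat i) w)"
begin

text \<open>At \<open>(log x\<^sub>1)\<^bsup>j\<^esup> (log x\<^sub>2)\<^bsup>k\<^esup>\<close> and for an eigenvector \<open>v\<^sub>1\<close> of \<open>\<S>\<^sub>h\<close> this is the identity without logarithms for
  the vectors \<open>(-N)\<^bsup>j\<^esup> v\<^sub>1 / j!\<close> and \<open>(-N)\<^bsup>k\<^esup> v\<^sub>2 / k!\<close>.\<close>

lemma YL_jacobi: "lhs v\<^sub>1 v\<^sub>2 l a j b k w = Sum_any (rhs_term v\<^sub>1 v\<^sub>2 l a j b k w)"
proof -
  let ?J = "\<lambda>v. finite {p. rhs_term v v\<^sub>2 l a j b k w p \<noteq> 0} \<and> lhs v v\<^sub>2 l a j b k w = Sum_any (rhs_term v v\<^sub>2 l a j b k w)"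
  have "?J v\<^sub>1"
  proof (induction v\<^sub>1 rule: S_induct)
    case (ES \<alpha> v)
    note M = ES_M[OF ES, of j]
    show ?case
    proof (intro conjI rhs_eigen(1)[OF ES])
      show "lhs v v\<^sub>2 l a j b k w = Sum_any (rhs_term v v\<^sub>2 l a j b k w)"
      proof (cases "a + \<alpha> \<in> \<int>")
        case True
        then show ?thesis using y_jacobi[OF M True, of l "M k v\<^sub>2" b w]
          unfolding rhs_eigen(2)[OF ES] lhs_term1_def lhs_term2_def YL_def by simp
      next
        case False
        have z: "y (M j v) (a + of_int m) x = 0" for m x
        proof (rule y_supp[OF M])
          show "a + of_int m + \<alpha> \<notin> \<int>"
          proof
            assume "a + of_int m + \<alpha> \<in> \<int>"
            then have "a + of_int m + \<alpha> - of_int m \<in> \<int>" by (intro Ints_diff) auto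
            then show False using False by simp
          qed
        qed
        have "lhs_term1 v v\<^sub>2 l a j b k w = (\<lambda>_. 0)"
          using z[of "int i - l" for i] by (auto simp: lhs_term1_def YL_def fun_eq_iff algebra_simps)
        moreover have "lhs_term2 v v\<^sub>2 l a j b k w = (\<lambda>_. 0)"
          using z[of "- int i" for i] by (auto simp: lhs_term2_def YL_def fun_eq_iff y_zero)
        ultimately show ?thesis using False rhs_eigen(2)[OF ES, of v\<^sub>2 l a j b k w] by simp
      qed
    qed
  next
    case (add x z)
    have a1: "lhs_term1 (x + z) v\<^sub>2 l a j b k w = (\<lambda>i. lhs_term1 x v\<^sub>2 l a j b k w i + lhs_term1 z v\<^sub>2 l a j b k w i)"
      by (auto simp: lhs_term1_def fun_eq_iff lin_add[OF YL_lin_l] W.scale_right_distrib)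
    have a2: "lhs_term2 (x + z) v\<^sub>2 l a j b k w = (\<lambda>i. lhs_term2 x v\<^sub>2 l a j b k w i + lhs_term2 z v\<^sub>2 l a j b k w i)"
      by (auto simp: lhs_term2_def fun_eq_iff lin_add[OF YL_lin_l] lin_add[OF YL_lin_r] W.scale_right_distrib)
    have q: "quotient_powr s h i d j c r (x + z) = quotient_powr s h i d j c r x + quotient_powr s h i d j c r z" for i d c r
    proof -
      have L: "V.lin (L_op s h)" unfolding L_op_def[abs_def] by (intro lin_plus S_lin N_lin)
      show ?thesis unfolding quotient_powr_def op_powr_def
        by (simp add: lin_add[OF V.lin_obinom[OF L]] lin_add[OF V.component_linear[OF S_direct]] lin_add[OF V.component_linear[OF neg_S_direct]]
           lin_add[OF lin_funpow[OF N_lin]] lin_add[OF lin_funpow[OF lin_uminus[OF N_lin]]] V.scale_right_distrib)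
    qed
    have a3: "rhs_term (x + z) v\<^sub>2 l a j b k w = (\<lambda>p. rhs_term x v\<^sub>2 l a j b k w p + rhs_term z v\<^sub>2 l a j b k w p)"
      by (auto simp: rhs_term_def fun_eq_iff q V.Y_add lin_add[OF YL_lin_l] W.scale_right_distrib sum.distrib)
    from add have fin: "finite {p. rhs_term x v\<^sub>2 l a j b k w p \<noteq> 0}" "finite {p. rhs_term z v\<^sub>2 l a j b k w p \<noteq> 0}" by auto
    show ?case
      unfolding a1 a2 a3 V.Sum_any_add_fin(1)[OF lhs_finite(1) lhs_finite(1)] V.Sum_any_add_fin(1)[OF lhs_finite(2) lhs_finite(2)] V.Sum_any_add_fin(1)[OF fin]
      using add V.Sum_any_add_fin(2)[OF fin] by (simp add: add_diff_add)
  qed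
  then show ?thesis by simp
qed

lemma M_commute: "V.lin C \<Longrightarrow> (\<And>x. N (C x) = C (N x)) \<Longrightarrow> M k (C x) = C (M k x)"
proof -
  assume C: "V.lin C" "\<And>x. N (C x) = C (N x)"
  have "((\<lambda>x. - N x) ^^ k) (C x) = C (((\<lambda>x. - N x) ^^ k) x)"
    by (rule funpow_commute_op) (simp add: C lin_neg[OF C(1)])
  then show ?thesis by (simp add: lin_scale[OF C(1)])
qed

lemma YL_log_polynomial: "\<exists>K. \<forall>n. \<forall>k>K. YL v n k w = 0"
proof -
  obtain K where "\<And>k. k \<ge> K \<Longrightarrow> ((\<lambda>x. - N x) ^^ k) v = 0" using V.nilpE[OF V.nilp_neg[OF N_nilp]] by metis
  then show ?thesis by (intro exI[of _ K]) (simp add: YL_def y_zero)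
qed

lemma YL_truncation: "\<exists>B. \<forall>n k. Re n < B \<longrightarrow> YL v n k w = 0"
proof -
  obtain K where K: "\<And>k. k \<ge> K \<Longrightarrow> ((\<lambda>x. - N x) ^^ k) v = 0" using V.nilpE[OF V.nilp_neg[OF N_nilp]] by metis
  have ex: "\<forall>k. \<exists>B. \<forall>n. Re n < B \<longrightarrow> y (M k v) n w = 0" using y_trunc by blast
  obtain B where B: "\<forall>k n. Re n < B k \<longrightarrow> y (M k v) n w = 0" using choice[OF ex] by blast
  define C where "C = Min (B ` {..K})"
  have "YL v n k w = 0" if "Re n < C" for n k
  proof (cases "k \<le> K")
    case True
    then have "C \<le> B k" unfolding C_def by (intro Min_le) auto
    then have "Re n < B k" using that by linarith
    then show ?thesis unfolding YL_def using B by blast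
  qed (simp add: K YL_def y_zero)
  then show ?thesis by blast
qed

lemma vac_fixed: "N vac = 0" "vac \<in> ES 0" and omega_fixed: "N \<omega> = 0" "\<omega> \<in> ES 0"
  using V.N_op_fixed[OF h_props(3,2,7)] V.N_op_fixed[OF h_props(3,2,8)] V.S_op_eigenspace[OF h_props(3,2), of 0] by auto

lemma M_fixed: "N v = 0 \<Longrightarrow> M k v = (if k = 0 then v else 0)"
proof (induction k)
  case (Suc k)
  have "((\<lambda>x. - N x) ^^ Suc k) v = ((\<lambda>x. - N x) ^^ k) 0"
    by (simp only: funpow_Suc_right o_apply Suc.prems minus_zero)
  then have "((\<lambda>x. - N x) ^^ Suc k) v = 0" by (simp only: lin_zero[OF lin_funpow[OF lin_uminus[OF N_lin]]])
  then show ?case by (simp del: funpow.simps)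
qed simp

lemma YL_identity: "YL vac n k w = (if n = 0 \<and> k = 0 then w else 0)"
  unfolding YL_def M_fixed[OF vac_fixed(1)] by (simp add: y_zero y_vac)

text \<open>The Jacobi identity with \<open>v\<^sub>2 = \<one>\<close>, \<open>l = -2\<close>, \<open>b = 0\<close>: on the left only \<open>y(v, a + 2)\<close> survives, and on the right
  only \<open>v\<^bsub>-2\<^esub> \<one> = L(-1) v\<close> for \<open>i = 0\<close> and \<open>((N - a - 1) v)\<^bsub>-1\<^esub> \<one>\<close> for \<open>i = 1\<close>.\<close>

lemma y_derivative: "y (Y \<omega> 0 v) n w = t (n + 1) (y v (n + 1) w) - y (N v) (n + 1) w"
proof (induction v rule: S_induct)
  case (ES \<alpha> v)
  have hL: "h (Y \<omega> n x) = Y \<omega> n (h x)" for n x by (simp add: h_props(4,8))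
  have SL: "S (Y \<omega> 0 x) = Y \<omega> 0 (S x)" for x
    by (rule V.S_op_commute[where h=h and C="Y \<omega> 0", OF h_props(3,2) V.linear_right]) (simp add: hL)
  show ?case
  proof (cases "n + \<alpha> \<in> \<int>")
    case False
    then have "n + 1 + \<alpha> \<notin> \<int>" using Ints_diff[of "n + 1 + \<alpha>" 1] by auto
    then show ?thesis using y_supp[OF ES] y_supp[OF ES_N[OF ES]]
        y_supp[OF ES_commute[where C="Y \<omega> 0", OF V.linear_right SL ES] False] by simp
  next
    case True
    \<comment> \<open>the term \<open>L(-1) v\<close> on the right appears at the exponent \<open>a + b + 1 = n\<close>\<close>
    define a where "a = n - 1"
    have a: "a + \<alpha> \<in> \<int>" "n = a + 1" using True Ints_diff[of "n + \<alpha>" 1] by (auto simp: a_def algebra_simps)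
    let ?B = "\<lambda>i. V.obinom (\<lambda>x. N x - s (a + 1) x) i v"
    have L1: "Sum_any (\<lambda>i::nat. t ((of_int (-2) gchoose i) * (-1) ^ i) (y v (a - of_int (-2) + of_nat i) (y vac (0 - of_nat i) w)))
      = y v (a + 2) w"
      by (subst Sum_any_eq_sum[of "{0}"]) (auto simp: y_vac y_zero)
    have L2: "Sum_any (\<lambda>i::nat. t ((of_int (-2) gchoose i) * (-1) powi (-2 - int i)) (y vac (0 - of_int (-2) + of_nat i) (y v (a - of_nat i) w))) = 0"
    proof -
      have "(0 - of_int (-2) + of_nat i :: complex) \<noteq> 0" for i
      proof -
        have "(0 - of_int (-2) + of_nat i :: complex) = of_nat (i + 2)" by simp
        then show ?thesis by (metis of_nat_eq_0_iff add_is_0 zero_neq_numeral)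
      qed
      then show ?thesis by (simp add: y_vac)
    qed
    have R: "Sum_any (\<lambda>i::nat. y (Y (?B i) (-2 + int i) vac) (a + 0 + 1 + of_nat i) w)
      = y (Y \<omega> 0 v) (a + 1) w + y (N v - s (a + 1) v) (a + 2) w"
    proof (subst Sum_any_eq_sum[of "{0,1}"])
      fix i :: nat assume "i \<notin> {0,1}"
      then have "-2 + int i \<ge> 0" by auto
      then show "y (Y (?B i) (-2 + int i) vac) (a + 0 + 1 + of_nat i) w = 0" by (simp add: V.creation y_zero)
    qed (auto simp: V.creation V.creation_minus2 add.commute)
    have "y v (a + 2) w = y (Y \<omega> 0 v) (a + 1) w + y (N v - s (a + 1) v) (a + 2) w"
      using y_jacobi[OF ES a(1), of "-2" vac 0 w] unfolding L1 L2 R by simp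
    moreover have "y (N v - s (a + 1) v) (a + 2) w = y (N v) (a + 2) w - t (a + 1) (y v (a + 2) w)"
      by (simp only: y_diff y_scale)
    moreover have "t (a + 1 + 1) x = t (a + 1) x + x" for x by (simp only: W.scale_left_distrib W.scale_one)
    moreover have "a + 1 + 1 = a + 2" by simp
    ultimately show ?thesis unfolding a(2) by (simp only:) (simp add: algebra_simps)
  qed
next
  case (add x z)
  then show ?case by (simp add: V.Y_add y_add lin_add[OF N_lin] W.scale_right_distrib)
qed

lemma YL_derivative:
  "YL (Lop Y \<omega> (-1) v) n k w = t (n + 1) (YL v (n + 1) k w) + t (of_nat (k + 1)) (YL v (n + 1) (k + 1) w)"
proof -
  have "M k (Y \<omega> 0 v) = Y \<omega> 0 (M k v)" by (rule M_commute[OF V.linear_right]) (rule h_props(6))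
  then have "YL (Lop Y \<omega> (-1) v) n k w = t (n + 1) (YL v (n + 1) k w) - y (N (M k v)) (n + 1) w"
    by (simp add: YL_def Lop_def y_derivative)
  moreover have "y (N (M k v)) (n + 1) w = - t (of_nat (k + 1)) (YL v (n + 1) (k + 1) w)"
  proof -
    have "- N (M k v) = s (of_nat (Suc k)) (M (Suc k) v)" by (rule V.dpow_Suc[OF lin_uminus[OF N_lin], symmetric])
    then have "N (M k v) = - s (of_nat (Suc k)) (M (Suc k) v)" by (metis minus_minus)
    then show ?thesis unfolding YL_def by (simp only: lin_neg[OF y_l] Suc_eq_plus1 y_scale(1)[where c="of_nat (k + 1)"])
  qed
  ultimately show ?thesis by simp
qed

abbreviation L0 :: "'w \<Rightarrow> 'w" where "L0 \<equiv> y \<omega> (-2)"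

lemma L0_lin: "W.lin L0" by (rule y_r)

lemma sum_l0: "Sum_any (\<lambda>i::nat. t ((of_int 0 gchoose i) * c i) (x i)) = t (c 0) (x 0)"
  by (subst Sum_any_eq_sum[of "{0}"]) (auto simp: gbinomial_0_left)

text \<open>The Jacobi identity with \<open>v\<^sub>1 = \<omega>\<close>, \<open>a = -2\<close>, \<open>l = 0\<close>.  As \<open>N \<omega> = 0\<close>, the binomial \<open>binom(N + 1, i)\<close> leaves the
  terms \<open>i = 0\<close> and \<open>i = 1\<close> on the right.\<close>

lemma L0_bracket: "L0 (y v b w) = y v b (L0 w) + y (Y \<omega> 0 v) (b - 1) w + y (Y \<omega> 1 v) b w"
proof -
  have N0: "V.obinom (\<lambda>x. N x - s (-2 + 1) x) i \<omega> = s (1 gchoose i) \<omega>" for i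
  proof (rule V.obinom_eigen)
    show "V.lin (\<lambda>x. N x - s (-2 + 1) x)" by (intro lin_minus N_lin V.lin_scaleV)
  qed (simp add: omega_fixed(1))
  have g: "(1 gchoose i :: complex) = 0" if "i \<ge> 2" for i
  proof -
    have "(of_nat 1 gchoose i :: complex) = of_nat (1 choose i)" by (rule binomial_gbinomial[symmetric])
    then show ?thesis using that by (simp add: binomial_eq_0)
  qed
  have "Sum_any (\<lambda>i::nat. y (Y (V.obinom (\<lambda>x. N x - s (-2 + 1) x) i \<omega>) (0 + int i) v) (-2 + b + 1 + of_nat i) w)
     = y (Y \<omega> 0 v) (b - 1) w + y (Y \<omega> 1 v) b w"
    unfolding N0 by (subst Sum_any_eq_sum[of "{0,1}"]) (auto simp: g y_zero algebra_simps)
  then show ?thesis using y_jacobi[OF omega_fixed(2), of "-2" 0 v b w]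
    unfolding sum_l0[of "\<lambda>i. (-1)^i"] sum_l0[of "\<lambda>i. (-1) powi (0 - int i)"] by (simp add: algebra_simps)
qed

text \<open>Inserting \<open>y_derivative\<close> into \<open>L0_bracket\<close> shows that \<open>L(0)\<close> on \<open>W\<close> and \<open>L(0) - N + b\<close> on \<open>V\<close> form a derivation of
  the product \<open>y v b w\<close>, and \<open>N\<close> is locally nilpotent and commutes with \<open>L(0)\<close>.\<close>

lemma L0_homogeneous:
  assumes v: "v \<in> V.ge (Y \<omega> 1) d" and w: "w \<in> W.ge L0 c" shows "y v b w \<in> W.ge L0 (c + d + b)"
proof -
  let ?D = "\<lambda>x. Y \<omega> 1 x - N x + s b x"
  have D: "V.lin ?D" by (intro lin_plus lin_minus V.linear_right N_lin V.lin_scaleV)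
  have der: "L0 (y v b w) = y (?D v) b w + y v b (L0 w)" for v w
    unfolding L0_bracket y_derivative by (simp add: y_add y_diff y_scale)
  obtain K where "(N ^^ K) v = 0" using V.nilpE[OF N_nilp] by blast
  then have "v \<in> V.ge N 0" by (intro V.geI[where K=K]) simp
  then have "v \<in> V.ge ?D (d - 0 + b)"
    by (intro V.ge_minus[where A="Y \<omega> 1" and B=N] v V.linear_right N_lin) (simp add: h_props(6))
  moreover have "bilinear_product s t (\<lambda>v w. y v b w)"
    by (intro bilinear_product.intro bilinear_product_axioms.intro y_l y_r V.complex_vector_space_axioms W.complex_vector_space_axioms)
  ultimately have "y v b w \<in> W.ge L0 (d + b + c)"
    using bilinear_product.derivation_ge[where B="\<lambda>v w. y v b w" and D="?D" and D'=L0 and b=c, OF _ D L0_lin der _ w] by simp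
  then show ?thesis by (simp add: add_ac)
qed

lemma Y1_triangulable: "V.triangulable (Y \<omega> 1)"
  by (rule V.wt_triangulable[OF V.linear_right]) simp

lemma h_omega: "h (Y \<omega> n x) = Y \<omega> n (h x)" by (simp add: h_props(4,8))

lemma S_omega: "S (Y \<omega> n x) = Y \<omega> n (S x)"
  by (rule V.S_op_commute[where h=h and C="Y \<omega> n", OF h_props(3,2) V.linear_right h_omega])

context
  fixes C :: "'w \<Rightarrow> 'w" and m :: complex
  assumes tri: "W.triangulable L0" and C_def: "C = component UNIV (W.ge L0) m"
begin

lemma C_lin: "W.lin C"
  unfolding C_def by (rule W.component_linear[OF W.triangulable_direct_sum[OF tri]])

text \<open>The component of weight \<open>m\<close> of \<open>Y\<^sub>W(v, x) w\<close> at \<open>log x = l\<close>; the branches in the equivariance axiom are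
  the values \<open>l = l\<^sub>p(z)\<close>.\<close>

definition eval_log :: "complex \<Rightarrow> 'v \<Rightarrow> 'w \<Rightarrow> 'w" where
  "eval_log l v w = Sum_any (\<lambda>(n, k). t (exp (n * l) * l ^ k) (C (YL v n k w)))"

text \<open>By \<open>L0_homogeneous\<close> only the exponent \<open>m - c - d\<close> contributes to the weight \<open>m\<close>, and the sum over the powers of
  \<open>l\<close> is the exponential series of \<open>- l N\<close>.\<close>

lemma eval_log_eigen:
  assumes v: "v \<in> V.ge (Y \<omega> 1) d" and w: "w \<in> W.ge L0 c"
  shows "finite {(n, k). C (YL v n k w) \<noteq> 0}"
    and "eval_log l v w = t (exp ((m - c - d) * l)) (C (y (V.ps_op (fps_exp (- l)) N v) (m - c - d) w))"
proof -
  let ?n = "m - c - d"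
  obtain K where K: "\<And>k. k \<ge> K \<Longrightarrow> ((\<lambda>x. - N x) ^^ k) v = 0" using V.nilpE[OF V.nilp_neg[OF N_nilp]] by metis
  have Mv: "M k v \<in> V.ge (Y \<omega> 1) d" for k
  proof -
    have "Y \<omega> 1 (M k x) = M k (Y \<omega> 1 x)" for x by (rule M_commute[symmetric, OF V.linear_right]) (rule h_props(6))
    then show ?thesis by (rule V.ge_commute[where T="Y \<omega> 1" and S="M k", OF M_lin _ v])
  qed
  have z: "C (YL v n k w) = 0" if "n \<noteq> ?n" for n k
    using W.component_self[OF W.triangulable_direct_sum[OF tri] UNIV_I L0_homogeneous[OF Mv[of k] w, of n], of m] that
    by (auto simp: C_def YL_def algebra_simps)
  have z2: "C (YL v n k w) = 0" if "k \<ge> K" for n k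
    using K[OF that] by (simp add: YL_def y_zero lin_zero[OF C_lin])
  have sub: "{(n, k). C (YL v n k w) \<noteq> 0} \<subseteq> {?n} \<times> {..<K}"
  proof clarify
    fix n k assume "C (YL v n k w) \<noteq> 0"
    then show "n \<in> {?n} \<and> k \<in> {..<K}" using z[of n k] z2[of k n] by (cases "k < K") auto
  qed
  then show "finite {(n, k). C (YL v n k w) \<noteq> 0}" by (rule finite_subset) simp
  have "eval_log l v w = (\<Sum>(n, k)\<in>{?n} \<times> {..<K}. t (exp (n * l) * l ^ k) (C (YL v n k w)))"
    unfolding eval_log_def
  proof (rule Sum_any_eq_sum)
    fix p assume p: "p \<notin> {?n} \<times> {..<K}"
    obtain n k where nk: "p = (n, k)" by (cases p)
    then have "C (YL v n k w) = 0" using p z[of n k] z2[of k n] by (cases "n = ?n") auto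
    then show "(case p of (n, k) \<Rightarrow> t (exp (n * l) * l ^ k) (C (YL v n k w))) = 0" by (simp add: nk)
  qed simp
  also have "\<dots> = (\<Sum>k<K. t (exp (?n * l)) (C (y (s (l ^ k) (M k v)) ?n w)))"
    unfolding sum.cartesian_product[symmetric] YL_def
    by (simp only: y_scale(1)[where c="l ^ _"] lin_scale[OF C_lin, where c="l ^ _"] W.scale_scale sum.insert[OF finite.emptyI] sum.empty empty_iff not_False_eq_True add_0_right)
  also have "\<dots> = t (exp (?n * l)) (C (y (\<Sum>k<K. s (l ^ k) (M k v)) ?n w))"
    by (simp only: y_sum lin_sum[OF C_lin] W.scale_sum_right)
  also have "(\<Sum>k<K. s (l ^ k) (M k v)) = V.ps_op (fps_exp l) (\<lambda>x. - N x) v"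
    unfolding V.ps_op_exp_eq by (rule Sum_any_eq_sum[symmetric]) (simp_all add: K)
  also have "\<dots> = V.ps_op (fps_exp (- l)) N v" by (rule V.ps_op_exp_neg[OF N_lin])
  finally show "eval_log l v w = t (exp (?n * l)) (C (y (V.ps_op (fps_exp (- l)) N v) ?n w))" .
qed

lemma eval_log_add:
  assumes "finite {(n, k). C (YL v n k w) \<noteq> 0}" "finite {(n, k). C (YL v' n k w') \<noteq> 0}"
    and "\<And>n k. C (YL x n k z) = C (YL v n k w) + C (YL v' n k w')"
  shows "finite {(n, k). C (YL x n k z) \<noteq> 0}" "eval_log l x z = eval_log l v w + eval_log l v' w'"
proof -
  have "{(n, k). C (YL x n k z) \<noteq> 0} \<subseteq> {(n, k). C (YL v n k w) \<noteq> 0} \<union> {(n, k). C (YL v' n k w') \<noteq> 0}"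
    using assms(3) by auto
  then show "finite {(n, k). C (YL x n k z) \<noteq> 0}" by (rule finite_subset) (use assms in auto)
  let ?f = "\<lambda>v w. \<lambda>p::complex \<times> nat. case p of (n, k) \<Rightarrow> t (exp (n * l) * l ^ k) (C (YL v n k w))"
  have fin: "finite {p. ?f v w p \<noteq> 0}" if "finite {(n, k). C (YL v n k w) \<noteq> 0}" for v w
    by (rule finite_subset[OF _ that]) auto
  have "?f x z = (\<lambda>p. ?f v w p + ?f v' w' p)" by (auto simp: assms(3) W.scale_right_distrib)
  then have "eval_log l x z = Sum_any (\<lambda>p. ?f v w p + ?f v' w' p)" by (simp only: eval_log_def)
  also have "\<dots> = eval_log l v w + eval_log l v' w'"
    unfolding eval_log_def by (rule V.Sum_any_add_fin(1)[OF fin[OF assms(1)] fin[OF assms(2)]])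
  finally show "eval_log l x z = eval_log l v w + eval_log l v' w'" .
qed

text \<open>For \<open>\<S>\<^sub>h v = \<alpha> v\<close> one has \<open>h v = e\<^bsup>2\<pi>i\<alpha>\<^esup> e\<^bsup>2\<pi>iN\<^esup> v\<close>, while passing from \<open>l\<close> to \<open>l + 2\<pi>i\<close> multiplies the coefficient
  of exponent \<open>n\<close> by \<open>e\<^bsup>2\<pi>in\<^esup>\<close> and applies \<open>e\<^bsup>- 2\<pi>iN\<^esup>\<close> to \<open>v\<close>.  The factors cancel because \<open>n + \<alpha>\<close> is an
  integer wherever the coefficient is nonzero.\<close>

lemma eval_log_equivariance: "eval_log (l + 2 * pi * \<i>) (h v) w = eval_log l v w"
proof -
  let ?fin = "\<lambda>v w. finite {(n, k). C (YL v n k w) \<noteq> 0}"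
  let ?J = "\<lambda>v w. ?fin v w \<and> ?fin (h v) w \<and> eval_log (l + 2 * pi * \<i>) (h v) w = eval_log l v w"
  have gen: "?J v w" if v: "v \<in> ES \<alpha>" "v \<in> V.ge (Y \<omega> 1) d" and w: "w \<in> W.ge L0 c" for v w \<alpha> c d
  proof -
    let ?n = "m - c - d" and ?e = "2 * pi * \<i>"
    have hv: "h v \<in> V.ge (Y \<omega> 1) d" by (rule V.ge_commute[where T="Y \<omega> 1" and S=h, OF h_props(1) h_omega[symmetric] v(2)])
    have "h v = s (cis2pi \<alpha>) (V.ps_op (fps_exp ?e) N v)"
      by (rule V.N_op_exp[OF h_props(3,2) V.S_op_eigenspace_cis[OF h_props(3,2) v(1)]])
    then have 1: "V.ps_op (fps_exp (- (l + ?e))) N (h v) = s (cis2pi \<alpha>) (V.ps_op (fps_exp (- (l + ?e)) * fps_exp ?e) N v)"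
      by (simp only: lin_scale[OF V.ps_op_lin[OF N_nilp]] V.ps_op_mult[OF N_nilp])
    have "fps_exp (- (l + ?e)) * fps_exp ?e = fps_exp (- l)" by (simp only: fps_exp_add_mult[symmetric]) simp
    then have 2: "eval_log (l + ?e) (h v) w = t (exp (?n * (l + ?e)) * cis2pi \<alpha>) (C (y (V.ps_op (fps_exp (- l)) N v) ?n w))"
      unfolding eval_log_eigen(2)[OF hv w] 1 by (simp only: y_scale lin_scale[OF C_lin] W.scale_scale)
    have 3: "exp (?n * (l + ?e)) * cis2pi \<alpha> = exp (?n * l) * cis2pi (?n + \<alpha>)"
      by (simp only: cis2pi_add) (simp add: cis2pi_def distrib_left exp_add mult_ac)
    have "eval_log (l + ?e) (h v) w = eval_log l v w"
    proof (cases "?n + \<alpha> \<in> \<int>")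
      case True
      then have "cis2pi (?n + \<alpha>) = 1" by (simp only: cis2pi_eq_1_iff)
      then show ?thesis unfolding 2 3 eval_log_eigen(2)[OF v(2) w] by simp
    next
      case False
      have "S (V.ps_op (fps_exp (- l)) N x) = V.ps_op (fps_exp (- l)) N (S x)" for x
        by (rule V.ps_op_commute[OF N_nilp S_lin]) (rule S_N[symmetric])
      then have "V.ps_op (fps_exp (- l)) N v \<in> ES \<alpha>"
        by (rule ES_commute[where C="V.ps_op (fps_exp (- l)) N", OF V.ps_op_lin[OF N_nilp] _ v(1)])
      then have "y (V.ps_op (fps_exp (- l)) N v) ?n w = 0" using False by (rule y_supp)
      then show ?thesis unfolding 2 eval_log_eigen(2)[OF v(2) w] by (simp add: lin_zero[OF C_lin])
    qed
    then show ?thesis using eval_log_eigen(1)[OF v(2) w] eval_log_eigen(1)[OF hv w] by blast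
  qed
  have "?J v w"
  proof (rule V.joint_induct[where T=S and S="Y \<omega> 1" and P="\<lambda>v. ?J v w", OF V.semisimple_ge(2)[OF S_semisimple] Y1_triangulable S_omega])
    fix \<alpha> d v assume "v \<in> V.ge S \<alpha>" and v2: "v \<in> V.ge (Y \<omega> 1) d"
    then have v1: "v \<in> ES \<alpha>" by (simp only: V.semisimple_ge(1)[OF S_semisimple])
    show "?J v w"
      using tri
    proof (induction w rule: W.triangulable_induct)
      case (ge c w) then show ?case by (rule gen[OF v1 v2])
    next
      case (add w w')
      have e: "C (YL x n k (w + w')) = C (YL x n k w) + C (YL x n k w')" for x n k
        by (simp only: lin_add[OF YL_lin_r] lin_add[OF C_lin])
      show ?case using add eval_log_add[of v w v w' v "w + w'", OF _ _ e] eval_log_add[of "h v" w "h v" w' "h v" "w + w'", OF _ _ e] by simp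
    qed
  next
    fix v v' assume J: "?J v w" "?J v' w"
    have e: "C (YL (v + v') n k w) = C (YL v n k w) + C (YL v' n k w)" for n k
      by (simp only: lin_add[OF YL_lin_l] lin_add[OF C_lin])
    have e': "C (YL (h (v + v')) n k w) = C (YL (h v) n k w) + C (YL (h v') n k w)" for n k
      by (simp only: lin_add[OF YL_lin_l] lin_add[OF C_lin] lin_add[OF h_props(1)])
    show "?J (v + v') w" using J eval_log_add[of v w v' w "v + v'" w, OF _ _ e] eval_log_add[of "h v" w "h v'" w "h (v + v')" w, OF _ _ e'] by simp
  qed
  then show ?thesis by blast
qed

end

text \<open>The axioms on \<open>Y\<^sub>W\<close> alone are consequences of the Jacobi identity without logarithms; the hypotheses
  concern the grading and the action of the automorphism.\<close>

theorem twisted_moduleI: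
  assumes tri: "W.triangulable L0" and wp: "\<And>n. wt_part t WG n = W.ge L0 n"
    and grading: "is_direct_sum t (UNIV \<times> C_mod_Z) (\<lambda>(n, \<Gamma>). WG n \<Gamma>)"
    and gW: "W.lin gW" "bij gW" "\<And>v n k w. gW (YL v n k w) = YL (h v) n k (gW w)"
    and gg: "\<And>\<Gamma> \<alpha>. \<Gamma> \<in> C_mod_Z \<Longrightarrow> \<alpha> \<in> \<Gamma> \<Longrightarrow> g_part t WG \<Gamma> \<subseteq> W.ge gW (exp (2 * pi * \<i> * \<alpha>))"
  shows "twisted_module s Y vac \<omega> t h WG gW YL"
proof (intro twisted_module.intro twisted_module_axioms.intro V.vertex_operator_algebra_axioms W.vs)
  show "voa_automorphism s Y vac \<omega> h" by (rule aut)
  show "is_direct_sum t (UNIV \<times> C_mod_Z) (\<lambda>(n, \<Gamma>). WG n \<Gamma>)" by (rule grading)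
  show "W.lin gW" by (rule gW)
  show "bij gW" by (rule gW)
  show "gW (YL v n k w) = YL (h v) n k (gW w)" for v n k w by (rule gW)
  show "Vector_Spaces.linear s t (\<lambda>v. YL v n k w)" for n k w by (rule YL_lin_l)
  show "W.lin (YL v n k)" for v n k by (rule YL_lin_r)
  show "\<exists>K. \<forall>n. \<forall>k>K. YL v n k w = 0" for v w by (rule YL_log_polynomial)
  show "branch_value t WG YL (p + 1) (h v) z w = branch_value t WG YL p v z w" for z p v w
  proof
    fix m
    have wp': "wt_part t WG = W.ge L0" using wp by blast
    have b: "branch_value t WG YL p v z w m = eval_log (component UNIV (W.ge L0) m) (log_branch p z) v w" for p v
      unfolding branch_value_def eval_log_def[OF tri refl] wp' ..
    have l: "log_branch (p + 1) z = log_branch p z + 2 * pi * \<i>"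
      by (simp add: log_branch_def algebra_simps)
    show "branch_value t WG YL (p + 1) (h v) z w m = branch_value t WG YL p v z w m"
      unfolding b l by (rule eval_log_equivariance[OF tri refl])
  qed
  show "YL vac n k w = (if n = 0 \<and> k = 0 then w else 0)" for n k w by (rule YL_identity)
  show "\<exists>B. \<forall>n k. Re n < B \<longrightarrow> YL v n k w = 0" for v w by (rule YL_truncation)
  show "Sum_any (\<lambda>i::nat. t ((of_int l gchoose i) * (-1) ^ i)
         (YL v\<^sub>1 (a - of_int l + of_nat i) j (YL v\<^sub>2 (b - of_nat i) k w)))
     - Sum_any (\<lambda>i::nat. t ((of_int l gchoose i) * (-1) powi (l - int i))
         (YL v\<^sub>2 (b - of_int l + of_nat i) k (YL v\<^sub>1 (a - of_nat i) j w)))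
     = Sum_any (\<lambda>(m::int, i::nat, i'::nat, c::complex). \<Sum>r\<le>k.
         t (of_int m gchoose i)
           (YL (Y (quotient_powr s h i' (a + of_int m + 1) j c r v\<^sub>1) (l + int i + int i') v\<^sub>2)
             (b - of_int m + of_nat i - c) (k - r) w))" for l v\<^sub>1 a j v\<^sub>2 b k w
    using YL_jacobi[of v\<^sub>1 v\<^sub>2 l a j b k w] unfolding lhs_term1_def lhs_term2_def rhs_term_def .
  have YL0: "YL \<omega> (-2) 0 = L0" by (simp add: YL_def fun_eq_iff)
  show "wt_part t WG n \<subseteq> W.ge (YL \<omega> (-2) 0) n" for n unfolding YL0 wp ..
  show "\<Gamma> \<in> C_mod_Z \<Longrightarrow> \<alpha> \<in> \<Gamma> \<Longrightarrow> g_part t WG \<Gamma> \<subseteq> W.ge gW (exp (2 * pi * \<i> * \<alpha>))" for \<Gamma> \<alpha> by (rule gg)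
  show "YL (Lop Y \<omega> (-1) v) n k w = t (n + 1) (YL v (n + 1) k w) + t (of_nat (k + 1)) (YL v (n + 1) (k + 1) w)" for v n k w
    by (rule YL_derivative)
qed

end

section \<open>The logarithms of a twisted module\<close>

text \<open>The Jacobi identity with \<open>v\<^sub>2 = \<one>\<close>, \<open>l = -1\<close>, \<open>b = 0\<close>.  On the left only \<open>Y\<^sub>W(v, x)\<close> at \<open>x\<^bsup>a+1\<^esup> (log x)\<^bsup>j\<^esup>\<close> survives.
  On the right \<open>v\<^bsub>-1+i+i'\<^esub> \<one> = 0\<close> unless \<open>i = i' = 0\<close>, and one index \<open>m\<close> remains, which exists exactly if
  \<open>a + 1 + \<alpha> \<in> \<int>\<close>.\<close>

lemma twisted_module_structure:
  assumes TM: "twisted_module s Y vac \<omega> t g WG gW YW"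
    and v: "v \<in> eigenspace s (S_op s g) \<alpha>"
  shows "YW v n j w = (if n + \<alpha> \<in> \<int> then YW (s (1 / fact j) (((\<lambda>x. - N_op s g x) ^^ j) v)) n 0 w else 0)"
proof -
  interpret TM: twisted_module s Y vac \<omega> t g WG gW YW by (rule TM)
  interpret W': complex_vector_space t by unfold_locales
  \<comment> \<open>the powers of \<open>\<L>\<^sub>g\<close> depend on the automorphism only, so the zero family gives access to them\<close>
  interpret F: twisted_family s Y vac \<omega> t g "\<lambda>_ _ _. 0"
  proof unfold_locales
    show "voa_automorphism s Y vac \<omega> g" by (rule TM.automorphism)
  qed (auto simp: Vector_Spaces.linear_iff TM.V.vs W'.vs)
  define a where "a = n - 1"
  have n: "n = a + 1" by (simp add: a_def)
  let ?x = "F.M j v" and ?O = "\<lambda>x. F.N x + s \<alpha> x"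
  have z1: "YW 0 n k w = 0" for n k w by (rule lin_zero[OF TM.linear_left])
  have z2: "YW v n k 0 = 0" for v n k by (rule lin_zero[OF TM.linear_right])
  have L1: "Sum_any (\<lambda>i::nat. t ((of_int (-1) gchoose i) * (-1) ^ i) (YW v (a - of_int (-1) + of_nat i) j (YW vac (0 - of_nat i) 0 w))) = YW v (a + 1) j w"
    by (subst Sum_any_eq_sum[of "{0}"]) (auto simp: TM.identity z2)
  have L2: "Sum_any (\<lambda>i::nat. t ((of_int (-1) gchoose i) * (-1) powi (-1 - int i)) (YW vac (0 - of_int (-1) + of_nat i) 0 (YW v (a - of_nat i) j w))) = 0"
  proof -
    have "(0 - of_int (-1) + of_nat i :: complex) \<noteq> 0" for i
    proof -
      have "(0 - of_int (-1) + of_nat i :: complex) = of_nat (Suc i)" by simp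
      then show ?thesis by (metis of_nat_eq_0_iff nat.distinct(2))
    qed
    then show ?thesis by (simp add: TM.identity)
  qed
  let ?F = "\<lambda>(m::int, i::nat, i'::nat, c::complex). \<Sum>r\<le>0::nat. t (of_int m gchoose i)
           (YW (Y (quotient_powr s g i' (a + of_int m + 1) j c r v) (-1 + int i + int i') vac) (0 - of_int m + of_nat i - c) (0 - r) w)"
  have F: "?F (m, i, i', c) = (if a + of_int m + 1 = - \<alpha> \<and> i = 0 \<and> i' = 0 \<and> c = \<alpha> then YW ?x (a + 1) 0 w else 0)" for m i i' c
  proof (cases "a + of_int m + 1 = - \<alpha> \<and> i = 0 \<and> i' = 0 \<and> c = \<alpha>")
    case True
    then have "\<alpha> = - (a + of_int m + 1)" by (metis minus_minus)
    then have e: "- of_int m - \<alpha> = a + 1" by simp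
    have "?F (m, i, i', c) = YW ?x (- of_int m - \<alpha>) 0 w"
      unfolding prod.case F.quotient_powr_eigen[OF v] using True by (simp add: TM.V.creation)
    then show ?thesis using True e by simp
  next
    case False
    have "Y (quotient_powr s g i' (a + of_int m + 1) j c 0 v) (-1 + int i + int i') vac = 0"
    proof (cases "i = 0 \<and> i' = 0")
      case True
      then have "\<not> (a + of_int m + 1 = - \<alpha> \<and> c + of_nat i' = \<alpha>)" using False by auto
      then show ?thesis unfolding F.quotient_powr_eigen[OF v] by (simp only: if_False TM.V.Y_0_left)
    next
      case False
      then have "-1 + int i + int i' \<ge> 0" by linarith
      then show ?thesis by (rule TM.V.creation(1))
    qed
    then show ?thesis unfolding if_not_P[OF False] by (simp add: z1)
  qed
  have R: "Sum_any ?F = (if n + \<alpha> \<in> \<int> then YW ?x n 0 w else 0)"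
  proof (cases "n + \<alpha> \<in> \<int>")
    case True
    then obtain m' where "n + \<alpha> = of_int m'" by (auto elim: Ints_cases)
    then have "\<alpha> = of_int m' - n" by (metis add_diff_cancel_left')
    then have m: "a + of_int (- m') + 1 = - \<alpha>" by (simp add: n)
    have uniq: "a + of_int m2 + 1 = - \<alpha> \<Longrightarrow> m2 = - m'" for m2 :: int
      using m by (metis add_left_cancel add_right_cancel of_int_eq_iff)
    have "Sum_any ?F = sum ?F {(- m', 0, 0, \<alpha>)}"
    proof (rule Sum_any_eq_sum)
      fix p :: "int \<times> nat \<times> nat \<times> complex" assume p: "p \<notin> {(- m', 0, 0, \<alpha>)}"
      obtain m i i' c where f: "p = (m, i, i', c)" by (cases p)
      then have nc: "\<not> (a + of_int m + 1 = - \<alpha> \<and> i = 0 \<and> i' = 0 \<and> c = \<alpha>)" using p uniq by auto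
      show "?F p = 0" unfolding f F if_not_P[OF nc] ..
    qed simp
    also have "\<dots> = ?F (- m', 0, 0, \<alpha>)" by simp
    also have "\<dots> = YW ?x n 0 w" unfolding F using m n by simp
    finally show ?thesis using True by simp
  next
    case False
    have "?F p = 0" for p :: "int \<times> nat \<times> nat \<times> complex"
    proof -
      obtain m i i' c where f: "p = (m, i, i', c)" by (cases p)
      have "a + of_int m + 1 \<noteq> - \<alpha>"
      proof
        assume "a + of_int m + 1 = - \<alpha>"
        then have "\<alpha> = - (a + of_int m + 1)" by (metis minus_minus)
        then have "n + \<alpha> = of_int (- m)" by (simp add: n)
        then show False using False by simp
      qed
      then show ?thesis unfolding f F by simp
    qed
    then show ?thesis using False by simp
  qed
  show ?thesis using TM.jacobi[of "-1" v a j vac 0 0 w] unfolding L1 L2 R by (simp add: n)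
qed

text \<open>The support and logarithm structure is \<open>twisted_module_structure\<close>; the identity without logarithms
  is then the case \<open>j = k = 0\<close> of the given Jacobi identity, simplified by \<open>rhs_eigen\<close>.\<close>

theorem twisted_module_core:
  assumes TM: "twisted_module s Y vac \<omega> t g WG gW YW"
  shows "twisted_core s Y vac \<omega> t g (\<lambda>v n w. YW v n 0 w)"
    and "twisted_family.YL s g (\<lambda>v n w. YW v n 0 w) = YW"
proof -
  interpret TM: twisted_module s Y vac \<omega> t g WG gW YW by (rule TM)
  interpret W': complex_vector_space t by unfold_locales
  let ?y = "\<lambda>v n w. YW v n 0 w"
  interpret F: twisted_family s Y vac \<omega> t g ?y
  proof (intro twisted_family.intro twisted_family_axioms.intro TM.V.vertex_operator_algebra_axioms W'.complex_vector_space_axioms)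
    show "voa_automorphism s Y vac \<omega> g" by (rule TM.automorphism)
    show "Vector_Spaces.linear s t (\<lambda>v. YW v n 0 w)" for n w by (rule TM.linear_left)
    show "Vector_Spaces.linear t t (\<lambda>w. YW v n 0 w)" for v n by (rule TM.linear_right)
    show "v \<in> eigenspace s (S_op s g) \<alpha> \<Longrightarrow> n + \<alpha> \<notin> \<int> \<Longrightarrow> YW v n 0 w = 0" for v \<alpha> n w
      using twisted_module_structure[OF TM] by metis
    show "\<exists>B. \<forall>n. Re n < B \<longrightarrow> YW v n 0 w = 0" for v w using TM.lower_truncation by blast
  qed
  have YL: "F.YL v n k w = YW v n k w" for v n k w
  proof (induction v rule: F.S_induct)
    case (ES \<alpha> v)
    show ?case
      using twisted_module_structure[OF TM ES, of n k w] F.y_supp[OF F.ES_M[OF ES], of n k w] unfolding F.YL_def by auto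
  qed (simp add: lin_add[OF F.YL_lin_l] lin_add[OF TM.linear_left])
  then show "F.YL = YW" by blast
  show "twisted_core s Y vac \<omega> t g ?y"
  proof unfold_locales
    show "YW vac n 0 w = (if n = 0 then w else 0)" for n w by (simp add: TM.identity)
    fix v\<^sub>1 \<alpha> a l v\<^sub>2 b w
    assume v: "v\<^sub>1 \<in> F.ES \<alpha>" and a: "a + \<alpha> \<in> \<int>"
    have "Sum_any (F.rhs_term v\<^sub>1 v\<^sub>2 l a 0 b 0 w) = Sum_any (\<lambda>i::nat. YW (Y (op_gbinomial s (\<lambda>x. F.N x - s (a + 1) x) i v\<^sub>1) (l + int i) v\<^sub>2) (a + b + 1 + of_nat i) 0 w)"
      using F.rhs_eigen(2)[OF v, of v\<^sub>2 l a 0 b 0 w] a by simp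
    then show "Sum_any (\<lambda>i::nat. t ((of_int l gchoose i) * (-1) ^ i) (YW v\<^sub>1 (a - of_int l + of_nat i) 0 (YW v\<^sub>2 (b - of_nat i) 0 w)))
      - Sum_any (\<lambda>i::nat. t ((of_int l gchoose i) * (-1) powi (l - int i)) (YW v\<^sub>2 (b - of_int l + of_nat i) 0 (YW v\<^sub>1 (a - of_nat i) 0 w)))
      = Sum_any (\<lambda>i::nat. YW (Y (op_gbinomial s (\<lambda>x. F.N x - s (a + 1) x) i v\<^sub>1) (l + int i) v\<^sub>2) (a + b + 1 + of_nat i) 0 w)"
      using TM.jacobi[of l v\<^sub>1 a 0 v\<^sub>2 b 0 w] unfolding F.rhs_term_def YL by simp
  qed
qed

section \<open>The twisted module transported by \<open>\<Delta>\<close>\<close>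

locale shift_twisted = V: shift_vector s Y vac \<omega> u + T: twisted_core s Y vac \<omega> t g y
  for s :: "complex \<Rightarrow> 'v::ab_group_add \<Rightarrow> 'v" and Y vac \<omega> u
    and t :: "complex \<Rightarrow> 'w::ab_group_add \<Rightarrow> 'w" and g y +
  assumes gu_fix: "g u = u"
begin

abbreviation h where "h \<equiv> g \<circ> V.gu"

lemmas h_aut = V.g_gu_automorphism[OF T.aut gu_fix]
lemmas hp = V.automorphism_props[OF h_aut]
lemmas N_h = V.N_op_g_gu[OF T.aut gu_fix]
lemmas U0_tri = V.u0_triangulable
lemmas U0_lin = V.U0_lin

abbreviation NH where "NH \<equiv> N_op s h"
abbreviation MU where "MU k \<equiv> V.dpow k (\<lambda>x. - V.NU x)"
abbreviation MH where "MH k \<equiv> V.dpow k (\<lambda>x. - NH x)"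

lemma NH_lin: "V.lin NH" by (rule V.N_op_lin[OF hp(3,2)])
lemma NU_lin: "V.lin V.NU" by (rule V.nilp_lin[OF V.NU_nilp])

lemma NU_u: "V.NU (Y u (int m) x) = Y u (int m) (V.NU x)"
  by (rule V.NU_commute[OF V.linear_right]) (use V.u_commute[of 0 m] in simp)

lemma Ng_u: "T.N (Y u n x) = Y u n (T.N x)"
  by (rule V.Ng_commute_u[OF T.aut gu_fix])

lemma NH_u: "NH (Y u (int m) x) = Y u (int m) (NH x)"
  unfolding N_h by (simp add: Ng_u NU_u V.Y_add)

lemma E_U0: "V.U0 (V.E q x) = V.E q (V.U0 x)"
  by (rule V.E_commute[OF U0_lin, symmetric]) (use V.u_commute[of _ 0] in simp)

lemma E_ge: "v \<in> V.ge V.U0 b \<Longrightarrow> V.E q v \<in> V.ge V.U0 b"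
  by (rule V.ge_commute[where T=V.U0 and S="V.E q", OF V.E_lin E_U0])

lemma g_u: "g (Y u n x) = Y u n (g x)" by (rule V.g_commute_u[OF T.aut gu_fix])

lemma E_g: "g (V.E q x) = V.E q (g x)"
  by (rule V.E_commute[OF T.h_props(1), symmetric]) (rule g_u[symmetric])

lemma E_MH: "V.E q (MH k x) = MH k (V.E q x)"
  by (rule V.E_commute[OF V.lin_dpow[OF lin_uminus[OF NH_lin]]])
    (simp add: funpow_commute_op[of "\<lambda>x. - NH x" "Y u (int _)"] NH_u V.Y_neg V.Y_scale)

lemma U0_NH: "V.U0 (NH x) = NH (V.U0 x)" using NH_u[of 0 x] by simp

lemma NH_ge: "v \<in> V.ge V.U0 b \<Longrightarrow> NH v \<in> V.ge V.U0 b"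
  by (rule V.ge_commute[where T=V.U0 and S=NH, OF NH_lin U0_NH])

lemma MH_ge: "v \<in> V.ge V.U0 b \<Longrightarrow> MH k v \<in> V.ge V.U0 b"
  by (intro V.ge_scale U0_lin V.funpow_in) (auto intro: V.subspace_neg[OF V.subspace_ge[OF U0_lin]] NH_ge)

subsection \<open>The operator \<open>\<Delta>\<close> on generalized eigenvectors of \<open>u\<^sub>0\<close>\<close>

abbreviation SU where "SU \<equiv> semisimple_part s V.U0"

lemma SU_neg_eigenspace: "eigenspace s (\<lambda>x. - SU x) d = V.ge V.U0 (- d)"
  unfolding V.semisimple_part_eigenspace[OF U0_tri, symmetric]
  by (auto simp: eigenspace_def neg_eq_iff_add_eq_0 eq_neg_iff_add_eq_0)

lemma SU_neg_direct: "is_direct_sum s UNIV (eigenspace s (\<lambda>x. - SU x))"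
proof -
  have "v \<in> V.span (\<Union>d. V.ge V.U0 (- d))" for v
    using U0_tri
  proof (induction v rule: V.triangulable_induct)
    case (ge c x)
    then show ?case by (intro V.span_base UN_I[of "- c"]) auto
  qed (rule V.span_add)
  then have "semisimple_op s (\<lambda>x. - SU x)"
    by (intro V.semisimpleI lin_uminus V.semisimple_part_props(1)[OF U0_tri]) (simp add: SU_neg_eigenspace)
  then show ?thesis by (simp add: semisimple_op_def)
qed

text \<open>The projection in \<open>x\<^bsup>- u\<^sub>0\<^esup>\<close> that selects the exponent \<open>d\<close>.\<close>

definition PU where "PU d = component UNIV (eigenspace s (\<lambda>x. - SU x)) d"

lemma PU_lin: "V.lin (PU d)" unfolding PU_def by (rule V.component_linear[OF SU_neg_direct])

lemma PU_ge: "x \<in> V.ge V.U0 b \<Longrightarrow> PU d x = (if d = - b then x else 0)"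
  unfolding PU_def by (rule V.component_self[OF SU_neg_direct]) (auto simp: SU_neg_eigenspace)

abbreviation DT where "DT a k \<equiv> Delta s Y u a k"

lemma DT_eq: "DT a k v = Sum_any (\<lambda>q. MU k (PU (a + of_nat q) (V.E q v)))"
  unfolding Delta_def op_powr_def PU_def ..

lemma MU_lin: "V.lin (MU k)" by (intro V.lin_dpow lin_uminus NU_lin)

lemma DT_finite: "finite {q. MU k (PU (a + of_nat q) (V.E q v)) \<noteq> 0}"
proof -
  obtain K where K: "\<forall>q\<ge>K. V.E q v = 0" using V.E_bound by blast
  show ?thesis
  proof (rule finite_subset[of _ "{..<K}"])
    show "{q. MU k (PU (a + of_nat q) (V.E q v)) \<noteq> 0} \<subseteq> {..<K}"
    proof
      fix q assume "q \<in> {q. MU k (PU (a + of_nat q) (V.E q v)) \<noteq> 0}"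
      then have "V.E q v \<noteq> 0" using lin_zero[OF PU_lin] lin_zero[OF MU_lin] by auto
      then show "q \<in> {..<K}" using K by (meson lessThan_iff not_le)
    qed
  qed simp
qed

lemma DT_lin: "V.lin (DT a k)"
proof (rule V.linI)
  show "DT a k (x + z) = DT a k x + DT a k z" for x z
    unfolding DT_eq V.Sum_any_add_fin(1)[OF DT_finite DT_finite, symmetric]
    by (simp only: lin_add[OF V.E_lin] lin_add[OF PU_lin] lin_add[OF MU_lin])
  show "DT a k (s c x) = s c (DT a k x)" for c x
    unfolding DT_eq lin_Sum_any[OF V.lin_scaleV DT_finite]
    by (simp only: lin_scale[OF V.E_lin] lin_scale[OF PU_lin] lin_scale[OF MU_lin])
qed

text \<open>On \<open>ge u\<^sub>0 b\<close> the factor \<open>x\<^bsup>- u\<^sub>0\<^esup>\<close> is \<open>x\<^bsup>-b\<^esup>\<close> times a polynomial in \<open>log x\<close>, and every \<open>E\<^sub>q\<close> preserves \<open>ge u\<^sub>0 b\<close>.\<close>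

lemma DT_ge:
  assumes v: "v \<in> V.ge V.U0 b"
  shows "DT (- b - of_nat q) k v = MU k (V.E q v)" and "(\<And>q. a \<noteq> - b - of_nat q) \<Longrightarrow> DT a k v = 0"
proof -
  have e: "MU k (PU (a + of_nat q) (V.E q v)) = (if a = - b - of_nat q then MU k (V.E q v) else 0)" for a q
    using PU_ge[OF E_ge[OF v], of "a + of_nat q" q] lin_zero[OF MU_lin] by (auto simp: eq_diff_eq)
  have "(- b - of_nat q = - b - (of_nat q' :: complex)) \<longleftrightarrow> q' = q" for q' by auto
  then show "DT (- b - of_nat q) k v = MU k (V.E q v)"
    unfolding DT_eq e using Sum_any.delta[of q "\<lambda>q. MU k (V.E q v)"] by (simp only:)
  show "DT a k v = 0" if "\<And>q. a \<noteq> - b - of_nat q"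
    unfolding DT_eq e using that by simp
qed

lemma DT_support: "finite {a. \<exists>k. DT a k v \<noteq> 0}"
  using U0_tri
proof (induction v rule: V.triangulable_induct)
  case (ge b v)
  obtain K where K: "\<forall>q\<ge>K. V.E q v = 0" using V.E_bound by blast
  show ?case
  proof (rule finite_subset[of _ "(\<lambda>q. - b - of_nat q) ` {..<K}"])
    show "{a. \<exists>k. DT a k v \<noteq> 0} \<subseteq> (\<lambda>q. - b - of_nat q) ` {..<K}"
    proof
      fix a assume "a \<in> {a. \<exists>k. DT a k v \<noteq> 0}"
      then obtain k where k: "DT a k v \<noteq> 0" by blast
      then obtain q where q: "a = - b - of_nat q" using DT_ge(2)[OF ge, of a k] by blast
      then have "V.E q v \<noteq> 0" using k DT_ge(1)[OF ge, of q k] lin_zero[OF MU_lin] by auto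
      then have "q < K" using K by (meson not_le)
      then show "a \<in> (\<lambda>q. - b - of_nat q) ` {..<K}" using q by blast
    qed
  qed simp
next
  case (add x z)
  have "{a. \<exists>k. DT a k (x + z) \<noteq> 0} \<subseteq> {a. \<exists>k. DT a k x \<noteq> 0} \<union> {a. \<exists>k. DT a k z \<noteq> 0}"
    by (auto simp: lin_add[OF DT_lin])
  then show ?case using add finite_subset by blast
qed

abbreviation TT :: "'v \<Rightarrow> complex \<Rightarrow> nat \<Rightarrow> 'w \<Rightarrow> 'w" where "TT \<equiv> Delta_twist s Y u T.YL"

lemma TT_eq: "TT v n k w = Sum_any (\<lambda>a. \<Sum>j\<le>k. T.YL (DT a j v) (n - a) (k - j) w)"
  by (rule Delta_twist_def)

lemma TT_finite: "finite {a. (\<Sum>j\<le>k. T.YL (DT a j v) (n - a) (k - j) w) \<noteq> 0}"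
proof (rule finite_subset[OF _ DT_support[of v]])
  show "{a. (\<Sum>j\<le>k. T.YL (DT a j v) (n - a) (k - j) w) \<noteq> 0} \<subseteq> {a. \<exists>k. DT a k v \<noteq> 0}"
  proof (rule subsetI, rule ccontr)
    fix a assume a: "a \<in> {a. (\<Sum>j\<le>k. T.YL (DT a j v) (n - a) (k - j) w) \<noteq> 0}" "a \<notin> {a. \<exists>k. DT a k v \<noteq> 0}"
    then have "DT a j v = 0" for j by blast
    then show False using a by (simp add: lin_zero[OF T.YL_lin_l])
  qed
qed

lemma TT_lin_l: "Vector_Spaces.linear s t (\<lambda>v. TT v n k w)"
proof -
  have "TT (x + z) n k w = TT x n k w + TT z n k w" for x z
    unfolding TT_eq V.Sum_any_add_fin(1)[OF TT_finite TT_finite, symmetric]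
    by (simp only: lin_add[OF DT_lin] lin_add[OF T.YL_lin_l] sum.distrib)
  moreover have "TT (s c x) n k w = t c (TT x n k w)" for c x
    unfolding TT_eq lin_Sum_any[OF T.W.lin_scaleV TT_finite]
    by (simp only: lin_scale[OF DT_lin] lin_scale[OF T.YL_lin_l] T.W.scale_sum_right)
  ultimately show ?thesis by (simp add: Vector_Spaces.linear_iff V.vs T.W.vs)
qed

lemma TT_lin_r: "T.W.lin (TT v n k)"
proof (rule T.W.linI)
  show "TT v n k (x + z) = TT v n k x + TT v n k z" for x z
    unfolding TT_eq V.Sum_any_add_fin(1)[OF TT_finite TT_finite, symmetric]
    by (simp only: lin_add[OF T.YL_lin_r] sum.distrib)
  show "TT v n k (t c x) = t c (TT v n k x)" for c x
    unfolding TT_eq lin_Sum_any[OF T.W.lin_scaleV TT_finite]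
    by (simp only: lin_scale[OF T.YL_lin_r] T.W.scale_sum_right)
qed

text \<open>The coefficient form of \<open>e\<^bsup>- N\<^sub>g log x\<^esup> e\<^bsup>- N\<^sub>u log x\<^esup> = e\<^bsup>- (N\<^sub>g + N\<^sub>u) log x\<^esup>\<close>: the logarithms of \<open>Y\<^sub>W\<close> and of \<open>\<Delta>\<close>
  combine to those for \<open>g g\<^sub>u\<close>.\<close>

lemma MH_convolution: "(\<Sum>j\<le>k. T.M (k - j) (MU j x)) = MH k x"
proof -
  have "(\<Sum>j\<le>k. T.M (k - j) (MU j x)) = (\<Sum>i\<le>k. T.M i (MU (k - i) x))"
    by (rule sum.reindex_bij_witness[of _ "\<lambda>j. k - j" "\<lambda>j. k - j"]) auto
  also have "\<dots> = V.dpow k (\<lambda>x. - T.N x + - V.NU x) x"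
  proof (rule V.dpow_add[symmetric, OF lin_uminus[OF T.N_lin] lin_uminus[OF NU_lin]])
    show "- T.N (- V.NU x) = - V.NU (- T.N x)" for x
      using V.Ng_commute_NU[OF T.aut gu_fix, of x] by (simp add: lin_neg[OF T.N_lin] lin_neg[OF NU_lin])
  qed
  also have "(\<lambda>x. - T.N x + - V.NU x) = (\<lambda>x. - NH x)" by (simp add: fun_eq_iff N_h)
  finally show ?thesis .
qed

lemma TT_ge:
  assumes v: "v \<in> V.ge V.U0 b" and K: "\<forall>q\<ge>K. V.E q v = 0"
  shows "TT v n k w = (\<Sum>q<K. y (MH k (V.E q v)) (n + b + of_nat q) w)"
proof -
  let ?a = "\<lambda>q::nat. - b - of_nat q"
  have inj: "inj_on ?a {..<K}" by (auto simp: inj_on_def)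
  have "TT v n k w = (\<Sum>a\<in>?a ` {..<K}. \<Sum>j\<le>k. T.YL (DT a j v) (n - a) (k - j) w)"
    unfolding TT_eq
  proof (rule Sum_any_eq_sum)
    fix a assume a: "a \<notin> ?a ` {..<K}"
    have "DT a j v = 0" for j
    proof (cases "\<exists>q. a = ?a q")
      case True
      then obtain q where q: "a = ?a q" by blast
      then have "q \<ge> K" using a by (meson image_eqI lessThan_iff not_le)
      then show ?thesis unfolding q DT_ge(1)[OF v] using K lin_zero[OF MU_lin] by simp
    next
      case False then show ?thesis using DT_ge(2)[OF v, of a j] by blast
    qed
    then show "(\<Sum>j\<le>k. T.YL (DT a j v) (n - a) (k - j) w) = 0" by (simp add: lin_zero[OF T.YL_lin_l])
  qed simp
  also have "\<dots> = (\<Sum>q<K. \<Sum>j\<le>k. T.YL (DT (?a q) j v) (n - ?a q) (k - j) w)"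
    by (simp only: sum.reindex[OF inj] o_def)
  also have "\<dots> = (\<Sum>q<K. y (MH k (V.E q v)) (n + b + of_nat q) w)"
  proof (intro sum.cong refl)
    fix q
    have e: "n - ?a q = n + b + of_nat q" by simp
    show "(\<Sum>j\<le>k. T.YL (DT (?a q) j v) (n - ?a q) (k - j) w) = y (MH k (V.E q v)) (n + b + of_nat q) w"
      unfolding DT_ge(1)[OF v] e T.YL_def T.y_sum(1)[symmetric] MH_convolution ..
  qed
  finally show ?thesis .
qed

text \<open>The transported family without logarithms.\<close>

definition yh :: "'v \<Rightarrow> complex \<Rightarrow> 'w \<Rightarrow> 'w" where "yh v n w = TT v n 0 w"

lemma yh_ge:
  assumes v: "v \<in> V.ge V.U0 b" and K: "\<forall>q\<ge>K. V.E q v = 0"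
  shows "yh v n w = (\<Sum>q<K. y (V.E q v) (n + b + of_nat q) w)"
  unfolding yh_def TT_ge[OF v K] by (simp add: V.scale_one)

lemma g_gu: "g (V.gu x) = V.gu (g x)" by (rule V.g_gu_commute[OF T.aut gu_fix])

lemma U0_gu: "V.U0 (V.gu x) = V.gu (V.U0 x)"
  unfolding V.gu_def
  by (rule V.op_exp_commute[where C=V.U0, symmetric, OF V.triangulable_scale(1)[OF U0_tri] U0_lin]) (simp add: lin_scale[OF U0_lin])

lemma g_h: "g (h x) = h (g x)" by (simp add: g_gu)
lemma U0_h: "V.U0 (h x) = h (V.U0 x)" by (simp add: U0_gu[symmetric] g_u[symmetric])

text \<open>On a joint generalized eigenvector of \<open>g\<close> and \<open>u\<^sub>0\<close> with eigenvalues \<open>e\<^bsup>2\<pi>i\<alpha>\<^esup>\<close> and \<open>b\<close> the automorphism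
  \<open>g g\<^sub>u\<close> has eigenvalue \<open>e\<^bsup>2\<pi>i(\<alpha> + b)\<^esup>\<close>.  So \<open>\<alpha> + b\<close> is determined modulo \<open>\<int>\<close> by \<open>c\<close>, while \<open>\<alpha>\<close> and \<open>b\<close> vary.\<close>

lemma h_induct:
  assumes v: "v \<in> V.ge h c"
    and P: "\<And>\<alpha> b x. x \<in> V.ge g (cis2pi \<alpha>) \<Longrightarrow> x \<in> T.ES \<alpha> \<Longrightarrow> x \<in> V.ge V.U0 b \<Longrightarrow> cis2pi (\<alpha> + b) = c \<Longrightarrow> P x"
     "\<And>x y. P x \<Longrightarrow> P y \<Longrightarrow> P (x + y)" "P 0"
  shows "P v"
proof (rule V.joint_induct_within[where T=g and S=V.U0 and R=h and c=c and P=P, OF T.h_props(3) U0_tri g_u hp(1) g_h U0_h v])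
  fix a b x assume x: "x \<in> V.ge g a" "x \<in> V.ge V.U0 b" "x \<in> V.ge h c"
  show "P x"
  proof (cases "x = 0")
    case False
    have xh: "x \<in> V.ge h (a * cis2pi b)" by (rule V.joint_ge[OF T.aut gu_fix x(1,2)])
    obtain M where M: "(V.shift h (a * cis2pi b) ^^ M) x = 0" using xh V.geE by metis
    have c: "a * cis2pi b = c"
      using V.shift_pow_inj_ge[OF hp(1) _ x(3) M] False by blast
    have "a \<noteq> 0" using V.ge_inj_0[OF T.h_props(3,2)] x(1) False by blast
    then obtain \<alpha> where al: "0 \<le> Re \<alpha>" "Re \<alpha> < 1" "cis2pi \<alpha> = a" using strip_log_exists by blast
    have "x \<in> T.ES \<alpha>" using V.S_op_eigenspace[OF T.h_props(3,2) al(1,2)] x(1) al(3) by simp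
    then show ?thesis using P(1)[of x \<alpha> b] x al(3) c by (simp add: cis2pi_add)
  qed (use P(3) in simp)
qed (rule P(2))

lemma yh_trunc: "\<exists>B. \<forall>n. Re n < B \<longrightarrow> yh v n w = 0"
  using U0_tri
proof (induction v rule: V.triangulable_induct)
  case (ge b v)
  obtain K where K: "\<forall>q\<ge>K. V.E q v = 0" using V.E_bound by blast
  have ex: "\<forall>q. \<exists>B. \<forall>n. Re n < B \<longrightarrow> y (V.E q v) n w = 0" using T.y_trunc by blast
  obtain B where B: "\<forall>q. \<forall>n. Re n < B q \<longrightarrow> y (V.E q v) n w = 0" using choice[OF ex] by blast
  define C where "C = Min (B ` {..K}) - Re b - real K"
  have "yh v n w = 0" if "Re n < C" for n
    unfolding yh_ge[OF ge K]
  proof (intro sum.neutral ballI)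
    fix q assume q: "q \<in> {..<K}"
    have "Min (B ` {..K}) \<le> B q" using q by (intro Min_le) auto
    moreover have "real q < real K" using q by simp
    moreover have "Re (n + b + of_nat q) = Re n + Re b + real q" by simp
    ultimately have "Re (n + b + of_nat q) < B q" using that unfolding C_def by linarith
    then show "y (V.E q v) (n + b + of_nat q) w = 0" using B by blast
  qed
  then show ?case by blast
next
  case (add x z)
  then obtain B C where "\<forall>n. Re n < B \<longrightarrow> yh x n w = 0" "\<forall>n. Re n < C \<longrightarrow> yh z n w = 0" by blast
  then show ?case unfolding yh_def by (intro exI[of _ "min B C"]) (simp add: lin_add[OF TT_lin_l])
qed

lemma yh_supp:
  assumes v: "v \<in> V.ge h (cis2pi \<beta>)" and n: "n + \<beta> \<notin> \<int>" shows "yh v n w = 0"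
proof (rule h_induct[OF v, of "\<lambda>v. yh v n w = 0"])
  fix \<alpha> b x assume x: "x \<in> V.ge g (cis2pi \<alpha>)" "x \<in> T.ES \<alpha>" "x \<in> V.ge V.U0 b" "cis2pi (\<alpha> + b) = cis2pi \<beta>"
  obtain K where K: "\<forall>q\<ge>K. V.E q x = 0" using V.E_bound by blast
  have ab: "\<alpha> + b - \<beta> \<in> \<int>" using x(4) by (simp only: cis2pi_eq_iff)
  show "yh x n w = 0"
    unfolding yh_ge[OF x(3) K]
  proof (intro sum.neutral ballI)
    fix q
    have "V.E q x \<in> T.ES \<alpha>"
    proof (rule T.ES_commute[where C="V.E q", OF V.E_lin _ x(2)])
      show "T.S (V.E q z) = V.E q (T.S z)" for z
        by (rule V.S_op_commute[where h=g and C="V.E q", OF T.h_props(3,2) V.E_lin E_g])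
    qed
    moreover have "n + b + of_nat q + \<alpha> \<notin> \<int>"
    proof
      assume "n + b + of_nat q + \<alpha> \<in> \<int>"
      then have "n + b + of_nat q + \<alpha> - of_nat q - (\<alpha> + b - \<beta>) \<in> \<int>" by (rule Ints_diff[OF Ints_diff[OF _ Ints_of_nat] ab])
      then show False using n by simp
    qed
    ultimately show "y (V.E q x) (n + b + of_nat q) w = 0" by (rule T.y_supp)
  qed
qed (auto simp: yh_def lin_add[OF TT_lin_l] lin_zero[OF TT_lin_l])

lemma yh_family: "twisted_family s Y vac \<omega> t h yh"
proof (intro twisted_family.intro twisted_family_axioms.intro V.vertex_operator_algebra_axioms T.W.complex_vector_space_axioms h_aut)
  show "Vector_Spaces.linear s t (\<lambda>v. yh v n w)" for n w unfolding yh_def by (rule TT_lin_l)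
  show "T.W.lin (yh v n)" for v n unfolding yh_def[abs_def] by (rule TT_lin_r)
  show "v \<in> eigenspace s (S_op s h) \<beta> \<Longrightarrow> n + \<beta> \<notin> \<int> \<Longrightarrow> yh v n w = 0" for v \<beta> n w
    by (rule yh_supp[OF V.S_op_eigenspace_cis[OF hp(3,2)]])
  show "\<exists>B. \<forall>n. Re n < B \<longrightarrow> yh v n w = 0" for v w by (rule yh_trunc)
qed

sublocale F: twisted_family s Y vac \<omega> t h yh by (rule yh_family)

text \<open>The nilpotent operator of \<open>g g\<^sub>u\<close> commutes with all \<open>E\<^sub>q\<close>, so the logarithms of the transported operator are
  the ones prescribed by its part without logarithms.\<close>

lemma F_YL: "F.YL = TT"
proof (intro ext)
  fix v n k w
  show "F.YL v n k w = TT v n k w"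
    using U0_tri
  proof (induction v rule: V.triangulable_induct)
    case (ge b v)
    obtain K where K: "\<forall>q\<ge>K. V.E q v = 0" using V.E_bound by blast
    have "\<forall>q\<ge>K. V.E q (MH k v) = 0"
      unfolding E_MH using K lin_zero[OF V.lin_dpow[OF lin_uminus[OF NH_lin]]] by simp
    from yh_ge[OF MH_ge[OF ge] this] show ?case
      unfolding F.YL_def TT_ge[OF ge K] E_MH .
  qed (simp only: lin_add[OF F.YL_lin_l] lin_add[OF TT_lin_l])
qed

lemma yh_vac: "yh vac n w = (if n = 0 then w else 0)"
proof -
  have v: "vac \<in> V.ge V.U0 0" by (rule V.geI[where K=1]) (simp add: V.creation)
  have E: "\<forall>q\<ge>1. V.E q vac = 0"
  proof (intro allI impI)
    fix q :: nat assume "q \<ge> 1"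
    then show "V.E q vac = 0" by (intro V.neg_wt_zero[OF V.E_wt[OF V.vac_wt]]) simp
  qed
  show ?thesis unfolding yh_ge[OF v E] by (simp add: T.y_vac)
qed

lemma uniform_bound:
  fixes P :: "'i \<Rightarrow> nat \<Rightarrow> bool"
  assumes "finite A" "\<And>x. x \<in> A \<Longrightarrow> \<exists>I. \<forall>i\<ge>I. P x i"
  shows "\<exists>I. \<forall>x\<in>A. \<forall>i\<ge>I. P x i"
proof -
  have "\<forall>x\<in>A. eventually (P x) sequentially" using assms(2) by (simp add: eventually_sequentially)
  then have "eventually (\<lambda>i. \<forall>x\<in>A. P x i) sequentially" by (rule eventually_ball_finite[OF assms(1)])
  then show ?thesis unfolding eventually_sequentially by blast
qed

lemma E_ES: "x \<in> T.ES \<alpha> \<Longrightarrow> V.E q x \<in> T.ES \<alpha>"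
  by (rule T.ES_commute[where C="V.E q", OF V.E_lin])
    (rule V.S_op_commute[where h=g and C="V.E q", OF T.h_props(3,2) V.E_lin E_g])

lemma T_truncation: "\<exists>I. \<forall>i\<ge>I. Y (V.obinom (\<lambda>x. T.N x - s c x) i v) (l + int i) w = 0"
proof -
  have e: "(\<lambda>x. T.N x - s c x) = (\<lambda>x. T.N x + s (- c) x)" by (simp add: fun_eq_iff)
  obtain n0 where n0: "\<forall>n\<ge>n0. \<forall>i. Y (V.obinom (\<lambda>x. T.N x + s (- c) x) i v) n w = 0" using T.uniform_truncation by blast
  have "Y (V.obinom (\<lambda>x. T.N x - s c x) i v) (l + int i) w = 0" if "i \<ge> nat (n0 - l)" for i
  proof -
    have "l + int i \<ge> n0" using that by linarith
    then show ?thesis unfolding e using n0 by blast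
  qed
  then show ?thesis by blast
qed

lemma F_truncation: "\<exists>I. \<forall>i\<ge>I. Y (V.obinom (\<lambda>x. NH x - s c x) i v) (l + int i) w = 0"
proof -
  have e: "(\<lambda>x. NH x - s c x) = (\<lambda>x. NH x + s (- c) x)" by (simp add: fun_eq_iff)
  obtain n0 where n0: "\<forall>n\<ge>n0. \<forall>i. Y (V.obinom (\<lambda>x. NH x + s (- c) x) i v) n w = 0" using F.uniform_truncation by blast
  have "Y (V.obinom (\<lambda>x. NH x - s c x) i v) (l + int i) w = 0" if "i \<ge> nat (n0 - l)" for i
  proof -
    have "l + int i \<ge> n0" using that by linarith
    then show ?thesis unfolding e using n0 by blast
  qed
  then show ?thesis by blast
qed

text \<open>On \<open>ge u\<^sub>0 b\<close> the nilpotent part of \<open>u\<^sub>0\<close> is \<open>u\<^sub>0 - b\<close>, hence \<open>N\<^sub>g - b = N\<^bsub>gg\<^sub>u\<^esub> - u\<^sub>0\<close>: the shift of the exponent by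
  \<open>b + r\<close> turns into the operator \<open>D\<^sub>r = - u\<^sub>0 - r\<close>.\<close>

lemma NH_shift_eq:
  assumes z: "z \<in> V.ge V.U0 b"
  shows "V.obinom (\<lambda>x. T.N x - s (a + b + of_nat r + 1) x) i z = V.obinom (\<lambda>x. (NH x - s (a + 1) x) + V.D r x) i z"
proof (rule V.obinom_cong[OF _ V.subspace_ge[OF U0_lin] _ z])
  fix x assume x: "x \<in> V.ge V.U0 b"
  show "T.N x - s (a + b + of_nat r + 1) x = (NH x - s (a + 1) x) + V.D r x"
    unfolding N_h V.NU_ge[OF x] V.D_def by (simp add: V.scale_left_distrib)
  have "T.N x \<in> V.ge V.U0 b"
    by (rule V.ge_commute[where T=V.U0 and S=T.N, OF T.N_lin _ x]) (rule Ng_u[symmetric])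
  then show "T.N x - s (a + b + of_nat r + 1) x \<in> V.ge V.U0 b" by (intro V.ge_diff V.ge_scale U0_lin x)
qed

text \<open>Both factors on the left are expanded by \<open>yh_ge\<close>; the pair of terms \<open>E\<^sub>r v\<^sub>1\<close>, \<open>E\<^sub>p v\<^sub>2\<close> is governed by the Jacobi
  identity of \<open>y\<close> at the exponents \<open>a + b\<^sub>1 + r\<close> and \<open>b + b\<^sub>2 + p\<close>, whose right-hand side involves
  \<open>binom((N\<^bsub>gg\<^sub>u\<^esub> - a - 1) + D\<^sub>r, i)\<close> by \<open>NH_shift_eq\<close>.  The terms with \<open>n = i + r + p\<close> all have the same exponent
  of \<open>x\<close>; for fixed \<open>n\<close> they are summed by \<open>jacobi_core\<close>, which produces the expansion of the right-hand
  side by \<open>yh_ge\<close>.\<close>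

lemma yh_jacobi_eigen:
  assumes v1: "v\<^sub>1 \<in> T.ES \<alpha>" "v\<^sub>1 \<in> V.ge V.U0 b\<^sub>1" and v2: "v\<^sub>2 \<in> V.ge V.U0 b\<^sub>2" and a: "a + (\<alpha> + b\<^sub>1) \<in> \<int>"
  shows "Sum_any (\<lambda>i::nat. t ((of_int l gchoose i) * (-1) ^ i) (yh v\<^sub>1 (a - of_int l + of_nat i) (yh v\<^sub>2 (b - of_nat i) w)))
    - Sum_any (\<lambda>i::nat. t ((of_int l gchoose i) * (-1) powi (l - int i)) (yh v\<^sub>2 (b - of_int l + of_nat i) (yh v\<^sub>1 (a - of_nat i) w)))
    = Sum_any (\<lambda>i::nat. yh (Y (V.obinom (\<lambda>x. NH x - s (a + 1) x) i v\<^sub>1) (l + int i) v\<^sub>2) (a + b + 1 + of_nat i) w)"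
proof -
  obtain K1 where K1: "\<forall>q\<ge>K1. V.E q v\<^sub>1 = 0" using V.E_bound by blast
  obtain K2 where K2: "\<forall>q\<ge>K2. V.E q v\<^sub>2 = 0" using V.E_bound by blast
  let ?P = "{..<K1} \<times> {..<K2}"
  let ?a = "\<lambda>q::nat. a + b\<^sub>1 + of_nat q" and ?b = "\<lambda>q::nat. b + b\<^sub>2 + of_nat q"
  let ?M = "\<lambda>x. NH x - s (a + 1) x"
  let ?O1 = "\<lambda>(q,p) i. t ((of_int l gchoose i) * (-1) ^ i) (y (V.E q v\<^sub>1) (?a q - of_int l + of_nat i) (y (V.E p v\<^sub>2) (?b p - of_nat i) w))"
  let ?O2 = "\<lambda>(q,p) i. t ((of_int l gchoose i) * (-1) powi (l - int i)) (y (V.E p v\<^sub>2) (?b p - of_int l + of_nat i) (y (V.E q v\<^sub>1) (?a q - of_nat i) w))"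
  have lM: "V.lin ?M" by (intro lin_minus NH_lin V.lin_scaleV)

  have A1: "t ((of_int l gchoose i) * (-1) ^ i) (yh v\<^sub>1 (a - of_int l + of_nat i) (yh v\<^sub>2 (b - of_nat i) w)) = (\<Sum>x\<in>?P. ?O1 x i)" for i
  proof -
    have e: "a - of_int l + of_nat i + b\<^sub>1 + of_nat q = ?a q - of_int l + of_nat i" "b - of_nat i + b\<^sub>2 + of_nat q = ?b q - of_nat i" for q by simp_all
    show ?thesis unfolding yh_ge[OF v1(2) K1] yh_ge[OF v2 K2] e T.y_sum T.W.scale_sum_right
      by (simp add: sum.cartesian_product split_def)
  qed
  have A2: "t ((of_int l gchoose i) * (-1) powi (l - int i)) (yh v\<^sub>2 (b - of_int l + of_nat i) (yh v\<^sub>1 (a - of_nat i) w)) = (\<Sum>x\<in>?P. ?O2 x i)" for i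
  proof -
    have e: "b - of_int l + of_nat i + b\<^sub>2 + of_nat q = ?b q - of_int l + of_nat i" "a - of_nat i + b\<^sub>1 + of_nat q = ?a q - of_nat i" for q by simp_all
    have "t ((of_int l gchoose i) * (-1) powi (l - int i)) (yh v\<^sub>2 (b - of_int l + of_nat i) (yh v\<^sub>1 (a - of_nat i) w))
      = (\<Sum>p<K2. \<Sum>q<K1. ?O2 (q, p) i)"
      unfolding yh_ge[OF v1(2) K1] yh_ge[OF v2 K2] e T.y_sum T.W.scale_sum_right by simp
    also have "\<dots> = (\<Sum>q<K1. \<Sum>p<K2. ?O2 (q, p) i)" by (rule sum.swap)
    also have "\<dots> = (\<Sum>x\<in>?P. ?O2 x i)" by (simp add: sum.cartesian_product split_def)
    finally show ?thesis .
  qed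
  have f1: "finite {i. ?O1 x i \<noteq> 0}" for x
    using T.lhs_finite(1)[of "V.E (fst x) v\<^sub>1" "V.E (snd x) v\<^sub>2" l "?a (fst x)" 0 "?b (snd x)" 0 w]
    unfolding T.lhs_term1_def T.YL_def by (simp add: split_def)
  have f2: "finite {i. ?O2 x i \<noteq> 0}" for x
    using T.lhs_finite(2)[of "V.E (fst x) v\<^sub>1" "V.E (snd x) v\<^sub>2" l "?a (fst x)" 0 "?b (snd x)" 0 w]
    unfolding T.lhs_term2_def T.YL_def by (simp add: split_def)
  let ?G = "\<lambda>p r i. y (Y (V.obinom (\<lambda>x. ?M x + V.D r x) i (V.E r v\<^sub>1)) (l + int i) (V.E p v\<^sub>2)) (a + b + b\<^sub>1 + b\<^sub>2 + 1 + of_nat (i + r + p)) w"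
  \<comment> \<open>the Jacobi identity of \<open>y\<close> for \<open>E\<^sub>r v\<^sub>1\<close> and \<open>E\<^sub>p v\<^sub>2\<close>\<close>
  have old: "Sum_any (?O1 (r, p)) - Sum_any (?O2 (r, p)) = Sum_any (?G p r)" for r p
  proof -
    have e: "?a r + \<alpha> = a + (\<alpha> + b\<^sub>1) + of_nat r" by simp
    have int: "?a r + \<alpha> \<in> \<int>" unfolding e by (rule Ints_add[OF a Ints_of_nat])
    have "Sum_any (?O1 (r, p)) - Sum_any (?O2 (r, p)) =
      Sum_any (\<lambda>i::nat. y (Y (V.obinom (\<lambda>x. T.N x - s (?a r + 1) x) i (V.E r v\<^sub>1)) (l + int i) (V.E p v\<^sub>2)) (?a r + ?b p + 1 + of_nat i) w)"
      using T.y_jacobi[OF E_ES[OF v1(1)] int, where l=l and v\<^sub>2="V.E p v\<^sub>2" and b="?b p" and w=w] by simp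
    also have "\<dots> = Sum_any (?G p r)"
    proof (rule Sum_any.cong)
      fix i
      have e: "?a r + ?b p + 1 + of_nat i = a + b + b\<^sub>1 + b\<^sub>2 + 1 + of_nat (i + r + p)" by simp
      show "y (Y (V.obinom (\<lambda>x. T.N x - s (?a r + 1) x) i (V.E r v\<^sub>1)) (l + int i) (V.E p v\<^sub>2)) (?a r + ?b p + 1 + of_nat i) w = ?G p r i"
        unfolding e NH_shift_eq[OF E_ge[OF v1(2)]] ..
    qed
    finally show ?thesis .
  qed
  have L: "Sum_any (\<lambda>i::nat. t ((of_int l gchoose i) * (-1) ^ i) (yh v\<^sub>1 (a - of_int l + of_nat i) (yh v\<^sub>2 (b - of_nat i) w)))
    - Sum_any (\<lambda>i::nat. t ((of_int l gchoose i) * (-1) powi (l - int i)) (yh v\<^sub>2 (b - of_int l + of_nat i) (yh v\<^sub>1 (a - of_nat i) w)))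
    = (\<Sum>r<K1. \<Sum>p<K2. Sum_any (?G p r))"
  proof -
    have "Sum_any (\<lambda>i. \<Sum>x\<in>?P. ?O1 x i) - Sum_any (\<lambda>i. \<Sum>x\<in>?P. ?O2 x i) = (\<Sum>x\<in>?P. Sum_any (?O1 x) - Sum_any (?O2 x))"
      unfolding sum_subtractf by (intro arg_cong2[where f="(-)"] Sum_any_sum_swap(1) f1 f2) auto
    also have "\<dots> = (\<Sum>(r,p)\<in>?P. Sum_any (?O1 (r,p)) - Sum_any (?O2 (r,p)))" by (simp only: split_def prod.collapse)
    also have "\<dots> = (\<Sum>r<K1. \<Sum>p<K2. Sum_any (?G p r))" unfolding old by (rule sum.cartesian_product[symmetric])
    finally show ?thesis unfolding A1 A2 .
  qed

  \<comment> \<open>\<open>I\<close> bounds the index \<open>i\<close> as \<open>K1\<close> and \<open>K2\<close> bound \<open>r\<close> and \<open>p\<close>, so all sums may be rearranged by total degree\<close>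
  have "\<exists>I. \<forall>x\<in>?P. \<forall>i\<ge>I. Y (V.obinom (\<lambda>z. ?M z + V.D (fst x) z) i (V.E (fst x) v\<^sub>1)) (l + int i) (V.E (snd x) v\<^sub>2) = 0"
    unfolding NH_shift_eq[OF E_ge[OF v1(2)], symmetric] by (intro uniform_bound T_truncation) auto
  then obtain I where I: "\<forall>x\<in>?P. \<forall>i\<ge>I. Y (V.obinom (\<lambda>z. ?M z + V.D (fst x) z) i (V.E (fst x) v\<^sub>1)) (l + int i) (V.E (snd x) v\<^sub>2) = 0" ..
  have lMD: "V.lin (V.obinom (\<lambda>x. ?M x + V.D r x) i)" for r i by (intro V.lin_obinom lin_plus lM V.D_lin)
  have G0: "?G p r i = 0" if "r \<ge> K1 \<or> i \<ge> I" for p r i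
  proof -
    have "Y (V.obinom (\<lambda>x. ?M x + V.D r x) i (V.E r v\<^sub>1)) (l + int i) (V.E p v\<^sub>2) = 0"
    proof (cases "r < K1 \<and> p < K2")
      case True
      then show ?thesis using I[rule_format, of "(r,p)" i] that by auto
    next
      case False
      then have "V.E r v\<^sub>1 = 0 \<or> V.E p v\<^sub>2 = 0" using K1 K2 by (meson not_le)
      then show ?thesis using lin_zero[OF lMD] by auto
    qed
    then show ?thesis by (simp only: T.y_zero)
  qed
  have G0': "?G p r i = 0" if "p \<ge> K2" for p r i
    using K2 that by (simp add: T.y_zero)
  let ?H = "\<lambda>p k. \<Sum>r\<le>k. ?G p r (k - r)"
  have H0: "?H p k = 0" if "p \<ge> K2 \<or> k \<ge> K1 + I" for p k
  proof (cases "k \<ge> K1 + I")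
    case True then show ?thesis by (intro V.Sum_any_convolution(2)[where K=K1 and L=I, OF G0])
  next
    case False then show ?thesis using that by (intro sum.neutral ballI G0') auto
  qed
  have H: "(\<Sum>r<K1. Sum_any (?G p r)) = (\<Sum>k<K1+I. ?H p k)" for p
  proof -
    have "(\<Sum>r<K1. Sum_any (?G p r)) = (\<Sum>r<K1. \<Sum>i<I. ?G p r i)"
      by (intro sum.cong refl Sum_any_eq_sum) (auto intro!: G0 simp del: of_nat_add)
    also have "\<dots> = Sum_any (?H p)" by (rule V.Sum_any_convolution(1)[where K=K1 and L=I, symmetric]) (rule G0)
    also have "\<dots> = (\<Sum>k<K1+I. ?H p k)"
    proof (rule Sum_any_eq_sum)
      fix k assume "k \<notin> {..<K1+I}"
      then have "k \<ge> K1 + I" by simp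
      then show "?H p k = 0" by (intro H0 disjI2)
    qed simp
    finally show ?thesis .
  qed
  let ?X = "\<lambda>i. Y (V.obinom ?M i v\<^sub>1) (l + int i) v\<^sub>2"
  let ?Z = "\<lambda>i q. y (V.E q (?X i)) (a + b + b\<^sub>1 + b\<^sub>2 + 1 + of_nat (i + q)) w"
  have Mu: "Y u (int m) (?M x) = ?M (Y u (int m) x)" for m x by (simp add: V.Y_diff V.Y_scale NH_u)
  have "(\<Sum>r<K1. \<Sum>p<K2. Sum_any (?G p r)) = (\<Sum>p<K2. \<Sum>r<K1. Sum_any (?G p r))" by (rule sum.swap)
  also have "\<dots> = (\<Sum>p<K2. \<Sum>k<K1+I. ?H p k)" by (simp only: H)
  also have "\<dots> = Sum_any (\<lambda>n. \<Sum>p\<le>n. ?H p (n - p))"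
    by (rule V.Sum_any_convolution(1)[where K=K2 and L="K1+I", symmetric]) (rule H0)
  also have "\<dots> = Sum_any (\<lambda>n. \<Sum>i\<le>n. ?Z i (n - i))"
  proof (rule Sum_any.cong)
    fix n
    have "(\<Sum>p\<le>n. ?H p (n - p)) = (\<Sum>p\<le>n. \<Sum>r\<le>n-p. y (Y (V.obinom (\<lambda>x. ?M x + V.D r x) (n - p - r) (V.E r v\<^sub>1)) (l + int (n - p - r)) (V.E p v\<^sub>2)) (a + b + b\<^sub>1 + b\<^sub>2 + 1 + of_nat n) w)"
    proof (intro sum.cong refl)
      fix p r assume "p \<in> {..n}" "r \<in> {..n - p}"
      then have "n - p - r + r + p = n" by simp
      then show "?G p r (n - p - r) = y (Y (V.obinom (\<lambda>x. ?M x + V.D r x) (n - p - r) (V.E r v\<^sub>1)) (l + int (n - p - r)) (V.E p v\<^sub>2)) (a + b + b\<^sub>1 + b\<^sub>2 + 1 + of_nat n) w"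
        by (simp only:)
    qed
    also have "\<dots> = y (\<Sum>p\<le>n. \<Sum>r\<le>n-p. Y (V.obinom (\<lambda>x. ?M x + V.D r x) (n - p - r) (V.E r v\<^sub>1)) (l + int (n - p - r)) (V.E p v\<^sub>2)) (a + b + b\<^sub>1 + b\<^sub>2 + 1 + of_nat n) w"
      by (simp only: T.y_sum)
    also have "\<dots> = y (\<Sum>i\<le>n. V.E (n - i) (?X i)) (a + b + b\<^sub>1 + b\<^sub>2 + 1 + of_nat n) w"
      unfolding V.jacobi_core[where M="?M", OF lM Mu] ..
    also have "\<dots> = (\<Sum>i\<le>n. y (V.E (n - i) (?X i)) (a + b + b\<^sub>1 + b\<^sub>2 + 1 + of_nat n) w)" by (simp only: T.y_sum)
    also have "\<dots> = (\<Sum>i\<le>n. ?Z i (n - i))"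
    proof (intro sum.cong refl)
      fix i assume "i \<in> {..n}"
      then have "i + (n - i) = n" by simp
      then show "y (V.E (n - i) (?X i)) (a + b + b\<^sub>1 + b\<^sub>2 + 1 + of_nat n) w = ?Z i (n - i)" by (simp only:)
    qed
    finally show "(\<Sum>p\<le>n. ?H p (n - p)) = (\<Sum>i\<le>n. ?Z i (n - i))" .
  qed
  also have "\<dots> = Sum_any (\<lambda>i::nat. yh (?X i) (a + b + 1 + of_nat i) w)"
  proof -
    obtain J where J: "\<forall>i\<ge>J. ?X i = 0" using F_truncation by blast
    obtain K where K: "\<forall>i\<in>{..<J}. \<forall>q\<ge>K. V.E q (?X i) = 0"
      using uniform_bound[of "{..<J}" "\<lambda>i q. V.E q (?X i) = 0"] V.E_bound by blast
    have EK: "\<forall>q\<ge>K. V.E q (?X i) = 0" for i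
    proof (cases "i < J")
      case False then show ?thesis using J lin_zero[OF V.E_lin] by simp
    qed (use K in simp)
    have U0D: "V.U0 (Y v n w) = Y (V.U0 v) n w + Y v n (V.U0 w)" for v n w by (rule V.u0_derivation)
    \<comment> \<open>\<open>u\<^sub>0\<close> is a derivation, so \<open>yh_ge\<close> applies to the products with the eigenvalue \<open>b\<^sub>1 + b\<^sub>2\<close>\<close>
    have Xg: "?X i \<in> V.ge V.U0 (b\<^sub>1 + b\<^sub>2)" for i
    proof (rule bilinear_product.derivation_ge[OF V.bilinear_mode, where D=V.U0 and D'=V.U0, OF U0_lin U0_lin U0D _ v2])
      show "V.obinom ?M i v\<^sub>1 \<in> V.ge V.U0 b\<^sub>1"
        by (rule V.subspace_obinom[OF V.subspace_ge[OF U0_lin] _ v1(2)]) (intro V.ge_diff V.ge_scale U0_lin NH_ge)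
    qed
    have Z: "yh (?X i) (a + b + 1 + of_nat i) w = (\<Sum>q<K. ?Z i q)" for i
      unfolding yh_ge[OF Xg EK] by (intro sum.cong refl) (simp add: algebra_simps)
    have Z0: "?Z i q = 0" if "i \<ge> J \<or> q \<ge> K" for i q
    proof -
      have "V.E q (?X i) = 0" using that J EK lin_zero[OF V.E_lin] by auto
      then show ?thesis by (simp only: T.y_zero)
    qed
    have "Sum_any (\<lambda>i::nat. yh (?X i) (a + b + 1 + of_nat i) w) = (\<Sum>i<J. \<Sum>q<K. ?Z i q)"
      unfolding Z by (rule Sum_any_eq_sum) (auto intro!: sum.neutral Z0 simp del: of_nat_add)
    also have "\<dots> = Sum_any (\<lambda>n. \<Sum>i\<le>n. ?Z i (n - i))"
      by (rule V.Sum_any_convolution(1)[where K=J and L=K, symmetric]) (rule Z0)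
    finally show ?thesis by simp
  qed
  finally show ?thesis unfolding L .
qed

text \<open>Both sides are additive in \<open>v\<^sub>1\<close> and \<open>v\<^sub>2\<close>, which reduces the identity to generalized eigenvectors.\<close>

lemma yh_jacobi:
  assumes v1: "v\<^sub>1 \<in> F.ES \<beta>" and a: "a + \<beta> \<in> \<int>"
  shows "Sum_any (\<lambda>i::nat. t ((of_int l gchoose i) * (-1) ^ i) (yh v\<^sub>1 (a - of_int l + of_nat i) (yh v\<^sub>2 (b - of_nat i) w)))
    - Sum_any (\<lambda>i::nat. t ((of_int l gchoose i) * (-1) powi (l - int i)) (yh v\<^sub>2 (b - of_int l + of_nat i) (yh v\<^sub>1 (a - of_nat i) w)))
    = Sum_any (\<lambda>i::nat. yh (Y (V.obinom (\<lambda>x. NH x - s (a + 1) x) i v\<^sub>1) (l + int i) v\<^sub>2) (a + b + 1 + of_nat i) w)"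
    (is "?J v\<^sub>1 v\<^sub>2")
proof -
  let ?A = "\<lambda>v\<^sub>1 v\<^sub>2. \<lambda>i::nat. t ((of_int l gchoose i) * (-1) ^ i) (yh v\<^sub>1 (a - of_int l + of_nat i) (yh v\<^sub>2 (b - of_nat i) w))"
  let ?B = "\<lambda>v\<^sub>1 v\<^sub>2. \<lambda>i::nat. t ((of_int l gchoose i) * (-1) powi (l - int i)) (yh v\<^sub>2 (b - of_int l + of_nat i) (yh v\<^sub>1 (a - of_nat i) w))"
  let ?C = "\<lambda>v\<^sub>1 v\<^sub>2. \<lambda>i::nat. yh (Y (V.obinom (\<lambda>x. NH x - s (a + 1) x) i v\<^sub>1) (l + int i) v\<^sub>2) (a + b + 1 + of_nat i) w"
  have fA: "finite {i. ?A v\<^sub>1 v\<^sub>2 i \<noteq> 0}" for v\<^sub>1 v\<^sub>2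
    using F.lhs_finite(1)[of v\<^sub>1 v\<^sub>2 l a 0 b 0 w] unfolding F.lhs_term1_def F.YL_def by simp
  have fB: "finite {i. ?B v\<^sub>1 v\<^sub>2 i \<noteq> 0}" for v\<^sub>1 v\<^sub>2
    using F.lhs_finite(2)[of v\<^sub>1 v\<^sub>2 l a 0 b 0 w] unfolding F.lhs_term2_def F.YL_def by simp
  have fC: "finite {i. ?C v\<^sub>1 v\<^sub>2 i \<noteq> 0}" for v\<^sub>1 v\<^sub>2
  proof -
    obtain I where I: "\<forall>i\<ge>I. Y (V.obinom (\<lambda>x. NH x - s (a + 1) x) i v\<^sub>1) (l + int i) v\<^sub>2 = 0" using F_truncation by blast
    show ?thesis
    proof (rule finite_subset[of _ "{..<I}"])
      show "{i. ?C v\<^sub>1 v\<^sub>2 i \<noteq> 0} \<subseteq> {..<I}"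
      proof
        fix i assume "i \<in> {i. ?C v\<^sub>1 v\<^sub>2 i \<noteq> 0}"
        then have "Y (V.obinom (\<lambda>x. NH x - s (a + 1) x) i v\<^sub>1) (l + int i) v\<^sub>2 \<noteq> 0" using F.y_zero by auto
        then show "i \<in> {..<I}" using I by (meson lessThan_iff not_le)
      qed
    qed simp
  qed
  have lM: "V.lin (V.obinom (\<lambda>x. NH x - s (a + 1) x) i)" for i by (intro V.lin_obinom lin_minus NH_lin V.lin_scaleV)
  have J_add: "?J x z" if "?A x z = (\<lambda>i. ?A x\<^sub>1 z\<^sub>1 i + ?A x\<^sub>2 z\<^sub>2 i)" "?B x z = (\<lambda>i. ?B x\<^sub>1 z\<^sub>1 i + ?B x\<^sub>2 z\<^sub>2 i)"
    "?C x z = (\<lambda>i. ?C x\<^sub>1 z\<^sub>1 i + ?C x\<^sub>2 z\<^sub>2 i)" "?J x\<^sub>1 z\<^sub>1" "?J x\<^sub>2 z\<^sub>2" for x x\<^sub>1 x\<^sub>2 z z\<^sub>1 z\<^sub>2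
    unfolding that(1-3) V.Sum_any_add_fin(1)[OF fA fA] V.Sum_any_add_fin(1)[OF fB fB] V.Sum_any_add_fin(1)[OF fC fC]
    using that(4,5) by (simp only: add_diff_add)
  show ?thesis
  proof (rule h_induct[OF V.S_op_eigenspace_cis[OF hp(3,2) v1], of "\<lambda>v\<^sub>1. ?J v\<^sub>1 v\<^sub>2"])
    fix \<alpha> b\<^sub>1 x assume x: "x \<in> T.ES \<alpha>" "x \<in> V.ge V.U0 b\<^sub>1" "cis2pi (\<alpha> + b\<^sub>1) = cis2pi \<beta>"
    have "\<alpha> + b\<^sub>1 - \<beta> \<in> \<int>" using x(3) by (simp only: cis2pi_eq_iff)
    then have "(\<alpha> + b\<^sub>1 - \<beta>) + (a + \<beta>) \<in> \<int>" using a by (rule Ints_add)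
    then have i: "a + (\<alpha> + b\<^sub>1) \<in> \<int>" by (simp add: algebra_simps)
    show "?J x v\<^sub>2"
      using U0_tri
    proof (induction v\<^sub>2 rule: V.triangulable_induct)
      case (ge b\<^sub>2 z) then show ?case by (rule yh_jacobi_eigen[OF x(1,2) _ i])
    next
      case (add z\<^sub>1 z\<^sub>2)
      show ?case by (rule J_add[OF _ _ _ add])
        (simp_all add: fun_eq_iff F.y_add V.Y_add T.W.scale_right_distrib)
    qed
  next
    fix x\<^sub>1 x\<^sub>2 assume J: "?J x\<^sub>1 v\<^sub>2" "?J x\<^sub>2 v\<^sub>2"
    show "?J (x\<^sub>1 + x\<^sub>2) v\<^sub>2"
      by (rule J_add[OF _ _ _ J]) (simp_all add: fun_eq_iff F.y_add V.Y_add lin_add[OF lM] T.W.scale_right_distrib)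
  next
    show "?J 0 v\<^sub>2" by (simp only: lin_zero[OF lM] F.y_zero V.Y_0_left T.W.scale_zero_right Sum_any.neutral diff_self)
  qed
qed

theorem yh_core: "twisted_core s Y vac \<omega> t h yh"
  by (intro twisted_core.intro twisted_core_axioms.intro yh_family yh_vac yh_jacobi)

end

section \<open>Classes of exponents modulo integers\<close>

lemma C_mod_Z_diff: "\<Gamma> \<in> C_mod_Z \<Longrightarrow> \<gamma> \<in> \<Gamma> \<Longrightarrow> \<delta> \<in> \<Gamma> \<Longrightarrow> \<gamma> - \<delta> \<in> \<int>"
proof -
  assume "\<Gamma> \<in> C_mod_Z" "\<gamma> \<in> \<Gamma>" "\<delta> \<in> \<Gamma>"
  then obtain a where "a - \<gamma> \<in> \<int>" "a - \<delta> \<in> \<int>" by (auto simp: C_mod_Z_def quotient_def)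
  have "(a - \<delta>) - (a - \<gamma>) \<in> \<int>" by (rule Ints_diff) fact+
  then show ?thesis by simp
qed

definition Z_class :: "complex \<Rightarrow> complex set" where "Z_class \<gamma> = {z. \<gamma> - z \<in> \<int>}"

lemma Z_class: "Z_class \<gamma> \<in> C_mod_Z" "\<gamma> \<in> Z_class \<gamma>"
  by (auto simp: Z_class_def C_mod_Z_def quotient_def)

lemma C_mod_Z_eq: "\<Gamma> \<in> C_mod_Z \<Longrightarrow> \<gamma> \<in> \<Gamma> \<Longrightarrow> \<Gamma> = Z_class \<gamma>"
proof -
  assume "\<Gamma> \<in> C_mod_Z" and g: "\<gamma> \<in> \<Gamma>"
  then obtain a where a: "\<Gamma> = {z. a - z \<in> \<int>}" by (auto simp: C_mod_Z_def quotient_def)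
  then have "a - \<gamma> \<in> \<int>" using g by simp
  have "a - z \<in> \<int> \<longleftrightarrow> \<gamma> - z \<in> \<int>" for z
    using Ints_diff[OF _ \<open>a - \<gamma> \<in> \<int>\<close>, of "a - z"] Ints_add[OF _ \<open>a - \<gamma> \<in> \<int>\<close>, of "\<gamma> - z"] by auto
  then show ?thesis by (simp add: a Z_class_def)
qed

lemma C_mod_Z_nonempty: "\<Gamma> \<in> C_mod_Z \<Longrightarrow> \<exists>\<gamma>. \<gamma> \<in> \<Gamma>"
proof -
  assume "\<Gamma> \<in> C_mod_Z"
  then obtain a where "\<Gamma> = {z. a - z \<in> \<int>}" by (auto simp: C_mod_Z_def quotient_def)
  then have "a \<in> \<Gamma>" by simp
  then show ?thesis by blast
qed

context complex_vector_space begin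

text \<open>The map \<open>\<gamma> \<mapsto> e\<^bsup>2\<pi>i\<gamma>\<^esup>\<close> is constant on the classes modulo \<open>\<int>\<close> and separates them, so \<open>WG n \<Gamma>\<close> is a joint generalized
  eigenspace \<open>ge L n \<inter> ge G c\<close>, and no eigenvalue of the invertible \<open>G\<close> is missed.  Independence
  follows from that of the generalized eigenspaces of \<open>L\<close> and then of \<open>G\<close>.\<close>

lemma joint_grading:
  fixes L G :: "'a \<Rightarrow> 'a"
  defines "WG \<equiv> \<lambda>n \<Gamma>. {w \<in> ge L n. \<exists>\<gamma>\<in>\<Gamma>. w \<in> ge G (exp (2 * pi * \<i> * \<gamma>))}"
  assumes L: "triangulable L" and G: "triangulable G" "inj G" and c: "\<And>x. G (L x) = L (G x)"
  shows "is_direct_sum scale (UNIV \<times> C_mod_Z) (\<lambda>(n, \<Gamma>). WG n \<Gamma>)"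
    and "wt_part scale WG n = ge L n"
    and "\<Gamma> \<in> C_mod_Z \<Longrightarrow> \<alpha> \<in> \<Gamma> \<Longrightarrow> g_part scale WG \<Gamma> \<subseteq> ge G (exp (2 * pi * \<i> * \<alpha>))"
proof -
  have lL: "lin L" and lG: "lin G" using L G triangulable_lin by auto
  have WG: "WG n \<Gamma> = ge L n \<inter> ge G (cis2pi \<gamma>)" if "\<Gamma> \<in> C_mod_Z" "\<gamma> \<in> \<Gamma>" for n \<Gamma> \<gamma>
  proof -
    have "cis2pi \<delta> = cis2pi \<gamma>" if "\<delta> \<in> \<Gamma>" for \<delta>
      using C_mod_Z_diff[OF \<open>\<Gamma> \<in> C_mod_Z\<close> that \<open>\<gamma> \<in> \<Gamma>\<close>] by (simp add: cis2pi_eq_iff)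
    then have "(\<exists>\<delta>\<in>\<Gamma>. w \<in> ge G (cis2pi \<delta>)) \<longleftrightarrow> w \<in> ge G (cis2pi \<gamma>)" for w using that(2) by metis
    then show ?thesis unfolding WG_def cis2pi_def[symmetric] by blast
  qed
  have sub: "subspace (WG n \<Gamma>)" if g: "\<Gamma> \<in> C_mod_Z" for n \<Gamma>
  proof -
    obtain \<gamma> where "\<gamma> \<in> \<Gamma>" using C_mod_Z_nonempty[OF g] by blast
    then show ?thesis unfolding WG[OF g \<open>\<gamma> \<in> \<Gamma>\<close>] by (intro subspace_inter subspace_ge lL lG)
  qed
  have span: "w \<in> span (\<Union>\<Gamma>\<in>C_mod_Z. WG n \<Gamma>)" if w: "w \<in> ge L n" for w n
  proof (rule triangulable_induct_within[where T=G and R=L and P="\<lambda>w. w \<in> span (\<Union>\<Gamma>\<in>C_mod_Z. WG n \<Gamma>)", OF G(1) lL c w])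
    fix a x assume x: "x \<in> ge G a" "x \<in> ge L n"
    show "x \<in> span (\<Union>\<Gamma>\<in>C_mod_Z. WG n \<Gamma>)"
    proof (cases "a = 0")
      case True
      then have "x = 0" using ge_inj_0[OF G] x by blast
      then show ?thesis by (simp add: span_zero)
    next
      case False
      then obtain \<gamma> where "cis2pi \<gamma> = a" using strip_log_exists by blast
      then have "x \<in> WG n (Z_class \<gamma>)" using WG[OF Z_class, of n \<gamma>] x by simp
      then show ?thesis using Z_class(1) by (intro span_base) blast
    qed
  qed (rule span_add)
  show wt: "wt_part scale WG n = ge L n" for n
    unfolding wt_part_def
  proof
    show "span (\<Union>\<Gamma>\<in>C_mod_Z. WG n \<Gamma>) \<subseteq> ge L n"
      by (rule span_minimal[OF _ subspace_ge[OF lL]]) (auto simp: WG_def)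
  qed (use span in blast)
  show "g_part scale WG \<Gamma> \<subseteq> ge G (exp (2 * pi * \<i> * \<alpha>))" if "\<Gamma> \<in> C_mod_Z" "\<alpha> \<in> \<Gamma>"
    unfolding g_part_def
    by (rule span_minimal[OF _ subspace_ge[OF lG]]) (use WG[OF that] in \<open>auto simp: cis2pi_def\<close>)
  show "is_direct_sum scale (UNIV \<times> C_mod_Z) (\<lambda>(n, \<Gamma>). WG n \<Gamma>)"
  proof (rule is_direct_sumI)
    show "subspace ((\<lambda>(n, \<Gamma>). WG n \<Gamma>) i)" if "i \<in> UNIV \<times> C_mod_Z" for i using that sub by auto
    have "span (\<Union>\<Gamma>\<in>C_mod_Z. WG n \<Gamma>) \<subseteq> span (\<Union>i\<in>UNIV \<times> C_mod_Z. (\<lambda>(n, \<Gamma>). WG n \<Gamma>) i)" for n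
      by (rule span_mono) auto
    then have *: "w \<in> ge L n \<Longrightarrow> w \<in> span (\<Union>i\<in>UNIV \<times> C_mod_Z. (\<lambda>(n, \<Gamma>). WG n \<Gamma>) i)" for w n using span by blast
    show "v \<in> span (\<Union>i\<in>UNIV \<times> C_mod_Z. (\<lambda>(n, \<Gamma>). WG n \<Gamma>) i)" for v
      using L by (induction v rule: triangulable_induct) (rule *, assumption, rule span_add)
  next
    fix f assume f: "decomposes (UNIV \<times> C_mod_Z) (\<lambda>(n, \<Gamma>). WG n \<Gamma>) 0 f"
    let ?F = "{i. f i \<noteq> 0}"
    let ?A = "fst ` ?F" and ?B = "snd ` ?F"
    have fin: "finite ?F" and fW: "\<And>n \<Gamma>. \<Gamma> \<in> C_mod_Z \<Longrightarrow> f (n, \<Gamma>) \<in> WG n \<Gamma>" and f0: "\<And>n \<Gamma>. \<Gamma> \<notin> C_mod_Z \<Longrightarrow> f (n, \<Gamma>) = 0"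
      and sf: "Sum_any f = 0" using f by (auto simp: decomposes_def)
    have BC: "?B \<subseteq> C_mod_Z"
    proof
      fix \<Gamma> assume "\<Gamma> \<in> ?B"
      then obtain n where "f (n, \<Gamma>) \<noteq> 0" by auto
      then show "\<Gamma> \<in> C_mod_Z" using f0[of \<Gamma> n] by (cases "\<Gamma> \<in> C_mod_Z") auto
    qed
    have fL: "f (n, \<Gamma>) \<in> ge L n" for n \<Gamma>
      using fW[of \<Gamma> n] f0[of \<Gamma> n] ge_0[OF lL] by (cases "\<Gamma> \<in> C_mod_Z") (auto simp: WG_def)
    have "Sum_any f = sum f (?A \<times> ?B)"
      by (rule Sum_any_eq_sum) (use fin in \<open>force+\<close>)
    then have "(\<Sum>n\<in>?A. \<Sum>\<Gamma>\<in>?B. f (n, \<Gamma>)) = 0" using sf by (simp add: sum.cartesian_product)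
    then have z: "(\<Sum>\<Gamma>\<in>?B. f (n, \<Gamma>)) = 0" if "n \<in> ?A" for n
      using ge_independent[OF lL, of ?A "\<lambda>n. \<Sum>\<Gamma>\<in>?B. f (n, \<Gamma>)" n] fin that fL by (auto intro: ge_sum[OF lL])
    define e where "e \<Gamma> = (SOME \<gamma>. \<gamma> \<in> \<Gamma>)" for \<Gamma> :: "complex set"
    have e: "e \<Gamma> \<in> \<Gamma>" if "\<Gamma> \<in> C_mod_Z" for \<Gamma>
      unfolding e_def by (rule someI_ex[OF C_mod_Z_nonempty[OF that]])
    let ?c = "\<lambda>\<Gamma>. cis2pi (e \<Gamma>)"
    have inj: "inj_on ?c C_mod_Z"
    proof (rule inj_onI)
      fix \<Gamma> \<Gamma>' assume G: "\<Gamma> \<in> C_mod_Z" "\<Gamma>' \<in> C_mod_Z" "?c \<Gamma> = ?c \<Gamma>'"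
      then have "e \<Gamma> - e \<Gamma>' \<in> \<int>" by (simp add: cis2pi_eq_iff)
      then have "e \<Gamma>' \<in> Z_class (e \<Gamma>)" by (simp add: Z_class_def)
      then have "e \<Gamma>' \<in> \<Gamma>" using C_mod_Z_eq[OF G(1) e[OF G(1)]] by simp
      then show "\<Gamma> = \<Gamma>'" using C_mod_Z_eq[OF G(1)] C_mod_Z_eq[OF G(2) e[OF G(2)]] by simp
    qed
    then have injB: "inj_on ?c ?B" using BC by (rule inj_on_subset)
    have "f (n, \<Gamma>) = 0" if n: "n \<in> ?A" and g: "\<Gamma> \<in> ?B" for n \<Gamma>
    proof -
      let ?x = "\<lambda>c. f (n, inv_into ?B ?c c)"
      have x: "?x (?c \<Gamma>) = f (n, \<Gamma>)" if "\<Gamma> \<in> ?B" for \<Gamma> using inv_into_f_f[OF injB that] by simp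
      have "(\<Sum>c\<in>?c ` ?B. ?x c) = (\<Sum>\<Gamma>\<in>?B. f (n, \<Gamma>))" unfolding sum.reindex[OF injB] o_def using x by (intro sum.cong refl)
      moreover have "?x c \<in> ge G c" if "c \<in> ?c ` ?B" for c
      proof -
        obtain \<Gamma> where G: "\<Gamma> \<in> ?B" "c = ?c \<Gamma>" using \<open>c \<in> ?c ` ?B\<close> by blast
        then have "\<Gamma> \<in> C_mod_Z" using BC by blast
        then show ?thesis unfolding G(2) x[OF G(1)] using fW[of \<Gamma> n] WG[OF _ e, of \<Gamma> n] by auto
      qed
      ultimately have "?x (?c \<Gamma>) = 0"
        using ge_independent[OF lG, of "?c ` ?B" ?x "?c \<Gamma>"] z[OF n] g fin by auto
      then show ?thesis using x[OF g] by simp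
    qed
    then show "f = (\<lambda>_. 0)" by (force simp: fun_eq_iff)
  qed
qed

end

section \<open>The grading of the transported module\<close>

context shift_twisted begin

abbreviation L :: "'w \<Rightarrow> 'w" where "L \<equiv> y \<omega> (-2)"
abbreviation U :: "'w \<Rightarrow> 'w" where "U \<equiv> y u (-1)"

text \<open>The Jacobi identity with \<open>v\<^sub>1 = u\<close>, \<open>a = -1\<close>, \<open>l = 0\<close>.  As \<open>g u = u\<close>, the operator \<open>N\<^sub>g - a - 1\<close> kills \<open>u\<close>, and only
  \<open>i = 0\<close> remains on the right.\<close>

lemma U_bracket: "U (y v b w) = y (V.U0 v) b w + y v b (U w)"
proof -
  have u: "T.N u = 0" "u \<in> T.ES 0"
    using V.N_op_fixed[OF T.h_props(3,2) gu_fix] V.S_op_eigenspace[OF T.h_props(3,2), of 0] by auto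
  have l: "V.lin (\<lambda>x. T.N x - s (-1 + 1) x)" by (intro lin_minus T.N_lin V.lin_scaleV)
  have ob: "V.obinom (\<lambda>x. T.N x - s (-1 + 1) x) i u = s (0 gchoose i) u" for i
    by (rule V.obinom_eigen[OF l]) (simp add: u)
  have "Sum_any (\<lambda>i::nat. y (Y (V.obinom (\<lambda>x. T.N x - s (-1 + 1) x) i u) (0 + int i) v) (-1 + b + 1 + of_nat i) w) = y (V.U0 v) b w"
    unfolding ob by (subst Sum_any_eq_sum[of "{0}"]) (auto simp: gbinomial_0_left T.y_zero)
  then show ?thesis using T.y_jacobi[OF u(2), where a="-1" and l=0 and v\<^sub>2=v and b=b and w=w]
    unfolding T.sum_l0[of "\<lambda>i. (-1)^i"] T.sum_l0[of "\<lambda>i. (-1) powi (0 - int i)"] by (simp add: algebra_simps)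
qed

lemma E_1_omega: "V.E 1 \<omega> = - u"
proof -
  have "(\<Sum>m\<le>1. s ((-1) ^ m) (Y u (int m) (V.E (1 - m) \<omega>))) = V.U0 (V.E 1 \<omega>) - u"
    using V.u_omega_1 by (simp add: atMost_Suc)
  then show ?thesis using V.E_rec[where v=\<omega> and q=1] by simp
qed

lemma E_2_omega: obtains \<kappa> where "V.E 2 \<omega> = s \<kappa> vac"
  using V.E_wt[OF V.omega_wt, of 2] V.wt0 by auto

text \<open>The vector \<open>\<omega>\<close> has \<open>u\<^sub>0\<close>-eigenvalue \<open>0\<close>, and \<open>E\<^sub>1 \<omega> = - u\<^sub>1 \<omega> = - u\<close>.  By weight, \<open>E\<^sub>2 \<omega>\<close> is a multiple \<open>\<kappa> \<one>\<close> of the vacuum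
  and \<open>E\<^sub>q \<omega> = 0\<close> for \<open>q \<ge> 3\<close>.  The exponents \<open>-2\<close>, \<open>-1\<close>, \<open>0\<close> of the three terms give \<open>L(0)\<close>, \<open>u\<^sub>0\<close> and
  the identity.\<close>

lemma yh_omega: "\<exists>\<kappa>. \<forall>w. yh \<omega> (-2) w = L w - U w + t \<kappa> w"
proof -
  obtain \<kappa> where k: "V.E 2 \<omega> = s \<kappa> vac" by (rule E_2_omega)
  have o: "\<omega> \<in> V.ge V.U0 0" by (rule V.geI[where K=1]) (simp add: V.u_omega_0)
  have E: "\<forall>q\<ge>3. V.E q \<omega> = 0"
  proof (intro allI impI)
    fix q :: nat assume "q \<ge> 3"
    then show "V.E q \<omega> = 0" by (intro V.neg_wt_zero[OF V.E_wt[OF V.omega_wt]]) simp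
  qed
  have "yh \<omega> (-2) w = L w - U w + t \<kappa> w" for w
  proof -
    have "yh \<omega> (-2) w = y (V.E 0 \<omega>) (-2) w + y (V.E 1 \<omega>) (-1) w + y (V.E 2 \<omega>) 0 w"
      unfolding yh_ge[OF o E] by (simp add: numeral_3_eq_3 numeral_2_eq_2)
    also have "\<dots> = L w - U w + t \<kappa> w"
      unfolding E_1_omega k by (simp add: lin_neg[OF T.y_l] T.y_scale T.y_vac)
    finally show ?thesis .
  qed
  then show ?thesis by blast
qed

end

locale shift_twisted_graded = shift_twisted s Y vac \<omega> u t g y
  for s :: "complex \<Rightarrow> 'v::ab_group_add \<Rightarrow> 'v" and Y vac \<omega> u
    and t :: "complex \<Rightarrow> 'w::ab_group_add \<Rightarrow> 'w" and g y +
  fixes gW :: "'w \<Rightarrow> 'w"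
  assumes L_tri: "complex_vector_space.triangulable t (y \<omega> (-2))"
    and U_tri: "complex_vector_space.triangulable t (y u (-1))"
    and gW_tri: "complex_vector_space.triangulable t gW"
    and gW_bij: "bij gW"
    and gW_compat: "gW (y v n w) = y (g v) n (gW w)"
begin

definition eU :: "'w \<Rightarrow> 'w" where "eU = op_exp t (\<lambda>w. t (2 * pi * \<i>) (U w))"

lemma U_lin: "T.W.lin U" by (rule T.y_r)
lemma gW_lin: "T.W.lin gW" by (rule T.W.triangulable_lin[OF gW_tri])
lemma eU_lin: "T.W.lin eU" unfolding eU_def by (rule T.W.op_exp_props(1)[OF T.W.triangulable_scale(1)[OF U_tri]])
lemma eU_bij: "bij eU" unfolding eU_def by (rule T.W.bij_op_exp[OF U_tri])

lemma L_U: "L (U w) = U (L w)" using U_bracket[of \<omega> "-2" w] by (simp add: V.u_omega_0 T.y_zero)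
lemma gW_L: "gW (L w) = L (gW w)" by (simp add: gW_compat T.h_props(8))
lemma gW_U: "gW (U w) = U (gW w)" by (simp add: gW_compat gu_fix)

lemma eU_commute: "T.W.lin C \<Longrightarrow> (\<And>x. U (C x) = C (U x)) \<Longrightarrow> eU (C x) = C (eU x)"
  unfolding eU_def
  by (rule T.W.op_exp_commute[where C=C, OF T.W.triangulable_scale(1)[OF U_tri]]) (simp_all add: lin_scale)

lemma gW_TT: "gW (TT v n k w) = TT (g v) n k (gW w)"
  using U0_tri
proof (induction v rule: V.triangulable_induct)
  case (ge b v)
  obtain K where K: "\<forall>q\<ge>K. V.E q v = 0" using V.E_bound by blast
  have gv: "g v \<in> V.ge V.U0 b" by (rule V.ge_commute[where T=V.U0 and S=g, OF T.h_props(1) g_u[symmetric] ge])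
  have K': "\<forall>q\<ge>K. V.E q (g v) = 0" unfolding E_g[symmetric] using K lin_zero[OF T.h_props(1)] by simp
  have "NH (g x) = g (NH x)" for x
    by (rule V.N_op_commute[where h=h and C=g, OF hp(3,2) T.h_props(1)]) (simp add: g_gu)
  then have "MH k (g x) = g (MH k x)" for x
    by (simp add: funpow_commute_op[of "\<lambda>x. - NH x" g] lin_neg[OF T.h_props(1)] lin_scale[OF T.h_props(1)])
  then show ?case unfolding TT_ge[OF ge K] TT_ge[OF gv K'] by (simp only: lin_sum[OF gW_lin] gW_compat E_g[symmetric])
qed (simp only: lin_add[OF TT_lin_l] lin_add[OF gW_lin] lin_add[OF T.h_props(1)])

lemma U_TT: "U (TT v n k w) = TT (V.U0 v) n k w + TT v n k (U w)"
  using U0_tri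
proof (induction v rule: V.triangulable_induct)
  case (ge b v)
  obtain K where K: "\<forall>q\<ge>K. V.E q v = 0" using V.E_bound by blast
  have gv: "V.U0 v \<in> V.ge V.U0 b" by (rule V.ge_self[OF U0_lin ge])
  have K': "\<forall>q\<ge>K. V.E q (V.U0 v) = 0" unfolding E_U0[symmetric] using K lin_zero[OF U0_lin] by simp
  have "MH k (V.U0 x) = V.U0 (MH k x)" for x
    by (simp add: funpow_commute_op[of "\<lambda>x. - NH x" V.U0] U0_NH[symmetric] lin_neg[OF U0_lin] lin_scale[OF U0_lin])
  then show ?case unfolding TT_ge[OF ge K] TT_ge[OF gv K']
    by (simp only: lin_sum[OF U_lin] U_bracket E_U0[symmetric] sum.distrib)
qed (simp add: lin_add[OF TT_lin_l] lin_add[OF U_lin] lin_add[OF U0_lin] algebra_simps)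

text \<open>By \<open>U_TT\<close> the operators \<open>u\<^sub>0\<close> on \<open>V\<close> and on \<open>W\<close> form a derivation of every coefficient of the transported
  operator, so their exponentials form an automorphism.\<close>

lemma eU_TT: "eU (TT v n k w) = TT (V.gu v) n k (eU w)"
proof -
  have B: "bilinear_product s t (\<lambda>v w. TT v n k w)"
    by (intro bilinear_product.intro bilinear_product_axioms.intro TT_lin_l TT_lin_r V.complex_vector_space_axioms T.W.complex_vector_space_axioms)
  show ?thesis unfolding eU_def V.gu_def
    by (rule bilinear_product.op_exp_derivation[OF B, where D=V.U0 and D'=U, OF U0_tri U_tri U_TT])
qed

abbreviation gWh :: "'w \<Rightarrow> 'w" where "gWh \<equiv> gW \<circ> eU"
abbreviation Lh :: "'w \<Rightarrow> 'w" where "Lh \<equiv> yh \<omega> (-2)"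

lemma joint_eigen:
  "\<exists>\<kappa>. \<forall>n b c w. w \<in> T.W.ge L n \<longrightarrow> w \<in> T.W.ge U b \<longrightarrow> w \<in> T.W.ge gW c \<longrightarrow>
    w \<in> T.W.ge Lh (n - b + \<kappa>) \<and> w \<in> T.W.ge gWh (c * cis2pi b)"
proof -
  obtain \<kappa> where k: "\<forall>w. Lh w = L w - U w + t \<kappa> w" using yh_omega by blast
  have "w \<in> T.W.ge Lh (n - b + \<kappa>) \<and> w \<in> T.W.ge gWh (c * cis2pi b)"
    if w: "w \<in> T.W.ge L n" "w \<in> T.W.ge U b" "w \<in> T.W.ge gW c" for n b c w
  proof
    have "Lh = (\<lambda>w. L w - U w + t \<kappa> w)" using k by blast
    then show "w \<in> T.W.ge Lh (n - b + \<kappa>)" using T.W.ge_minus[where A=L and B=U, OF T.y_r T.y_r L_U w(1,2), of \<kappa>] by simp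
    have "w \<in> T.W.ge eU (cis2pi b)" unfolding eU_def cis2pi_def by (rule T.W.ge_op_exp[OF U_tri w(2)])
    moreover have "gW (eU x) = eU (gW x)" for x by (rule eU_commute[symmetric, OF gW_lin]) (rule gW_U[symmetric])
    ultimately have "w \<in> T.W.ge (\<lambda>x. gW (eU x)) (c * cis2pi b)"
      using T.W.ge_compose[where A=gW and B=eU, OF gW_lin eU_lin _ w(3)] by blast
    then show "w \<in> T.W.ge gWh (c * cis2pi b)" by (simp add: o_def)
  qed
  then show ?thesis by blast
qed

text \<open>\<open>W\<close> is spanned by joint generalized eigenvectors of \<open>L(0)\<close>, \<open>u\<^sub>0\<close> and \<open>g\<close>, to which \<open>joint_eigen\<close> applies.\<close>

lemma Lh_gWh_triangulable: "T.W.triangulable Lh" "T.W.triangulable gWh"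
proof -
  obtain \<kappa> where k: "\<forall>n b c w. w \<in> T.W.ge L n \<longrightarrow> w \<in> T.W.ge U b \<longrightarrow> w \<in> T.W.ge gW c \<longrightarrow>
    w \<in> T.W.ge Lh (n - b + \<kappa>) \<and> w \<in> T.W.ge gWh (c * cis2pi b)" using joint_eigen by blast
  have "w \<in> T.W.span (\<Union>c. T.W.ge Lh c) \<and> w \<in> T.W.span (\<Union>c. T.W.ge gWh c)" for w
  proof (rule T.W.joint_induct3[where T=L and S=U and R=gW and P="\<lambda>w. w \<in> T.W.span (\<Union>c. T.W.ge Lh c) \<and> w \<in> T.W.span (\<Union>c. T.W.ge gWh c)",
      OF L_tri U_tri gW_tri L_U gW_L[symmetric] gW_U[symmetric]])
    fix n b c w assume "w \<in> T.W.ge L n" "w \<in> T.W.ge U b" "w \<in> T.W.ge gW c"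
    then have "w \<in> T.W.ge Lh (n - b + \<kappa>)" "w \<in> T.W.ge gWh (c * cis2pi b)" using k by blast+
    then show "w \<in> T.W.span (\<Union>c. T.W.ge Lh c) \<and> w \<in> T.W.span (\<Union>c. T.W.ge gWh c)"
      by (intro conjI T.W.span_base UN_I[of "n - b + \<kappa>"] UN_I[of "c * cis2pi b"]) auto
  qed (auto intro: T.W.span_add)
  moreover have "T.W.lin gWh" unfolding o_def by (rule lin_compose[OF eU_lin gW_lin])
  ultimately show "T.W.triangulable Lh" "T.W.triangulable gWh"
    using F.y_r[of \<omega> "-2"] unfolding T.W.triangulable_def by auto
qed

lemma gWh_Lh: "gWh (Lh x) = Lh (gWh x)"
proof -
  obtain \<kappa> where k: "\<forall>w. Lh w = L w - U w + t \<kappa> w" using yh_omega by blast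
  have "eU (L x) = L (eU x)" for x by (rule eU_commute[OF T.y_r]) (rule L_U[symmetric])
  moreover have "eU (U x) = U (eU x)" for x by (rule eU_commute[OF T.y_r]) simp
  ultimately show ?thesis
    by (simp add: k lin_add[OF eU_lin] lin_diff[OF eU_lin] lin_scale[OF eU_lin] lin_add[OF gW_lin] lin_diff[OF gW_lin] lin_scale[OF gW_lin] gW_L gW_U)
qed

theorem transported_twisted_module:
  "twisted_module s Y vac \<omega> t h (\<lambda>n \<Gamma>. {w \<in> T.W.ge (TT \<omega> (-2) 0) n. \<exists>\<gamma>\<in>\<Gamma>. w \<in> T.W.ge gWh (exp (2 * pi * \<i> * \<gamma>))}) gWh TT"
proof -
  interpret C: twisted_core s Y vac \<omega> t h yh by (rule yh_core)
  have bij: "bij gWh" by (rule bij_comp[OF eU_bij gW_bij])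
  have YL0: "F.YL \<omega> (-2) 0 = Lh" unfolding F_YL by (simp add: yh_def fun_eq_iff)
  note grading = T.W.joint_grading[where L=Lh and G=gWh, OF Lh_gWh_triangulable bij_is_inj[OF bij] gWh_Lh]
  show ?thesis
    unfolding F_YL[symmetric] unfolding YL0
  proof (rule C.twisted_moduleI[OF Lh_gWh_triangulable(1) grading(2) grading(1) _ bij _ grading(3)])
    show "T.W.lin gWh" by (rule T.W.triangulable_lin[OF Lh_gWh_triangulable(2)])
    show "gWh (F.YL v n k w) = F.YL (h v) n k (gWh w)" for v n k w
      unfolding F_YL by (simp add: eU_TT gW_TT)
  qed
qed

end

theorem theorem4p3:
  fixes s :: "complex \<Rightarrow> 'v::ab_group_add \<Rightarrow> 'v"
    and Y :: "'v \<Rightarrow> int \<Rightarrow> 'v \<Rightarrow> 'v" and vac \<omega> :: 'v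
    and g :: "'v \<Rightarrow> 'v" and u :: 'v
    and t :: "complex \<Rightarrow> 'w::ab_group_add \<Rightarrow> 'w"
    and WG :: "complex \<Rightarrow> complex set \<Rightarrow> 'w set"
    and gW :: "'w \<Rightarrow> 'w"
    and YW :: "'v \<Rightarrow> complex \<Rightarrow> nat \<Rightarrow> 'w \<Rightarrow> 'w"
  assumes "vertex_operator_algebra s Y vac \<omega>"
    and "wt_space s Y \<omega> 0 = range (\<lambda>c. s c vac)"
    and "\<forall>n<0. wt_space s Y \<omega> n = {0}"
    and "voa_automorphism s Y vac \<omega> g"
    and "u \<in> wt_space s Y \<omega> 1"
    and "Lop Y \<omega> 1 u = 0"
    and "g u = u"
    and "twisted_module s Y vac \<omega> t g WG gW YW"
    and "is_direct_sum t UNIV (gen_eigenspace t (YW u (-1) 0))"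
  shows "let gu = op_exp s (\<lambda>v. s (2 * pi * \<i>) (Y u 0 v));
             gW' = gW \<circ> op_exp t (\<lambda>w. t (2 * pi * \<i>) (YW u (-1) 0 w));
             YW' = Delta_twist s Y u YW;
             WG' = (\<lambda>n \<Gamma>. {w \<in> gen_eigenspace t (YW' \<omega> (-2) 0) n.
                            \<exists>\<gamma>\<in>\<Gamma>. w \<in> gen_eigenspace t gW' (exp (2 * pi * \<i> * \<gamma>))})
         in twisted_module s Y vac \<omega> t (g \<circ> gu) WG' gW' YW'"
proof -
  let ?y = "\<lambda>v n w. YW v n 0 w"
  interpret TM: twisted_module s Y vac \<omega> t g WG gW YW by (rule assms(8))
  interpret W': complex_vector_space t by unfold_locales
  interpret C: twisted_core s Y vac \<omega> t g ?y by (rule twisted_module_core(1)[OF assms(8)])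
  have YL: "C.YL = YW" by (rule twisted_module_core(2)[OF assms(8)])
  \<comment> \<open>the homogeneous subspaces lie in generalized eigenspaces of \<open>L(0)\<close> and of \<open>g\<close>, and they span \<open>W\<close>\<close>
  have span: "w \<in> TM.W.span (\<Union>c. W'.ge A c)"
    if A: "\<And>n \<Gamma>. \<Gamma> \<in> C_mod_Z \<Longrightarrow> \<exists>c. WG n \<Gamma> \<subseteq> W'.ge A c" for A w
  proof (rule W'.direct_sum_induct[OF TM.grading, of "\<lambda>w. w \<in> TM.W.span (\<Union>c. W'.ge A c)"])
    fix i x assume "i \<in> UNIV \<times> C_mod_Z" "x \<in> (case i of (n, \<Gamma>) \<Rightarrow> WG n \<Gamma>)"
    then obtain n \<Gamma> where "\<Gamma> \<in> C_mod_Z" "x \<in> WG n \<Gamma>" by auto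
    then show "x \<in> TM.W.span (\<Union>c. W'.ge A c)" using A[of \<Gamma> n] by (intro TM.W.span_base) blast
  qed (auto intro: TM.W.span_add TM.W.span_zero)
  have L_tri: "W'.triangulable (?y \<omega> (-2))"
    unfolding W'.triangulable_def
  proof (intro conjI)
    show "W'.lin (?y \<omega> (-2))" by (rule C.y_r)
    have "WG n \<Gamma> \<subseteq> W'.ge (?y \<omega> (-2)) n" if "\<Gamma> \<in> C_mod_Z" for n \<Gamma>
    proof -
      have "WG n \<Gamma> \<subseteq> wt_part t WG n" unfolding wt_part_def
        by (rule order_trans[OF UN_upper[OF that] TM.W.span_superset])
      then show ?thesis using TM.L0_grading[of n] by blast
    qed
    then show "TM.W.span (\<Union>c. W'.ge (?y \<omega> (-2)) c) = UNIV" using span[of "?y \<omega> (-2)"] by blast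
  qed
  have gW_tri: "W'.triangulable gW"
    unfolding W'.triangulable_def
  proof (intro conjI)
    show "W'.lin gW" by (rule TM.g_linear)
    have "\<exists>c. WG n \<Gamma> \<subseteq> W'.ge gW c" if G: "\<Gamma> \<in> C_mod_Z" for n \<Gamma>
    proof -
      have "WG n \<Gamma> \<subseteq> g_part t WG \<Gamma>" unfolding g_part_def
        by (rule order_trans[OF UN_upper[of n] TM.W.span_superset]) simp
      moreover obtain \<alpha> where "\<alpha> \<in> \<Gamma>" using C_mod_Z_nonempty[OF G] ..
      ultimately have "WG n \<Gamma> \<subseteq> W'.ge gW (exp (2 * pi * \<i> * \<alpha>))" using TM.g_grading[OF G] by (meson order_trans)
      then show ?thesis ..
    qed
    then show "TM.W.span (\<Union>c. W'.ge gW c) = UNIV" using span[of gW] by blast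
  qed
  interpret X: shift_twisted_graded s Y vac \<omega> u t g ?y gW
  proof (intro shift_twisted_graded.intro shift_twisted.intro shift_vector.intro shift_vector_axioms.intro
      shift_twisted_axioms.intro shift_twisted_graded_axioms.intro assms(1-3,5-7) C.twisted_core_axioms L_tri gW_tri TM.g_bij TM.g_compatible)
    show "W'.triangulable (?y u (-1))" by (rule W'.direct_sum_triangulable[OF C.y_r assms(9)])
  qed
  show ?thesis
    using X.transported_twisted_module unfolding Let_def YL X.V.gu_def X.eU_def .
qed

end
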